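(* Suppose Assumptions (A1)–(A5) of the context hold and $f\in\mathcal D_{\alpha,2}(L)$ for some $L>0$, where $\alpha$ is in the range specified below. (Case 2) Let $\alpha\in(1/2,r)$ be given and $K_{n,\alpha}\asymp n^{1/(2\alpha+1)}$. If $\hat\beta_{\hat I}$ is the selected estimator over the collection $\{S_{I,K_{n,\alpha}}\}_{I\in\mathcal I}$ with penalty $\mathrm{pen}(I,K_{n,\alpha})=2(|I|+1)rK_{n,\alpha}\frac{\log n}{n}$, then $$\sqrt n(\hat\beta_{\hat I}-\beta_{I_0})\xrightarrow{d}N_q(0,\mathbf V).$$ (Case 3) Let $0<a<r-1/2$ and $K_{n,a}\asymp n^{1/(2a+2)}$. If $\hat\beta_{\hat I}$ is the selected estimator over the collection $\{S_{I,K_{n,a}}\}_{I\in\mathcal I}$ with penalty $\mathrm{pen}(I,K_{n,a})=2(|I|+1)rK_{n,a}\frac{\log n}{n}$, then $$\sqrt n(\hat\beta_{\hat I}-\beta_{I_0})\xrightarrow{d}N_q(0,\mathbf V),$$ uniformly over $\alpha\in[1/2+a,r)$, in the sense that this single procedure, which does not depend on $\alpha$, has this property for every $\alpha\in[1/2+a,r)$. In both cases the limiting distribution has all its mass concentrated on the space generated by the $I_0$ covariates, i.e. on $\{v\in\mathbb R^q: v_j=0\text{ for all } j\notin I_0\}$.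
   Context: Model. Let $q\ge 1$. For $n\ge 2$ one observes i.i.d. $((\underline X_i,T_i),Y_i)$, $i=1,\dots,n$, with $Y_i=\beta'\underline X_i+f(T_i)+W_i=s(\underline X_i,T_i)+W_i$, where $\beta\in\mathbb R^q$, $f:[0,1]\to\mathbb R$, $s(\underline x,t)=\beta'\underline x+f(t)$, and the $W_i$ are i.i.d., mean zero, with variance $\sigma^2$, independent of the $(\underline X_i,T_i)\in\mathbb R^q\times\mathbb R$. The law of the data does not change with $n$. $\mu,\mu_X,\mu_T$ are the laws of $(\underline X,T)$, $\underline X=(X_1,\dots,X_q)'$ and $T$; $\lambda$ is Lebesgue measure (on $\mathcal K\times[0,1]$ below); $\|\cdot\|_\nu$ is the $L_2(\nu)$ norm. $I_0\subseteq\{1,\dots,q\}$ is the set of indices of the nonzero components of $\beta$, $q_0=|I_0|$, and $\beta_{I_0}\in\mathbb R^q$ denotes $\beta$ itself. Smoothness classes. For $\alpha>0$, $\mathrm{Lip}^*(\alpha,L_2(\mu_T))$ is the generalized Lipschitz space of $g\in L_2([0,1],\mu_T)$ with finite seminorm $|g|_{\alpha,2}=\sup_{h>0}h^{-\alpha}\omega_{k}(g,h)_2$, where $k=[\alpha]+1$ and $\omega_k(\cdot,\cdot)_2$ is the $k$-th order modulus of smoothness in $L_2(\mu_T)$. For $A>0$, $\mathcal D_{\alpha,2}(A)=\{g\in \mathrm{Lip}^*(\alpha,L_2(\mu_T)):|g|_{\alpha,2}\le A\}$. Assumptions. Fix a constant $b\ge 3$ and put $r=[\frac{b-1}{2}]$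 ($[\cdot]$ is integer part). (A1) The support of $\mu$ is $\mathcal K\times[0,1]$ for a compact set $\mathcal K\subset\mathbb R^q$ ($\underline X\in\mathcal K$, $T\in[0,1]$ almost surely), and there $\mu$ has a Lebesgue density bounded below by $h_0>0$ and above by $h_1<\infty$. (A2) There are $d>0$ and $p>4+d$ with $\tau_p=E|W_1|^p<\infty$. (A3) For every $l\in\mathbb R^q\setminus\{0\}$, $\mathrm{Var}(l'\underline X\mid T=t)>0$ for all $t\in[0,1]$. (A4) $s\in L_2(\mathcal K\times[0,1],\lambda)$. (A5) For some $\gamma>b/4$ and $A>0$, $\theta_j(t)=E(X_j\mid T=t)$ belongs to $\mathcal D_{\gamma,2}(A)$ for all $j\in\{1,\dots,q\}$. Approximating spaces. $\mathcal I$ is the set of all subsets of $\{1,\dots,q\}$. For $K$ a power of $2$, $S_K$ is the space of piecewise polynomials $v(t)=\sum_{j=1}^K P_j(t)\mathbb 1(\frac{j-1}{K}\le t<\frac jK)$ with each $P_j$ of degree at most $r-1$ (dimension $rK$). $S_{I,K}$ is the linear span of the coordinate functions $x_i$, $i\in I$, together with $S_K$ (as functions of $t$). $a\asymp b$ means that $a$ is an integer power of $2$ that differs from $b$ by at most a factor of $2$. Estimators. For $u\in S_{I,K}$ let $\gamma_n(u)=n^{-1}\sum_{i=1}^n[Y_i-u(\underline X_i,T_i)]^2$. Given a collection of spaces and a penalty $\mathrm{pen}(I,K)$, $\tilde s\in S_{\hat I,\hat K_n}$ is a minimizer of $\gamma_n(u)+\mathrm{pen}(I,K)$ over all $u\in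 S_{I,K}$ and all $(I,K)$ in the collection. Write $\tilde s(\underline x,t)=\tilde\beta'\underline x+\tilde f(t)$ with $\tilde f\in S_{\hat K_n}$ and $\tilde\beta\in\mathbb R^q$ zero outside $\hat I$. Let $\Gamma_n=\{\|\tilde s\|_\lambda\le 2\exp(\log^2 n)\}$; the selected estimator of $\beta$ is $\hat\beta_{\hat I}=\tilde\beta\,\mathbb 1_{\Gamma_n}$, regarded as a vector in $\mathbb R^q$. On the event (of probability tending to zero) where the least squares solution is not unique, estimators are set to zero. Covariance. $\Sigma_{q_0}=(\sigma_{kj})_{(k,j)\in I_0\times I_0}$ with $\sigma_{kj}=\mathrm{Cov}(X_k,X_j)-\mathrm{Cov}(\theta_k(T),\theta_j(T))$; $\mathbf V^0=\sigma^2\Sigma_{q_0}^{-1}$ (indexed by $I_0\times I_0$); $\mathbf V$ is the $q\times q$ matrix with $\mathbf V_{ij}=\mathbf V^0_{ij}$ for $(i,j)\in I_0\times I_0$ and $\mathbf V_{ij}=0$ otherwise. *)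

theory Defs
  imports "HOL-Probability.Probability" "HOL-Computational_Algebra.Polynomial"
begin

definition L2_fun :: "'a measure \<Rightarrow> ('a \<Rightarrow> real) set" where
  "L2_fun \<nu> = {g \<in> borel_measurable \<nu>. integrable \<nu> (\<lambda>x. (g x)\<^sup>2)}"

definition L2_norm :: "'a measure \<Rightarrow> ('a \<Rightarrow> real) \<Rightarrow> ennreal" where
  "L2_norm \<nu> g =
     (let J = (\<integral>\<^sup>+ x. ennreal ((g x)\<^sup>2) \<partial>\<nu>)
      in if J = \<infinity> then \<infinity> else ennreal (sqrt (enn2real J)))"

definition finite_diff :: "nat \<Rightarrow> real \<Rightarrow> (real \<Rightarrow> real) \<Rightarrow> real \<Rightarrow> real" where
  "finite_diff k u g t = (\<Sum>i\<le>k. (- 1) ^ (k - i) * real (k choose i) * g (t + real i * u))"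

text \<open>The modulus of smoothness on \<open>[0,1]\<close>: the \<open>k\<close>-th difference with step \<open>u\<close> is measured on
  the set of those \<open>t\<close> for which both \<open>t\<close> and \<open>t + k u\<close> lie in \<open>[0,1]\<close>.\<close>

definition smoothness_modulus :: "real measure \<Rightarrow> nat \<Rightarrow> (real \<Rightarrow> real) \<Rightarrow> real \<Rightarrow> ennreal" where
  "smoothness_modulus \<nu> k g h =
     (SUP u\<in>{0<..h}. L2_norm (restrict_space \<nu> {0..1 - real k * u}) (finite_diff k u g))"

definition Lip_seminorm :: "real measure \<Rightarrow> real \<Rightarrow> (real \<Rightarrow> real) \<Rightarrow> ennreal" where
  "Lip_seminorm \<nu> \<alpha> g =
     (SUP h\<in>{0<..}. ennreal (h powr (- \<alpha>)) * smoothness_modulus \<nu> (nat \<lfloor>\<alpha>\<rfloor> + 1) g h)"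

definition Lip_star :: "real measure \<Rightarrow> real \<Rightarrow> (real \<Rightarrow> real) set" where
  "Lip_star \<nu> \<alpha> = {g \<in> L2_fun (restrict_space \<nu> {0..1}). Lip_seminorm \<nu> \<alpha> g < \<infinity>}"

definition Lip_ball :: "real measure \<Rightarrow> real \<Rightarrow> real \<Rightarrow> (real \<Rightarrow> real) set" where
  "Lip_ball \<nu> \<alpha> A = {g \<in> Lip_star \<nu> \<alpha>. Lip_seminorm \<nu> \<alpha> g \<le> ennreal A}"

definition reg_fun :: "real ^ 'q \<Rightarrow> (real \<Rightarrow> real) \<Rightarrow> ((real ^ 'q) \<times> real) \<Rightarrow> real" where
  "reg_fun \<beta> f = (\<lambda>(x, t). \<beta> \<bullet> x + f t)"

definition noise_law :: "real measure \<Rightarrow> real \<Rightarrow> bool" where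
  "noise_law \<zeta> \<sigma> \<longleftrightarrow> prob_space \<zeta> \<and> sets \<zeta> = sets borel \<and>
     integrable \<zeta> (\<lambda>w. w\<^sup>2) \<and> (\<integral>w. w \<partial>\<zeta>) = 0 \<and> prob_space.variance \<zeta> (\<lambda>w. w) = \<sigma>\<^sup>2"

text \<open>A sample of size \<open>n\<close>. Here \<open>\<mu>\<close> is the common law of the covariates \<open>(X i, T i)\<close> and \<open>\<zeta>\<close> that of
  the errors \<open>W i\<close>; the product law makes \<open>W i\<close> independent of \<open>(X i, T i)\<close>.\<close>

definition iid_sample ::
  "nat \<Rightarrow> 'w measure \<Rightarrow> (nat \<Rightarrow> 'w \<Rightarrow> real ^ 'q) \<Rightarrow> (nat \<Rightarrow> 'w \<Rightarrow> real) \<Rightarrow> (nat \<Rightarrow> 'w \<Rightarrow> real) \<Rightarrow>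
   ((real ^ 'q) \<times> real) measure \<Rightarrow> real measure \<Rightarrow> bool" where
  "iid_sample n M X T W \<mu> \<zeta> \<longleftrightarrow>
     prob_space M \<and>
     prob_space.indep_vars M (\<lambda>_. borel) (\<lambda>i \<omega>. ((X i \<omega>, T i \<omega>), W i \<omega>)) {1..n} \<and>
     (\<forall>i\<in>{1..n}. distr M borel (\<lambda>\<omega>. ((X i \<omega>, T i \<omega>), W i \<omega>)) = \<mu> \<Otimes>\<^sub>M \<zeta>)"

definition observation ::
  "real ^ 'q \<Rightarrow> (real \<Rightarrow> real) \<Rightarrow> (nat \<Rightarrow> 'w \<Rightarrow> real ^ 'q) \<Rightarrow> (nat \<Rightarrow> 'w \<Rightarrow> real) \<Rightarrow> (nat \<Rightarrow> 'w \<Rightarrow> real) \<Rightarrow>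
   'w \<Rightarrow> nat \<Rightarrow> ((real ^ 'q) \<times> real) \<times> real" where
  "observation \<beta> f X T W \<omega> i =
     ((X i \<omega>, T i \<omega>), reg_fun \<beta> f (X i \<omega>, T i \<omega>) + W i \<omega>)"

definition law_T :: "((real ^ 'q) \<times> real) measure \<Rightarrow> real measure" where
  "law_T \<mu> = distr \<mu> borel snd"

text \<open>\<open>\<kappa> t\<close> is a version of the conditional law of \<open>X\<close> given \<open>T = t\<close>.\<close>

definition conditional_law :: "((real ^ 'q) \<times> real) measure \<Rightarrow> (real \<Rightarrow> (real ^ 'q) measure) \<Rightarrow> bool" where
  "conditional_law \<mu> \<kappa> \<longleftrightarrow>
     \<kappa> \<in> borel \<rightarrow>\<^sub>M prob_algebra borel \<and>
     (\<forall>A\<in>sets borel. \<forall>B\<in>sets borel.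
        emeasure \<mu> (A \<times> B) = (\<integral>\<^sup>+ t. emeasure (\<kappa> t) A * indicator B t \<partial>law_T \<mu>))"

definition cond_mean :: "(real \<Rightarrow> (real ^ 'q) measure) \<Rightarrow> 'q \<Rightarrow> real \<Rightarrow> real" where
  "cond_mean \<kappa> j t = (\<integral>x. x $ j \<partial>\<kappa> t)"

definition measure_support :: "'a::topological_space measure \<Rightarrow> 'a set" where
  "measure_support \<nu> = {x. \<forall>U. open U \<and> x \<in> U \<longrightarrow> emeasure \<nu> U > 0}"

definition design_density :: "((real ^ 'q) \<times> real) measure \<Rightarrow> (real ^ 'q) set \<Rightarrow> real \<Rightarrow> real \<Rightarrow> bool" where
  "design_density \<mu> \<K> h0 h1 \<longleftrightarrow>
     compact \<K> \<and> measure_support \<mu> = \<K> \<times> {0..1} \<and> 0 < h0 \<and>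
     (\<exists>\<phi> \<in> borel_measurable borel. \<mu> = density lborel (\<lambda>z. ennreal (\<phi> z)) \<and>
        (\<forall>z \<in> \<K> \<times> {0..1}. h0 \<le> \<phi> z \<and> \<phi> z \<le> h1))"

definition error_moments :: "real measure \<Rightarrow> bool" where
  "error_moments \<zeta> \<longleftrightarrow> (\<exists>d>0. \<exists>p>4 + d. integrable \<zeta> (\<lambda>w. \<bar>w\<bar> powr p))"

definition nondegenerate_given_T :: "(real \<Rightarrow> (real ^ 'q) measure) \<Rightarrow> bool" where
  "nondegenerate_given_T \<kappa> \<longleftrightarrow>
     (\<forall>l. l \<noteq> 0 \<longrightarrow> (\<forall>t\<in>{0..1}. prob_space.variance (\<kappa> t) (\<lambda>x. l \<bullet> x) > 0))"

definition regression_L2 :: "real ^ 'q \<Rightarrow> (real \<Rightarrow> real) \<Rightarrow> (real ^ 'q) set \<Rightarrow> bool" where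
  "regression_L2 \<beta> f \<K> \<longleftrightarrow> reg_fun \<beta> f \<in> L2_fun (restrict_space lborel (\<K> \<times> {0..1}))"

definition smooth_cond_means ::
  "((real ^ 'q) \<times> real) measure \<Rightarrow> (real \<Rightarrow> (real ^ 'q) measure) \<Rightarrow> real \<Rightarrow> bool" where
  "smooth_cond_means \<mu> \<kappa> b \<longleftrightarrow>
     (\<exists>\<gamma>>b / 4. \<exists>A>0. \<forall>j. cond_mean \<kappa> j \<in> Lip_ball (law_T \<mu>) \<gamma> A)"

definition pw_poly :: "nat \<Rightarrow> nat \<Rightarrow> (real \<Rightarrow> real) set" where
  "pw_poly r K = {v. \<exists>P :: nat \<Rightarrow> real poly. (\<forall>j\<in>{1..K}. degree (P j) \<le> r - 1) \<and>
     v = (\<lambda>t. \<Sum>j=1..K. poly (P j) t * indicator {(real j - 1) / real K..<real j / real K} t)}"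

definition approx_space :: "nat \<Rightarrow> 'q set \<Rightarrow> nat \<Rightarrow> (((real ^ 'q) \<times> real) \<Rightarrow> real) set" where
  "approx_space r I K = {reg_fun c v | c v. (\<forall>j. j \<notin> I \<longrightarrow> c $ j = 0) \<and> v \<in> pw_poly r K}"

definition emp_risk :: "nat \<Rightarrow> (nat \<Rightarrow> 'z \<times> real) \<Rightarrow> ('z \<Rightarrow> real) \<Rightarrow> real" where
  "emp_risk n obs u = (\<Sum>i=1..n. (snd (obs i) - u (fst (obs i)))\<^sup>2) / real n"

definition penalized_minimizer ::
  "nat \<Rightarrow> nat \<Rightarrow> ('q set \<times> nat) set \<Rightarrow> ('q set \<Rightarrow> nat \<Rightarrow> real) \<Rightarrow>
   (nat \<Rightarrow> ((real ^ 'q) \<times> real) \<times> real) \<Rightarrow> 'q set \<Rightarrow> nat \<Rightarrow> (((real ^ 'q) \<times> real) \<Rightarrow> real) \<Rightarrow> bool" where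
  "penalized_minimizer n r C pen obs I K u \<longleftrightarrow>
     (I, K) \<in> C \<and> u \<in> approx_space r I K \<and>
     (\<forall>(I', K') \<in> C. \<forall>u' \<in> approx_space r I' K'.
        emp_risk n obs u + pen I K \<le> emp_risk n obs u' + pen I' K')"

definition unique_least_squares ::
  "nat \<Rightarrow> (nat \<Rightarrow> 'z \<times> real) \<Rightarrow> ('z \<Rightarrow> real) set \<Rightarrow> bool" where
  "unique_least_squares n obs S \<longleftrightarrow> (\<exists>!u. u \<in> S \<and> (\<forall>u'\<in>S. emp_risk n obs u \<le> emp_risk n obs u'))"

text \<open>\<open>bh\<close> is a value of the selected estimator at the data \<open>obs\<close>. Ties between minimizers may be broken
  in any way; the value is \<open>0\<close> outside \<open>\<Gamma>\<^sub>n\<close> and when least squares over the selected space has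
  several solutions.\<close>

definition selected_value ::
  "nat \<Rightarrow> nat \<Rightarrow> (real ^ 'q) set \<Rightarrow> ('q set \<times> nat) set \<Rightarrow> ('q set \<Rightarrow> nat \<Rightarrow> real) \<Rightarrow>
   (nat \<Rightarrow> ((real ^ 'q) \<times> real) \<times> real) \<Rightarrow> real ^ 'q \<Rightarrow> bool" where
  "selected_value n r \<K> C pen obs bh \<longleftrightarrow>
     (\<exists>I K c v. (\<forall>j. j \<notin> I \<longrightarrow> c $ j = 0) \<and> v \<in> pw_poly r K \<and>
        penalized_minimizer n r C pen obs I K (reg_fun c v) \<and>
        bh = (if unique_least_squares n obs (approx_space r I K) \<and>
                 L2_norm (restrict_space lborel (\<K> \<times> {0..1})) (reg_fun c v)
                   \<le> ennreal (2 * exp ((ln (real n))\<^sup>2))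
              then c else 0))"

definition selected_estimator ::
  "nat \<Rightarrow> 'w measure \<Rightarrow> nat \<Rightarrow> (real ^ 'q) set \<Rightarrow> ('q set \<times> nat) set \<Rightarrow> ('q set \<Rightarrow> nat \<Rightarrow> real) \<Rightarrow>
   ('w \<Rightarrow> nat \<Rightarrow> ((real ^ 'q) \<times> real) \<times> real) \<Rightarrow> ('w \<Rightarrow> real ^ 'q) \<Rightarrow> bool" where
  "selected_estimator n M r \<K> C pen obs bhat \<longleftrightarrow>
     bhat \<in> borel_measurable M \<and>
     (\<forall>\<omega>\<in>space M. selected_value n r \<K> C pen (obs \<omega>) (bhat \<omega>))"

definition log_penalty :: "nat \<Rightarrow> nat \<Rightarrow> 'q set \<Rightarrow> nat \<Rightarrow> real" where
  "log_penalty n r I K = 2 * (real (card I) + 1) * real r * real K * (ln (real n) / real n)"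

definition dyadic_near :: "nat \<Rightarrow> real \<Rightarrow> bool" where
  "dyadic_near K x \<longleftrightarrow> (\<exists>m. K = 2 ^ m) \<and> x / 2 \<le> real K \<and> real K \<le> 2 * x"

definition covar :: "'a measure \<Rightarrow> ('a \<Rightarrow> real) \<Rightarrow> ('a \<Rightarrow> real) \<Rightarrow> real" where
  "covar \<nu> g h = (\<integral>z. (g z - (\<integral>y. g y \<partial>\<nu>)) * (h z - (\<integral>y. h y \<partial>\<nu>)) \<partial>\<nu>)"

definition Sigma_mat ::
  "((real ^ 'q) \<times> real) measure \<Rightarrow> (real \<Rightarrow> (real ^ 'q) measure) \<Rightarrow> real ^ 'q ^ 'q" where
  "Sigma_mat \<mu> \<kappa> = (\<chi> k j.
     covar \<mu> (\<lambda>z. fst z $ k) (\<lambda>z. fst z $ j)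
     - covar \<mu> (\<lambda>z. cond_mean \<kappa> k (snd z)) (\<lambda>z. cond_mean \<kappa> j (snd z)))"

text \<open>The inverse of the \<open>I \<times> I\<close> block of \<open>A\<close>, filled up with zeros outside \<open>I \<times> I\<close>
  (cf. \<^const>\<open>matrix_inv\<close>).\<close>

definition block_inv :: "'q set \<Rightarrow> real ^ 'q ^ 'q \<Rightarrow> real ^ 'q ^ 'q" where
  "block_inv I A = (SOME B.
     (\<forall>i\<in>I. \<forall>j\<in>I. (\<Sum>k\<in>I. A $ i $ k * B $ k $ j) = (if i = j then 1 else 0) \<and>
                   (\<Sum>k\<in>I. B $ i $ k * A $ k $ j) = (if i = j then 1 else 0)) \<and>
     (\<forall>i j. \<not> (i \<in> I \<and> j \<in> I) \<longrightarrow> B $ i $ j = 0))"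

definition limit_cov ::
  "'q set \<Rightarrow> ((real ^ 'q) \<times> real) measure \<Rightarrow> (real \<Rightarrow> (real ^ 'q) measure) \<Rightarrow> real \<Rightarrow> real ^ 'q ^ 'q" where
  "limit_cov I \<mu> \<kappa> \<sigma> = (\<chi> i j. if i \<in> I \<and> j \<in> I then \<sigma>\<^sup>2 * block_inv I (Sigma_mat \<mu> \<kappa>) $ i $ j else 0)"

definition std_mv_normal :: "(real ^ 'q) measure" where
  "std_mv_normal = density lborel (\<lambda>x. ennreal (\<Prod>i\<in>UNIV. std_normal_density (x $ i)))"

text \<open>The law of \<open>m + B Z\<close> for \<open>Z\<close> standard normal and \<open>B B\<^sup>T = V\<close>; it does not depend on
  the choice of \<open>B\<close>, and \<open>V\<close> may be singular.\<close>

definition mv_normal :: "real ^ 'q \<Rightarrow> real ^ 'q ^ 'q \<Rightarrow> (real ^ 'q) measure" where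
  "mv_normal m V =
     distr std_mv_normal borel (\<lambda>z. m + (SOME B :: real ^ 'q ^ 'q. B ** transpose B = V) *v z)"

text \<open>Weak convergence of probability measures; the library version \<^const>\<open>weak_conv_m\<close> covers
  only measures on the real line.\<close>

definition converges_weakly :: "(nat \<Rightarrow> 'a::metric_space measure) \<Rightarrow> 'a measure \<Rightarrow> bool" where
  "converges_weakly N_seq N \<longleftrightarrow>
     (\<forall>g :: 'a \<Rightarrow> real. continuous_on UNIV g \<and> bounded (range g) \<longrightarrow>
        (\<lambda>n. \<integral>x. g x \<partial>N_seq n) \<longlonglongrightarrow> (\<integral>x. g x \<partial>N))"

end

theory Submission
  imports Defs
begin

text \<open>Let \<open>fK\<close> and \<open>g j\<close> be piecewise polynomials close to \<open>f\<close> and \<open>\<theta> j\<close>. In a local basis \<open>\<phi> a\<close> of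
  the approximating space, \<open>\<Sum>a. (\<phi> a)\<^sup>2\<close> is bounded; as \<open>K\<^sup>2 / n \<rightarrow> 0\<close>, Chebyshev's inequality makes empirical
  and population norms comparable outside a set of small probability. There the penalized criterion gives
  \<open>|s~ - s_K|\<^sup>2 = O(K / n)\<close> and selects exactly \<open>I0\<close>: the penalty beats the noise, and a missing covariate
  costs a constant. The normal equation in the direction \<open>x j - g j\<close> then reads
  \<open>\<Sigma> (\<beta>~ - \<beta>) = 1/n * \<Sum>i. W i (X i - \<theta> (T i)) + o(n powr (-1/2))\<close>, to which the central limit theorem applies.
  Functions in the Lipschitz balls are approximated by polynomials that interpolate cell averages,
  telescoping over the dyadic levels.\<close>

section \<open>Characteristic functions and weak convergence\<close>

text \<open>The delicate point is a product of two approximation errors in the normal equation. The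
  squared error is of order K/n for \<open>f\<close> and \<epsilon>/K for \<theta> j, so by
  Cauchy-Schwarz the product is sqrt \<epsilon> times n powr (-1/2), and \<theta> j has to be
  approximated with an order strictly above 1/2. The exponent \<gamma> > b/4 is at least 3/4, but it
  may exceed what degree r - 1 can exploit (\<open>r\<close> is 1 for b = 3); hence \<theta> j is
  approximated by piecewise constants with exponent 3/4, whatever \<gamma> is.

  The local basis is far from orthonormal: its Gram matrix has smallest eigenvalue at least of order
  1/K. An error of order n powr (-1/2) in Frobenius norm is therefore a relative error K / sqrt n,
  which is where K^2/n -> 0 comes from, that is \<alpha> > 1/2 in Case 2 and a > 0 in Case 3.

  The modulus of smoothness sees only increments inside [0,1]. A cell is therefore cut into 2 k
  parts and interpolated on its first half, so that all k-th differences involved stay within one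
  cell.\<close>

definition mv_char :: "'a::euclidean_space measure \<Rightarrow> 'a \<Rightarrow> complex" where
  "mv_char N t = (CLINT x|N. iexp (t \<bullet> x))"

lemma prod_components_Basis:
  fixes x :: "real ^ 'q"
  shows "(\<Prod>i\<in>UNIV. g (axis i 1) (x $ i)) = (\<Prod>b\<in>Basis. g b (x \<bullet> b))"
proof -
  have B: "(Basis :: (real^'q) set) = (\<lambda>i. axis i 1) ` UNIV"
    by (auto simp: Basis_vec_def)
  have "(\<Prod>b\<in>Basis. g b (x \<bullet> b)) = (\<Prod>i\<in>UNIV. g (axis i 1) (x \<bullet> axis i 1))"
    unfolding B by (subst prod.reindex) (auto simp: inj_on_def axis_eq_axis)
  then show ?thesis
    by (simp add: inner_axis)
qed

text \<open>Fubini over the coordinates: \<open>lborel\<close> is the image of the product of real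
  Lebesgue measures under the coordinate map. Complex values are allowed because the factors will be
  densities times exponentials.\<close>

lemma integral_lborel_prod:
  fixes f :: "'a::euclidean_space \<Rightarrow> real \<Rightarrow> complex"
  assumes "\<And>b. b \<in> Basis \<Longrightarrow> integrable lborel (f b)"
  shows "(\<integral>x. (\<Prod>b\<in>Basis. f b (x \<bullet> b)) \<partial>lborel) = (\<Prod>b\<in>Basis. (\<integral>x. f b x \<partial>lborel))"
proof -
  interpret product_sigma_finite "\<lambda>_::'a. lborel :: real measure" ..
  have [measurable]: "f b \<in> borel_measurable borel" if "b \<in> Basis" for b
    using assms[OF that] borel_measurable_integrable by force
  have "(\<integral>x. (\<Prod>b\<in>Basis. f b (x \<bullet> b)) \<partial>lborel) =
    (\<integral>y. (\<Prod>b\<in>Basis. f b ((\<Sum>b\<in>Basis. y b *\<^sub>R b) \<bullet> b)) \<partial>(\<Pi>\<^sub>M b\<in>Basis. lborel))"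
    by (subst lborel_eq, subst integral_distr) simp_all
  also have "\<dots> = (\<integral>y. (\<Prod>b\<in>Basis. f b (y b)) \<partial>(\<Pi>\<^sub>M b\<in>(Basis::'a set). lborel))"
    by (intro Bochner_Integration.integral_cong prod.cong) auto
  also have "\<dots> = (\<Prod>b\<in>Basis. (\<integral>x. f b x \<partial>lborel))"
    by (rule product_integral_prod) (auto intro: assms)
  finally show ?thesis .
qed

lemma std_mv_density_eq:
  "(\<Prod>i\<in>UNIV. std_normal_density (x $ i)) = (\<Prod>b\<in>Basis. std_normal_density (x \<bullet> b))"
  for x :: "real ^ 'q"
  by (rule prod_components_Basis)

lemma std_mv_normal_eq:
  "(std_mv_normal :: (real^'q) measure) =
     density lborel (\<lambda>x. ennreal (\<Prod>b\<in>Basis. std_normal_density (x \<bullet> b)))"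
  by (simp only: std_mv_normal_def std_mv_density_eq)

lemma sets_std_mv_normal [simp, measurable_cong]: "sets std_mv_normal = sets borel"
  by (simp add: std_mv_normal_def)

lemma space_std_mv_normal [simp]: "space std_mv_normal = UNIV"
  by (simp add: std_mv_normal_def)

lemma prob_space_std_mv_normal: "prob_space (std_mv_normal :: (real^'q) measure)"
proof
  have "(\<integral>\<^sup>+x. ennreal (\<Prod>b\<in>(Basis::(real^'q) set). std_normal_density (x \<bullet> b)) \<partial>lborel)
      = (\<integral>\<^sup>+x. (\<Prod>b\<in>(Basis::(real^'q) set). ennreal (std_normal_density (x \<bullet> b))) \<partial>lborel)"
    by (intro nn_integral_cong) (simp add: prod_ennreal)
  also have "\<dots> = (\<Prod>b\<in>(Basis::(real^'q) set). (\<integral>\<^sup>+x. ennreal (std_normal_density x) \<partial>lborel))"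
    by (intro nn_integral_lborel_prod) auto
  also have "(\<integral>\<^sup>+x. ennreal (std_normal_density x) \<partial>lborel) = 1"
    using prob_space.emeasure_space_1[OF prob_space_normal_density[of 1 0]]
    by (simp add: emeasure_density)
  finally show "emeasure (std_mv_normal :: (real^'q) measure) (space std_mv_normal) = 1"
    by (simp add: std_mv_normal_eq emeasure_density)
qed

text \<open>Both the density and \<open>iexp\<close> of an inner product factor over the
  coordinates, which reduces the claim to the one-dimensional standard normal law.\<close>

lemma mv_char_std_mv_normal:
  "mv_char (std_mv_normal :: (real^'q) measure) t = exp (- (norm t)\<^sup>2 / 2)"
proof -
  let ?d = "\<lambda>x::real^'q. \<Prod>b\<in>Basis. std_normal_density (x \<bullet> b)"
  have 1: "integrable lborel (\<lambda>s. complex_of_real (std_normal_density s) * iexp (c * s))" for c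
  proof -
    have "integrable std_normal_distribution (\<lambda>s. iexp (c * s))"
    proof -
      interpret prob_space std_normal_distribution by (rule prob_space_normal_density) auto
      show ?thesis by (rule integrable_const_bound[of _ 1]) auto
    qed
    then show ?thesis
      by (subst (asm) integrable_density) (auto simp: scaleR_conv_of_real)
  qed
  have 2: "(\<integral>s. complex_of_real (std_normal_density s) * iexp (c * s) \<partial>lborel) = exp (- c\<^sup>2 / 2)" for c
  proof -
    have "char std_normal_distribution c = (\<integral>s. complex_of_real (std_normal_density s) * iexp (c * s) \<partial>lborel)"
      unfolding char_def by (subst integral_density) (auto simp: scaleR_conv_of_real)
    then show ?thesis by (simp add: char_std_normal_distribution)
  qed
  have "mv_char (std_mv_normal :: (real^'q) measure) t = (\<integral>x. ?d x *\<^sub>R iexp (t \<bullet> x) \<partial>lborel)"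
    unfolding mv_char_def std_mv_normal_eq
    by (subst integral_density) (auto intro!: prod_nonneg)
  also have "\<dots> = (\<integral>x. (\<Prod>b\<in>Basis. complex_of_real (std_normal_density (x \<bullet> b)) * iexp ((t \<bullet> b) * (x \<bullet> b))) \<partial>lborel)"
  proof (intro Bochner_Integration.integral_cong refl)
    fix x :: "real^'q"
    have "iexp (t \<bullet> x) = (\<Prod>b\<in>Basis. iexp ((t \<bullet> b) * (x \<bullet> b)))"
      by (subst euclidean_inner) (simp add: exp_sum sum_distrib_left)
    then show "?d x *\<^sub>R iexp (t \<bullet> x) = (\<Prod>b\<in>Basis. complex_of_real (std_normal_density (x \<bullet> b)) * iexp ((t \<bullet> b) * (x \<bullet> b)))"
      by (simp only: prod.distrib scaleR_conv_of_real of_real_prod)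
  qed
  also have "\<dots> = (\<Prod>b\<in>Basis. complex_of_real (exp (- (t \<bullet> b)\<^sup>2 / 2)))"
    by (subst integral_lborel_prod) (simp_all only: 1 2)
  also have "\<dots> = complex_of_real (exp (\<Sum>b\<in>Basis. - (t \<bullet> b)\<^sup>2 / 2))"
    by (simp only: of_real_prod[symmetric] exp_sum[OF finite_Basis])
  also have "(\<Sum>b\<in>Basis. - (t \<bullet> b)\<^sup>2 / 2) = - (norm t)\<^sup>2 / 2"
    unfolding power2_norm_eq_inner euclidean_inner[of t t]
    by (simp add: sum_negf sum_divide_distrib[symmetric] power2_eq_square)
  finally show ?thesis .
qed

text \<open>Up to normalization this is the density of e Z with Z standard normal; at the same time
  it is the characteristic function of Z at u / e. The smoothing argument uses both
  readings.\<close>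

definition gauss_kernel :: "real \<Rightarrow> 'a::euclidean_space \<Rightarrow> real" where
  "gauss_kernel e u = exp (- (norm u / e)\<^sup>2 / 2)"

text \<open>A Parseval identity: the kernel is itself a Gaussian average of exponentials, and after
  exchanging the two averages \<open>N\<close> enters only through its characteristic
  function.\<close>

lemma gauss_kernel_average:
  fixes N :: "(real^'q) measure"
  assumes "prob_space N" and [measurable_cong]: "sets N = sets borel" and e: "e > 0"
  shows "complex_of_real (\<integral>x. gauss_kernel e (y - x) \<partial>N) =
    (CLINT z|std_mv_normal. iexp (z \<bullet> (y /\<^sub>R e)) * mv_char N (- z /\<^sub>R e))"
proof -
  interpret N: prob_space N by fact
  interpret S: prob_space "std_mv_normal :: (real^'q) measure" by (rule prob_space_std_mv_normal)
  interpret P: pair_prob_space N "std_mv_normal :: (real^'q) measure" ..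
  have "complex_of_real (\<integral>x. gauss_kernel e (y - x) \<partial>N) = (CLINT x|N. complex_of_real (gauss_kernel e (y - x)))"
    by simp
  also have "\<dots> = (CLINT x|N. CLINT z|std_mv_normal. iexp (((y - x) /\<^sub>R e) \<bullet> z))"
  proof (intro Bochner_Integration.integral_cong refl)
    fix x
    show "complex_of_real (gauss_kernel e (y - x)) = (CLINT z|std_mv_normal. iexp (((y - x) /\<^sub>R e) \<bullet> z))"
    proof -
      have n: "norm ((y - x) /\<^sub>R e) = norm (y - x) / e"
        unfolding norm_scaleR using e by (simp add: field_simps)
      show ?thesis
        using mv_char_std_mv_normal[of "(y - x) /\<^sub>R e"]
        unfolding mv_char_def gauss_kernel_def n by (simp only:)
    qed
  qed
  also have "\<dots> = (CLINT z|std_mv_normal. CLINT x|N. iexp (((y - x) /\<^sub>R e) \<bullet> z))"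
    by (intro P.Fubini_integral[symmetric] P.integrable_const_bound[of _ 1]) (auto simp: split_beta)
  also have "\<dots> = (CLINT z|std_mv_normal. iexp (z \<bullet> (y /\<^sub>R e)) * mv_char N (- z /\<^sub>R e))"
  proof (intro Bochner_Integration.integral_cong refl)
    fix z
    have "(CLINT x|N. iexp (((y - x) /\<^sub>R e) \<bullet> z)) = (CLINT x|N. iexp (z \<bullet> (y /\<^sub>R e)) * iexp ((- z /\<^sub>R e) \<bullet> x))"
      by (intro Bochner_Integration.integral_cong refl)
        (auto simp: exp_add[symmetric] inner_commute algebra_simps inner_diff_right)
    then show "(CLINT x|N. iexp (((y - x) /\<^sub>R e) \<bullet> z)) = iexp (z \<bullet> (y /\<^sub>R e)) * mv_char N (- z /\<^sub>R e)"
      by (simp add: mv_char_def)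
  qed
  finally show ?thesis .
qed

lemma norm_mv_char_le: "prob_space N \<Longrightarrow> norm (mv_char N t) \<le> 1"
proof -
  assume "prob_space N"
  then interpret prob_space N .
  have "norm (mv_char N t) \<le> (\<integral>x. norm (iexp (t \<bullet> x)) \<partial>N)"
    unfolding mv_char_def by (rule integral_norm_bound)
  also have "\<dots> = 1" by (simp add: prob_space)
  finally show ?thesis .
qed

lemma measurable_mv_char:
  assumes "prob_space N" and [measurable_cong]: "sets N = sets borel"
  shows "mv_char N \<in> borel_measurable borel"
proof -
  interpret prob_space N by fact
  show ?thesis unfolding mv_char_def by measurable
qed

text \<open>In the Parseval identity the integrands converge pointwise and are bounded by 1, so
  dominated convergence applies.\<close>

lemma gauss_kernel_average_tendsto:
  fixes N :: "nat \<Rightarrow> (real^'q) measure"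
  assumes N: "\<And>n. prob_space (N n)" "\<And>n. sets (N n) = sets borel"
    and L: "prob_space L" "sets L = sets borel"
    and lim: "\<And>t. (\<lambda>n. mv_char (N n) t) \<longlonglongrightarrow> mv_char L t" and e: "e > 0"
  shows "(\<lambda>n. \<integral>x. gauss_kernel e (y - x) \<partial>N n) \<longlonglongrightarrow> (\<integral>x. gauss_kernel e (y - x) \<partial>L)"
proof -
  interpret S: prob_space "std_mv_normal :: (real^'q) measure" by (rule prob_space_std_mv_normal)
  note [measurable] = measurable_mv_char[OF N] measurable_mv_char[OF L]
  have "(\<lambda>n. CLINT z|std_mv_normal. iexp (z \<bullet> (y /\<^sub>R e)) * mv_char (N n) (- z /\<^sub>R e))
     \<longlonglongrightarrow> (CLINT z|std_mv_normal. iexp (z \<bullet> (y /\<^sub>R e)) * mv_char L (- z /\<^sub>R e))"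
  proof (rule integral_dominated_convergence[where w="\<lambda>_. 1"])
    show "AE z in std_mv_normal. norm (iexp (z \<bullet> (y /\<^sub>R e)) * mv_char (N n) (- z /\<^sub>R e)) \<le> 1" for n
      using norm_mv_char_le[OF N(1)] by (auto simp: norm_mult)
  qed (auto intro!: tendsto_intros lim)
  then have "(\<lambda>n. complex_of_real (\<integral>x. gauss_kernel e (y - x) \<partial>N n)) \<longlonglongrightarrow> complex_of_real (\<integral>x. gauss_kernel e (y - x) \<partial>L)"
    by (simp only: gauss_kernel_average[OF N e] gauss_kernel_average[OF L e])
  then show ?thesis by (simp only: tendsto_of_real_iff)
qed

lemma nn_integral_lborel_affine:
  fixes h :: "'a::euclidean_space \<Rightarrow> ennreal"
  assumes [measurable]: "h \<in> borel_measurable borel" and "c \<noteq> 0"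
  shows "(\<integral>\<^sup>+x. h x \<partial>lborel) = ennreal (\<bar>c\<bar> ^ DIM('a)) * (\<integral>\<^sup>+x. h (t + c *\<^sub>R x) \<partial>lborel)"
  by (subst lborel_affine[OF assms(2), of t])
    (simp add: nn_integral_density nn_integral_distr nn_integral_cmult)

lemma std_mv_density_gauss:
  "(\<Prod>i\<in>UNIV. std_normal_density (z $ i)) = (1 / sqrt (2 * pi)) ^ CARD('q) * exp (- (norm z)\<^sup>2 / 2)"
  for z :: "real ^ 'q"
proof -
  have "(\<Prod>i\<in>UNIV. std_normal_density (z $ i)) = (1 / sqrt (2 * pi)) ^ CARD('q) * (\<Prod>i\<in>UNIV. exp (- (z $ i)\<^sup>2 / 2))"
    by (simp only: std_normal_density_def prod.distrib prod_constant)
  also have "(\<Prod>i\<in>UNIV. exp (- (z $ i)\<^sup>2 / 2)) = exp (\<Sum>i\<in>UNIV. - (z $ i)\<^sup>2 / 2)"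
    by (rule exp_sum[symmetric]) simp
  also have "(\<Sum>i\<in>UNIV. - (z $ i)\<^sup>2 / 2) = - (norm z)\<^sup>2 / 2"
    unfolding power2_norm_eq_inner inner_vec_def
    by (simp add: sum_negf sum_divide_distrib[symmetric] power2_eq_square)
  finally show ?thesis .
qed

text \<open>The substitution y = x + e z shows that the smoothed law has a density, namely the
  normalized kernel average. The statement uses nonnegative integrals, for which the exchange of
  integrals is unconditional.\<close>

lemma smoothed_integral:
  fixes N :: "(real^'q) measure"
  assumes "prob_space N" and [measurable_cong]: "sets N = sets borel"
    and [measurable]: "g \<in> borel_measurable borel" and g: "\<And>x. 0 \<le> g x" and e: "e > 0"
  shows "(\<integral>\<^sup>+x. \<integral>\<^sup>+z. ennreal (g (x + e *\<^sub>R z)) \<partial>std_mv_normal \<partial>N) =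
    (\<integral>\<^sup>+y. ennreal (g y * (1 / (e * sqrt (2 * pi))) ^ CARD('q) * (\<integral>x. gauss_kernel e (y - x) \<partial>N)) \<partial>lborel)"
proof -
  interpret N: prob_space N by fact
  interpret P: pair_sigma_finite N "lborel :: (real^'q) measure" ..
  let ?c = "(1 / (e * sqrt (2 * pi))) ^ CARD('q)"
  have [measurable]: "gauss_kernel e \<in> borel_measurable borel"
    unfolding gauss_kernel_def by measurable
  have c: "?c \<ge> 0" using e by simp
  have k0: "gauss_kernel e u \<ge> 0" for u :: "real^'q" by (simp add: gauss_kernel_def)
  have "(\<integral>\<^sup>+z. ennreal (g (x + e *\<^sub>R z)) \<partial>std_mv_normal) =
     (\<integral>\<^sup>+y. ennreal (g y * ?c * gauss_kernel e (y - x)) \<partial>lborel)" for x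
  proof -
    have eq: "e ^ CARD('q) * (?c * gauss_kernel e (e *\<^sub>R z)) = (1 / sqrt (2 * pi)) ^ CARD('q) * exp (- (norm z)\<^sup>2 / 2)" for z :: "real^'q"
      using e by (simp add: gauss_kernel_def power_divide power_mult_distrib)
    have "(\<integral>\<^sup>+y. ennreal (g y * ?c * gauss_kernel e (y - x)) \<partial>lborel) =
      ennreal (\<bar>e\<bar> ^ DIM(real^'q)) * (\<integral>\<^sup>+z. ennreal (g (x + e *\<^sub>R z) * ?c * gauss_kernel e (x + e *\<^sub>R z - x)) \<partial>lborel)"
      using e by (subst nn_integral_lborel_affine[where c=e and t=x]) auto
    also have "\<dots> = (\<integral>\<^sup>+z. ennreal (e ^ CARD('q)) * ennreal (g (x + e *\<^sub>R z) * ?c * gauss_kernel e (e *\<^sub>R z)) \<partial>lborel)"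
      using e by (subst nn_integral_cmult) auto
    also have "\<dots> = (\<integral>\<^sup>+z. ennreal (\<Prod>i\<in>UNIV. std_normal_density (z $ i)) * ennreal (g (x + e *\<^sub>R z)) \<partial>lborel)"
    proof (intro nn_integral_cong)
      fix z :: "real^'q"
      have "e ^ CARD('q) * (g (x + e *\<^sub>R z) * ?c * gauss_kernel e (e *\<^sub>R z)) =
        (\<Prod>i\<in>UNIV. std_normal_density (z $ i)) * g (x + e *\<^sub>R z)"
        unfolding std_mv_density_gauss eq[symmetric] by (simp add: mult_ac)
      then show "ennreal (e ^ CARD('q)) * ennreal (g (x + e *\<^sub>R z) * ?c * gauss_kernel e (e *\<^sub>R z)) =
         ennreal (\<Prod>i\<in>UNIV. std_normal_density (z $ i)) * ennreal (g (x + e *\<^sub>R z))"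
        using g e c k0 by (simp only: ennreal_mult[symmetric] zero_le_power less_imp_le
            mult_nonneg_nonneg prod_nonneg normal_density_nonneg)
    qed
    also have "\<dots> = (\<integral>\<^sup>+z. ennreal (g (x + e *\<^sub>R z)) \<partial>std_mv_normal)"
      unfolding std_mv_normal_def by (subst nn_integral_density) auto
    finally show ?thesis ..
  qed
  then have "(\<integral>\<^sup>+x. \<integral>\<^sup>+z. ennreal (g (x + e *\<^sub>R z)) \<partial>std_mv_normal \<partial>N) =
     (\<integral>\<^sup>+x. \<integral>\<^sup>+y. ennreal (g y * ?c * gauss_kernel e (y - x)) \<partial>lborel \<partial>N)"
    by simp
  also have "\<dots> = (\<integral>\<^sup>+y. \<integral>\<^sup>+x. ennreal (g y * ?c * gauss_kernel e (y - x)) \<partial>N \<partial>lborel)"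
    by (rule P.Fubini'[symmetric]) simp
  also have "\<dots> = (\<integral>\<^sup>+y. ennreal (g y * ?c * (\<integral>x. gauss_kernel e (y - x) \<partial>N)) \<partial>lborel)"
  proof (intro nn_integral_cong)
    fix y :: "real^'q"
    have i: "integrable N (\<lambda>x. gauss_kernel e (y - x))"
      by (rule N.integrable_const_bound[of _ 1]) (auto simp: gauss_kernel_def)
    have "(\<integral>\<^sup>+x. ennreal (g y * ?c * gauss_kernel e (y - x)) \<partial>N) =
      ennreal (\<integral>x. g y * ?c * gauss_kernel e (y - x) \<partial>N)"
      using g c k0 i by (intro nn_integral_eq_integral) (auto intro!: mult_nonneg_nonneg AE_I2)
    then show "(\<integral>\<^sup>+x. ennreal (g y * ?c * gauss_kernel e (y - x)) \<partial>N) =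
      ennreal (g y * ?c * (\<integral>x. gauss_kernel e (y - x) \<partial>N))" by simp
  qed
  finally show ?thesis .
qed

lemma smoothed_integral_real:
  fixes N :: "(real^'q) measure"
  assumes "prob_space N" and [measurable_cong]: "sets N = sets borel"
    and [measurable]: "g \<in> borel_measurable borel" and g: "\<And>x. 0 \<le> g x" "\<And>x. g x \<le> B"
  shows "(\<integral>\<^sup>+x. \<integral>\<^sup>+z. ennreal (g (x + e *\<^sub>R z)) \<partial>std_mv_normal \<partial>N) =
    ennreal (\<integral>x. \<integral>z. g (x + e *\<^sub>R z) \<partial>std_mv_normal \<partial>N)"
proof -
  interpret N: prob_space N by fact
  interpret S: prob_space "std_mv_normal :: (real^'q) measure" by (rule prob_space_std_mv_normal)
  have B: "0 \<le> B" using g[of undefined] by linarith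
  have 1: "integrable std_mv_normal (\<lambda>z. g (x + e *\<^sub>R z))" for x
    by (rule S.integrable_const_bound[of _ B]) (use g in auto)
  have 2: "0 \<le> (\<integral>z. g (x + e *\<^sub>R z) \<partial>std_mv_normal)" for x
    by (simp add: g)
  have 3: "(\<integral>z. g (x + e *\<^sub>R z) \<partial>std_mv_normal) \<le> B" for x
    using integral_mono[OF 1[of x], of "\<lambda>_. B"] g S.prob_space by simp
  have "(\<integral>\<^sup>+x. \<integral>\<^sup>+z. ennreal (g (x + e *\<^sub>R z)) \<partial>std_mv_normal \<partial>N) =
     (\<integral>\<^sup>+x. ennreal (\<integral>z. g (x + e *\<^sub>R z) \<partial>std_mv_normal) \<partial>N)"
    using g 1 by (intro nn_integral_cong nn_integral_eq_integral) auto
  also have "\<dots> = ennreal (\<integral>x. \<integral>z. g (x + e *\<^sub>R z) \<partial>std_mv_normal \<partial>N)"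
    using 2 3 by (intro nn_integral_eq_integral N.integrable_const_bound[of _ B]) auto
  finally show ?thesis .
qed

text \<open>The densities of the smoothed laws converge pointwise. Fatou's lemma bounds the limit
  inferior from below; applied to B - g it bounds the limit superior from above. This takes the
  place of a dominating function.\<close>

lemma smoothed_integral_tendsto:
  fixes N :: "nat \<Rightarrow> (real^'q) measure" and g :: "real^'q \<Rightarrow> real" and B :: real
  assumes N: "\<And>n. prob_space (N n)" "\<And>n. sets (N n) = sets borel"
    and L: "prob_space L" "sets L = sets borel"
    and lim: "\<And>t. (\<lambda>n. mv_char (N n) t) \<longlonglongrightarrow> mv_char L t" and e: "e > 0"
    and g: "g \<in> borel_measurable borel" "\<And>x. 0 \<le> g x" "\<And>x. g x \<le> B"
  shows "(\<lambda>n. \<integral>x. \<integral>z. g (x + e *\<^sub>R z) \<partial>std_mv_normal \<partial>N n) \<longlonglongrightarrow> (\<integral>x. \<integral>z. g (x + e *\<^sub>R z) \<partial>std_mv_normal \<partial>L)"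
proof -
  interpret S: prob_space "std_mv_normal :: (real^'q) measure" by (rule prob_space_std_mv_normal)
  define A where "A g P = (\<integral>x. \<integral>z. g (x + e *\<^sub>R z) \<partial>std_mv_normal \<partial>P)" for g :: "real^'q \<Rightarrow> real" and P
  have low: "\<forall>\<^sub>F n in sequentially. A g L - d < A g (N n)" if d: "(d::real) > 0"
    and g: "g \<in> borel_measurable borel" "\<And>x. 0 \<le> g x" "\<And>x. g x \<le> B" for d and g :: "real^'q \<Rightarrow> real"
  proof -
    let ?c = "(1 / (e * sqrt (2 * pi))) ^ CARD('q)"
    let ?u = "\<lambda>n y. ennreal (g y * ?c * (\<integral>x. gauss_kernel e (y - x) \<partial>N n))"
    have A0: "0 \<le> A g P" for P unfolding A_def by (simp add: g)
    have eq: "ennreal (A g P) = (\<integral>\<^sup>+y. ennreal (g y * ?c * (\<integral>x. gauss_kernel e (y - x) \<partial>P)) \<partial>lborel)"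
      if "prob_space P" "sets P = sets borel" for P
      unfolding A_def smoothed_integral_real[OF that g, symmetric]
      by (rule smoothed_integral[OF that g(1,2) e])
    have [measurable]: "(\<lambda>y. \<integral>x. gauss_kernel e (y - x) \<partial>N n) \<in> borel_measurable borel" for n
    proof -
      interpret prob_space "N n" by (rule N)
      note [measurable_cong] = N(2)[of n]
      show ?thesis unfolding gauss_kernel_def by measurable
    qed
    have "ennreal (A g L) = (\<integral>\<^sup>+y. liminf (\<lambda>n. ?u n y) \<partial>lborel)"
      unfolding eq[OF L]
    proof (intro nn_integral_cong)
      fix y
      have "(\<lambda>n. ?u n y) \<longlonglongrightarrow> ennreal (g y * ?c * (\<integral>x. gauss_kernel e (y - x) \<partial>L))"
        by (intro tendsto_ennrealI tendsto_intros gauss_kernel_average_tendsto N L lim e)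
      from lim_imp_Liminf[OF _ this]
      show "ennreal (g y * ?c * (\<integral>x. gauss_kernel e (y - x) \<partial>L)) = liminf (\<lambda>n. ?u n y)" by simp
    qed
    also have "\<dots> \<le> liminf (\<lambda>n. \<integral>\<^sup>+y. ?u n y \<partial>lborel)"
      using g(1) by (intro nn_integral_liminf measurable_compose[OF _ measurable_ennreal] borel_measurable_times) simp_all
    also have "\<dots> = liminf (\<lambda>n. ennreal (A g (N n)))"
      by (simp only: eq[OF N])
    finally have le: "ennreal (A g L) \<le> liminf (\<lambda>n. ennreal (A g (N n)))" .
    show ?thesis
    proof (cases "A g L - d < 0")
      case True
      then show ?thesis using A0 by (intro always_eventually allI) (meson less_le_trans)
    next
      case False
      then have "ennreal (A g L - d) < ennreal (A g L)"
        using d by (intro ennreal_lessI) auto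
      with le have "\<forall>\<^sub>F n in sequentially. ennreal (A g L - d) < ennreal (A g (N n))"
        using le unfolding le_Liminf_iff by blast
      then show ?thesis
        using False by (auto simp: ennreal_less_iff elim!: eventually_mono)
    qed
  qed
  \<comment> \<open>Passing from g to B - g reflects the averages, because all measures involved
    have mass one.\<close>
  have comp: "A (\<lambda>x. B - g x) P = B - A g P" if P: "prob_space P" "sets P = sets borel" for P
  proof -
    interpret P: prob_space P by (rule P)
    note [measurable_cong] = P(2) and [measurable] = g(1)
    have 1: "integrable std_mv_normal (\<lambda>z. g (x + e *\<^sub>R z))" for x
      by (rule S.integrable_const_bound[of _ B]) (use g in auto)
    have 2: "0 \<le> (\<integral>z. g (x + e *\<^sub>R z) \<partial>std_mv_normal)" for x
      by (simp add: g)
    have 3: "(\<integral>z. g (x + e *\<^sub>R z) \<partial>std_mv_normal) \<le> B" for x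
      using integral_mono[OF 1[of x], of "\<lambda>_. B"] g S.prob_space by simp
    have "A (\<lambda>x. B - g x) P = (\<integral>x. B - (\<integral>z. g (x + e *\<^sub>R z) \<partial>std_mv_normal) \<partial>P)"
      unfolding A_def using 1 S.prob_space by (intro Bochner_Integration.integral_cong) auto
    also have "\<dots> = B - A g P"
      unfolding A_def using 2 3 P.prob_space
      by (subst Bochner_Integration.integral_diff) (auto intro!: P.integrable_const_bound[of _ B])
    finally show ?thesis .
  qed
  show ?thesis
    unfolding A_def[symmetric]
  proof (rule tendstoI)
    fix d :: real assume d: "d > 0"
    have "\<forall>\<^sub>F n in sequentially. A g L - d < A g (N n)" by (rule low[OF d g])
    moreover have "\<forall>\<^sub>F n in sequentially. A (\<lambda>x. B - g x) L - d < A (\<lambda>x. B - g x) (N n)"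
      by (rule low[OF d]) (use g in auto)
    ultimately show "\<forall>\<^sub>F n in sequentially. dist (A g (N n)) (A g L) < d"
      by eventually_elim (auto simp: comp[OF N] comp[OF L] dist_real_def)
  qed
qed

text \<open>Replacing g by its Gaussian smoothing at a small scale costs a Lipschitz error that does
  not depend on the measure; at a fixed scale the smoothed integrals converge by
  \<open>smoothed_integral_tendsto\<close>.\<close>

lemma lipschitz_integral_tendsto_nonneg:
  fixes N :: "nat \<Rightarrow> (real^'q) measure" and g :: "real^'q \<Rightarrow> real" and B :: real
  assumes N: "\<And>n. prob_space (N n)" "\<And>n. sets (N n) = sets borel"
    and L: "prob_space L" "sets L = sets borel"
    and lim: "\<And>t. (\<lambda>n. mv_char (N n) t) \<longlonglongrightarrow> mv_char L t"
    and g: "\<And>x y. \<bar>g x - g y\<bar> \<le> c * dist x y" "\<And>x. 0 \<le> g x" "\<And>x. g x \<le> B"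
  shows "(\<lambda>n. \<integral>x. g x \<partial>N n) \<longlonglongrightarrow> (\<integral>x. g x \<partial>L)"
proof (rule tendstoI)
  fix d :: real assume d: "d > 0"
  interpret S: prob_space "std_mv_normal :: (real^'q) measure" by (rule prob_space_std_mv_normal)
  have c: "0 \<le> c"
  proof -
    have "0 \<le> c * dist (0::real^'q) 1" using g(1)[of 0 1] by linarith
    moreover have "dist (0::real^'q) 1 > 0" by simp
    ultimately show ?thesis by (simp add: zero_le_mult_iff)
  qed
  have B: "0 \<le> B" using g(2,3)[of undefined] by linarith
  have "continuous_on UNIV g"
    using g(1) c by (intro lipschitz_on_continuous_on[of c]) (auto intro!: lipschitz_onI simp: dist_real_def)
  then have gm[measurable]: "g \<in> borel_measurable borel" by (rule borel_measurable_continuous_onI)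
  \<comment> \<open>Bounds the effect of smoothing at scale 1 / (k + 1). The truncation at
    \<open>B\<close> gives dominated convergence a constant bound.\<close>
  define w where "w k z = min B (c * (1 / Suc k) * norm z)" for k and z :: "real^'q"
  have "(\<lambda>k. \<integral>z. w k z \<partial>std_mv_normal) \<longlonglongrightarrow> (\<integral>z. 0 \<partial>(std_mv_normal :: (real^'q) measure))"
  proof (rule integral_dominated_convergence[where w="\<lambda>_. B"])
    have "(\<lambda>k. min B (c * (1 / real (Suc k)) * norm z)) \<longlonglongrightarrow> min B (c * 0 * norm z)" for z :: "real^'q"
      by (intro tendsto_intros lim_inverse_n'[THEN LIMSEQ_Suc])
    then show "AE z in std_mv_normal. (\<lambda>k. w k z) \<longlonglongrightarrow> 0"
      using B by (simp add: w_def)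
  qed (use B c in \<open>auto simp: w_def\<close>)
  then have "(\<lambda>k. \<integral>z. w k z \<partial>std_mv_normal) \<longlonglongrightarrow> 0" by simp
  from tendstoD[OF this, of "d / 3"] d obtain k where "dist (\<integral>z. w k z \<partial>std_mv_normal) 0 < d / 3"
    by (auto simp: eventually_sequentially)
  then have k: "(\<integral>z. w k z \<partial>std_mv_normal) < d / 3" by auto
  let ?e = "1 / real (Suc k)"
  have close: "\<bar>(\<integral>z. g (x + ?e *\<^sub>R z) \<partial>std_mv_normal) - g x\<bar> \<le> d / 3" for x
  proof -
    have 1: "integrable std_mv_normal (\<lambda>z. g (x + ?e *\<^sub>R z))"
      by (rule S.integrable_const_bound[of _ B]) (use g in auto)
    have "\<bar>(\<integral>z. g (x + ?e *\<^sub>R z) \<partial>std_mv_normal) - g x\<bar> = \<bar>\<integral>z. g (x + ?e *\<^sub>R z) - g x \<partial>std_mv_normal\<bar>"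
      using 1 S.prob_space by simp
    also have "\<dots> \<le> (\<integral>z. \<bar>g (x + ?e *\<^sub>R z) - g x\<bar> \<partial>std_mv_normal)"
      by (rule integral_abs_bound)
    also have "\<dots> \<le> (\<integral>z. w k z \<partial>std_mv_normal)"
    proof (intro integral_mono)
      show "integrable std_mv_normal (w k)"
        unfolding w_def by (rule S.integrable_const_bound[of _ B]) (use B c in \<open>auto\<close>)
      fix z
      have "\<bar>g (x + ?e *\<^sub>R z) - g x\<bar> \<le> B"
        using g(2,3)[of "x + ?e *\<^sub>R z"] g(2,3)[of x] by linarith
      moreover have "\<bar>g (x + ?e *\<^sub>R z) - g x\<bar> \<le> c * (?e * norm z)"
        using g(1)[of "x + ?e *\<^sub>R z" x] by (simp add: dist_norm)
      ultimately show "\<bar>g (x + ?e *\<^sub>R z) - g x\<bar> \<le> w k z" by (simp add: w_def mult.assoc)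
    qed (use 1 in auto)
    finally show ?thesis using k by simp
  qed
  have close': "\<bar>(\<integral>x. (\<integral>z. g (x + ?e *\<^sub>R z) \<partial>std_mv_normal) \<partial>P) - (\<integral>x. g x \<partial>P)\<bar> \<le> d / 3"
    if P: "prob_space P" "sets P = sets borel" for P
  proof -
    interpret P: prob_space P by (rule P)
    note [measurable_cong] = P(2)
    have 1: "integrable std_mv_normal (\<lambda>z. g (x + ?e *\<^sub>R z))" for x
      by (rule S.integrable_const_bound[of _ B]) (use g in auto)
    have 2: "0 \<le> (\<integral>z. g (x + ?e *\<^sub>R z) \<partial>std_mv_normal)" for x
      by (simp add: g)
    have 3: "(\<integral>z. g (x + ?e *\<^sub>R z) \<partial>std_mv_normal) \<le> B" for x
      using integral_mono[OF 1[of x], of "\<lambda>_. B"] g S.prob_space by simp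
    have i1: "integrable P (\<lambda>x. \<integral>z. g (x + ?e *\<^sub>R z) \<partial>std_mv_normal)"
      by (rule P.integrable_const_bound[of _ B]) (use 2 3 in auto)
    have i2: "integrable P g"
      by (rule P.integrable_const_bound[of _ B]) (use g in auto)
    have "\<bar>(\<integral>x. (\<integral>z. g (x + ?e *\<^sub>R z) \<partial>std_mv_normal) \<partial>P) - (\<integral>x. g x \<partial>P)\<bar>
       = \<bar>\<integral>x. (\<integral>z. g (x + ?e *\<^sub>R z) \<partial>std_mv_normal) - g x \<partial>P\<bar>"
      using i1 i2 by simp
    also have "\<dots> \<le> (\<integral>x. \<bar>(\<integral>z. g (x + ?e *\<^sub>R z) \<partial>std_mv_normal) - g x\<bar> \<partial>P)"
      by (rule integral_abs_bound)
    also have "\<dots> \<le> (\<integral>x. d / 3 \<partial>P)"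
      using i1 i2 close by (intro integral_mono) auto
    finally show ?thesis using P.prob_space by simp
  qed
  have "(\<lambda>n. \<integral>x. \<integral>z. g (x + ?e *\<^sub>R z) \<partial>std_mv_normal \<partial>N n) \<longlonglongrightarrow> (\<integral>x. \<integral>z. g (x + ?e *\<^sub>R z) \<partial>std_mv_normal \<partial>L)"
    by (rule smoothed_integral_tendsto[OF N L lim _ gm g(2,3)]) simp
  from tendstoD[OF this, of "d / 3"] d
  have "\<forall>\<^sub>F n in sequentially. dist (\<integral>x. \<integral>z. g (x + ?e *\<^sub>R z) \<partial>std_mv_normal \<partial>N n) (\<integral>x. \<integral>z. g (x + ?e *\<^sub>R z) \<partial>std_mv_normal \<partial>L) < d / 3"
    by simp
  then show "\<forall>\<^sub>F n in sequentially. dist (\<integral>x. g x \<partial>N n) (\<integral>x. g x \<partial>L) < d"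
  proof eventually_elim
    case (elim n)
    then show ?case using close'[OF N, of n] close'[OF L] unfolding dist_real_def by argo
  qed
qed

lemma lipschitz_integral_tendsto:
  fixes N :: "nat \<Rightarrow> (real^'q) measure" and g :: "real^'q \<Rightarrow> real" and B :: real
  assumes N: "\<And>n. prob_space (N n)" "\<And>n. sets (N n) = sets borel"
    and L: "prob_space L" "sets L = sets borel"
    and lim: "\<And>t. (\<lambda>n. mv_char (N n) t) \<longlonglongrightarrow> mv_char L t"
    and g: "\<And>x y. \<bar>g x - g y\<bar> \<le> c * dist x y" "\<And>x. \<bar>g x\<bar> \<le> B"
  shows "(\<lambda>n. \<integral>x. g x \<partial>N n) \<longlonglongrightarrow> (\<integral>x. g x \<partial>L)"
proof -
  have c: "0 \<le> c"
  proof -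
    have "0 \<le> c * dist (0::real^'q) 1" using g(1)[of 0 1] by linarith
    moreover have "dist (0::real^'q) 1 > 0" by simp
    ultimately show ?thesis by (simp add: zero_le_mult_iff)
  qed
  have "continuous_on UNIV g"
    using g(1) c by (intro lipschitz_on_continuous_on[of c]) (auto intro!: lipschitz_onI simp: dist_real_def)
  then have gm[measurable]: "g \<in> borel_measurable borel" by (rule borel_measurable_continuous_onI)
  have "(\<lambda>n. \<integral>x. g x + B \<partial>N n) \<longlonglongrightarrow> (\<integral>x. g x + B \<partial>L)"
  proof (rule lipschitz_integral_tendsto_nonneg[OF N L lim])
    show "\<bar>(g x + B) - (g y + B)\<bar> \<le> c * dist x y" for x y using g(1) by simp
    show "0 \<le> g x + B" "g x + B \<le> 2 * B" for x using g(2)[of x] by auto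
  qed
  moreover have "(\<integral>x. g x + B \<partial>P) = (\<integral>x. g x \<partial>P) + B" if P: "prob_space P" "sets P = sets borel" for P
  proof -
    interpret P: prob_space P by (rule P)
    note [measurable_cong] = P(2)
    have "integrable P g"
      by (rule P.integrable_const_bound[of _ B]) (use g in auto)
    then show ?thesis using P.prob_space by simp
  qed
  ultimately have "(\<lambda>n. (\<integral>x. g x \<partial>N n) + B) \<longlonglongrightarrow> (\<integral>x. g x \<partial>L) + B"
    by (simp only: N L)
  from tendsto_diff[OF this tendsto_const[of B]] show ?thesis by simp
qed

text \<open>The largest m-Lipschitz function below g (Pasch-Hausdorff envelope). It serves to pass
  from Lipschitz to continuous test functions by approximation from below.\<close>

definition inf_conv :: "('a::metric_space \<Rightarrow> real) \<Rightarrow> nat \<Rightarrow> 'a \<Rightarrow> real" where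
  "inf_conv g m x = (INF y. g y + real m * dist x y)"

lemma inf_conv_props:
  fixes g :: "'a::metric_space \<Rightarrow> real"
  assumes g: "\<And>x. \<bar>g x\<bar> \<le> B"
  shows "inf_conv g m x \<le> g x" "\<bar>inf_conv g m x\<bar> \<le> B"
    "\<bar>inf_conv g m x - inf_conv g m y\<bar> \<le> real m * dist x y"
proof -
  have bdd: "bdd_below (range (\<lambda>y. g y + real m * dist x y))" for x
  proof (rule bdd_belowI2)
    fix y
    have "0 \<le> real m * dist x y" by simp
    then show "- B \<le> g y + real m * dist x y" using g[of y] by linarith
  qed
  have le: "inf_conv g m x \<le> g y + real m * dist x y" for x y
    unfolding inf_conv_def by (rule cINF_lower[OF bdd]) simp
  show 1: "inf_conv g m x \<le> g x" for x using le[of x x] by simp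
  have "- B \<le> inf_conv g m x" unfolding inf_conv_def
  proof (rule cINF_greatest)
    fix y
    have "0 \<le> real m * dist x y" by simp
    then show "- B \<le> g y + real m * dist x y" using g[of y] by linarith
  qed simp
  then show "\<bar>inf_conv g m x\<bar> \<le> B" using 1[of x] g[of x] by linarith
  have "inf_conv g m x - real m * dist x y \<le> inf_conv g m y" for x y
    unfolding inf_conv_def[of g m y]
  proof (rule cINF_greatest)
    fix z
    have "real m * dist x z \<le> real m * dist x y + real m * dist y z"
      unfolding distrib_left[symmetric] by (intro mult_left_mono dist_triangle) auto
    then show "inf_conv g m x - real m * dist x y \<le> g z + real m * dist y z"
      using le[of x z] by linarith
  qed simp
  from this[of x y] this[of y x]
  show "\<bar>inf_conv g m x - inf_conv g m y\<bar> \<le> real m * dist x y"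
    by (simp add: dist_commute abs_le_iff)
qed

text \<open>A point y within d of x changes g by less than e / 2; any other point pays at least m d
  >= 2 B, which no drop of g can offset.\<close>

lemma inf_conv_tendsto:
  fixes g :: "'a::metric_space \<Rightarrow> real"
  assumes g: "\<And>x. \<bar>g x\<bar> \<le> B" and cont: "continuous_on UNIV g"
  shows "(\<lambda>m. inf_conv g m x) \<longlonglongrightarrow> g x"
proof (rule tendstoI)
  fix e :: real assume e: "e > 0"
  have "isCont g x" using cont by (simp add: continuous_on_eq_continuous_at)
  then obtain d where d: "d > 0" "\<And>y. dist y x < d \<Longrightarrow> dist (g y) (g x) < e / 2"
    using e unfolding continuous_at_eps_delta by (metis half_gt_zero)
  obtain m0 :: nat where m0: "2 * B / d < real m0" using reals_Archimedean2 by blast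
  show "\<forall>\<^sub>F m in sequentially. dist (inf_conv g m x) (g x) < e"
  proof (rule eventually_sequentiallyI[of m0])
    fix m assume "m0 \<le> m"
    then have m: "2 * B \<le> real m * d" using m0 d(1) by (simp add: field_simps) (smt (verit) mult_left_mono of_nat_le_iff)
    have "g x - e / 2 \<le> inf_conv g m x" unfolding inf_conv_def
    proof (rule cINF_greatest)
      fix y
      show "g x - e / 2 \<le> g y + real m * dist x y"
      proof (cases "dist y x < d")
        case True
        then have "\<bar>g y - g x\<bar> < e / 2" using d(2) by (simp add: dist_real_def)
        moreover have "0 \<le> real m * dist x y" by simp
        ultimately show ?thesis by linarith
      next
        case False
        then have "real m * d \<le> real m * dist x y"
          by (intro mult_left_mono) (auto simp: dist_commute)
        then show ?thesis using m g[of x] g[of y] e by linarith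
      qed
    qed simp
    then show "dist (inf_conv g m x) (g x) < e"
      using inf_conv_props(1)[of g B m x, OF g] e by (simp add: dist_real_def)
  qed
qed

text \<open>The Lipschitz minorants \<open>inf_conv g m\<close> bound the limit inferior of the
  integrals of g from below; the same argument for -g gives the upper bound.\<close>

lemma converges_weakly_lipschitzI:
  fixes N :: "nat \<Rightarrow> ('a::metric_space) measure"
  assumes N: "\<And>n. prob_space (N n)" "\<And>n. sets (N n) = sets borel"
    and L: "prob_space L" "sets L = sets borel"
    and lip: "\<And>g c B. (\<And>x y. \<bar>g x - g y\<bar> \<le> c * dist x y) \<Longrightarrow> 0 \<le> c \<Longrightarrow> (\<And>x. \<bar>g x\<bar> \<le> B) \<Longrightarrow>
      (\<lambda>n. \<integral>x. g x \<partial>N n) \<longlonglongrightarrow> (\<integral>x. g x \<partial>L)"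
  shows "converges_weakly N L"
proof -
  have int: "integrable P g" if P: "prob_space P" "sets P = sets borel"
    and g: "\<And>x. \<bar>g x\<bar> \<le> B" "continuous_on UNIV g" for P and g :: "'a \<Rightarrow> real" and B :: real
  proof -
    interpret P: prob_space P by (rule P)
    note [measurable_cong] = P(2)
    have [measurable]: "g \<in> borel_measurable borel" using g(2) by (rule borel_measurable_continuous_onI)
    show ?thesis by (rule P.integrable_const_bound[of _ B]) (use g in auto)
  qed
  have low: "\<forall>\<^sub>F n in sequentially. (\<integral>x. g x \<partial>L) - d < (\<integral>x. g x \<partial>N n)"
    if d: "d > 0" and g: "\<And>x. \<bar>g x\<bar> \<le> B" and cont: "continuous_on UNIV g" for g :: "'a \<Rightarrow> real" and d B :: real
  proof -
    have ccont: "continuous_on UNIV (inf_conv g m)" for m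
      using inf_conv_props(3)[of g B m, OF g]
      by (intro lipschitz_on_continuous_on[of "real m"]) (auto intro!: lipschitz_onI simp: dist_real_def)
    interpret L: prob_space L by (rule L)
    have [measurable]: "g \<in> borel_measurable L" "inf_conv g m \<in> borel_measurable L" for m
      using borel_measurable_continuous_onI[OF cont] borel_measurable_continuous_onI[OF ccont] L(2)
      by (auto cong: measurable_cong_sets)
    have "(\<lambda>m. \<integral>x. inf_conv g m x \<partial>L) \<longlonglongrightarrow> (\<integral>x. g x \<partial>L)"
      by (rule integral_dominated_convergence[where w="\<lambda>_. B"])
        (auto intro: inf_conv_tendsto[OF g cont] inf_conv_props(2)[OF g])
    from tendstoD[OF this, of "d / 2"] d obtain m where m: "dist (\<integral>x. inf_conv g m x \<partial>L) (\<integral>x. g x \<partial>L) < d / 2"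
      by (auto simp: eventually_sequentially)
    have "(\<lambda>n. \<integral>x. inf_conv g m x \<partial>N n) \<longlonglongrightarrow> (\<integral>x. inf_conv g m x \<partial>L)"
      by (rule lip[of _ "real m" B]) (use inf_conv_props[OF g] in auto)
    from tendstoD[OF this, of "d / 2"] d
    have "\<forall>\<^sub>F n in sequentially. dist (\<integral>x. inf_conv g m x \<partial>N n) (\<integral>x. inf_conv g m x \<partial>L) < d / 2" by simp
    then show ?thesis
    proof eventually_elim
      case (elim n)
      have "(\<integral>x. inf_conv g m x \<partial>N n) \<le> (\<integral>x. g x \<partial>N n)"
        by (intro integral_mono int[OF N inf_conv_props(2)[OF g] ccont] int[OF N g cont] inf_conv_props[OF g])
      with elim m show ?case unfolding dist_real_def by argo
    qed
  qed
  show ?thesis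
    unfolding converges_weakly_def
  proof (intro allI impI, elim conjE, rule tendstoI)
    fix g :: "'a \<Rightarrow> real" and d :: real
    assume cont: "continuous_on UNIV g" and "bounded (range g)" and d: "d > 0"
    then obtain B where g: "\<And>x. \<bar>g x\<bar> \<le> B" by (auto simp: bounded_iff)
    have "\<forall>\<^sub>F n in sequentially. (\<integral>x. g x \<partial>L) - d < (\<integral>x. g x \<partial>N n)"
      by (rule low[OF d g cont])
    moreover have "\<forall>\<^sub>F n in sequentially. (\<integral>x. - g x \<partial>L) - d < (\<integral>x. - g x \<partial>N n)"
      by (rule low[OF d, of _ B]) (use g cont in \<open>auto intro: continuous_intros\<close>)
    ultimately show "\<forall>\<^sub>F n in sequentially. dist (\<integral>x. g x \<partial>N n) (\<integral>x. g x \<partial>L) < d"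
      by eventually_elim (auto simp: dist_real_def)
  qed
qed

text \<open>Closeness in probability is stated through a measurable event \<open>G\<close> rather
  than through the probability of a large distance, since an event is what the analysis of the fit
  delivers. The spaces \<open>M n\<close> may vary with n.\<close>

lemma converges_weakly_slutsky:
  fixes Z U :: "nat \<Rightarrow> 'w \<Rightarrow> real^'q" and M :: "nat \<Rightarrow> 'w measure"
  assumes M: "\<And>n. prob_space (M n)"
    and Z: "\<And>n. Z n \<in> borel_measurable (M n)" and U: "\<And>n. U n \<in> borel_measurable (M n)"
    and L: "prob_space L" "sets L = sets borel"
    and lim: "\<And>t. (\<lambda>n. mv_char (distr (M n) borel (U n)) t) \<longlonglongrightarrow> mv_char L t"
    and close: "\<And>e. e > 0 \<Longrightarrow> \<forall>\<^sub>F n in sequentially. \<exists>G\<in>sets (M n). measure (M n) G \<ge> 1 - e \<and>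
        (\<forall>\<omega>\<in>G. dist (Z n \<omega>) (U n \<omega>) \<le> e)"
  shows "converges_weakly (\<lambda>n. distr (M n) borel (Z n)) L"
proof (rule converges_weakly_lipschitzI)
  show "prob_space (distr (M n) borel (Z n))" for n
    by (rule prob_space.prob_space_distr[OF M Z])
  fix g :: "real^'q \<Rightarrow> real" and c B :: real
  assume g: "\<And>x y. \<bar>g x - g y\<bar> \<le> c * dist x y" and c: "0 \<le> c" and B: "\<And>x. \<bar>g x\<bar> \<le> B"
  have B0: "0 \<le> B" using B[of undefined] by linarith
  have "continuous_on UNIV g"
    using g(1) c by (intro lipschitz_on_continuous_on[of c]) (auto intro!: lipschitz_onI simp: dist_real_def)
  then have gm[measurable]: "g \<in> borel_measurable borel" by (rule borel_measurable_continuous_onI)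
  have 1: "(\<lambda>n. \<integral>x. g x \<partial>distr (M n) borel (U n)) \<longlonglongrightarrow> (\<integral>x. g x \<partial>L)"
    by (rule lipschitz_integral_tendsto[OF _ _ L lim g B]) (auto intro: prob_space.prob_space_distr[OF M U])
  have 2: "(\<lambda>n. (\<integral>x. g x \<partial>distr (M n) borel (Z n)) - (\<integral>x. g x \<partial>distr (M n) borel (U n))) \<longlonglongrightarrow> 0"
  proof (rule tendstoI)
    fix d :: real assume d: "d > 0"
    \<comment> \<open>On \<open>G\<close> the integrands differ by at most c e; off
      \<open>G\<close>, a set of measure at most e, by at most 2 B. The extra 1 keeps the
      denominator positive and the total below d.\<close>
    define e where "e = d / (c + 2 * B + 1)"
    have e: "e > 0" using d c B0 by (simp add: e_def)
    have ed: "(c + 2 * B) * e < d"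
      using d c B0 by (simp add: e_def field_simps)
    from close[OF e]
    show "\<forall>\<^sub>F n in sequentially. dist ((\<integral>x. g x \<partial>distr (M n) borel (Z n)) - (\<integral>x. g x \<partial>distr (M n) borel (U n))) 0 < d"
    proof eventually_elim
      case (elim n)
      then obtain G where G[measurable]: "G \<in> sets (M n)" and mG: "measure (M n) G \<ge> 1 - e"
        and cl: "\<And>\<omega>. \<omega> \<in> G \<Longrightarrow> dist (Z n \<omega>) (U n \<omega>) \<le> e" by auto
      interpret prob_space "M n" by (rule M)
      note [measurable] = Z[of n] U[of n]
      have i: "integrable (M n) (\<lambda>\<omega>. g (Z n \<omega>))" "integrable (M n) (\<lambda>\<omega>. g (U n \<omega>))"
        using B by (auto intro!: integrable_const_bound[of _ B])
      have "\<bar>(\<integral>\<omega>. g (Z n \<omega>) \<partial>M n) - (\<integral>\<omega>. g (U n \<omega>) \<partial>M n)\<bar> = \<bar>\<integral>\<omega>. g (Z n \<omega>) - g (U n \<omega>) \<partial>M n\<bar>"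
        using i by simp
      also have "\<dots> \<le> (\<integral>\<omega>. \<bar>g (Z n \<omega>) - g (U n \<omega>)\<bar> \<partial>M n)"
        by (rule integral_abs_bound)
      also have "\<dots> \<le> (\<integral>\<omega>. c * e + 2 * B * indicator (space (M n) - G) \<omega> \<partial>M n)"
      proof (rule integral_mono)
        fix \<omega> assume w: "\<omega> \<in> space (M n)"
        show "\<bar>g (Z n \<omega>) - g (U n \<omega>)\<bar> \<le> c * e + 2 * B * indicator (space (M n) - G) \<omega>"
        proof (cases "\<omega> \<in> G")
          case True
          have "c * dist (Z n \<omega>) (U n \<omega>) \<le> c * e" using cl[OF True] c by (rule mult_left_mono)
          then show ?thesis using g[of "Z n \<omega>" "U n \<omega>"] True by simp
        next
          case False
          have "0 \<le> c * e" using c e by simp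
          then show ?thesis using B[of "Z n \<omega>"] B[of "U n \<omega>"] False w by (simp add: indicator_def)
        qed
      qed (use i in \<open>auto intro!: Bochner_Integration.integrable_add integrable_mult_right integrable_real_indicator simp: emeasure_eq_measure\<close>)
      also have "\<dots> = c * e + 2 * B * (1 - measure (M n) G)"
        using prob_compl[OF G] by (subst Bochner_Integration.integral_add) (auto simp: prob_space emeasure_eq_measure)
      also have "\<dots> \<le> c * e + 2 * B * e"
        using mG B0 by (intro add_left_mono mult_left_mono) auto
      also have "\<dots> < d" using ed by (simp add: algebra_simps)
      finally show ?case
        by (simp add: integral_distr dist_real_def)
    qed
  qed
  from tendsto_add[OF 1 2] show "(\<lambda>n. \<integral>x. g x \<partial>distr (M n) borel (Z n)) \<longlonglongrightarrow> (\<integral>x. g x \<partial>L)"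
    by simp
qed (use L in auto)

section \<open>Second moments and the central limit theorem\<close>

lemma (in prob_space) char_distr_iid_sum:
  assumes "indep_vars (\<lambda>_. borel) Y I" "\<And>i. i \<in> I \<Longrightarrow> distr M borel (Y i) = \<nu>"
  shows "char (distr M borel (\<lambda>\<omega>. \<Sum>i\<in>I. Y i \<omega>)) t = char \<nu> t ^ card I"
  using assms by (simp add: char_distr_sum)

text \<open>The conclusion mentions only the law \<nu>. So the central limit theorem can be applied
  on an infinite product of copies of \<nu>, and the result is then available for samples that live
  on a different space for each n.\<close>

lemma char_power_tendsto:
  fixes \<nu> :: "real measure"
  assumes \<nu>: "prob_space \<nu>" and s[measurable_cong]: "sets \<nu> = sets borel"
    and mean: "(\<integral>x. x \<partial>\<nu>) = 0" and sq: "integrable \<nu> (\<lambda>x. x\<^sup>2)"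
  shows "(\<lambda>n. char \<nu> (t / sqrt (real n)) ^ n) \<longlonglongrightarrow> exp (- (t\<^sup>2 * (\<integral>x. x\<^sup>2 \<partial>\<nu>)) / 2)"
proof -
  define v where "v = (\<integral>x. x\<^sup>2 \<partial>\<nu>)"
  interpret \<nu>: prob_space \<nu> by fact
  have sp: "space \<nu> = UNIV" using sets_eq_imp_space_eq[OF s] by simp
  have v0: "v \<ge> 0" by (simp add: v_def)
  show ?thesis
  \<comment> \<open>The central limit theorem divides by the standard deviation, so the degenerate
    law, the point mass at 0, is treated apart.\<close>
  proof (cases "v = 0")
    case True
    then have "AE x in \<nu>. x\<^sup>2 = 0"
      unfolding v_def by (subst (asm) integral_nonneg_eq_0_iff_AE[OF sq]) auto
    then have ae: "AE x in \<nu>. x = 0" by simp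
    have "char \<nu> s = 1" for s
    proof -
      have "char \<nu> s = (CLINT x|\<nu>. 1)"
        unfolding char_def using ae by (intro integral_cong_AE) auto
      then show ?thesis by (simp add: \<nu>.prob_space)
    qed
    then show ?thesis using True by (simp add: v_def[symmetric])
  next
    case False
    define \<sigma> where "\<sigma> = sqrt v"
    have \<sigma>: "\<sigma> > 0" "\<sigma>\<^sup>2 = v" using False v0 by (auto simp: \<sigma>_def)
    define P where "P = PiM (UNIV :: nat set) (\<lambda>_. \<nu>)"
    interpret PP: product_prob_space "\<lambda>_::nat. \<nu>" UNIV ..
    interpret P: prob_space P unfolding P_def by (rule prob_space_PiM) (rule \<nu>)
    have m[measurable]: "(\<lambda>\<omega>. \<omega> i) \<in> P \<rightarrow>\<^sub>M borel" for i :: nat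
      unfolding P_def by (subst measurable_cong_sets[OF refl s[symmetric]]) measurable
    have d: "distr P borel (\<lambda>\<omega>. \<omega> i) = \<nu>" for i :: nat
    proof -
      have "distr P borel (\<lambda>\<omega>. \<omega> i) = distr P \<nu> (\<lambda>\<omega>. \<omega> i)"
        by (rule distr_cong) (simp_all add: s)
      also have "\<dots> = \<nu>" unfolding P_def by (rule distr_PiM_component) (auto intro: \<nu>)
      finally show ?thesis .
    qed
    have ind: "P.indep_vars (\<lambda>_. borel) (\<lambda>i \<omega>. \<omega> i) (UNIV :: nat set)"
    proof (subst P.indep_vars_iff_distr_eq_PiM)
      have "distr P (PiM UNIV (\<lambda>_. borel)) (\<lambda>x. \<lambda>i\<in>(UNIV::nat set). x i) = distr P P (\<lambda>x. x)"
      proof (rule distr_cong)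
        show "sets (PiM UNIV (\<lambda>_::nat. borel)) = sets P"
          unfolding P_def by (rule sets_PiM_cong) (simp_all add: s)
      qed auto
      then show "distr P (PiM UNIV (\<lambda>_. borel)) (\<lambda>x. \<lambda>i\<in>(UNIV::nat set). x i) = PiM UNIV (\<lambda>i. distr P borel (\<lambda>\<omega>. \<omega> i))"
        by (simp add: d) (simp add: P_def)
    qed auto
    have e1: "P.expectation (\<lambda>\<omega>. \<omega> i) = 0" for i
      using integral_distr[OF m[of i], of "\<lambda>x. x"] mean by (simp add: d)
    have e2: "P.expectation (\<lambda>\<omega>. (\<omega> i)\<^sup>2) = v" for i
      using integral_distr[OF m[of i], of "\<lambda>x. x\<^sup>2"] by (simp add: d v_def)
    have e3: "integrable P (\<lambda>\<omega>. (\<omega> i)\<^sup>2)" for i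
      using integrable_distr_eq[OF m[of i], of "\<lambda>x. x\<^sup>2"] sq by (simp add: d)
    have "weak_conv_m (\<lambda>n. distr P borel (\<lambda>x. (\<Sum>i<n. x i) / sqrt (n * \<sigma>\<^sup>2))) std_normal_distribution"
      by (rule P.central_limit_theorem_zero_mean[OF ind e1 \<sigma>(1) e3 _ d]) (simp add: e1 e2 \<sigma>)
    from levy_continuity1[OF _ _ this, of "\<sigma> * t"]
    have lim: "(\<lambda>n. char (distr P borel (\<lambda>x. (\<Sum>i<n. x i) / sqrt (n * \<sigma>\<^sup>2))) (\<sigma> * t)) \<longlonglongrightarrow> char std_normal_distribution (\<sigma> * t)"
      by (auto intro!: P.real_distribution_distr real_dist_normal_dist)
    have "char (distr P borel (\<lambda>x. (\<Sum>i<n. x i) / sqrt (n * \<sigma>\<^sup>2))) (\<sigma> * t) = char \<nu> (t / sqrt n) ^ n" for n :: nat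
    proof -
      have "char (distr P borel (\<lambda>x. (\<Sum>i<n. x i) / sqrt (n * \<sigma>\<^sup>2))) (\<sigma> * t) =
        (CLINT x|P. iexp (t / sqrt n * (\<Sum>i<n. x i)))"
        unfolding char_def using \<sigma>(1)
        by (subst integral_distr) (auto simp: real_sqrt_mult field_simps)
      also have "\<dots> = char (distr P borel (\<lambda>\<omega>. \<Sum>i<n. \<omega> i)) (t / sqrt n)"
        unfolding char_def by (subst integral_distr) auto
      also have "\<dots> = char \<nu> (t / sqrt n) ^ n"
        by (subst P.char_distr_iid_sum[OF P.indep_vars_subset[OF ind]]) (auto simp: d)
      finally show ?thesis .
    qed
    with lim show ?thesis
      by (simp add: char_std_normal_distribution power_mult_distrib \<sigma> v_def[symmetric] mult.commute)
  qed
qed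

text \<open>For a fixed direction t the vector sum becomes a scalar sum, as in the Cramer-Wold
  device. The sample size \<open>k n\<close> is kept general because the lemma will be applied along
  n + 2.\<close>

lemma mv_char_clt:
  fixes h :: "'b \<Rightarrow> real^'q"
  assumes M: "\<And>n. prob_space (M n)"
    and ind: "\<And>n. prob_space.indep_vars (M n) (\<lambda>_. N) (Z n) {1..k n}"
    and law: "\<And>n i. i \<in> {1..k n} \<Longrightarrow> distr (M n) N (Z n i) = \<nu>"
    and \<nu>: "prob_space \<nu>" "sets \<nu> = sets N"
    and h[measurable]: "h \<in> borel_measurable N"
    and sq: "integrable \<nu> (\<lambda>z. (norm (h z))\<^sup>2)" and mean: "(\<integral>z. h z \<partial>\<nu>) = 0"
    and k: "filterlim k at_top sequentially"
  shows "(\<lambda>n. mv_char (distr (M n) borel (\<lambda>\<omega>. (1 / sqrt (real (k n))) *\<^sub>R (\<Sum>i=1..k n. h (Z n i \<omega>)))) t)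
     \<longlonglongrightarrow> exp (- (\<integral>z. (t \<bullet> h z)\<^sup>2 \<partial>\<nu>) / 2)"
proof -
  interpret \<nu>: prob_space \<nu> by fact
  note [measurable_cong] = \<nu>(2)
  define \<rho> where "\<rho> = distr \<nu> borel (\<lambda>z. t \<bullet> h z)"
  have hi: "integrable \<nu> h"
    by (rule integrable_norm_cancel) (use \<nu>.square_integrable_imp_integrable[of "\<lambda>z. norm (h z)"] sq in auto)
  have sqt: "integrable \<nu> (\<lambda>z. (t \<bullet> h z)\<^sup>2)"
  proof (rule Bochner_Integration.integrable_bound[OF integrable_mult_right[OF sq, of "(norm t)\<^sup>2"]])
    show "AE z in \<nu>. norm ((t \<bullet> h z)\<^sup>2) \<le> norm ((norm t)\<^sup>2 * (norm (h z))\<^sup>2)"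
      using Cauchy_Schwarz_ineq2[of t] by (auto simp: power_mult_distrib[symmetric] abs_le_square_iff[symmetric])
  qed measurable
  have "(\<integral>x. x \<partial>\<rho>) = t \<bullet> (\<integral>z. h z \<partial>\<nu>)"
    unfolding \<rho>_def using hi by (subst integral_distr) auto
  then have 1: "(\<lambda>n. char \<rho> (1 / sqrt (real n)) ^ n) \<longlonglongrightarrow> exp (- (1\<^sup>2 * (\<integral>x. x\<^sup>2 \<partial>\<rho>)) / 2)"
    by (intro char_power_tendsto)
      (auto simp: mean \<rho>_def integrable_distr_eq sqt intro!: \<nu>.prob_space_distr)
  have 2: "(\<integral>x. x\<^sup>2 \<partial>\<rho>) = (\<integral>z. (t \<bullet> h z)\<^sup>2 \<partial>\<nu>)"
    unfolding \<rho>_def by (subst integral_distr) auto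
  have "mv_char (distr (M n) borel (\<lambda>\<omega>. (1 / sqrt (real (k n))) *\<^sub>R (\<Sum>i=1..k n. h (Z n i \<omega>)))) t
     = char \<rho> (1 / sqrt (real (k n))) ^ k n" for n
  proof -
    interpret prob_space "M n" by (rule M)
    have Zm[measurable]: "Z n i \<in> M n \<rightarrow>\<^sub>M N" if "i \<in> {1..k n}" for i
      using ind[of n] that unfolding indep_vars_def by auto
    have hm[measurable]: "(\<lambda>\<omega>. \<Sum>i=1..k n. h (Z n i \<omega>)) \<in> borel_measurable (M n)"
      by (intro borel_measurable_sum measurable_compose[OF Zm h]) auto
    have indh: "indep_vars (\<lambda>_. borel) (\<lambda>i \<omega>. t \<bullet> h (Z n i \<omega>)) {1..k n}"
      by (rule indep_vars_compose2[OF ind]) simp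
    have dh: "distr (M n) borel (\<lambda>\<omega>. t \<bullet> h (Z n i \<omega>)) = \<rho>" if "i \<in> {1..k n}" for i
      unfolding \<rho>_def law[OF that, symmetric] using that by (subst distr_distr) (auto simp: o_def)
    have "mv_char (distr (M n) borel (\<lambda>\<omega>. (1 / sqrt (real (k n))) *\<^sub>R (\<Sum>i=1..k n. h (Z n i \<omega>)))) t
      = (CLINT \<omega>|M n. iexp (1 / sqrt (real (k n)) * (\<Sum>i=1..k n. t \<bullet> h (Z n i \<omega>))))"
      unfolding mv_char_def by (subst integral_distr) (auto simp: inner_sum_right)
    also have "\<dots> = char (distr (M n) borel (\<lambda>\<omega>. \<Sum>i=1..k n. t \<bullet> h (Z n i \<omega>))) (1 / sqrt (real (k n)))"
      unfolding char_def using indh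
      by (subst integral_distr) (auto intro!: borel_measurable_sum simp: indep_vars_def)
    also have "\<dots> = char \<rho> (1 / sqrt (real (k n))) ^ k n"
      by (subst char_distr_iid_sum[OF indh]) (auto simp: dh)
    finally show ?thesis .
  qed
  with filterlim_compose[OF 1 k] show ?thesis by (simp add: 2)
qed

text \<open>Independence kills the off-diagonal covariances, which leaves the variance of one term
  divided by n; the variance is at most the second moment.\<close>

lemma (in prob_space) iid_mean_deviation:
  fixes h :: "'b \<Rightarrow> real" and n :: nat
  assumes ind: "indep_vars (\<lambda>_. N) Z {1..n}"
    and law: "\<And>i. i \<in> {1..n} \<Longrightarrow> distr M N (Z i) = \<nu>"
    and \<nu>: "prob_space \<nu>" "sets \<nu> = sets N"
    and h[measurable]: "h \<in> borel_measurable N"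
    and sq: "integrable \<nu> (\<lambda>z. (h z)\<^sup>2)" and n: "n \<ge> 1"
  shows "integrable M (\<lambda>\<omega>. ((\<Sum>i=1..n. h (Z i \<omega>)) / n - (\<integral>z. h z \<partial>\<nu>))\<^sup>2)"
    "expectation (\<lambda>\<omega>. ((\<Sum>i=1..n. h (Z i \<omega>)) / n - (\<integral>z. h z \<partial>\<nu>))\<^sup>2) \<le> (\<integral>z. (h z)\<^sup>2 \<partial>\<nu>) / n"
proof -
  interpret \<nu>: prob_space \<nu> by fact
  note [measurable_cong] = \<nu>(2)
  define m where "m = (\<integral>z. h z \<partial>\<nu>)"
  define Y where "Y i \<omega> = h (Z i \<omega>) - m" for i \<omega>
  have Zm[measurable]: "Z i \<in> M \<rightarrow>\<^sub>M N" if "i \<in> {1..n}" for i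
    using ind that unfolding indep_vars_def by auto
  have hi: "integrable \<nu> h" by (rule \<nu>.square_integrable_imp_integrable) (use sq in auto)
  have tr: "integrable M (\<lambda>\<omega>. g (Z i \<omega>))" "expectation (\<lambda>\<omega>. g (Z i \<omega>)) = (\<integral>z. g z \<partial>\<nu>)"
    if "i \<in> {1..n}" "integrable \<nu> g" for i and g :: "'b \<Rightarrow> real"
  proof -
    have "g \<in> borel_measurable N" using that(2) by (auto cong: measurable_cong_sets)
    then show "integrable M (\<lambda>\<omega>. g (Z i \<omega>))" "expectation (\<lambda>\<omega>. g (Z i \<omega>)) = (\<integral>z. g z \<partial>\<nu>)"
      using that(2) integrable_distr[OF Zm[OF that(1)], of g] integral_distr[OF Zm[OF that(1)], of g]
      unfolding law[OF that(1)] by simp_all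
  qed
  have sq2: "integrable \<nu> (\<lambda>z. (h z - m)\<^sup>2)" "(\<integral>z. (h z - m)\<^sup>2 \<partial>\<nu>) \<le> (\<integral>z. (h z)\<^sup>2 \<partial>\<nu>)"
  proof -
    show "integrable \<nu> (\<lambda>z. (h z - m)\<^sup>2)" using sq hi by (simp add: power2_diff)
    have "(\<integral>z. (h z - m)\<^sup>2 \<partial>\<nu>) = (\<integral>z. (h z)\<^sup>2 \<partial>\<nu>) + m\<^sup>2 - 2 * m * m"
      using sq hi \<nu>.prob_space by (simp add: power2_diff m_def[symmetric])
    then have "(\<integral>z. (h z - m)\<^sup>2 \<partial>\<nu>) = (\<integral>z. (h z)\<^sup>2 \<partial>\<nu>) - m\<^sup>2"
      by (simp add: power2_eq_square)
    then show "(\<integral>z. (h z - m)\<^sup>2 \<partial>\<nu>) \<le> (\<integral>z. (h z)\<^sup>2 \<partial>\<nu>)" by simp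
  qed
  have Yi: "integrable M (Y i)" "expectation (Y i) = 0" if "i \<in> {1..n}" for i
    using tr[OF that, of "\<lambda>z. h z - m"] hi \<nu>.prob_space by (auto simp: Y_def[abs_def] m_def)
  have Y2: "integrable M (\<lambda>\<omega>. Y i \<omega> * Y i \<omega>)" "expectation (\<lambda>\<omega>. Y i \<omega> * Y i \<omega>) \<le> (\<integral>z. (h z)\<^sup>2 \<partial>\<nu>)" if "i \<in> {1..n}" for i
    using tr[OF that sq2(1)] sq2(2) by (auto simp: Y_def[abs_def] power2_eq_square)
  have ivY: "indep_vars (\<lambda>_. borel) Y {1..n}"
    unfolding Y_def[abs_def] by (rule indep_vars_compose2[OF ind]) simp
  have YY: "integrable M (\<lambda>\<omega>. Y i \<omega> * Y j \<omega>)" "expectation (\<lambda>\<omega>. Y i \<omega> * Y j \<omega>) = 0"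
    if "i \<in> {1..n}" "j \<in> {1..n}" "i \<noteq> j" for i j
  proof -
    have iv: "indep_var borel (Y i) borel (Y j)"
      using indep_vars_sum[of "{j}" i Y] indep_vars_subset[OF ivY, of "{i, j}"] that by simp
    show "integrable M (\<lambda>\<omega>. Y i \<omega> * Y j \<omega>)" by (rule indep_var_integrable[OF iv Yi(1) Yi(1)]) (use that in auto)
    show "expectation (\<lambda>\<omega>. Y i \<omega> * Y j \<omega>) = 0"
      using indep_var_lebesgue_integral[OF iv Yi(1) Yi(1)] Yi(2) that by auto
  qed
  have eq: "((\<Sum>i=1..n. h (Z i \<omega>)) / n - m)\<^sup>2 = (\<Sum>i=1..n. \<Sum>j=1..n. Y i \<omega> * Y j \<omega>) / (real n)\<^sup>2" for \<omega>
  proof -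
    have "(\<Sum>i=1..n. h (Z i \<omega>)) / n - m = (\<Sum>i=1..n. Y i \<omega>) / n"
      using n by (simp add: Y_def sum_subtractf field_simps)
    then show ?thesis by (simp add: power_divide power2_eq_square sum_product)
  qed
  have int: "integrable M (\<lambda>\<omega>. Y i \<omega> * Y j \<omega>)" if "i \<in> {1..n}" "j \<in> {1..n}" for i j
    using YY(1) Y2(1) that by (cases "i = j") auto
  show "integrable M (\<lambda>\<omega>. ((\<Sum>i=1..n. h (Z i \<omega>)) / n - (\<integral>z. h z \<partial>\<nu>))\<^sup>2)"
    unfolding m_def[symmetric] eq by (intro integrable_divide Bochner_Integration.integrable_sum int)
  have "expectation (\<lambda>\<omega>. ((\<Sum>i=1..n. h (Z i \<omega>)) / n - m)\<^sup>2)
     = (\<Sum>i=1..n. \<Sum>j=1..n. expectation (\<lambda>\<omega>. Y i \<omega> * Y j \<omega>)) / (real n)\<^sup>2"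
  proof -
    have "expectation (\<lambda>\<omega>. \<Sum>i=1..n. \<Sum>j=1..n. Y i \<omega> * Y j \<omega>) = (\<Sum>i=1..n. expectation (\<lambda>\<omega>. \<Sum>j=1..n. Y i \<omega> * Y j \<omega>))"
      by (rule Bochner_Integration.integral_sum) (intro Bochner_Integration.integrable_sum int)
    also have "\<dots> = (\<Sum>i=1..n. \<Sum>j=1..n. expectation (\<lambda>\<omega>. Y i \<omega> * Y j \<omega>))"
      by (intro sum.cong refl Bochner_Integration.integral_sum int)
    finally show ?thesis unfolding eq by simp
  qed
  also have "(\<Sum>i=1..n. \<Sum>j=1..n. expectation (\<lambda>\<omega>. Y i \<omega> * Y j \<omega>)) = (\<Sum>i=1..n. \<Sum>j=1..n. if i = j then expectation (\<lambda>\<omega>. Y i \<omega> * Y i \<omega>) else 0)"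
    by (intro sum.cong refl) (auto simp: YY(2))
  also have "\<dots> = (\<Sum>i=1..n. expectation (\<lambda>\<omega>. Y i \<omega> * Y i \<omega>))"
    by (simp add: sum.delta)
  also have "\<dots> \<le> (\<Sum>i=1..n. (\<integral>z. (h z)\<^sup>2 \<partial>\<nu>))"
    by (rule sum_mono) (rule Y2(2))
  also have "\<dots> / (real n)\<^sup>2 = (\<integral>z. (h z)\<^sup>2 \<partial>\<nu>) / n"
    using n by (simp add: power2_eq_square)
  finally show "expectation (\<lambda>\<omega>. ((\<Sum>i=1..n. h (Z i \<omega>)) / n - (\<integral>z. h z \<partial>\<nu>))\<^sup>2) \<le> (\<integral>z. (h z)\<^sup>2 \<partial>\<nu>) / n"
    by (simp add: m_def divide_right_mono)
qed

lemma (in prob_space) iid_mean: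
  fixes h :: "'b \<Rightarrow> real" and n :: nat
  assumes rv: "\<And>i. i \<in> {1..n} \<Longrightarrow> Z i \<in> M \<rightarrow>\<^sub>M N"
    and law: "\<And>i. i \<in> {1..n} \<Longrightarrow> distr M N (Z i) = \<nu>"
    and h: "integrable \<nu> h" and n: "n \<ge> 1"
  shows "integrable M (\<lambda>\<omega>. (\<Sum>i=1..n. h (Z i \<omega>)) / n)"
    "expectation (\<lambda>\<omega>. (\<Sum>i=1..n. h (Z i \<omega>)) / n) = (\<integral>z. h z \<partial>\<nu>)"
proof -
  have s: "sets \<nu> = sets N" using law[of 1] n by auto
  have hm: "h \<in> borel_measurable N" using h s by (auto cong: measurable_cong_sets)
  have *: "integrable M (\<lambda>\<omega>. h (Z i \<omega>))" "expectation (\<lambda>\<omega>. h (Z i \<omega>)) = (\<integral>z. h z \<partial>\<nu>)" if "i \<in> {1..n}" for i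
    using that h rv[OF that] hm unfolding law[OF that, symmetric]
    by (auto simp: integrable_distr_eq integral_distr)
  show "integrable M (\<lambda>\<omega>. (\<Sum>i=1..n. h (Z i \<omega>)) / n)"
    by (intro integrable_divide Bochner_Integration.integrable_sum *)
  show "expectation (\<lambda>\<omega>. (\<Sum>i=1..n. h (Z i \<omega>)) / n) = (\<integral>z. h z \<partial>\<nu>)"
    using * n by (simp add: Bochner_Integration.integral_sum)
qed

section \<open>Approximation by piecewise polynomials\<close>

lemma L2_fun_measurable [measurable_dest]: "f \<in> L2_fun M \<Longrightarrow> f \<in> borel_measurable M"
  by (simp add: L2_fun_def)

lemma L2_fun_integrable_sq: "f \<in> L2_fun M \<Longrightarrow> integrable M (\<lambda>x. (f x)\<^sup>2)"
  by (simp add: L2_fun_def)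

lemma L2_fun_mult:
  assumes "f \<in> L2_fun M" "g \<in> L2_fun M"
  shows "integrable M (\<lambda>x. f x * g x)"
proof (rule Bochner_Integration.integrable_bound)
  show "integrable M (\<lambda>x. (f x)\<^sup>2 + (g x)\<^sup>2)" using assms by (auto simp: L2_fun_def)
  have "\<bar>a * b\<bar> \<le> \<bar>a\<^sup>2 + b\<^sup>2\<bar>" for a b :: real
  proof -
    have "2 * (\<bar>a\<bar> * \<bar>b\<bar>) \<le> a\<^sup>2 + b\<^sup>2" using sum_squares_bound[of "\<bar>a\<bar>" "\<bar>b\<bar>"] by (simp add: mult.assoc)
    moreover have "0 \<le> \<bar>a\<bar> * \<bar>b\<bar>" by simp
    ultimately show ?thesis unfolding abs_mult by linarith
  qed
  then show "AE x in M. norm (f x * g x) \<le> norm ((f x)\<^sup>2 + (g x)\<^sup>2)" by simp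
qed (use assms in measurable)

lemma L2_fun_add: "f \<in> L2_fun M \<Longrightarrow> g \<in> L2_fun M \<Longrightarrow> (\<lambda>x. f x + g x) \<in> L2_fun M"
  using L2_fun_mult[of f M g] by (auto simp: L2_fun_def power2_sum mult.assoc)

lemma L2_fun_cmult: "f \<in> L2_fun M \<Longrightarrow> (\<lambda>x. c * f x) \<in> L2_fun M"
  by (auto simp: L2_fun_def power_mult_distrib)

lemma L2_fun_minus: "f \<in> L2_fun M \<Longrightarrow> (\<lambda>x. - f x) \<in> L2_fun M"
  using L2_fun_cmult[of f M "-1"] by simp

lemma L2_fun_diff: "f \<in> L2_fun M \<Longrightarrow> g \<in> L2_fun M \<Longrightarrow> (\<lambda>x. f x - g x) \<in> L2_fun M"
  using L2_fun_add[OF _ L2_fun_minus, of f M g] by simp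

lemma L2_fun_sum: "(\<And>i. i \<in> I \<Longrightarrow> f i \<in> L2_fun M) \<Longrightarrow> (\<lambda>x. \<Sum>i\<in>I. f i x) \<in> L2_fun M"
  by (induction I rule: infinite_finite_induct) (simp_all add: L2_fun_add, simp_all add: L2_fun_def)

lemma L2_fun_bounded:
  assumes "finite_measure M" "f \<in> borel_measurable M" "AE x in M. \<bar>f x\<bar> \<le> B"
  shows "f \<in> L2_fun M"
proof -
  interpret finite_measure M by fact
  have "integrable M (\<lambda>x. (f x)\<^sup>2)"
    using assms(2,3) by (intro integrable_const_bound[of _ "B\<^sup>2"])
      (auto elim!: eventually_mono simp: abs_le_square_iff[symmetric])
  then show ?thesis using assms by (simp add: L2_fun_def)
qed

lemma L2_fun_integrable: "finite_measure M \<Longrightarrow> f \<in> L2_fun M \<Longrightarrow> integrable M f"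
  by (rule finite_measure.square_integrable_imp_integrable) (auto simp: L2_fun_def)

text \<open>Integrating the square of b f - c g avoids dividing by b; if b = 0, then g vanishes
  almost everywhere.\<close>

lemma Cauchy_Schwarz_integral:
  assumes f: "f \<in> L2_fun M" and g: "g \<in> L2_fun M"
  shows "(\<integral>x. f x * g x \<partial>M)\<^sup>2 \<le> (\<integral>x. (f x)\<^sup>2 \<partial>M) * (\<integral>x. (g x)\<^sup>2 \<partial>M)"
proof -
  define a b c where "a = (\<integral>x. (f x)\<^sup>2 \<partial>M)" and "b = (\<integral>x. (g x)\<^sup>2 \<partial>M)" and "c = (\<integral>x. f x * g x \<partial>M)"
  note i = L2_fun_integrable_sq[OF f] L2_fun_integrable_sq[OF g] L2_fun_mult[OF f g]
  show ?thesis
  proof (cases "b = 0")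
    case True
    then have "AE x in M. (g x)\<^sup>2 = 0"
      unfolding b_def by (subst (asm) integral_nonneg_eq_0_iff_AE[OF i(2)]) auto
    then have "c = (\<integral>x. 0 \<partial>M)"
      unfolding c_def using f g by (intro integral_cong_AE) auto
    then show ?thesis by (simp add: c_def[symmetric] a_def[symmetric] b_def[symmetric] True)
  next
    case False
    have "b \<ge> 0" by (simp add: b_def)
    with False have b: "b > 0" by simp
    have "0 \<le> (\<integral>x. (b * f x - c * g x)\<^sup>2 \<partial>M)" by simp
    also have "(\<integral>x. (b * f x - c * g x)\<^sup>2 \<partial>M) = (\<integral>x. b\<^sup>2 * (f x)\<^sup>2 + c\<^sup>2 * (g x)\<^sup>2 - (2 * b * c) * (f x * g x) \<partial>M)"
      by (simp add: power2_diff power_mult_distrib algebra_simps)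
    also have "\<dots> = b\<^sup>2 * a + c\<^sup>2 * b - (2 * b * c) * c"
      using i unfolding a_def b_def c_def by simp
    also have "\<dots> = b * (a * b - c\<^sup>2)" by (simp add: power2_eq_square algebra_simps)
    finally show ?thesis using b
      by (simp add: zero_le_mult_iff a_def[symmetric] b_def[symmetric] c_def[symmetric])
  qed
qed

definition l2 :: "'a measure \<Rightarrow> ('a \<Rightarrow> real) \<Rightarrow> real" where
  "l2 M f = sqrt (\<integral>x. (f x)\<^sup>2 \<partial>M)"

lemma l2_nonneg [simp]: "0 \<le> l2 M f" by (simp add: l2_def)

lemma l2_sq: "(l2 M f)\<^sup>2 = (\<integral>x. (f x)\<^sup>2 \<partial>M)" by (simp add: l2_def)

lemma Cauchy_Schwarz_l2:
  assumes "f \<in> L2_fun M" "g \<in> L2_fun M"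
  shows "\<bar>\<integral>x. f x * g x \<partial>M\<bar> \<le> l2 M f * l2 M g"
  unfolding l2_def real_sqrt_mult[symmetric] using Cauchy_Schwarz_integral[OF assms]
  by (intro real_le_rsqrt) simp

lemma l2_triangle:
  assumes "f \<in> L2_fun M" "g \<in> L2_fun M"
  shows "l2 M (\<lambda>x. f x + g x) \<le> l2 M f + l2 M g"
proof (rule power2_le_imp_le)
  have "(l2 M (\<lambda>x. f x + g x))\<^sup>2 = (l2 M f)\<^sup>2 + (l2 M g)\<^sup>2 + 2 * (\<integral>x. f x * g x \<partial>M)"
    unfolding l2_sq power2_sum using L2_fun_mult[OF assms] L2_fun_integrable_sq[OF assms(1)] L2_fun_integrable_sq[OF assms(2)]
    by (simp add: mult.assoc)
  also have "\<dots> \<le> (l2 M f + l2 M g)\<^sup>2"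
    using Cauchy_Schwarz_l2[OF assms] unfolding power2_sum by linarith
  finally show "(l2 M (\<lambda>x. f x + g x))\<^sup>2 \<le> (l2 M f + l2 M g)\<^sup>2" .
qed simp

lemma l2_minus: "l2 M (\<lambda>x. - f x) = l2 M f" by (simp add: l2_def)

lemma l2_commute: "l2 M (\<lambda>x. f x - g x) = l2 M (\<lambda>x. g x - f x)"
  by (simp add: l2_def power2_commute)

lemma l2_triangle_diff:
  assumes "f \<in> L2_fun M" "g \<in> L2_fun M" "h \<in> L2_fun M"
  shows "l2 M (\<lambda>x. f x - h x) \<le> l2 M (\<lambda>x. f x - g x) + l2 M (\<lambda>x. g x - h x)"
  using l2_triangle[OF L2_fun_diff[OF assms(1,2)] L2_fun_diff[OF assms(2,3)]] by simp

lemma l2_mono: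
  assumes "f \<in> borel_measurable M" "g \<in> L2_fun M" "AE x in M. \<bar>f x\<bar> \<le> \<bar>g x\<bar>"
  shows "l2 M f \<le> l2 M g" "f \<in> L2_fun M"
proof -
  have sq: "AE x in M. (f x)\<^sup>2 \<le> (g x)\<^sup>2" using assms(3) by (simp add: abs_le_square_iff)
  have "integrable M (\<lambda>x. (f x)\<^sup>2)"
    by (rule Bochner_Integration.integrable_bound[OF L2_fun_integrable_sq[OF assms(2)]]) (use assms(1) sq in auto)
  then show f: "f \<in> L2_fun M" using assms(1) by (simp add: L2_fun_def)
  show "l2 M f \<le> l2 M g" unfolding l2_def
    by (intro real_sqrt_le_mono integral_mono_AE L2_fun_integrable_sq f assms sq)
qed

section \<open>Finite differences and polynomial interpolation at integer nodes\<close>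

lemma finite_diff_Suc: "finite_diff (Suc k) u g t = finite_diff k u g (t + u) - finite_diff k u g t"
proof -
  let ?s = "\<lambda>n i. (- 1 :: real) ^ (n - i)"
  have "finite_diff (Suc k) u g t =
     (\<Sum>i\<le>Suc k. ?s (Suc k) i * real (Suc k choose i) * g (t + real i * u))"
    by (simp only: finite_diff_def)
  also have "\<dots> = ?s (Suc k) 0 * g t + (\<Sum>i\<le>k. ?s k i * (real (k choose i) + real (k choose Suc i)) * g (t + real (Suc i) * u))"
    by (subst sum.atMost_Suc_shift) simp
  also have "\<dots> = (\<Sum>i\<le>k. ?s k i * real (k choose i) * g (t + u + real i * u)) +
     (?s (Suc k) 0 * g t + (\<Sum>i\<le>k. ?s k i * real (k choose Suc i) * g (t + real (Suc i) * u)))"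
    by (simp add: sum.distrib algebra_simps)
  also have "?s (Suc k) 0 * g t + (\<Sum>i\<le>k. ?s k i * real (k choose Suc i) * g (t + real (Suc i) * u))
     = (\<Sum>i\<le>Suc k. ?s (Suc k) i * real (k choose i) * g (t + real i * u))"
    by (subst sum.atMost_Suc_shift) simp
  also have "\<dots> = (\<Sum>i\<le>k. ?s (Suc k) i * real (k choose i) * g (t + real i * u))"
    by simp
  also have "\<dots> = - (\<Sum>i\<le>k. ?s k i * real (k choose i) * g (t + real i * u))"
    unfolding sum_negf[symmetric] by (intro sum.cong refl) (simp add: Suc_diff_le)
  finally show ?thesis by (simp add: finite_diff_def)
qed

lemma finite_diff_diff: "finite_diff k u (\<lambda>s. f s - g s) t = finite_diff k u f t - finite_diff k u g t"
  by (simp add: finite_diff_def sum_subtractf algebra_simps)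

lemma finite_diff_shift: "finite_diff k u g (t + c) = finite_diff k u (\<lambda>s. g (s + c)) t"
  by (simp add: finite_diff_def add_ac)

text \<open>A shift of the argument preserves the leading coefficient, so it cancels in the
  difference.\<close>

lemma degree_shift_diff:
  fixes F :: "real poly"
  assumes "degree F \<le> Suc k"
  shows "degree (pcompose F [:u, 1:] - F) \<le> k"
proof (rule degree_le, intro allI impI)
  fix i assume i: "k < i"
  have d: "degree (pcompose F [:u, 1:]) = degree F" by (simp add: degree_pcompose)
  show "coeff (pcompose F [:u, 1:] - F) i = 0"
  proof (cases "i = degree F")
    case True
    have "lead_coeff (pcompose F [:u, 1:]) = lead_coeff F"
      by (subst lead_coeff_comp) auto
    then show ?thesis using True d by simp
  next
    case False
    then have "degree F < i" using i assms by simp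
    then show ?thesis using d by (simp add: coeff_eq_0)
  qed
qed

lemma finite_diff_poly_eq_0:
  fixes F :: "real poly"
  assumes "degree F \<le> k"
  shows "finite_diff (Suc k) u (poly F) t = 0"
  using assms
proof (induction k arbitrary: F)
  case 0
  then obtain c where "F = [:c:]" by (auto elim: degree_eq_zeroE)
  then show ?case by (simp add: finite_diff_def)
next
  case (Suc k)
  have "finite_diff (Suc (Suc k)) u (poly F) t = finite_diff (Suc k) u (\<lambda>s. poly F (s + u) - poly F s) t"
    by (subst finite_diff_Suc) (simp only: finite_diff_shift finite_diff_diff)
  also have "(\<lambda>s. poly F (s + u) - poly F s) = poly (pcompose F [:u, 1:] - F)"
    by (auto simp: poly_pcompose add_ac)
  also have "finite_diff (Suc k) u \<dots> t = 0"
    by (rule Suc.IH) (rule degree_shift_diff[OF Suc.prems])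
  finally show ?case .
qed

definition lagrange_poly :: "nat \<Rightarrow> nat \<Rightarrow> real poly" where
  "lagrange_poly k j = (\<Prod>i\<in>{..k} - {j}. smult (1 / (real j - real i)) [:- real i, 1:])"

lemma poly_lagrange_poly:
  assumes "j \<le> k" "i \<le> k"
  shows "poly (lagrange_poly k j) (real i) = (if i = j then 1 else 0)"
  using assms by (auto simp: lagrange_poly_def poly_prod diff_divide_distrib[symmetric] intro!: prod.neutral)

lemma degree_lagrange_poly: "j \<le> k \<Longrightarrow> degree (lagrange_poly k j) \<le> k"
proof -
  assume j: "j \<le> k"
  have "degree (lagrange_poly k j) \<le> (\<Sum>i\<in>{..k} - {j}. degree (smult (1 / (real j - real i)) [:- real i, 1:]))"
    unfolding lagrange_poly_def by (rule order_trans[OF degree_prod_sum_le]) auto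
  also have "\<dots> \<le> (\<Sum>i\<in>{..k} - {j}. 1)"
    by (intro sum_mono) (auto intro: order_trans[OF degree_smult_le])
  also have "\<dots> = k" using j by simp
  finally show ?thesis .
qed

definition interpolant :: "nat \<Rightarrow> (real \<Rightarrow> real) \<Rightarrow> real poly" where
  "interpolant k A = (\<Sum>j\<le>k. smult (A (real j)) (lagrange_poly k j))"

lemma degree_interpolant: "degree (interpolant k A) \<le> k"
  unfolding interpolant_def
  by (intro degree_sum_le) (auto intro!: order_trans[OF degree_smult_le] degree_lagrange_poly)

lemma poly_interpolant: "i \<le> k \<Longrightarrow> poly (interpolant k A) (real i) = A (real i)"
proof -
  assume i: "i \<le> k"
  have "poly (interpolant k A) (real i) = (\<Sum>j\<le>k. if i = j then A (real j) else 0)"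
    unfolding interpolant_def poly_sum using i by (intro sum.cong) (auto simp: poly_lagrange_poly)
  also have "\<dots> = A (real i)" using i by (simp add: sum.delta)
  finally show ?thesis .
qed

lemma interpolant_poly:
  assumes "degree F \<le> k"
  shows "interpolant k (poly F) = F"
proof -
  let ?D = "interpolant k (poly F) - F"
  have "?D = 0"
  proof (rule ccontr)
    assume nz: "?D \<noteq> 0"
    have "degree ?D \<le> k" using assms degree_interpolant by (intro degree_diff_le)
    moreover have "card (real ` {..k}) \<le> card {x. poly ?D x = 0}"
      using nz by (intro card_mono poly_roots_finite) (auto simp: poly_interpolant)
    moreover have "card {x. poly ?D x = 0} \<le> degree ?D" by (rule card_poly_roots_bound[OF nz])
    ultimately show False by (simp add: card_image)
  qed
  then show ?thesis by simp
qed

lemma pderiv_sum': "pderiv (\<Sum>x\<in>S. f x) = (\<Sum>x\<in>S. pderiv (f x))" for f :: "_ \<Rightarrow> real poly"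
  by (induction S rule: infinite_finite_induct) (auto simp: pderiv_add)

lemma poly_pderiv_interpolant:
  "poly (pderiv (interpolant k A)) z = (\<Sum>j\<le>k. A (real j) * poly (pderiv (lagrange_poly k j)) z)"
  by (simp add: interpolant_def pderiv_sum' pderiv_smult poly_sum)

text \<open>The interpolant has degree at most k, so its difference of order k + 1 vanishes. Hence
  the error at a node beyond k equals a difference of \<open>A\<close> minus a combination of the
  errors at the k + 1 preceding nodes. The binomial weights sum to at most 2 ^ (k + 1), which
  produces the geometric growth.\<close>

lemma interpolant_extrapolation:
  fixes A :: "real \<Rightarrow> real" and k :: nat
  defines "E \<equiv> (\<Sum>i<k. \<bar>finite_diff (Suc k) 1 A (real i)\<bar>)"
  assumes "i \<le> 2 * k"
  shows "\<bar>A (real i) - poly (interpolant k A) (real i)\<bar> \<le> (2 ^ Suc k + 1) ^ i * E"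
  using assms(2)
proof (induction i rule: less_induct)
  case (less i)
  let ?d = "\<lambda>s. A s - poly (interpolant k A) s" and ?M = "2 ^ Suc k + 1 :: real"
  have E0: "0 \<le> E" unfolding E_def by (rule sum_nonneg) simp
  show ?case
  proof (cases "i \<le> k")
    case True
    then show ?thesis using E0 by (simp add: poly_interpolant)
  next
    case False
    define j where "j = i - Suc k"
    have j: "i = j + Suc k" "j < k" using False less.prems by (auto simp: j_def)
    have "finite_diff (Suc k) 1 A (real j) = finite_diff (Suc k) 1 ?d (real j)"
      by (simp add: finite_diff_diff finite_diff_poly_eq_0 degree_interpolant)
    also have "\<dots> = ?d (real i) + (\<Sum>l\<le>k. (- 1) ^ (Suc k - l) * real (Suc k choose l) * ?d (real j + real l))"
      unfolding finite_diff_def by (simp add: j add_ac)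
    finally have "\<bar>?d (real i)\<bar> \<le> \<bar>finite_diff (Suc k) 1 A (real j)\<bar> + \<bar>\<Sum>l\<le>k. (- 1) ^ (Suc k - l) * real (Suc k choose l) * ?d (real j + real l)\<bar>"
      by linarith
    also have "\<bar>finite_diff (Suc k) 1 A (real j)\<bar> \<le> E"
      unfolding E_def using j by (intro member_le_sum) auto
    also have "\<bar>\<Sum>l\<le>k. (- 1) ^ (Suc k - l) * real (Suc k choose l) * ?d (real j + real l)\<bar>
       \<le> (\<Sum>l\<le>k. real (Suc k choose l) * (?M ^ (i - 1) * E))"
    proof (rule order_trans[OF sum_abs], rule sum_mono)
      fix l assume l: "l \<in> {..k}"
      have "\<bar>?d (real (j + l))\<bar> \<le> ?M ^ (j + l) * E"
        using l j less.prems by (intro less.IH) auto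
      also have "\<dots> \<le> ?M ^ (i - 1) * E"
        using l j E0 by (intro mult_right_mono power_increasing) auto
      finally have "\<bar>?d (real j + real l)\<bar> \<le> ?M ^ (i - 1) * E" by simp
      then show "\<bar>(- 1) ^ (Suc k - l) * real (Suc k choose l) * ?d (real j + real l)\<bar> \<le> real (Suc k choose l) * (?M ^ (i - 1) * E)"
        by (simp add: abs_mult mult_left_mono)
    qed
    also have "\<dots> \<le> (\<Sum>l\<le>Suc k. real (Suc k choose l) * (?M ^ (i - 1) * E))"
      using E0 by simp
    also have "\<dots> = 2 ^ Suc k * (?M ^ (i - 1) * E)"
      using choose_row_sum[of "Suc k"] unfolding sum_distrib_right[symmetric] of_nat_sum[symmetric] by simp
    finally have "\<bar>?d (real i)\<bar> \<le> E + 2 ^ Suc k * (?M ^ (i - 1) * E)" by simp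
    moreover have "1 * E \<le> ?M ^ (i - 1) * E"
      using E0 by (intro mult_right_mono one_le_power) auto
    ultimately have "\<bar>?d (real i)\<bar> \<le> ?M * ?M ^ (i - 1) * E"
      unfolding distrib_right by simp
    also have "?M * ?M ^ (i - 1) = ?M ^ i" using j by (cases i) auto
    finally show ?thesis .
  qed
qed

text \<open>Compares, in the local coordinate of a dyadic interval with \<open>2 k\<close> cells, the interpolant of a
  parent with that of its left (\<open>e = 0\<close>) or right (\<open>e = 1\<close>) child; \<open>A\<close> and \<open>B\<close> are the primitives.\<close>

lemma refinement_difference:
  fixes A B :: "real \<Rightarrow> real"
  assumes e: "e \<le> 1" and AB: "\<And>z. z \<le> k \<Longrightarrow> A (real (k * e + z)) - A (real (k * e)) = B (real (2 * z)) / 2"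
  shows "\<exists>\<eta>. (\<forall>z. poly (pderiv (interpolant k A)) (real (k * e) + z) - poly (pderiv (interpolant k B)) (2 * z)
       = (\<Sum>j\<le>k. \<eta> j * poly (pderiv (lagrange_poly k j)) z)) \<and>
     (\<forall>j\<le>k. \<bar>\<eta> j\<bar> \<le> (2 ^ Suc k + 1) ^ (2 * k) *
        ((\<Sum>i<k. \<bar>finite_diff (Suc k) 1 A (real i)\<bar>) + (\<Sum>i<k. \<bar>finite_diff (Suc k) 1 B (real i)\<bar>)))"
proof -
  let ?FA = "interpolant k A" and ?FB = "interpolant k B" and ?M = "2 ^ Suc k + 1 :: real"
  let ?EA = "\<Sum>i<k. \<bar>finite_diff (Suc k) 1 A (real i)\<bar>" and ?EB = "\<Sum>i<k. \<bar>finite_diff (Suc k) 1 B (real i)\<bar>"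
  \<comment> \<open>Parent minus child, both measured from the left end of the child in units of the
    parent's step; the child's step is half as long, hence the factor 1/2 and the argument 2 z. The
    constant A (k e) is removed so that, by \<open>AB\<close>, the value of \<open>G\<close> at a
    node combines only the extrapolation errors of the two interpolants.\<close>
  define G where "G = pcompose ?FA [:real (k * e), 1:] - smult (1/2) (pcompose ?FB [:0, 2:]) - [:A (real (k * e)):]"
  define \<eta> where "\<eta> j = poly G (real j)" for j :: nat
  have dG: "degree G \<le> k" unfolding G_def
    using degree_interpolant[of k A] degree_interpolant[of k B]
    by (intro degree_diff_le order_trans[OF degree_smult_le]) (simp_all add: degree_pcompose)
  have "poly (pderiv ?FA) (real (k * e) + z) - poly (pderiv ?FB) (2 * z) = poly (pderiv G) z" for z
    by (simp add: G_def pderiv_diff pderiv_smult pderiv_pcompose pderiv_pCons poly_pcompose mult.commute)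
  moreover have "poly (pderiv G) z = (\<Sum>j\<le>k. \<eta> j * poly (pderiv (lagrange_poly k j)) z)" for z
    using poly_pderiv_interpolant[of k "poly G" z] by (simp add: interpolant_poly[OF dG] \<eta>_def)
  moreover have "\<bar>\<eta> j\<bar> \<le> ?M ^ (2 * k) * (?EA + ?EB)" if j: "j \<le> k" for j
  proof -
    have E0: "0 \<le> ?EA" "0 \<le> ?EB" by (auto intro: sum_nonneg)
    have i1: "k * e + j \<le> 2 * k" using e j by (cases e) auto
    have eq: "\<eta> j = poly ?FA (real (k * e + j)) - poly ?FB (real (2 * j)) / 2 - A (real (k * e))"
      by (simp add: \<eta>_def G_def poly_pcompose mult.commute)
    have "\<bar>A (real (k * e + j)) - poly ?FA (real (k * e + j))\<bar> \<le> ?M ^ (k * e + j) * ?EA"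
      by (rule interpolant_extrapolation[OF i1])
    also have "\<dots> \<le> ?M ^ (2 * k) * ?EA"
      using i1 E0 by (intro mult_right_mono power_increasing) auto
    finally have 1: "\<bar>A (real (k * e + j)) - poly ?FA (real (k * e + j))\<bar> \<le> ?M ^ (2 * k) * ?EA" .
    have "\<bar>B (real (2 * j)) - poly ?FB (real (2 * j))\<bar> \<le> ?M ^ (2 * j) * ?EB"
      using j by (intro interpolant_extrapolation) auto
    also have "\<dots> \<le> ?M ^ (2 * k) * ?EB"
      using j E0 by (intro mult_right_mono power_increasing) auto
    finally have 2: "\<bar>B (real (2 * j)) - poly ?FB (real (2 * j))\<bar> \<le> ?M ^ (2 * k) * ?EB" .
    show ?thesis using 1 2 AB[OF j] unfolding eq distrib_left by linarith
  qed
  ultimately show ?thesis by (intro exI[of _ \<eta>]) auto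
qed

lemma poly_bounds_on_interval:
  fixes p :: "real poly"
  shows "\<exists>C\<ge>0. (\<forall>z\<in>{a..b}. \<bar>poly p z\<bar> \<le> C) \<and> (\<forall>z\<in>{a..b}. \<forall>w\<in>{a..b}. \<bar>poly p z - poly p w\<bar> \<le> C * \<bar>z - w\<bar>)"
proof -
  have ex: "\<exists>C\<ge>0. \<forall>z\<in>{a..b}. \<bar>poly q z\<bar> \<le> C" for q :: "real poly"
  proof -
    have "compact (poly q ` {a..b})" by (intro compact_continuous_image continuous_intros) auto
    then have "bounded (poly q ` {a..b})" by (rule compact_imp_bounded)
    then obtain C where "C > 0" "\<forall>y\<in>poly q ` {a..b}. norm y \<le> C" by (auto simp: bounded_pos)
    then show ?thesis by (intro exI[of _ C]) auto
  qed
  obtain C1 where C1: "C1 \<ge> 0" "\<forall>z\<in>{a..b}. \<bar>poly p z\<bar> \<le> C1" using ex by blast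
  obtain C2 where C2: "C2 \<ge> 0" "\<forall>z\<in>{a..b}. \<bar>poly (pderiv p) z\<bar> \<le> C2" using ex by blast
  have "\<bar>poly p z - poly p w\<bar> \<le> C2 * \<bar>z - w\<bar>" if "z \<in> {a..b}" "w \<in> {a..b}" for z w
    using field_differentiable_bound[of "{a..b}" "poly p" "poly (pderiv p)" C2 z w] C2(2) that
    by (auto intro: DERIV_subset poly_DERIV)
  then have "\<bar>poly p z - poly p w\<bar> \<le> max C1 C2 * \<bar>z - w\<bar>" if "z \<in> {a..b}" "w \<in> {a..b}" for z w
    using that by (meson abs_ge_zero max.cobounded2 mult_right_mono order_trans)
  then show ?thesis using C1 by (intro exI[of _ "max C1 C2"]) auto
qed

section \<open>Cells, and norms computed cell by cell\<close>

definition cell :: "nat \<Rightarrow> nat \<Rightarrow> real set" where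
  "cell K j = {real j / real K..<real (Suc j) / real K}"

lemma cell_borel [measurable]: "cell K j \<in> sets borel" by (simp add: cell_def)

lemma cell_exists:
  assumes "K > 0" "t \<in> {0..<1}"
  obtains j where "j < K" "t \<in> cell K j"
proof -
  define j where "j = nat \<lfloor>t * real K\<rfloor>"
  have j: "real j \<le> t * real K" "t * real K < real (Suc j)"
    using assms by (auto simp: j_def of_nat_nat) linarith+
  have "t * real K < real K" using assms by simp
  then have "real j < real K" using j by linarith
  then have "j < K" by simp
  moreover have "t \<in> cell K j" using j assms(1) by (simp add: cell_def field_simps)
  ultimately show ?thesis using that by blast
qed

lemma cell_unique:
  assumes "K > 0" "t \<in> cell K i" "t \<in> cell K j"
  shows "i = j"
proof -
  have "real i < real (Suc j)" "real j < real (Suc i)"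
    using assms by (auto simp: cell_def divide_le_eq pos_less_divide_eq less_divide_eq field_simps)
  then show ?thesis by simp
qed

lemma cell_subset: "j < K \<Longrightarrow> cell K j \<subseteq> {0..<1}"
proof
  fix t assume j: "j < K" and t: "t \<in> cell K j"
  have "real (Suc j) / real K \<le> 1" using j by simp
  moreover have "0 \<le> real j / real K" by simp
  ultimately show "t \<in> {0..<1}" using t unfolding cell_def atLeastLessThan_iff by linarith
qed

lemma sum_cell_indicator:
  fixes f :: "nat \<Rightarrow> real"
  assumes "j < K" "t \<in> cell K j"
  shows "(\<Sum>i<K. f i * indicator (cell K i) t) = f j"
proof -
  have "(\<Sum>i<K. f i * indicator (cell K i) t) = (\<Sum>i<K. if i = j then f j else 0)"
  proof (intro sum.cong refl)
    fix i
    have "t \<notin> cell K i" if "i \<noteq> j" using cell_unique[of K t i j] assms that by auto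
    then show "f i * indicator (cell K i) t = (if i = j then f j else 0)"
      using assms(2) by (cases "i = j") simp_all
  qed
  then show ?thesis using assms by simp
qed

lemma sum_cell_indicator_outside:
  fixes f :: "nat \<Rightarrow> real"
  assumes "t \<notin> {0..<1}"
  shows "(\<Sum>i<K. f i * indicator (cell K i) t) = 0"
proof (intro sum.neutral ballI)
  fix i assume "i \<in> {..<K}"
  then have "t \<notin> cell K i" using cell_subset[of i K] assms by auto
  then show "f i * indicator (cell K i) t = 0" by simp
qed

text \<open>Renumbers the cells from 0; \<open>pw_poly\<close> counts them from 1.\<close>

lemma pw_poly_cell_iff:
  "v \<in> pw_poly r K \<longleftrightarrow> (\<exists>P. (\<forall>j<K. degree (P j) \<le> r - 1) \<and>
     v = (\<lambda>t. \<Sum>j<K. poly (P j) t * indicator (cell K j) t))"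
proof -
  have eq: "(\<Sum>j=1..K. poly (P j) t * indicator {(real j - 1) / real K..<real j / real K} t)
     = (\<Sum>j<K. poly (P (Suc j)) t * indicator (cell K j) t)" for P :: "nat \<Rightarrow> real poly" and t
    by (simp add: cell_def sum.atLeast1_atMost_eq)
  show ?thesis
  proof
    assume "v \<in> pw_poly r K"
    then obtain P where P: "\<forall>j\<in>{1..K}. degree (P j) \<le> r - 1"
      "v = (\<lambda>t. \<Sum>j=1..K. poly (P j) t * indicator {(real j - 1) / real K..<real j / real K} t)"
      unfolding pw_poly_def by blast
    then show "\<exists>P. (\<forall>j<K. degree (P j) \<le> r - 1) \<and> v = (\<lambda>t. \<Sum>j<K. poly (P j) t * indicator (cell K j) t)"
      by (intro exI[of _ "\<lambda>j. P (Suc j)"]) (auto simp: eq[symmetric])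
  next
    assume "\<exists>P. (\<forall>j<K. degree (P j) \<le> r - 1) \<and> v = (\<lambda>t. \<Sum>j<K. poly (P j) t * indicator (cell K j) t)"
    then obtain P where P: "\<forall>j<K. degree (P j) \<le> r - 1" "v = (\<lambda>t. \<Sum>j<K. poly (P j) t * indicator (cell K j) t)"
      by blast
    show "v \<in> pw_poly r K"
      unfolding pw_poly_def mem_Collect_eq
    proof (intro exI[of _ "\<lambda>j. P (j - 1)"] conjI ballI)
      show "v = (\<lambda>t. \<Sum>j=1..K. poly (P (j - 1)) t * indicator {(real j - 1) / real K..<real j / real K} t)"
        using eq[of "\<lambda>j. P (j - 1)"] P(2) by simp
    qed (use P in auto)
  qed
qed

lemma pw_poly_mono:
  assumes "k \<le> r"
  shows "pw_poly k K \<subseteq> pw_poly r K"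
proof
  fix v assume "v \<in> pw_poly k K"
  then obtain P where "\<forall>j<K. degree (P j) \<le> k - 1" "v = (\<lambda>t. \<Sum>j<K. poly (P j) t * indicator (cell K j) t)"
    unfolding pw_poly_cell_iff by blast
  then show "v \<in> pw_poly r K"
    unfolding pw_poly_cell_iff using assms by (intro exI[of _ P]) (auto intro: order_trans[OF _ diff_le_mono])
qed

text \<open>Half-open, so that the cells partition the space exactly; the endpoint 1 is a null set
  for Lebesgue measure and for the law of \<open>T\<close>.\<close>

definition unif :: "real measure" where "unif = restrict_space lborel {0..<1}"

lemma space_unif [simp]: "space unif = {0..<1}" by (simp add: unif_def space_restrict_space)

lemma measurable_unif [measurable (raw)]: "f \<in> borel_measurable borel \<Longrightarrow> f \<in> borel_measurable unif"
  unfolding unif_def by (rule measurable_restrict_space1) simp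

lemma finite_measure_unif: "finite_measure unif"
  unfolding unif_def by (rule finite_measureI) (simp add: emeasure_restrict_space space_restrict_space)

lemma integral_unif: "(\<integral>t. f t \<partial>unif) = (\<integral>t. f t * indicator {0..<1} t \<partial>lborel)" for f :: "real \<Rightarrow> real"
  unfolding unif_def by (subst integral_restrict_space) (simp_all add: mult.commute)

lemma integrable_unif:
  fixes f :: "real \<Rightarrow> real"
  assumes "integrable lborel f" shows "integrable unif f"
proof -
  have "integrable lborel (\<lambda>t. indicator {0..<1} t *\<^sub>R f t)"
    by (rule integrable_mult_indicator) (use assms in auto)
  then show ?thesis unfolding unif_def by (subst integrable_restrict_space) auto
qed

lemma L2_fun_unif: "f \<in> L2_fun lborel \<Longrightarrow> f \<in> L2_fun unif"
  using integrable_unif[of "\<lambda>x. (f x)\<^sup>2"] by (auto simp: L2_fun_def)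

text \<open>The square is dominated by a step function on cells of equal length 1 / K. This converts
  the cellwise bounds of the approximation theory into norm bounds.\<close>

lemma step_function_L2:
  assumes v: "v \<in> borel_measurable borel" and K: "K > 0"
    and R: "\<And>j t. j < K \<Longrightarrow> t \<in> cell K j \<Longrightarrow> (v t)\<^sup>2 \<le> R j"
  shows "v \<in> L2_fun unif" "(l2 unif v)\<^sup>2 \<le> (\<Sum>j<K. R j) / real K"
proof -
  interpret finite_measure unif by (rule finite_measure_unif)
  let ?s = "\<lambda>t. \<Sum>j<K. R j * indicator (cell K j) t"
  have le: "(v t)\<^sup>2 \<le> ?s t" if t: "t \<in> {0..<1}" for t
  proof -
    obtain j where "j < K" "t \<in> cell K j" by (rule cell_exists[OF K t])
    then show ?thesis using R by (simp only: sum_cell_indicator)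
  qed
  have ec: "emeasure lborel (cell K j) = ennreal (1 / real K)" for j
    unfolding cell_def using K by (subst emeasure_lborel_Ico) (auto simp: field_simps)
  have ist: "integrable lborel ?s"
    by (intro Bochner_Integration.integrable_sum integrable_mult_right integrable_real_indicator) (auto simp: ec)
  have isu: "integrable unif ?s"
    by (rule integrable_unif[OF ist])
  have iv: "integrable unif (\<lambda>t. (v t)\<^sup>2)"
    by (rule Bochner_Integration.integrable_bound[OF isu]) (use v le in \<open>auto intro!: AE_I2 order_trans[OF _ abs_ge_self]\<close>)
  then show "v \<in> L2_fun unif" using v by (simp add: L2_fun_def)
  have "(l2 unif v)\<^sup>2 \<le> (\<integral>t. ?s t \<partial>unif)"
    unfolding l2_sq by (rule integral_mono[OF iv isu]) (use le in auto)
  also have "\<dots> = (\<integral>t. ?s t \<partial>lborel)"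
    unfolding integral_unif
  proof (intro Bochner_Integration.integral_cong refl)
    fix t show "?s t * indicator {0..<1} t = ?s t"
    proof (cases "t \<in> {0..<1}")
      case False
      show ?thesis unfolding sum_cell_indicator_outside[OF False] by simp
    qed simp
  qed
  also have "\<dots> = (\<Sum>j<K. R j * (1 / real K))"
    by (subst Bochner_Integration.integral_sum) (auto simp: ec measure_def intro!: integrable_real_indicator)
  finally show "(l2 unif v)\<^sup>2 \<le> (\<Sum>j<K. R j) / real K" by (simp add: sum_divide_distrib)
qed

lemma sum_integral_cells_le:
  fixes h :: "real \<Rightarrow> real"
  assumes h: "integrable lborel h" "\<And>t. 0 \<le> h t" and K: "K > 0"
    and S: "\<And>j. j < K \<Longrightarrow> S j \<in> sets borel" "\<And>j. j < K \<Longrightarrow> S j \<subseteq> cell K j \<inter> T" and T: "T \<in> sets borel"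
  shows "(\<Sum>j<K. \<integral>t. h t * indicator (S j) t \<partial>lborel) \<le> (\<integral>t. h t * indicator T t \<partial>lborel)"
proof -
  have i: "integrable lborel (\<lambda>t. h t * indicator A t)" if "A \<in> sets borel" for A
    using integrable_mult_indicator[OF _ h(1), of A] that by (simp add: mult.commute)
  have "(\<Sum>j<K. \<integral>t. h t * indicator (S j) t \<partial>lborel) = (\<integral>t. (\<Sum>j<K. h t * indicator (S j) t) \<partial>lborel)"
    by (rule Bochner_Integration.integral_sum[symmetric]) (rule i, rule S, simp)
  also have "\<dots> \<le> (\<integral>t. h t * indicator T t \<partial>lborel)"
  proof (rule integral_mono)
    show "integrable lborel (\<lambda>t. \<Sum>j<K. h t * indicator (S j) t)"
      by (rule Bochner_Integration.integrable_sum) (rule i, rule S, simp)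
    fix t
    show "(\<Sum>j<K. h t * indicator (S j) t) \<le> h t * indicator T t"
    proof (cases "\<exists>j<K. t \<in> S j")
      case True
      then obtain j where j: "j < K" "t \<in> S j" by blast
      then have tj: "t \<in> cell K j" "t \<in> T" using S by auto
      have "(\<Sum>i<K. h t * indicator (S i) t) \<le> (\<Sum>i<K. h t * indicator (cell K i) t)"
        using S h(2) by (intro sum_mono mult_left_mono) (auto simp: indicator_def)
      also have "\<dots> = h t" by (rule sum_cell_indicator[OF j(1) tj(1)])
      finally show ?thesis using tj by simp
    next
      case False
      then have z: "(\<Sum>j<K. h t * indicator (S j) t) = 0" by (intro sum.neutral) auto
      have "0 \<le> h t * indicator T t" using h(2)[of t] by simp
      then show ?thesis unfolding z .
    qed
  qed (rule i[OF T])
  finally show ?thesis .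
qed

section \<open>Local interpolation of cell averages\<close>

definition cum :: "(real \<Rightarrow> real) \<Rightarrow> real \<Rightarrow> real" where
  "cum g x = (\<integral>s. g s * indicator {0..<x} s \<partial>lborel)"

lemma integrable_times_indicator:
  fixes g :: "'a \<Rightarrow> real"
  shows "integrable M g \<Longrightarrow> A \<in> sets M \<Longrightarrow> integrable M (\<lambda>t. g t * indicator A t)"
  using integrable_mult_indicator[of A M g] by (simp add: mult.commute)

lemma cum_diff:
  assumes "integrable lborel g" "0 \<le> x" "x \<le> y"
  shows "cum g y - cum g x = (\<integral>s. g s * indicator {x..<y} s \<partial>lborel)"
proof -
  have "cum g y - cum g x = (\<integral>s. g s * indicator {0..<y} s - g s * indicator {0..<x} s \<partial>lborel)"
    unfolding cum_def using assms(1) by (intro Bochner_Integration.integral_diff[symmetric] integrable_times_indicator) auto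
  also have "\<dots> = (\<integral>s. g s * indicator {x..<y} s \<partial>lborel)"
    using assms by (intro Bochner_Integration.integral_cong) (auto simp: indicator_def)
  finally show ?thesis .
qed

text \<open>One step of length u turns the primitive into integrals of \<open>g\<close> over windows
  of length u, which absorbs one order: a difference of order k + 1 of the primitive is an
  integrated difference of order k of \<open>g\<close>.\<close>

lemma finite_diff_Suc_cum:
  assumes g: "integrable lborel g" and x: "0 \<le> x" and u: "0 < u"
  shows "finite_diff (Suc k) u (cum g) x = (\<integral>s. finite_diff k u g s * indicator {x..<x + u} s \<partial>lborel)"
proof -
  have "finite_diff (Suc k) u (cum g) x = finite_diff k u (\<lambda>s. cum g (s + u) - cum g s) x"
    by (simp only: finite_diff_Suc finite_diff_shift finite_diff_diff)
  also have "\<dots> = (\<Sum>i\<le>k. (- 1) ^ (k - i) * real (k choose i) * (\<integral>s. g (s + real i * u) * indicator {x..<x + u} s \<partial>lborel))"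
    unfolding finite_diff_def
  proof (intro sum.cong refl arg_cong2[where f="(*)"])
    fix i
    have "cum g (x + real i * u + u) - cum g (x + real i * u) = (\<integral>s. g s * indicator {x + real i * u..<x + real i * u + u} s \<partial>lborel)"
      using x u by (intro cum_diff g) auto
    also have "\<dots> = (\<integral>s. g (s + real i * u) * indicator {x..<x + u} s \<partial>lborel)"
      by (subst lborel_integral_real_affine[where c=1 and t="real i * u"])
        (auto simp: add_ac indicator_def intro!: Bochner_Integration.integral_cong)
    finally show "cum g (x + real i * u + u) - cum g (x + real i * u) = (\<integral>s. g (s + real i * u) * indicator {x..<x + u} s \<partial>lborel)" .
  qed
  also have "\<dots> = (\<integral>s. (\<Sum>i\<le>k. (- 1) ^ (k - i) * real (k choose i) * (g (s + real i * u) * indicator {x..<x + u} s)) \<partial>lborel)"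
  proof (subst Bochner_Integration.integral_sum)
    have "integrable lborel (\<lambda>s. g (s + real i * u))" for i
      using lborel_integrable_real_affine[OF g, of 1 "real i * u"] by (simp add: add_ac)
    then show "integrable lborel (\<lambda>s. (- 1) ^ (k - i) * real (k choose i) * (g (s + real i * u) * indicator {x..<x + u} s))" for i
      by (intro integrable_mult_right integrable_times_indicator) auto
  qed simp
  finally show ?thesis by (simp add: finite_diff_def sum_distrib_right mult.assoc)
qed

lemma finite_diff_L2:
  assumes "g \<in> L2_fun lborel"
  shows "finite_diff k u g \<in> L2_fun lborel"
proof -
  have "(\<lambda>s. g (s + c)) \<in> L2_fun lborel" for c
    using assms lborel_integrable_real_affine[OF L2_fun_integrable_sq[OF assms], of 1 c]
    by (auto simp: L2_fun_def add_ac)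
  then show ?thesis unfolding finite_diff_def
    by (intro L2_fun_sum L2_fun_cmult)
qed

lemma integral_interval_Cauchy_Schwarz:
  assumes g: "g \<in> L2_fun lborel" and xy: "x \<le> y"
  shows "(\<integral>s. \<bar>g s\<bar> * indicator {x..<y} s \<partial>lborel)\<^sup>2 \<le> (y - x) * (\<integral>s. (g s)\<^sup>2 * indicator {x..<y} s \<partial>lborel)"
proof -
  have 1: "(\<lambda>s. \<bar>g s\<bar> * indicator {x..<y} s) \<in> L2_fun lborel"
  proof -
    have "(\<lambda>s. (\<bar>g s\<bar> * indicator {x..<y} s)\<^sup>2) = (\<lambda>s. (g s)\<^sup>2 * indicator {x..<y} s)"
      by (auto simp: indicator_def)
    moreover have "integrable lborel (\<lambda>s. (g s)\<^sup>2 * indicator {x..<y} s)"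
      by (intro integrable_times_indicator L2_fun_integrable_sq[OF g]) auto
    moreover have [measurable]: "g \<in> borel_measurable borel" using g by (simp add: L2_fun_def)
    have "(\<lambda>s. \<bar>g s\<bar> * indicator {x..<y} s) \<in> borel_measurable lborel" by measurable
    ultimately show ?thesis by (simp add: L2_fun_def)
  qed
  have 2: "(\<lambda>s. indicator {x..<y} s :: real) \<in> L2_fun lborel"
  proof -
    have "(\<lambda>s. (indicator {x..<y} s :: real)\<^sup>2) = indicator {x..<y}" by (auto simp: indicator_def)
    moreover have "integrable lborel (indicator {x..<y} :: real \<Rightarrow> real)"
      using xy by (intro integrable_real_indicator) auto
    ultimately show ?thesis by (simp add: L2_fun_def)
  qed
  have "(\<integral>s. (\<bar>g s\<bar> * indicator {x..<y} s) * indicator {x..<y} s \<partial>lborel)\<^sup>2 \<le>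
     (\<integral>s. (\<bar>g s\<bar> * indicator {x..<y} s)\<^sup>2 \<partial>lborel) * (\<integral>s. (indicator {x..<y} s)\<^sup>2 \<partial>lborel)"
    by (rule Cauchy_Schwarz_integral[OF 1 2])
  also have "(\<lambda>s. (\<bar>g s\<bar> * indicator {x..<y} s) * indicator {x..<y} s) = (\<lambda>s. \<bar>g s\<bar> * indicator {x..<y} s)"
    by (auto simp: indicator_def)
  also have "(\<lambda>s. (\<bar>g s\<bar> * indicator {x..<y} s)\<^sup>2) = (\<lambda>s. (g s)\<^sup>2 * indicator {x..<y} s)"
    by (auto simp: indicator_def)
  also have "(\<lambda>s. (indicator {x..<y} s :: real)\<^sup>2) = indicator {x..<y}"
    by (auto simp: indicator_def)
  also have "(\<integral>s. indicator {x..<y} s \<partial>lborel) = y - x" using xy by simp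
  finally show ?thesis by (simp add: mult.commute)
qed

text \<open>One of 2 k equal parts of a cell. Then k steps make half a cell, so a k-th difference
  that starts in the first half of a cell never leaves it.\<close>

definition mesh :: "nat \<Rightarrow> nat \<Rightarrow> real" where
  "mesh k K = 1 / (2 * real k * real K)"

text \<open>A primitive of \<open>g\<close> on the cell, in units of the mesh and zero at the left
  end, so that its increments between consecutive integers are the means of \<open>g\<close> over
  the parts of the cell.\<close>

definition local_primitive :: "nat \<Rightarrow> nat \<Rightarrow> (real \<Rightarrow> real) \<Rightarrow> nat \<Rightarrow> real \<Rightarrow> real" where
  "local_primitive k K g j y = (cum g (real j / real K + y * mesh k K) - cum g (real j / real K)) / mesh k K"

text \<open>On each cell, the polynomial of degree less than \<open>k\<close> whose means over the first \<open>k\<close> of the \<open>2 k\<close>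
  equal parts of the cell agree with those of \<open>g\<close>.\<close>

definition quasi :: "nat \<Rightarrow> nat \<Rightarrow> (real \<Rightarrow> real) \<Rightarrow> real \<Rightarrow> real" where
  "quasi k K g t = (\<Sum>j<K. poly (pderiv (interpolant k (local_primitive k K g j))) ((t - real j / real K) / mesh k K)
      * indicator (cell K j) t)"

lemma integrable_cell: "integrable lborel (indicator (cell K j) :: real \<Rightarrow> real)"
  by (rule integrable_real_indicator) (auto simp: cell_def divide_right_mono)

lemma quasi_cell:
  assumes "j < K" "t \<in> cell K j"
  shows "quasi k K g t = poly (pderiv (interpolant k (local_primitive k K g j))) ((t - real j / real K) / mesh k K)"
  unfolding quasi_def
  by (rule sum_cell_indicator[OF assms, of "\<lambda>j. poly (pderiv (interpolant k (local_primitive k K g j))) ((t - real j / real K) / mesh k K)"])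

lemma mesh_pos: "k > 0 \<Longrightarrow> K > 0 \<Longrightarrow> mesh k K > 0"
  by (simp add: mesh_def)

lemma quasi_in_pw_poly: "quasi k K g \<in> pw_poly k K"
  unfolding pw_poly_cell_iff
proof (intro exI[of _ "\<lambda>j. pcompose (pderiv (interpolant k (local_primitive k K g j))) [:- (real j / real K) / mesh k K, 1 / mesh k K:]"] conjI allI impI)
  fix j
  have "degree (pcompose (pderiv (interpolant k (local_primitive k K g j))) [:- (real j / real K) / mesh k K, 1 / mesh k K:])
     \<le> degree (pderiv (interpolant k (local_primitive k K g j)))"
    by (rule order_trans[OF degree_pcompose_le]) simp
  also have "\<dots> \<le> k - 1"
    using degree_interpolant[of k "local_primitive k K g j"] by (simp add: degree_pderiv diff_le_mono)
  finally show "degree (pcompose (pderiv (interpolant k (local_primitive k K g j))) [:- (real j / real K) / mesh k K, 1 / mesh k K:]) \<le> k - 1" .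
qed (auto simp: quasi_def poly_pcompose diff_divide_distrib)

lemma pw_poly_measurable [measurable_dest]: "v \<in> pw_poly r K \<Longrightarrow> v \<in> borel_measurable borel"
proof -
  assume "v \<in> pw_poly r K"
  then obtain P where v: "v = (\<lambda>t. \<Sum>j<K. poly (P j) t * indicator (cell K j) t)"
    unfolding pw_poly_cell_iff by blast
  have [measurable]: "poly p \<in> borel_measurable borel" for p :: "real poly"
    by (intro borel_measurable_continuous_onI continuous_intros)
  show ?thesis unfolding v by measurable
qed

lemmas quasi_measurable [measurable] = pw_poly_measurable[OF quasi_in_pw_poly]

lemma lagrange_deriv_bounds:
  "\<exists>C\<ge>0. \<forall>j\<le>k. (\<forall>z\<in>{0..2 * real k}. \<bar>poly (pderiv (lagrange_poly k j)) z\<bar> \<le> C) \<and>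
     (\<forall>z\<in>{0..2 * real k}. \<forall>w\<in>{0..2 * real k}.
        \<bar>poly (pderiv (lagrange_poly k j)) z - poly (pderiv (lagrange_poly k j)) w\<bar> \<le> C * \<bar>z - w\<bar>)"
proof -
  have "\<forall>j. \<exists>C\<ge>0. (\<forall>z\<in>{0..2 * real k}. \<bar>poly (pderiv (lagrange_poly k j)) z\<bar> \<le> C) \<and>
     (\<forall>z\<in>{0..2 * real k}. \<forall>w\<in>{0..2 * real k}.
        \<bar>poly (pderiv (lagrange_poly k j)) z - poly (pderiv (lagrange_poly k j)) w\<bar> \<le> C * \<bar>z - w\<bar>)"
    using poly_bounds_on_interval by blast
  then obtain c where c: "\<And>j. c j \<ge> 0"
    "\<And>j z. z \<in> {0..2 * real k} \<Longrightarrow> \<bar>poly (pderiv (lagrange_poly k j)) z\<bar> \<le> c j"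
    "\<And>j z w. z \<in> {0..2 * real k} \<Longrightarrow> w \<in> {0..2 * real k} \<Longrightarrow>
       \<bar>poly (pderiv (lagrange_poly k j)) z - poly (pderiv (lagrange_poly k j)) w\<bar> \<le> c j * \<bar>z - w\<bar>"
    by metis
  have m: "c j \<le> sum c {..k}" if "j \<le> k" for j
    using that c(1) by (intro member_le_sum) auto
  show ?thesis
  proof (intro exI[of _ "sum c {..k}"] conjI allI impI ballI)
    show "0 \<le> sum c {..k}" by (rule sum_nonneg) (rule c(1))
    fix j z w assume "j \<le> k"
    { assume "z \<in> {0..2 * real k}"
      then show "\<bar>poly (pderiv (lagrange_poly k j)) z\<bar> \<le> sum c {..k}"
        using c(2)[of z j] m[OF \<open>j \<le> k\<close>] by linarith }
    { assume "z \<in> {0..2 * real k}" "w \<in> {0..2 * real k}"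
      then show "\<bar>poly (pderiv (lagrange_poly k j)) z - poly (pderiv (lagrange_poly k j)) w\<bar> \<le> sum c {..k} * \<bar>z - w\<bar>"
        using c(3)[of z w j] mult_right_mono[OF m[OF \<open>j \<le> k\<close>], of "\<bar>z - w\<bar>"] by linarith }
  qed
qed

lemma node_interval_subset_cell:
  assumes "k > 0" "K > 0" "i \<le> k"
  shows "{real j / real K..<real j / real K + real i * mesh k K} \<subseteq> cell K j"
proof -
  have "real i * mesh k K \<le> real k * mesh k K"
    using assms mesh_pos[of k K] by (intro mult_right_mono) auto
  also have "\<dots> \<le> 1 / real K" using assms by (simp add: mesh_def field_simps)
  finally have "real j / real K + real i * mesh k K \<le> real (Suc j) / real K"
    by (simp add: add_divide_distrib)
  then show ?thesis by (auto simp: cell_def)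
qed

lemma cell_local_coordinate:
  assumes "k > 0" "K > 0" "t \<in> cell K j"
  shows "(t - real j / real K) / mesh k K \<in> {0..2 * real k}"
proof -
  have "0 \<le> t - real j / real K" "t - real j / real K \<le> 1 / real K"
    using assms(3) by (auto simp: cell_def add_divide_distrib)
  moreover have "1 / real K = 2 * real k * mesh k K" using assms by (simp add: mesh_def)
  ultimately show ?thesis using mesh_pos[OF assms(1,2)] by (simp add: divide_le_eq)
qed

text \<open>The coefficients of \<open>quasi\<close> are node values of the local primitive:
  integrals over part of the cell divided by the mesh, hence the factor \<open>K\<close>.\<close>

lemma quasi_bound:
  assumes k: "k > 0"
  obtains C where "C \<ge> 0" "\<And>K g j t. K > 0 \<Longrightarrow> integrable lborel g \<Longrightarrow> j < K \<Longrightarrow> t \<in> cell K j \<Longrightarrow>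
     \<bar>quasi k K g t\<bar> \<le> C * real K * (\<integral>s. \<bar>g s\<bar> * indicator (cell K j) s \<partial>lborel)"
proof -
  obtain c where c: "c \<ge> 0" "\<And>j z. j \<le> k \<Longrightarrow> z \<in> {0..2 * real k} \<Longrightarrow> \<bar>poly (pderiv (lagrange_poly k j)) z\<bar> \<le> c"
    using lagrange_deriv_bounds[of k] by blast
  show ?thesis
  proof (rule that[of "real (Suc k) * c * (2 * real k)"])
    show "0 \<le> real (Suc k) * c * (2 * real k)" using c(1) by simp
    fix K j :: nat and g :: "real \<Rightarrow> real" and t :: real
    assume K: "K > 0" and g: "integrable lborel g" and j: "j < K" and t: "t \<in> cell K j"
    let ?I = "\<integral>s. \<bar>g s\<bar> * indicator (cell K j) s \<partial>lborel"
    have m: "mesh k K > 0" by (rule mesh_pos[OF k K])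
    have A: "\<bar>local_primitive k K g j (real i)\<bar> \<le> 2 * real k * real K * ?I" if i: "i \<le> k" for i
    proof -
      let ?J = "{real j / real K..<real j / real K + real i * mesh k K}"
      have "cum g (real j / real K + real i * mesh k K) - cum g (real j / real K) = (\<integral>s. g s * indicator ?J s \<partial>lborel)"
        using m by (intro cum_diff g) auto
      then have "\<bar>cum g (real j / real K + real i * mesh k K) - cum g (real j / real K)\<bar> \<le> (\<integral>s. \<bar>g s * indicator ?J s\<bar> \<partial>lborel)"
        by simp
      also have "\<dots> \<le> ?I"
      proof (rule integral_mono)
        show "integrable lborel (\<lambda>s. \<bar>g s * indicator ?J s\<bar>)" "integrable lborel (\<lambda>s. \<bar>g s\<bar> * indicator (cell K j) s)"
          using g by (auto intro!: integrable_times_indicator)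
        fix s
        show "\<bar>g s * indicator ?J s\<bar> \<le> \<bar>g s\<bar> * indicator (cell K j) s"
          using node_interval_subset_cell[OF k K i, of j] by (auto simp: indicator_def abs_mult)
      qed
      finally have "\<bar>cum g (real j / real K + real i * mesh k K) - cum g (real j / real K)\<bar> / mesh k K \<le> ?I / mesh k K"
        using m by (intro divide_right_mono) auto
      moreover have "?I / mesh k K = 2 * real k * real K * ?I" by (simp add: mesh_def)
      ultimately show ?thesis using m by (simp add: local_primitive_def)
    qed
    have "\<bar>quasi k K g t\<bar> \<le> (\<Sum>i\<le>k. \<bar>local_primitive k K g j (real i) * poly (pderiv (lagrange_poly k i)) ((t - real j / real K) / mesh k K)\<bar>)"
      unfolding quasi_cell[OF j t] poly_pderiv_interpolant by (rule sum_abs)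
    also have "\<dots> \<le> (\<Sum>i\<le>k. (2 * real k * real K * ?I) * c)"
      unfolding abs_mult using A c cell_local_coordinate[OF k K t]
      by (intro sum_mono mult_mono) auto
    also have "\<dots> = real (Suc k) * c * (2 * real k) * real K * ?I" by simp
    finally show "\<bar>quasi k K g t\<bar> \<le> real (Suc k) * c * (2 * real k) * real K * ?I" .
  qed
qed

lemma cum_subtract:
  assumes "integrable lborel g" "integrable lborel h"
  shows "cum (\<lambda>s. g s - h s) x = cum g x - cum h x"
  unfolding cum_def using assms
  by (simp add: left_diff_distrib integrable_times_indicator)

lemma quasi_diff:
  assumes "integrable lborel g" "integrable lborel h"
  shows "quasi k K (\<lambda>s. g s - h s) t = quasi k K g t - quasi k K h t"
proof -
  have "local_primitive k K (\<lambda>s. g s - h s) j y = local_primitive k K g j y - local_primitive k K h j y" for j y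
    by (simp add: local_primitive_def cum_subtract[OF assms] diff_divide_distrib)
  then show ?thesis
    unfolding quasi_def poly_pderiv_interpolant by (simp add: left_diff_distrib sum_subtractf)
qed

text \<open>The local primitive of a constant is linear, and interpolation of degree k >= 1
  reproduces it.\<close>

lemma quasi_const:
  assumes k: "k > 0" and j: "j < K" and t: "t \<in> cell K j"
  shows "quasi k K (\<lambda>s. c * indicator (cell K j) s) t = c"
proof -
  let ?g = "\<lambda>s. c * indicator (cell K j) s"
  have K: "K > 0" using j by simp
  have m: "mesh k K > 0" by (rule mesh_pos[OF k K])
  have g: "integrable lborel ?g"
    by (intro integrable_mult_right integrable_cell)
  have "local_primitive k K ?g j (real i) = c * real i" if i: "i \<le> k" for i
  proof -
    let ?J = "{real j / real K..<real j / real K + real i * mesh k K}"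
    have "cum ?g (real j / real K + real i * mesh k K) - cum ?g (real j / real K) = (\<integral>s. ?g s * indicator ?J s \<partial>lborel)"
      using m by (intro cum_diff g) auto
    also have "\<dots> = (\<integral>s. c * indicator ?J s \<partial>lborel)"
      using node_interval_subset_cell[OF k K i, of j]
      by (intro Bochner_Integration.integral_cong) (auto simp: indicator_def)
    also have "\<dots> = c * (real i * mesh k K)" using m by simp
    finally show ?thesis using m by (simp add: local_primitive_def)
  qed
  then have "interpolant k (local_primitive k K ?g j) = interpolant k (poly [:0, c:])"
    unfolding interpolant_def by (intro sum.cong) (auto simp: mult.commute)
  also have "\<dots> = [:0, c:]" using k by (intro interpolant_poly) simp
  finally show ?thesis by (simp add: quasi_cell[OF j t] pderiv_pCons)
qed

text \<open>The constant is free of \<open>K\<close>: in the squared cellwise bound one factor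
  \<open>K\<close> is cancelled by Cauchy-Schwarz on a cell of length 1 / K, the other by the weight
  1 / K in \<open>step_function_L2\<close>.\<close>

lemma quasi_L2_bound:
  assumes k: "k > 0"
  obtains C where "C \<ge> 0" "\<And>K g. K > 0 \<Longrightarrow> g \<in> L2_fun lborel \<Longrightarrow> integrable lborel g \<Longrightarrow>
     l2 unif (quasi k K g) \<le> C * l2 unif g"
proof -
  obtain C where C: "C \<ge> 0" and b: "\<And>K g j t. K > 0 \<Longrightarrow> integrable lborel g \<Longrightarrow> j < K \<Longrightarrow> t \<in> cell K j \<Longrightarrow>
     \<bar>quasi k K g t\<bar> \<le> C * real K * (\<integral>s. \<bar>g s\<bar> * indicator (cell K j) s \<partial>lborel)"
    by (rule quasi_bound[OF k], rule that, assumption, assumption)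
  show ?thesis
  proof (rule that[OF C])
    fix K :: nat and g :: "real \<Rightarrow> real"
    assume K: "K > 0" and g2: "g \<in> L2_fun lborel" and g: "integrable lborel g"
    let ?Q = "\<lambda>j. \<integral>s. (g s)\<^sup>2 * indicator (cell K j) s \<partial>lborel"
    have "(l2 unif (quasi k K g))\<^sup>2 \<le> (\<Sum>j<K. C\<^sup>2 * real K * ?Q j) / real K"
    proof (rule step_function_L2(2)[OF _ K])
      fix j t assume j: "j < K" and t: "t \<in> cell K j"
      have "(quasi k K g t)\<^sup>2 \<le> (C * real K * (\<integral>s. \<bar>g s\<bar> * indicator (cell K j) s \<partial>lborel))\<^sup>2"
        using power_mono[OF b[OF K g j t], of 2] by simp
      also have "\<dots> = C\<^sup>2 * (real K)\<^sup>2 * (\<integral>s. \<bar>g s\<bar> * indicator (cell K j) s \<partial>lborel)\<^sup>2"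
        by (simp add: power_mult_distrib)
      also have "\<dots> \<le> C\<^sup>2 * (real K)\<^sup>2 * ((1 / real K) * ?Q j)"
        using integral_interval_Cauchy_Schwarz[OF g2, of "real j / real K" "real (Suc j) / real K"] K
        by (intro mult_left_mono) (auto simp: cell_def add_divide_distrib divide_right_mono)
      also have "\<dots> = C\<^sup>2 * real K * ?Q j" using K by (simp add: power2_eq_square)
      finally show "(quasi k K g t)\<^sup>2 \<le> C\<^sup>2 * real K * ?Q j" .
    qed measurable
    also have "\<dots> = C\<^sup>2 * (\<Sum>j<K. ?Q j)"
      using K by (simp add: sum_distrib_left[symmetric])
    also have "\<dots> \<le> C\<^sup>2 * (\<integral>s. (g s)\<^sup>2 * indicator {0..<1} s \<partial>lborel)"
      using cell_subset by (intro mult_left_mono sum_integral_cells_le L2_fun_integrable_sq[OF g2] K) auto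
    also have "\<dots> = (C * l2 unif g)\<^sup>2"
      by (simp add: power_mult_distrib l2_sq integral_unif)
    finally show "l2 unif (quasi k K g) \<le> C * l2 unif g"
      using C by (auto intro: power2_le_imp_le)
  qed
qed

text \<open>On a cell \<open>quasi\<close> is linear in the function and reproduces the constant g
  t, so its error at t is the local bound applied to g - g t, a multiple of the oscillation of
  \<open>h\<close> on the cell.\<close>

lemma quasi_uniform_tendsto:
  assumes k: "k > 0" and h: "continuous_on UNIV h" and g: "\<And>t. g t = h t * indicator {0..1} t"
  shows "(\<lambda>m. l2 unif (\<lambda>t. g t - quasi k (2 ^ m) g t)) \<longlonglongrightarrow> 0"
proof (rule LIMSEQ_I)
  fix e :: real assume e: "e > 0"
  obtain C where C: "C \<ge> 0" and b: "\<And>K g j t. K > 0 \<Longrightarrow> integrable lborel g \<Longrightarrow> j < K \<Longrightarrow> t \<in> cell K j \<Longrightarrow>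
     \<bar>quasi k K g t\<bar> \<le> C * real K * (\<integral>s. \<bar>g s\<bar> * indicator (cell K j) s \<partial>lborel)"
    by (rule quasi_bound[OF k], rule that, assumption, assumption)
  have gi: "integrable lborel g"
    unfolding g[abs_def] using borel_integrable_atLeastAtMost'[of 0 1 h] h
    by (simp add: set_integrable_def mult.commute continuous_on_subset)
  have "uniformly_continuous_on {0..1} h"
    by (rule compact_uniformly_continuous) (auto intro: continuous_on_subset[OF h])
  moreover have "e / (2 * (C + 1)) > 0" using e C by simp
  ultimately have "\<exists>d>0. \<forall>x\<in>{0..1}. \<forall>y\<in>{0..1}. dist y x < d \<longrightarrow> dist (h y) (h x) < e / (2 * (C + 1))"
    unfolding uniformly_continuous_on_def by blast
  then obtain d where d: "d > 0" "\<And>x y. x \<in> {0..1} \<Longrightarrow> y \<in> {0..1} \<Longrightarrow> dist y x < d \<Longrightarrow> dist (h y) (h x) < e / (2 * (C + 1))"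
    by blast
  obtain m0 where m0: "(1 / 2 :: real) ^ m0 < d" using real_arch_pow_inv[OF d(1), of "1/2"] by auto
  show "\<exists>m0. \<forall>m\<ge>m0. norm (l2 unif (\<lambda>t. g t - quasi k (2 ^ m) g t) - 0) < e"
  proof (intro exI[of _ m0] allI impI)
    fix m assume "m0 \<le> m"
    define K :: nat where "K = 2 ^ m"
    have K: "K > 0" by (simp add: K_def)
    have "(1 / 2 :: real) ^ m \<le> (1/2) ^ m0" using \<open>m0 \<le> m\<close> by (intro power_decreasing) auto
    then have Kd: "1 / real K < d" using m0 by (simp add: K_def power_one_over)
    let ?e = "e / (2 * (C + 1))"
    have small: "(g t - quasi k K g t)\<^sup>2 \<le> (C * ?e)\<^sup>2" if j: "j < K" and t: "t \<in> cell K j" for j t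
    proof -
      let ?c = "\<lambda>s. g t * indicator (cell K j) s"
      have ci: "integrable lborel ?c"
        by (intro integrable_mult_right integrable_cell)
      have "quasi k K g t - g t = quasi k K (\<lambda>s. g s - ?c s) t"
        by (simp add: quasi_diff[OF gi ci] quasi_const[OF k j t])
      then have "\<bar>quasi k K g t - g t\<bar> \<le> C * real K * (\<integral>s. \<bar>g s - ?c s\<bar> * indicator (cell K j) s \<partial>lborel)"
        using b[OF K Bochner_Integration.integrable_diff[OF gi ci] j t] by simp
      also have "\<dots> \<le> C * real K * (\<integral>s. ?e * indicator (cell K j) s \<partial>lborel)"
      proof (intro mult_left_mono integral_mono)
        show "integrable lborel (\<lambda>s. \<bar>g s - ?c s\<bar> * indicator (cell K j) s)"
          by (rule integrable_times_indicator[OF integrable_abs[OF Bochner_Integration.integrable_diff[OF gi ci]]]) simp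
        show "integrable lborel (\<lambda>s. ?e * indicator (cell K j) s)"
          by (intro integrable_mult_right integrable_cell)
        fix s
        show "\<bar>g s - ?c s\<bar> * indicator (cell K j) s \<le> ?e * indicator (cell K j) s"
        proof (cases "s \<in> cell K j")
          case True
          have "\<bar>s - t\<bar> \<le> 1 / real K"
            using True t by (auto simp: cell_def add_divide_distrib)
          then have "dist s t < d" using Kd by (simp add: dist_real_def)
          moreover have "s \<in> {0..<1}" "t \<in> {0..<1}" using True t cell_subset[OF j] by auto
          ultimately have "dist (h s) (h t) < ?e" by (intro d(2)) auto
          then show ?thesis using True \<open>s \<in> {0..<1}\<close> \<open>t \<in> {0..<1}\<close> by (simp add: g dist_real_def)
        qed simp
      qed (use C in auto)
      also have "\<dots> = C * ?e"
        using K by (simp add: cell_def measure_lborel_Ico add_divide_distrib divide_right_mono)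
      finally have "\<bar>quasi k K g t - g t\<bar> \<le> C * ?e" .
      from power_mono[OF this, of 2] show ?thesis by (subst power2_commute) simp
    qed
    have gm: "g \<in> borel_measurable borel" using gi by auto
    have "(l2 unif (\<lambda>t. g t - quasi k K g t))\<^sup>2 \<le> (\<Sum>j<K. (C * ?e)\<^sup>2) / real K"
      by (rule step_function_L2(2)[OF _ K small]) (use gm in measurable)
    also have "\<dots> = (C * ?e)\<^sup>2" using K by simp
    finally have "l2 unif (\<lambda>t. g t - quasi k K g t) \<le> C * ?e"
      using C e by (auto intro!: power2_le_imp_le)
    also have "\<dots> < e"
    proof -
      have "0 \<le> C * e" using C e by simp
      then have "C * e < e * (2 * (C + 1))" using e by (simp add: algebra_simps add_nonneg_pos)
      then show ?thesis using C by (simp add: divide_less_eq mult_ac)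
    qed
    finally show "norm (l2 unif (\<lambda>t. g t - quasi k (2 ^ m) g t) - 0) < e" by (simp add: K_def)
  qed
qed

text \<open>Truncation comes first. Continuous functions that converge to \<open>g\<close> almost
  everywhere are then truncated at the same level, which makes dominated convergence applicable to
  them.\<close>

lemma L2_dense_continuous:
  assumes g: "g \<in> L2_fun lborel" and e: "e > 0"
  shows "\<exists>h. continuous_on UNIV h \<and> bounded (range h) \<and> l2 unif (\<lambda>t. g t - h t) < e"
proof -
  have gm[measurable]: "g \<in> borel_measurable borel" using g by (simp add: L2_fun_def)
  interpret U: finite_measure unif by (rule finite_measure_unif)
  define cut where "cut B x = max (- B) (min B x)" for B x :: real
  have cutm[measurable]: "cut B \<in> borel_measurable borel" for B unfolding cut_def by measurable
  have "(\<lambda>n. \<integral>t. (g t - cut (real n) (g t))\<^sup>2 \<partial>unif) \<longlonglongrightarrow> (\<integral>t. 0 \<partial>unif)"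
  proof (rule integral_dominated_convergence[where w="\<lambda>t. (g t)\<^sup>2"])
    show "integrable unif (\<lambda>t. (g t)\<^sup>2)" by (intro integrable_unif L2_fun_integrable_sq g)
    show "AE t in unif. (\<lambda>n. (g t - cut (real n) (g t))\<^sup>2) \<longlonglongrightarrow> 0"
    proof (rule AE_I2)
      fix t
      obtain n0 :: nat where "\<bar>g t\<bar> < real n0" using reals_Archimedean2 by blast
      then have "\<forall>\<^sub>F n in sequentially. (g t - cut (real n) (g t))\<^sup>2 = 0"
        by (intro eventually_sequentiallyI[of n0]) (auto simp: cut_def)
      then show "(\<lambda>n. (g t - cut (real n) (g t))\<^sup>2) \<longlonglongrightarrow> 0" by (rule tendsto_eventually)
    qed
    show "AE t in unif. norm ((g t - cut (real n) (g t))\<^sup>2) \<le> (g t)\<^sup>2" for n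
      by (rule AE_I2) (auto simp: cut_def abs_le_square_iff[symmetric])
  qed measurable
  then have "(\<lambda>n. \<integral>t. (g t - cut (real n) (g t))\<^sup>2 \<partial>unif) \<longlonglongrightarrow> 0" by simp
  from tendsto_real_sqrt[OF this] have "(\<lambda>n. l2 unif (\<lambda>t. g t - cut (real n) (g t))) \<longlonglongrightarrow> 0"
    by (simp add: l2_def)
  from LIMSEQ_D[OF this, of "e / 2"] e obtain n where n: "l2 unif (\<lambda>t. g t - cut (real n) (g t)) < e / 2"
    by auto
  have "g measurable_on UNIV"
    by (rule lebesgue_measurable_imp_measurable_on_real) (use gm in \<open>auto intro: measurable_completion\<close>)
  then obtain N \<phi> where N: "negligible N" and \<phi>: "\<And>n::nat. continuous_on UNIV (\<phi> n)" "\<And>x. x \<notin> N \<Longrightarrow> (\<lambda>n. \<phi> n x) \<longlonglongrightarrow> g x"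
    unfolding measurable_on_def by auto
  have [measurable]: "\<phi> i \<in> borel_measurable borel" for i
    by (rule borel_measurable_continuous_onI) (rule \<phi>)
  have "AE x in lebesgue. x \<notin> N"
    using N by (intro AE_not_in) (simp only: negligible_iff_null_sets)
  then have aeN: "AE x in lborel. x \<notin> N" by (simp only: AE_completion_iff)
  have aeU: "AE x in unif. x \<notin> N"
    unfolding unif_def by (subst AE_restrict_space_iff) (use aeN in auto)
  have cutc: "isCont (cut (real n)) x" for x unfolding cut_def by (intro continuous_intros)
  have "(\<lambda>i. \<integral>t. (cut (real n) (g t) - cut (real n) (\<phi> i t))\<^sup>2 \<partial>unif) \<longlonglongrightarrow> (\<integral>t. 0 \<partial>unif)"
  proof (rule integral_dominated_convergence[where w="\<lambda>t. (2 * real n)\<^sup>2"])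
    show "AE t in unif. (\<lambda>i. (cut (real n) (g t) - cut (real n) (\<phi> i t))\<^sup>2) \<longlonglongrightarrow> 0"
      using aeU
    proof eventually_elim
      case (elim t)
      have "(\<lambda>i. (cut (real n) (g t) - cut (real n) (\<phi> i t))\<^sup>2) \<longlonglongrightarrow> (cut (real n) (g t) - cut (real n) (g t))\<^sup>2"
        by (intro tendsto_intros isCont_tendsto_compose[OF cutc] \<phi>(2) elim)
      then show ?case by simp
    qed
    show "AE t in unif. norm ((cut (real n) (g t) - cut (real n) (\<phi> i t))\<^sup>2) \<le> (2 * real n)\<^sup>2" for i
    proof (rule AE_I2)
      fix t
      have "\<bar>cut (real n) (g t) - cut (real n) (\<phi> i t)\<bar> \<le> 2 * real n" by (auto simp: cut_def)
      from power_mono[OF this, of 2]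
      show "norm ((cut (real n) (g t) - cut (real n) (\<phi> i t))\<^sup>2) \<le> (2 * real n)\<^sup>2" by simp
    qed
  qed auto
  then have "(\<lambda>i. \<integral>t. (cut (real n) (g t) - cut (real n) (\<phi> i t))\<^sup>2 \<partial>unif) \<longlonglongrightarrow> 0" by simp
  from tendsto_real_sqrt[OF this] have "(\<lambda>i. l2 unif (\<lambda>t. cut (real n) (g t) - cut (real n) (\<phi> i t))) \<longlonglongrightarrow> 0"
    by (simp add: l2_def)
  from LIMSEQ_D[OF this, of "e / 2"] e obtain i where i: "l2 unif (\<lambda>t. cut (real n) (g t) - cut (real n) (\<phi> i t)) < e / 2"
    by auto
  have cb: "(\<lambda>t. cut (real n) (w t)) \<in> L2_fun unif" if [measurable]: "w \<in> borel_measurable borel" for w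
    by (rule L2_fun_bounded[OF finite_measure_unif, of _ "real n"]) (auto simp: cut_def)
  have "l2 unif (\<lambda>t. g t - cut (real n) (\<phi> i t)) < e"
    using l2_triangle_diff[OF L2_fun_unif[OF g] cb[OF gm] cb[of "\<phi> i"]] n i by simp
  moreover have "continuous_on UNIV (\<lambda>t. cut (real n) (\<phi> i t))"
    unfolding cut_def by (intro continuous_intros \<phi>)
  moreover have "bounded (range (\<lambda>t. cut (real n) (\<phi> i t)))"
    unfolding bounded_iff by (intro exI[of _ "real n"]) (auto simp: cut_def)
  ultimately show ?thesis by blast
qed

lemma L2_fun_lborel_indicator:
  fixes h :: "real \<Rightarrow> real"
  assumes "h \<in> borel_measurable borel" "\<And>t. \<bar>h t\<bar> \<le> B"
  shows "(\<lambda>t. h t * indicator {0..1} t) \<in> L2_fun lborel" "integrable lborel (\<lambda>t. h t * indicator {0..1} t)"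
proof -
  note [measurable] = assms(1)
  have i: "integrable lborel (\<lambda>t. c * indicator {0..1::real} t :: real)" for c
    by (intro integrable_mult_right integrable_real_indicator) auto
  show "integrable lborel (\<lambda>t. h t * indicator {0..1} t)"
    by (rule Bochner_Integration.integrable_bound[OF i[of B]]) (use assms(2) in \<open>auto simp: indicator_def intro: order_trans[OF _ abs_ge_self]\<close>)
  have "integrable lborel (\<lambda>t. (h t * indicator {0..1} t)\<^sup>2)"
    by (rule Bochner_Integration.integrable_bound[OF i[of "B\<^sup>2"]])
      (use assms(2) in \<open>auto simp: indicator_def abs_le_square_iff[symmetric] intro: order_trans[OF _ abs_ge_self]\<close>)
  then show "(\<lambda>t. h t * indicator {0..1} t) \<in> L2_fun lborel" by (simp add: L2_fun_def)
qed

text \<open>Density of continuous functions plus the uniform bound \<open>quasi_L2_bound\<close>.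
  There is no rate here; the lemma identifies \<open>g\<close> as the limit of the telescoping sums
  in \<open>quasi_error\<close>.\<close>

lemma quasi_tendsto:
  assumes k: "k > 0" and g2: "g \<in> L2_fun lborel" and g: "integrable lborel g"
  shows "(\<lambda>m. l2 unif (\<lambda>t. g t - quasi k (2 ^ m) g t)) \<longlonglongrightarrow> 0"
proof (rule LIMSEQ_I)
  fix e :: real assume e: "e > 0"
  obtain C where C: "C \<ge> 0" and b: "\<And>K g. K > 0 \<Longrightarrow> g \<in> L2_fun lborel \<Longrightarrow> integrable lborel g \<Longrightarrow>
     l2 unif (quasi k K g) \<le> C * l2 unif g"
    by (rule quasi_L2_bound[OF k], rule that, assumption, assumption)
  have "e / (2 * (C + 1)) > 0" using e C by simp
  from L2_dense_continuous[OF g2 this] obtain h where h: "continuous_on UNIV h" "bounded (range h)"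
    "l2 unif (\<lambda>t. g t - h t) < e / (2 * (C + 1))" by blast
  then obtain B where B: "\<And>t. \<bar>h t\<bar> \<le> B" by (auto simp: bounded_iff)
  define w where "w t = h t * indicator {0..1} t" for t
  have w: "w \<in> L2_fun lborel" "integrable lborel w"
    using L2_fun_lborel_indicator[OF borel_measurable_continuous_onI[OF h(1)] B] by (simp_all add: w_def[abs_def])
  have hw: "l2 unif (\<lambda>t. g t - w t) = l2 unif (\<lambda>t. g t - h t)"
    unfolding l2_def by (intro arg_cong[where f=sqrt] Bochner_Integration.integral_cong) (auto simp: w_def)
  obtain m0 where m0: "\<And>m. m \<ge> m0 \<Longrightarrow> l2 unif (\<lambda>t. w t - quasi k (2 ^ m) w t) < e / 2"
    using LIMSEQ_D[OF quasi_uniform_tendsto[OF k h(1) w_def], of "e / 2"] e by auto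
  show "\<exists>m0. \<forall>m\<ge>m0. norm (l2 unif (\<lambda>t. g t - quasi k (2 ^ m) g t) - 0) < e"
  proof (intro exI[of _ m0] allI impI)
    fix m assume m: "m0 \<le> m"
    have q: "quasi k (2 ^ m) f \<in> L2_fun unif" if f: "f \<in> L2_fun lborel" "integrable lborel f" for f
    proof -
      obtain C' where "C' \<ge> 0" and C': "\<And>K g j t. K > 0 \<Longrightarrow> integrable lborel g \<Longrightarrow> j < K \<Longrightarrow> t \<in> cell K j \<Longrightarrow>
         \<bar>quasi k K g t\<bar> \<le> C' * real K * (\<integral>s. \<bar>g s\<bar> * indicator (cell K j) s \<partial>lborel)"
        by (rule quasi_bound[OF k], rule that, assumption, assumption)
      show ?thesis
      proof (rule step_function_L2(1))
        show "(quasi k (2 ^ m) f t)\<^sup>2 \<le> (C' * real (2 ^ m) * (\<integral>s. \<bar>f s\<bar> * indicator (cell (2 ^ m) j) s \<partial>lborel))\<^sup>2"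
          if "j < 2 ^ m" "t \<in> cell (2 ^ m) j" for j t
          using power_mono[OF C'[OF _ f(2) that], of 2] by simp
      qed auto
    qed
    have d: "(\<lambda>t. g t - w t) \<in> L2_fun lborel" "integrable lborel (\<lambda>t. g t - w t)"
      using g2 g w by (auto intro: L2_fun_diff)
    have "l2 unif (\<lambda>t. g t - quasi k (2 ^ m) g t) \<le> l2 unif (\<lambda>t. g t - w t) + l2 unif (\<lambda>t. w t - quasi k (2 ^ m) g t)"
      by (intro l2_triangle_diff L2_fun_unif g2 w q g)
    also have "l2 unif (\<lambda>t. w t - quasi k (2 ^ m) g t) \<le> l2 unif (\<lambda>t. w t - quasi k (2 ^ m) w t) + l2 unif (\<lambda>t. quasi k (2 ^ m) w t - quasi k (2 ^ m) g t)"
      by (intro l2_triangle_diff L2_fun_unif g2 w q g)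
    also have "l2 unif (\<lambda>t. quasi k (2 ^ m) w t - quasi k (2 ^ m) g t) = l2 unif (quasi k (2 ^ m) (\<lambda>t. g t - w t))"
      unfolding quasi_diff[OF g w(2)] by (rule l2_commute)
    also have "\<dots> \<le> C * l2 unif (\<lambda>t. g t - w t)" by (rule b[OF _ d]) simp
    finally have "l2 unif (\<lambda>t. g t - quasi k (2 ^ m) g t) \<le> (C + 1) * l2 unif (\<lambda>t. g t - h t) + l2 unif (\<lambda>t. w t - quasi k (2 ^ m) w t)"
      by (simp add: hw algebra_simps)
    also have "\<dots> < (C + 1) * (e / (2 * (C + 1))) + e / 2"
      using C h(3) m0[OF m] by (intro add_strict_mono mult_strict_left_mono) auto
    also have "\<dots> = e" using C by (simp add: field_simps)
    finally show "norm (l2 unif (\<lambda>t. g t - quasi k (2 ^ m) g t) - 0) < e" by simp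
  qed
qed

section \<open>Rates of approximation along dyadic refinements\<close>

definition cell_diff :: "nat \<Rightarrow> nat \<Rightarrow> (real \<Rightarrow> real) \<Rightarrow> nat \<Rightarrow> real" where
  "cell_diff k K g j = (\<integral>s. (finite_diff k (mesh k K) g s)\<^sup>2 *
     indicator {real j / real K..<real j / real K + real k * mesh k K} s \<partial>lborel)"

definition total_diff :: "nat \<Rightarrow> nat \<Rightarrow> (real \<Rightarrow> real) \<Rightarrow> real" where
  "total_diff k K g = (\<integral>s. (finite_diff k (mesh k K) g s)\<^sup>2 * indicator {0..1 - real k * mesh k K} s \<partial>lborel)"

lemma cell_diff_nonneg: "0 \<le> cell_diff k K g j"
  unfolding cell_diff_def by (rule Bochner_Integration.integral_nonneg) simp

lemma mesh_times: "k > 0 \<Longrightarrow> real k * mesh k K = 1 / (2 * real K)"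
  by (simp add: mesh_def)

text \<open>The starting points in \<open>cell_diff\<close> fill only the first half of each cell.
  These halves are disjoint, and the one in the last cell ends at 1 - 1 / (2 K), exactly the last
  starting point that the modulus of smoothness allows.\<close>

lemma sum_cell_diff_le:
  assumes k: "k > 0" and K: "K > 0" and g: "g \<in> L2_fun lborel"
  shows "(\<Sum>j<K. cell_diff k K g j) \<le> total_diff k K g"
  unfolding cell_diff_def total_diff_def
proof (rule sum_integral_cells_le)
  show "integrable lborel (\<lambda>s. (finite_diff k (mesh k K) g s)\<^sup>2)"
    by (intro L2_fun_integrable_sq finite_diff_L2 g)
  fix j assume j: "j < K"
  have "real (Suc j) / real K \<le> 1" using j by simp
  then have "real j / real K + 1 / real K \<le> 1" by (simp add: add_divide_distrib)
  moreover have "1 / (2 * real K) + 1 / (2 * real K) = 1 / real K" by simp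
  moreover have "0 \<le> real j / real K" by simp
  ultimately have "{real j / real K..<real j / real K + real k * mesh k K} \<subseteq> {0..1 - real k * mesh k K}"
    unfolding mesh_times[OF k] by (intro subsetI) (simp only: atLeastLessThan_iff atLeastAtMost_iff, linarith)
  then show "{real j / real K..<real j / real K + real k * mesh k K} \<subseteq> cell K j \<inter> {0..1 - real k * mesh k K}"
    using node_interval_subset_cell[OF k K order_refl, of j] by blast
qed (use K in auto)

text \<open>The additive constant in the local primitive is a polynomial of degree 0 and drops out.
  What remains is \<open>finite_diff_Suc_cum\<close> and Cauchy-Schwarz on a window of length k u;
  the factor is k u / u^2 = 2 k^2 K for u = 1 / (2 k K).\<close>

lemma finite_diff_local_primitive:
  assumes k: "k > 0" and K: "K > 0" and g2: "g \<in> L2_fun lborel" and g: "integrable lborel g" and i: "i < k"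
  shows "\<bar>finite_diff (Suc k) 1 (local_primitive k K g j) (real i)\<bar> \<le> sqrt (2 * (real k)\<^sup>2 * real K * cell_diff k K g j)"
proof -
  define u where "u = mesh k K"
  define x where "x = real j / real K"
  have u: "u > 0" unfolding u_def by (rule mesh_pos[OF k K])
  have x: "0 \<le> x" by (simp add: x_def)
  have "local_primitive k K g j = (\<lambda>y. cum g (x + y * u) / u - poly [:cum g x / u:] y)"
    by (auto simp: local_primitive_def x_def u_def diff_divide_distrib)
  moreover have "finite_diff (Suc k) 1 (\<lambda>y. cum g (x + y * u) / u - poly [:cum g x / u:] y) (real i)
     = finite_diff (Suc k) 1 (\<lambda>y. cum g (x + y * u) / u) (real i) - finite_diff (Suc k) 1 (poly [:cum g x / u:]) (real i)"
    by (rule finite_diff_diff)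
  moreover have "finite_diff (Suc k) 1 (poly [:cum g x / u:]) (real i) = 0"
    by (rule finite_diff_poly_eq_0) simp
  ultimately have "finite_diff (Suc k) 1 (local_primitive k K g j) (real i) = finite_diff (Suc k) 1 (\<lambda>y. cum g (x + y * u) / u) (real i)"
    by (simp only: diff_zero)
  also have "\<dots> = finite_diff (Suc k) u (cum g) (x + real i * u) / u"
    unfolding finite_diff_def sum_divide_distrib by (intro sum.cong refl) (simp add: algebra_simps)
  also have "\<dots> = (\<integral>s. finite_diff k u g s * indicator {x + real i * u..<x + real i * u + u} s \<partial>lborel) / u"
    using u x by (subst finite_diff_Suc_cum[OF g]) auto
  finally have eq: "finite_diff (Suc k) 1 (local_primitive k K g j) (real i) =
     (\<integral>s. finite_diff k u g s * indicator {x + real i * u..<x + real i * u + u} s \<partial>lborel) / u" .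
  have fd: "finite_diff k u g \<in> L2_fun lborel" by (rule finite_diff_L2[OF g2])
  have fi: "integrable lborel (finite_diff k u g)"
  proof -
    have "integrable lborel (\<lambda>s. g (s + c))" for c
      using lborel_integrable_real_affine[OF g, of 1 c] by (simp add: add_ac)
    then show ?thesis unfolding finite_diff_def by (intro Bochner_Integration.integrable_sum integrable_mult_right)
  qed
  have iu: "real i * u + u \<le> real k * u" "0 \<le> real i * u"
    using i u by (auto simp: distrib_right[of _ 1 u, simplified, symmetric] intro!: mult_right_mono)
  have "\<bar>\<integral>s. finite_diff k u g s * indicator {x + real i * u..<x + real i * u + u} s \<partial>lborel\<bar>
     \<le> (\<integral>s. \<bar>finite_diff k u g s * indicator {x + real i * u..<x + real i * u + u} s\<bar> \<partial>lborel)"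
    by (rule integral_abs_bound)
  also have "\<dots> \<le> (\<integral>s. \<bar>finite_diff k u g s\<bar> * indicator {x..<x + real k * u} s \<partial>lborel)"
  proof (rule integral_mono)
    show "integrable lborel (\<lambda>s. \<bar>finite_diff k u g s * indicator {x + real i * u..<x + real i * u + u} s\<bar>)"
      "integrable lborel (\<lambda>s. \<bar>finite_diff k u g s\<bar> * indicator {x..<x + real k * u} s)"
      by (intro integrable_abs integrable_times_indicator fi; simp)+
    fix s
    show "\<bar>finite_diff k u g s * indicator {x + real i * u..<x + real i * u + u} s\<bar> \<le> \<bar>finite_diff k u g s\<bar> * indicator {x..<x + real k * u} s"
      using iu by (auto simp: indicator_def abs_mult)
  qed
  finally have "\<bar>finite_diff (Suc k) 1 (local_primitive k K g j) (real i)\<bar> \<le> (\<integral>s. \<bar>finite_diff k u g s\<bar> * indicator {x..<x + real k * u} s \<partial>lborel) / u"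
    unfolding eq abs_divide using u by (simp add: divide_right_mono)
  then have "(finite_diff (Suc k) 1 (local_primitive k K g j) (real i))\<^sup>2 \<le> ((\<integral>s. \<bar>finite_diff k u g s\<bar> * indicator {x..<x + real k * u} s \<partial>lborel) / u)\<^sup>2"
    using power_mono[of "\<bar>finite_diff (Suc k) 1 (local_primitive k K g j) (real i)\<bar>" _ 2] by simp
  also have "\<dots> \<le> (real k * u) * cell_diff k K g j / u\<^sup>2"
    unfolding power_divide
    using integral_interval_Cauchy_Schwarz[OF fd, of x "x + real k * u"] u
    by (intro divide_right_mono) (simp_all add: cell_diff_def u_def x_def)
  also have "\<dots> = 2 * (real k)\<^sup>2 * real K * cell_diff k K g j"
    using k K by (simp add: u_def mesh_def power2_eq_square field_simps)
  finally show ?thesis by (intro real_le_rsqrt) simp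
qed

text \<open>Cell j of level 2 K has the parent cell j div 2 of level \<open>K\<close>. Both local
  primitives come from one primitive of \<open>g\<close> and the mesh halves exactly, which is the
  relation that \<open>refinement_difference\<close> requires.\<close>

lemma quasi_refine:
  assumes k: "k > 0"
  obtains C where "C \<ge> 0" "\<And>K g j. K > 0 \<Longrightarrow> g \<in> L2_fun lborel \<Longrightarrow> integrable lborel g \<Longrightarrow> j < 2 * K \<Longrightarrow>
    \<exists>\<eta>. (\<forall>t\<in>cell (2 * K) j. quasi k K g t - quasi k (2 * K) g t =
          (\<Sum>l\<le>k. \<eta> l * poly (pderiv (lagrange_poly k l)) ((t - real j / real (2 * K)) / mesh k K))) \<and>
        (\<forall>l\<le>k. \<bar>\<eta> l\<bar> \<le> C * sqrt (real K * (cell_diff k K g (j div 2) + cell_diff k (2 * K) g j)))"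
\<comment> \<open>The first factor is the extrapolation constant. Each of the two sums of
  differences has k terms, each at most 2 k sqrt (K D), where D is the sum of the cell differences
  of parent and child.\<close>
proof (rule that[of "(2 ^ Suc k + 1) ^ (2 * k) * (real k * (2 * (2 * real k)))"])
  show "0 \<le> (2 ^ Suc k + 1) ^ (2 * k) * (real k * (2 * (2 * real k)))" by simp
  fix K j :: nat and g :: "real \<Rightarrow> real"
  assume K: "K > 0" and g2: "g \<in> L2_fun lborel" and g: "integrable lborel g" and j: "j < 2 * K"
  define p e u where "p = j div 2" and "e = j mod 2" and "u = mesh k K"
  have K2: "2 * K > 0" using K by simp
  have p: "p < K" using j by (auto simp: p_def)
  have je: "j = 2 * p + e" by (simp add: p_def e_def)
  have u: "u > 0" unfolding u_def by (rule mesh_pos[OF k K])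
  have u2: "mesh k (2 * K) = u / 2" by (simp add: u_def mesh_def)
  have node: "real j / real (2 * K) = real p / real K + real (k * e) * u"
    using k K by (simp add: je u_def mesh_def field_simps)
  let ?A = "local_primitive k K g p" and ?B = "local_primitive k (2 * K) g j"
  let ?M = "(2 ^ Suc k + 1 :: real) ^ (2 * k)" and ?D = "cell_diff k K g p + cell_diff k (2 * K) g j"
  have "?A (real (k * e + z)) - ?A (real (k * e)) = ?B (real (2 * z)) / 2" for z
    unfolding local_primitive_def u2 node using u by (simp add: u_def[symmetric] field_simps)
  then have AB: "?A (real (k * e + z)) - ?A (real (k * e)) = ?B (real (2 * z)) / 2" if "z \<le> k" for z .
  have e1: "e \<le> 1" using mod_less_divisor[of 2 j] unfolding e_def by linarith
  from refinement_difference[OF e1 AB] obtain \<eta>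
    where eta: "\<And>z. poly (pderiv (interpolant k ?A)) (real (k * e) + z) - poly (pderiv (interpolant k ?B)) (2 * z)
       = (\<Sum>j\<le>k. \<eta> j * poly (pderiv (lagrange_poly k j)) z)"
    and eb: "\<And>j. j \<le> k \<Longrightarrow> \<bar>\<eta> j\<bar> \<le> ?M * ((\<Sum>i<k. \<bar>finite_diff (Suc k) 1 ?A (real i)\<bar>) + (\<Sum>i<k. \<bar>finite_diff (Suc k) 1 ?B (real i)\<bar>))"
    by blast
  have s1: "(\<Sum>i<k. \<bar>finite_diff (Suc k) 1 ?A (real i)\<bar>) \<le> real k * (2 * real k * sqrt (real K * ?D))"
  proof -
    have "\<bar>finite_diff (Suc k) 1 ?A (real i)\<bar> \<le> 2 * real k * sqrt (real K * ?D)" if "i < k" for i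
    proof -
      have "sqrt (2 * (real k)\<^sup>2 * real K * cell_diff k K g p) \<le> sqrt ((2 * real k)\<^sup>2 * (real K * ?D))"
        using cell_diff_nonneg[of k K g p] cell_diff_nonneg[of k "2 * K" g j]
        unfolding power_mult_distrib mult.assoc by (intro real_sqrt_le_mono mult_mono) auto
      also have "\<dots> = 2 * real k * sqrt (real K * ?D)" by (simp add: real_sqrt_mult)
      finally show ?thesis using finite_diff_local_primitive[OF k K g2 g that, of p] by linarith
    qed
    from sum_mono[of "{..<k}", OF this] show ?thesis by simp
  qed
  have s2: "(\<Sum>i<k. \<bar>finite_diff (Suc k) 1 ?B (real i)\<bar>) \<le> real k * (2 * real k * sqrt (real K * ?D))"
  proof -
    have "\<bar>finite_diff (Suc k) 1 ?B (real i)\<bar> \<le> 2 * real k * sqrt (real K * ?D)" if "i < k" for i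
    proof -
      have "sqrt (2 * (real k)\<^sup>2 * real (2 * K) * cell_diff k (2 * K) g j) = sqrt ((2 * real k)\<^sup>2 * (real K * cell_diff k (2 * K) g j))"
        by (simp add: power_mult_distrib mult_ac)
      also have "\<dots> \<le> sqrt ((2 * real k)\<^sup>2 * (real K * ?D))"
        using cell_diff_nonneg[of k K g p] by (intro real_sqrt_le_mono mult_left_mono) auto
      also have "\<dots> = 2 * real k * sqrt (real K * ?D)" by (simp add: real_sqrt_mult)
      finally show ?thesis using finite_diff_local_primitive[OF k K2 g2 g that, of j] by linarith
    qed
    from sum_mono[of "{..<k}", OF this] show ?thesis by simp
  qed
  have "\<bar>\<eta> l\<bar> \<le> ?M * (real k * (2 * (2 * real k))) * sqrt (real K * ?D)" if "l \<le> k" for l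
  proof -
    have "\<bar>\<eta> l\<bar> \<le> ?M * (real k * (2 * real k * sqrt (real K * ?D)) + real k * (2 * real k * sqrt (real K * ?D)))"
      using s1 s2 by (intro order_trans[OF eb[OF that]] mult_left_mono add_mono) auto
    then show ?thesis by (simp add: algebra_simps)
  qed
  moreover have "quasi k K g t - quasi k (2 * K) g t =
          (\<Sum>l\<le>k. \<eta> l * poly (pderiv (lagrange_poly k l)) ((t - real j / real (2 * K)) / mesh k K))"
    if t: "t \<in> cell (2 * K) j" for t
  proof -
    let ?z = "(t - real j / real (2 * K)) / u"
    have "t \<in> cell K p"
    proof -
      have "real (2 * p) / real (2 * K) \<le> real j / real (2 * K)"
        by (intro divide_right_mono) (auto simp: je)
      moreover have "real (Suc j) / real (2 * K) \<le> real (2 * Suc p) / real (2 * K)"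
        using e1 by (intro divide_right_mono) (auto simp: je)
      moreover have "real (2 * p) / real (2 * K) = real p / real K" "real (2 * Suc p) / real (2 * K) = real (Suc p) / real K"
        using K by (simp_all add: field_simps)
      ultimately show ?thesis using t unfolding cell_def atLeastLessThan_iff by linarith
    qed
    then have "quasi k K g t = poly (pderiv (interpolant k ?A)) ((t - real p / real K) / u)"
      by (simp only: quasi_cell[OF p] u_def)
    also have "(t - real p / real K) / u = real (k * e) + ?z" unfolding node using u by (simp add: field_simps)
    finally have 1: "quasi k K g t = poly (pderiv (interpolant k ?A)) (real (k * e) + ?z)" .
    have "quasi k (2 * K) g t = poly (pderiv (interpolant k ?B)) ((t - real j / real (2 * K)) / (u / 2))"
      unfolding u2[symmetric] by (rule quasi_cell[OF j t])
    also have "(t - real j / real (2 * K)) / (u / 2) = 2 * ?z" by simp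
    finally show ?thesis unfolding 1 u_def[symmetric] using eta[of ?z] by simp
  qed
  ultimately show "\<exists>\<eta>. (\<forall>t\<in>cell (2 * K) j. quasi k K g t - quasi k (2 * K) g t =
          (\<Sum>l\<le>k. \<eta> l * poly (pderiv (lagrange_poly k l)) ((t - real j / real (2 * K)) / mesh k K))) \<and>
        (\<forall>l\<le>k. \<bar>\<eta> l\<bar> \<le> ?M * (real k * (2 * (2 * real k))) * sqrt (real K * (cell_diff k K g (j div 2) + cell_diff k (2 * K) g j)))"
    unfolding p_def[symmetric] by (intro exI[of _ \<eta>]) blast
qed

lemma sum_div_two: "(\<Sum>j<2 * K. f (j div 2)) = 2 * (\<Sum>j<K. f j)" for f :: "nat \<Rightarrow> real"
  by (induction K) auto

text \<open>The left end of the cell of length 1 / N that contains t. Composing with it samples a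
  function on the grid and makes it piecewise constant.\<close>

definition grid_floor :: "nat \<Rightarrow> real \<Rightarrow> real" where
  "grid_floor N t = real_of_int \<lfloor>t * real N\<rfloor> / real N"

lemma grid_floor_cell:
  assumes "N > 0" "t \<in> cell N i"
  shows "grid_floor N t = real i / real N"
proof -
  have "real i \<le> t * real N" "t * real N < real i + 1"
    using assms by (auto simp: cell_def field_simps)
  then have "\<lfloor>t * real N\<rfloor> = int i" by (intro floor_unique) auto
  then show ?thesis by (simp add: grid_floor_def)
qed

lemma grid_floor_in_cell:
  assumes K: "K > 0" and N: "N > 0" "K dvd N" and t: "t \<in> cell K j"
  shows "grid_floor N t \<in> cell K j" "\<bar>t - grid_floor N t\<bar> \<le> 1 / real N"
proof -
  obtain c where c: "N = K * c" using N(2) by (elim dvdE)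
  have c0: "c > 0" using N c by (cases c) auto
  have le: "real_of_int \<lfloor>t * real N\<rfloor> \<le> t * real N" "t * real N < real_of_int \<lfloor>t * real N\<rfloor> + 1"
    by linarith+
  have f: "grid_floor N t \<le> t" "t < grid_floor N t + 1 / real N"
    using le N by (auto simp: grid_floor_def field_simps)
  then show "\<bar>t - grid_floor N t\<bar> \<le> 1 / real N" by simp
  have "real j / real K \<le> t" "t < real (Suc j) / real K" using t by (auto simp: cell_def)
  then have "real (j * c) \<le> t * real N" using K c0 by (simp add: c field_simps)
  then have "int (j * c) \<le> \<lfloor>t * real N\<rfloor>" by (simp add: le_floor_iff)
  then have "real (j * c) \<le> real_of_int \<lfloor>t * real N\<rfloor>" by linarith
  then have "real j / real K \<le> grid_floor N t"
    using N K c0 by (simp add: grid_floor_def c field_simps)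
  then show "grid_floor N t \<in> cell K j"
    using f(1) \<open>t < real (Suc j) / real K\<close> by (simp add: cell_def)
qed

lemma grid_floor_measurable [measurable]: "grid_floor N \<in> borel_measurable borel"
  unfolding grid_floor_def by measurable

text \<open>Both bounds integrate \<open>quasi_refine\<close>. In the second, divisibility puts t
  and its grid point in the same cell; their local coordinates differ by at most 2 k K / N, and the
  Lipschitz bound for the derivatives of the Lagrange polynomials yields the gain (K / N)^2.\<close>

lemma quasi_refine_norm:
  assumes k: "k > 0"
  obtains C where "C \<ge> 0"
    "\<And>K g. K > 0 \<Longrightarrow> g \<in> L2_fun lborel \<Longrightarrow> integrable lborel g \<Longrightarrow>
      (l2 unif (\<lambda>t. quasi k K g t - quasi k (2 * K) g t))\<^sup>2 \<le> C * (total_diff k K g + total_diff k (2 * K) g)"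
    "\<And>K N g. K > 0 \<Longrightarrow> N > 0 \<Longrightarrow> 2 * K dvd N \<Longrightarrow> g \<in> L2_fun lborel \<Longrightarrow> integrable lborel g \<Longrightarrow>
      (l2 unif (\<lambda>t. (quasi k K g t - quasi k (2 * K) g t) - (quasi k K g (grid_floor N t) - quasi k (2 * K) g (grid_floor N t))))\<^sup>2
        \<le> C * (real K / real N)\<^sup>2 * (total_diff k K g + total_diff k (2 * K) g)"
proof -
  obtain C where C: "C \<ge> 0" and ref: "\<And>K g j. K > 0 \<Longrightarrow> g \<in> L2_fun lborel \<Longrightarrow> integrable lborel g \<Longrightarrow> j < 2 * K \<Longrightarrow>
    \<exists>\<eta>. (\<forall>t\<in>cell (2 * K) j. quasi k K g t - quasi k (2 * K) g t =
          (\<Sum>l\<le>k. \<eta> l * poly (pderiv (lagrange_poly k l)) ((t - real j / real (2 * K)) / mesh k K))) \<and>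
        (\<forall>l\<le>k. \<bar>\<eta> l\<bar> \<le> C * sqrt (real K * (cell_diff k K g (j div 2) + cell_diff k (2 * K) g j)))"
    by (rule quasi_refine[OF k], rule that, assumption, assumption)
  obtain c where c: "c \<ge> 0" "\<And>j z. j \<le> k \<Longrightarrow> z \<in> {0..2 * real k} \<Longrightarrow> \<bar>poly (pderiv (lagrange_poly k j)) z\<bar> \<le> c"
    "\<And>j z w. j \<le> k \<Longrightarrow> z \<in> {0..2 * real k} \<Longrightarrow> w \<in> {0..2 * real k} \<Longrightarrow>
        \<bar>poly (pderiv (lagrange_poly k j)) z - poly (pderiv (lagrange_poly k j)) w\<bar> \<le> c * \<bar>z - w\<bar>"
    using lagrange_deriv_bounds[of k] by metis
  \<comment> \<open>There are k + 1 terms, each a coefficient bound times a bound for the derivative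
    of a Lagrange polynomial.\<close>
  define C1 where "C1 = (real (Suc k) * C * c)\<^sup>2"
  have coord: "(t - real j / real (2 * K)) / mesh k K \<in> {0..2 * real k}" if "K > 0" "t \<in> cell (2 * K) j" for K j t
  proof -
    have m: "mesh k (2 * K) = mesh k K / 2" "mesh k K > 0" using mesh_pos[OF k that(1)] by (auto simp: mesh_def)
    have "(t - real j / real (2 * K)) / (mesh k K / 2) \<in> {0..2 * real k}"
      using cell_local_coordinate[OF k _ that(2)] that(1) m by simp
    then show ?thesis using m(2) by (auto simp: field_simps)
  qed
  have sum_le: "(\<Sum>j<2 * K. B * real K * (cell_diff k K g (j div 2) + cell_diff k (2 * K) g j)) / real (2 * K)
      \<le> B * (total_diff k K g + total_diff k (2 * K) g)"
    if K: "K > 0" and g: "g \<in> L2_fun lborel" and B: "B \<ge> 0" for K g B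
  proof -
    have a: "(\<Sum>j<K. cell_diff k K g j) \<le> total_diff k K g" by (rule sum_cell_diff_le[OF k K g])
    have b: "(\<Sum>j<2*K. cell_diff k (2*K) g j) \<le> total_diff k (2*K) g" using K by (intro sum_cell_diff_le[OF k _ g]) simp
    have b0: "0 \<le> (\<Sum>j<2*K. cell_diff k (2*K) g j)" by (intro sum_nonneg cell_diff_nonneg)
    have "(\<Sum>j<2 * K. B * real K * (cell_diff k K g (j div 2) + cell_diff k (2 * K) g j)) / real (2 * K)
       = B * (2 * (\<Sum>j<K. cell_diff k K g j) + (\<Sum>j<2*K. cell_diff k (2*K) g j)) / 2"
      using K unfolding sum_distrib_left[symmetric] sum.distrib sum_div_two by (simp add: field_simps)
    also have "\<dots> \<le> B * (2 * (total_diff k K g + total_diff k (2 * K) g)) / 2"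
      using a b b0 B by (intro divide_right_mono mult_left_mono) auto
    also have "\<dots> = B * (total_diff k K g + total_diff k (2 * K) g)" by simp
    finally show ?thesis .
  qed
  show ?thesis
  proof (rule that[of "max C1 (C1 * (2 * real k)\<^sup>2)"])
    show "0 \<le> max C1 (C1 * (2 * real k)\<^sup>2)" by (simp add: C1_def le_max_iff_disj)
    fix K :: nat and g :: "real \<Rightarrow> real"
    assume K: "K > 0" and g2: "g \<in> L2_fun lborel" and g: "integrable lborel g"
    let ?E = "\<lambda>j. cell_diff k K g (j div 2) + cell_diff k (2 * K) g j"
    let ?D = "\<lambda>t. quasi k K g t - quasi k (2 * K) g t"
    have E0: "0 \<le> real K * ?E j" for j using cell_diff_nonneg by simp
    have W0: "0 \<le> total_diff k K g + total_diff k (2 * K) g"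
      unfolding total_diff_def by (intro add_nonneg_nonneg Bochner_Integration.integral_nonneg) auto
    have "(l2 unif ?D)\<^sup>2 \<le> (\<Sum>j<2*K. C1 * real K * ?E j) / real (2 * K)"
    proof (rule step_function_L2(2))
      fix j t assume j: "j < 2 * K" and t: "t \<in> cell (2 * K) j"
      obtain \<eta> where eta: "\<And>t. t \<in> cell (2 * K) j \<Longrightarrow> ?D t = (\<Sum>l\<le>k. \<eta> l * poly (pderiv (lagrange_poly k l)) ((t - real j / real (2 * K)) / mesh k K))"
        and eb: "\<And>l. l \<le> k \<Longrightarrow> \<bar>\<eta> l\<bar> \<le> C * sqrt (real K * ?E j)"
        using ref[OF K g2 g j] by blast
      have "\<bar>?D t\<bar> \<le> (\<Sum>l\<le>k. (C * sqrt (real K * ?E j)) * c)"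
        unfolding eta[OF t] using eb c(1,2) coord[OF K t] C E0[of j]
        by (intro order_trans[OF sum_abs] sum_mono) (auto simp: abs_mult intro!: mult_mono mult_nonneg_nonneg)
      also have "\<dots> = real (Suc k) * C * c * sqrt (real K * ?E j)" by simp
      finally have "(?D t)\<^sup>2 \<le> (real (Suc k) * C * c * sqrt (real K * ?E j))\<^sup>2"
        using power_mono[of "\<bar>?D t\<bar>" _ 2] by simp
      also have "\<dots> = C1 * real K * ?E j" using E0[of j] by (simp add: C1_def power_mult_distrib)
      finally show "(?D t)\<^sup>2 \<le> C1 * real K * ?E j" .
    qed (use K in auto)
    also have "\<dots> \<le> C1 * (total_diff k K g + total_diff k (2 * K) g)"
      by (rule sum_le[OF K g2]) (simp add: C1_def)
    also have "\<dots> \<le> max C1 (C1 * (2 * real k)\<^sup>2) * (total_diff k K g + total_diff k (2 * K) g)"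
      using W0 by (intro mult_right_mono) auto
    finally show "(l2 unif ?D)\<^sup>2 \<le> max C1 (C1 * (2 * real k)\<^sup>2) * (total_diff k K g + total_diff k (2 * K) g)" .
    fix N :: nat assume N: "N > 0" "2 * K dvd N"
    let ?B = "C1 * (2 * real k)\<^sup>2 * (real K / real N)\<^sup>2"
    have "(l2 unif (\<lambda>t. ?D t - ?D (grid_floor N t)))\<^sup>2 \<le> (\<Sum>j<2*K. ?B * real K * ?E j) / real (2 * K)"
    proof (rule step_function_L2(2))
      fix j t assume j: "j < 2 * K" and t: "t \<in> cell (2 * K) j"
      obtain \<eta> where eta: "\<And>t. t \<in> cell (2 * K) j \<Longrightarrow> ?D t = (\<Sum>l\<le>k. \<eta> l * poly (pderiv (lagrange_poly k l)) ((t - real j / real (2 * K)) / mesh k K))"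
        and eb: "\<And>l. l \<le> k \<Longrightarrow> \<bar>\<eta> l\<bar> \<le> C * sqrt (real K * ?E j)"
        using ref[OF K g2 g j] by blast
      have gf: "grid_floor N t \<in> cell (2 * K) j" "\<bar>t - grid_floor N t\<bar> \<le> 1 / real N"
        using K grid_floor_in_cell[OF _ N t] by simp_all
      let ?z = "\<lambda>t. (t - real j / real (2 * K)) / mesh k K"
      have zz: "\<bar>?z t - ?z (grid_floor N t)\<bar> \<le> 2 * real k * (real K / real N)"
      proof -
        have "\<bar>?z t - ?z (grid_floor N t)\<bar> = \<bar>t - grid_floor N t\<bar> / mesh k K"
          using mesh_pos[OF k K] by (simp add: diff_divide_distrib[symmetric])
        also have "\<dots> \<le> (1 / real N) / mesh k K"
          using gf mesh_pos[OF k K] by (intro divide_right_mono) auto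
        also have "\<dots> = 2 * real k * (real K / real N)" by (simp add: mesh_def)
        finally show ?thesis .
      qed
      have "?D t - ?D (grid_floor N t) = (\<Sum>l\<le>k. \<eta> l * (poly (pderiv (lagrange_poly k l)) (?z t) - poly (pderiv (lagrange_poly k l)) (?z (grid_floor N t))))"
        unfolding eta[OF t] eta[OF gf(1)] by (simp add: right_diff_distrib sum_subtractf)
      then have "\<bar>?D t - ?D (grid_floor N t)\<bar> \<le> (\<Sum>l\<le>k. \<bar>\<eta> l * (poly (pderiv (lagrange_poly k l)) (?z t) - poly (pderiv (lagrange_poly k l)) (?z (grid_floor N t)))\<bar>)"
        by (simp only: sum_abs)
      also have "\<dots> \<le> (\<Sum>l\<le>k. (C * sqrt (real K * ?E j)) * (c * (2 * real k * (real K / real N))))"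
      proof (rule sum_mono)
        fix l assume "l \<in> {..k}"
        then have l: "l \<le> k" by simp
        have "\<bar>poly (pderiv (lagrange_poly k l)) (?z t) - poly (pderiv (lagrange_poly k l)) (?z (grid_floor N t))\<bar> \<le> c * \<bar>?z t - ?z (grid_floor N t)\<bar>"
          by (rule c(3)[OF l coord[OF K t] coord[OF K gf(1)]])
        also have "\<dots> \<le> c * (2 * real k * (real K / real N))" by (rule mult_left_mono[OF zz c(1)])
        finally show "\<bar>\<eta> l * (poly (pderiv (lagrange_poly k l)) (?z t) - poly (pderiv (lagrange_poly k l)) (?z (grid_floor N t)))\<bar>
           \<le> (C * sqrt (real K * ?E j)) * (c * (2 * real k * (real K / real N)))"
          unfolding abs_mult using C E0[of j] by (intro mult_mono eb[OF l]) auto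
      qed
      also have "\<dots> = real (Suc k) * C * c * (2 * real k) * (real K / real N) * sqrt (real K * ?E j)" by simp
      finally have "(?D t - ?D (grid_floor N t))\<^sup>2 \<le> (real (Suc k) * C * c * (2 * real k) * (real K / real N) * sqrt (real K * ?E j))\<^sup>2"
        using power_mono[of "\<bar>?D t - ?D (grid_floor N t)\<bar>" _ 2] by simp
      also have "\<dots> = ?B * real K * ?E j"
        unfolding C1_def power_mult_distrib real_sqrt_pow2[OF E0] by (simp only: mult_ac)
      finally show "(?D t - ?D (grid_floor N t))\<^sup>2 \<le> ?B * real K * ?E j" .
    qed (use K in auto)
    also have "\<dots> \<le> ?B * (total_diff k K g + total_diff k (2 * K) g)"
      by (rule sum_le[OF K g2]) (simp add: C1_def)
    also have "\<dots> \<le> max C1 (C1 * (2 * real k)\<^sup>2) * (real K / real N)\<^sup>2 * (total_diff k K g + total_diff k (2 * K) g)"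
      using W0 by (intro mult_right_mono) auto
    finally show "(l2 unif (\<lambda>t. ?D t - ?D (grid_floor N t)))\<^sup>2 \<le> max C1 (C1 * (2 * real k)\<^sup>2) * (real K / real N)\<^sup>2 * (total_diff k K g + total_diff k (2 * K) g)" .
  qed
qed

lemma l2_diff_le:
  assumes "f \<in> L2_fun M" "g \<in> L2_fun M"
  shows "l2 M (\<lambda>x. f x - g x) \<le> l2 M f + l2 M g"
  using l2_triangle[OF assms(1) L2_fun_minus[OF assms(2)]] unfolding l2_minus by simp

lemma quasi_L2:
  assumes k: "k > 0" and K: "K > 0" and g: "integrable lborel g"
  shows "quasi k K g \<in> L2_fun unif"
proof -
  obtain C where "C \<ge> 0" and C: "\<And>K g j t. K > 0 \<Longrightarrow> integrable lborel g \<Longrightarrow> j < K \<Longrightarrow> t \<in> cell K j \<Longrightarrow>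
     \<bar>quasi k K g t\<bar> \<le> C * real K * (\<integral>s. \<bar>g s\<bar> * indicator (cell K j) s \<partial>lborel)"
    by (rule quasi_bound[OF k], rule that, assumption, assumption)
  show ?thesis
  proof (rule step_function_L2(1)[OF _ K])
    fix j t assume "j < K" "t \<in> cell K j"
    from power_mono[OF C[OF K g this], of 2]
    show "(quasi k K g t)\<^sup>2 \<le> (C * real K * (\<integral>s. \<bar>g s\<bar> * indicator (cell K j) s \<partial>lborel))\<^sup>2"
      by simp
  qed measurable
qed

text \<open>The bounds of \<open>quasi_refine_norm\<close> at K = 2 ^ m, with
  \<open>total_diff\<close> estimated through \<open>mod\<close>. Steps up to 1/2 suffice there
  because the mesh 1 / (2 k K) never exceeds 1/2.\<close>

lemma quasi_increment:
  assumes k: "k > 0" and \<alpha>: "\<alpha> > 0" and g2: "g \<in> L2_fun lborel" and g: "integrable lborel g"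
    and A: "A \<ge> 0" and mod: "\<And>u. 0 < u \<Longrightarrow> u \<le> 1 / 2 \<Longrightarrow>
      (\<integral>s. (finite_diff k u g s)\<^sup>2 * indicator {0..1 - real k * u} s \<partial>lborel) \<le> A * u powr (2 * \<alpha>)"
  obtains C where "C \<ge> 0"
    "\<And>m. l2 unif (\<lambda>t. quasi k (2 ^ m) g t - quasi k (2 ^ Suc m) g t) \<le> C * (2 powr - \<alpha>) ^ m"
    "\<And>m n. m < n \<Longrightarrow> l2 unif (\<lambda>t. (quasi k (2 ^ m) g t - quasi k (2 ^ Suc m) g t) -
        (quasi k (2 ^ m) g (grid_floor (2 ^ n) t) - quasi k (2 ^ Suc m) g (grid_floor (2 ^ n) t)))
        \<le> C * (2 ^ m / 2 ^ n) * (2 powr - \<alpha>) ^ m"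
proof -
  obtain C where C: "C \<ge> 0"
    and C1: "\<And>K g. K > 0 \<Longrightarrow> g \<in> L2_fun lborel \<Longrightarrow> integrable lborel g \<Longrightarrow>
      (l2 unif (\<lambda>t. quasi k K g t - quasi k (2 * K) g t))\<^sup>2 \<le> C * (total_diff k K g + total_diff k (2 * K) g)"
    and C2: "\<And>K N g. K > 0 \<Longrightarrow> N > 0 \<Longrightarrow> 2 * K dvd N \<Longrightarrow> g \<in> L2_fun lborel \<Longrightarrow> integrable lborel g \<Longrightarrow>
      (l2 unif (\<lambda>t. (quasi k K g t - quasi k (2 * K) g t) - (quasi k K g (grid_floor N t) - quasi k (2 * K) g (grid_floor N t))))\<^sup>2
        \<le> C * (real K / real N)\<^sup>2 * (total_diff k K g + total_diff k (2 * K) g)"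
    by (rule quasi_refine_norm[OF k], rule that, assumption, assumption, assumption)
  have td: "total_diff k K g \<le> A * (1 / real K) powr (2 * \<alpha>)" if K: "K > 0" for K
  proof -
    have m: "mesh k K > 0" by (rule mesh_pos[OF k K])
    have "real 1 \<le> real (k * K)" using k K by (subst of_nat_le_iff) simp
    then have m2: "mesh k K \<le> 1 / 2" using k K by (simp add: mesh_def field_simps)
    have m3: "mesh k K \<le> 1 / real K" using k K by (simp add: mesh_def field_simps)
    have "total_diff k K g \<le> A * mesh k K powr (2 * \<alpha>)"
      unfolding total_diff_def by (rule mod[OF m m2])
    also have "\<dots> \<le> A * (1 / real K) powr (2 * \<alpha>)"
      using m m3 \<alpha> A by (intro mult_left_mono powr_mono2) auto
    finally show ?thesis .
  qed
  have pw: "(1 / real (2 ^ m)) powr (2 * \<alpha>) = ((2 powr - \<alpha>) ^ m)\<^sup>2" for m :: nat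
  proof -
    have "((2 powr - \<alpha>) ^ m)\<^sup>2 = (2 powr (- \<alpha> * (real m * 2)))"
      by (simp add: powr_realpow[symmetric] powr_powr powr_power mult_ac)
    moreover have "(1 / real (2 ^ m)) powr (2 * \<alpha>) = 2 powr (- \<alpha> * (real m * 2))"
      by (simp add: powr_realpow[symmetric] powr_minus_divide[symmetric] powr_powr mult_ac)
    ultimately show ?thesis by simp
  qed
  have tds: "total_diff k (2 ^ m) g + total_diff k (2 * 2 ^ m) g \<le> 2 * A * ((2 powr - \<alpha>) ^ m)\<^sup>2" for m :: nat
  proof -
    have "total_diff k (2 * 2 ^ m) g \<le> A * (1 / real (2 * 2 ^ m)) powr (2 * \<alpha>)" by (rule td) simp
    also have "\<dots> \<le> A * (1 / real (2 ^ m)) powr (2 * \<alpha>)"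
      using \<alpha> A by (intro mult_left_mono powr_mono2) (auto simp: field_simps)
    finally show ?thesis using td[of "2 ^ m"] unfolding pw by simp
  qed
  show ?thesis
  proof (rule that[of "sqrt (2 * C * A)"])
    show "0 \<le> sqrt (2 * C * A)" using C A by simp
    fix m :: nat
    have "(l2 unif (\<lambda>t. quasi k (2 ^ m) g t - quasi k (2 ^ Suc m) g t))\<^sup>2 \<le> C * (2 * A * ((2 powr - \<alpha>) ^ m)\<^sup>2)"
      using order_trans[OF C1[OF _ g2 g, of "2 ^ m"] mult_left_mono[OF tds C]] by simp
    also have "\<dots> = (sqrt (2 * C * A) * (2 powr - \<alpha>) ^ m)\<^sup>2"
      using C A by (simp add: power_mult_distrib)
    finally show "l2 unif (\<lambda>t. quasi k (2 ^ m) g t - quasi k (2 ^ Suc m) g t) \<le> sqrt (2 * C * A) * (2 powr - \<alpha>) ^ m"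
      using C A by (auto intro: power2_le_imp_le)
    fix n assume "m < n"
    then have dv: "2 * 2 ^ m dvd (2 ^ n :: nat)" unfolding power_Suc[symmetric] by (intro le_imp_power_dvd) simp
    have "(l2 unif (\<lambda>t. (quasi k (2 ^ m) g t - quasi k (2 ^ Suc m) g t) -
        (quasi k (2 ^ m) g (grid_floor (2 ^ n) t) - quasi k (2 ^ Suc m) g (grid_floor (2 ^ n) t))))\<^sup>2
        \<le> C * (real (2 ^ m) / real (2 ^ n))\<^sup>2 * (2 * A * ((2 powr - \<alpha>) ^ m)\<^sup>2)"
      unfolding power_Suc using C by (intro order_trans[OF C2[OF _ _ dv g2 g] mult_left_mono[OF tds]]) simp_all
    also have "\<dots> = (sqrt (2 * C * A) * (2 ^ m / 2 ^ n) * (2 powr - \<alpha>) ^ m)\<^sup>2"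
    proof -
      have ca: "0 \<le> 2 * C * A" using C A by simp
      show ?thesis
        unfolding power_mult_distrib[of "sqrt (2 * C * A) * (2 ^ m / 2 ^ n)"]
          power_mult_distrib[of "sqrt (2 * C * A)"] real_sqrt_pow2[OF ca] by simp
    qed
    finally show "l2 unif (\<lambda>t. (quasi k (2 ^ m) g t - quasi k (2 ^ Suc m) g t) -
        (quasi k (2 ^ m) g (grid_floor (2 ^ n) t) - quasi k (2 ^ Suc m) g (grid_floor (2 ^ n) t)))
        \<le> sqrt (2 * C * A) * (2 ^ m / 2 ^ n) * (2 powr - \<alpha>) ^ m"
      using C A by (auto intro: power2_le_imp_le)
  qed
qed

text \<open>The increments over all finer levels form a geometric series, hence the constant C / (1
  - q) with q = 2 powr (-\<alpha>); the error at the finest level vanishes in the limit by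
  \<open>quasi_tendsto\<close>.\<close>

lemma quasi_error:
  assumes k: "k > 0" and \<alpha>: "\<alpha> > 0" and g2: "g \<in> L2_fun lborel" and g: "integrable lborel g"
    and A: "A \<ge> 0" and mod: "\<And>u. 0 < u \<Longrightarrow> u \<le> 1 / 2 \<Longrightarrow>
      (\<integral>s. (finite_diff k u g s)\<^sup>2 * indicator {0..1 - real k * u} s \<partial>lborel) \<le> A * u powr (2 * \<alpha>)"
  obtains C where "C \<ge> 0" "\<And>m. l2 unif (\<lambda>t. g t - quasi k (2 ^ m) g t) \<le> C * (2 powr - \<alpha>) ^ m"
proof -
  obtain C where C: "C \<ge> 0"
    and C1: "\<And>m. l2 unif (\<lambda>t. quasi k (2 ^ m) g t - quasi k (2 ^ Suc m) g t) \<le> C * (2 powr - \<alpha>) ^ m"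
    by (rule quasi_increment[OF assms], assumption, assumption, rule that, assumption, assumption)
  let ?q = "2 powr - \<alpha> :: real"
  have q: "0 < ?q" "?q < 1" using \<alpha> by (auto simp: powr_minus_divide)
  define E where "E m = l2 unif (\<lambda>t. g t - quasi k (2 ^ m) g t)" for m
  define C' where "C' = C / (1 - ?q)"
  have C': "C' * (1 - ?q) = C" "C' \<ge> 0" using q C by (auto simp: C'_def)
  have step: "E m \<le> C * ?q ^ m + E (Suc m)" for m
  proof -
    have "E m \<le> l2 unif (\<lambda>t. g t - quasi k (2 ^ Suc m) g t) + l2 unif (\<lambda>t. quasi k (2 ^ Suc m) g t - quasi k (2 ^ m) g t)"
      unfolding E_def by (intro l2_triangle_diff L2_fun_unif g2 quasi_L2 k g) auto
    also have "l2 unif (\<lambda>t. quasi k (2 ^ Suc m) g t - quasi k (2 ^ m) g t) \<le> C * ?q ^ m"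
      by (subst l2_commute) (rule C1)
    finally show ?thesis by (simp add: E_def)
  qed
  have "E m \<le> C' * (?q ^ m - ?q ^ (m + n)) + E (m + n)" for m n
  proof (induction n)
    case (Suc n)
    have "E m \<le> C' * (?q ^ m - ?q ^ (m + n)) + (C * ?q ^ (m + n) + E (Suc (m + n)))"
      using Suc step[of "m + n"] by linarith
    also have "C * ?q ^ (m + n) = C' * (?q ^ (m + n) - ?q ^ (m + Suc n))"
      unfolding C'(1)[symmetric] by (simp add: algebra_simps)
    finally show ?case by (simp add: algebra_simps)
  qed simp
  then have b: "E m \<le> C' * ?q ^ m + E (m + n)" for m n
  proof -
    assume a: "\<And>m n. E m \<le> C' * (?q ^ m - ?q ^ (m + n)) + E (m + n)"
    have "C' * (?q ^ m - ?q ^ (m + n)) \<le> C' * ?q ^ m" using C' q by (intro mult_left_mono) auto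
    then show ?thesis using a[of m n] by linarith
  qed
  have "E m \<le> C' * ?q ^ m" for m
  proof -
    have "(\<lambda>n. E (n + m)) \<longlonglongrightarrow> 0"
      using quasi_tendsto[OF k g2 g] unfolding E_def by (rule LIMSEQ_ignore_initial_segment)
    then have "(\<lambda>n. C' * ?q ^ m + E (m + n)) \<longlonglongrightarrow> C' * ?q ^ m + 0"
      by (intro tendsto_add tendsto_const) (simp add: add.commute)
    from LIMSEQ_le_const[OF this, of "E m"] b show ?thesis by auto
  qed
  then show ?thesis using that[of C'] C' unfolding E_def by blast
qed

text \<open>The degree is 0 however smooth \<open>g\<close> is, so the finest \<open>quasi\<close>
  is sampled on the grid of level n. Under sampling the increment of level m changes by at most a
  multiple of 2 ^ m / 2 ^ n * (2 powr (-3/4)) ^ m = (2 powr (1/4)) ^ m / 2 ^ n. As 3/4 < 1, this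
  grows geometrically in m, so the sum over m < n has the size of its last term, (2 powr (-3/4)) ^
  n.\<close>

lemma piecewise_constant_error:
  assumes k: "k > 0" and \<alpha>: "\<alpha> \<ge> 3 / 4" and g2: "g \<in> L2_fun lborel" and g: "integrable lborel g"
    and A: "A \<ge> 0" and mod: "\<And>u. 0 < u \<Longrightarrow> u \<le> 1 / 2 \<Longrightarrow>
      (\<integral>s. (finite_diff k u g s)\<^sup>2 * indicator {0..1 - real k * u} s \<partial>lborel) \<le> A * u powr (2 * \<alpha>)"
  obtains C where "C \<ge> 0" "\<And>n. \<exists>v\<in>pw_poly 1 (2 ^ n). l2 unif (\<lambda>t. g t - v t) \<le> C * (2 powr - (3/4)) ^ n"
proof -
  have \<alpha>0: "\<alpha> > 0" using \<alpha> by simp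
  obtain C0 where C0: "C0 \<ge> 0" and e0: "\<And>m. l2 unif (\<lambda>t. g t - quasi k (2 ^ m) g t) \<le> C0 * (2 powr - \<alpha>) ^ m"
    by (rule quasi_error[OF k \<alpha>0 g2 g A mod], assumption, assumption, rule that, assumption, assumption)
  obtain C where C: "C \<ge> 0"
    and C2: "\<And>m n. m < n \<Longrightarrow> l2 unif (\<lambda>t. (quasi k (2 ^ m) g t - quasi k (2 ^ Suc m) g t) -
        (quasi k (2 ^ m) g (grid_floor (2 ^ n) t) - quasi k (2 ^ Suc m) g (grid_floor (2 ^ n) t)))
        \<le> C * (2 ^ m / 2 ^ n) * (2 powr - \<alpha>) ^ m"
    by (rule quasi_increment[OF k \<alpha>0 g2 g A mod], assumption, assumption, rule that, assumption, assumption)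
  let ?q = "2 powr - (3/4) :: real" and ?s = "2 powr (1/4) :: real"
  have qa: "(2 powr - \<alpha>) ^ m \<le> ?q ^ m" for m using \<alpha> by (intro power_mono powr_mono) auto
  have s1: "?s > 1" by (rule gr_one_powr) auto
  have sq: "2 * ?q = ?s" using powr_add[of 2 1 "- (3/4) :: real"] by simp
  define H where "H m n = l2 unif (\<lambda>t. quasi k (2 ^ m) g t - quasi k (2 ^ m) g (grid_floor (2 ^ n) t))" for m n :: nat
  have gfc: "grid_floor (2 ^ n) t \<in> {0..<1}" if "t \<in> {0..<1}" for t n
    using grid_floor_in_cell(1)[of 1 "2 ^ n" t 0] that by (simp add: cell_def)
  have qf: "(\<lambda>t. quasi k K g (grid_floor (2 ^ n) t)) \<in> L2_fun unif" if K: "K > 0" for K n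
  proof -
    obtain C where "C \<ge> 0" and C: "\<And>K g j t. K > 0 \<Longrightarrow> integrable lborel g \<Longrightarrow> j < K \<Longrightarrow> t \<in> cell K j \<Longrightarrow>
       \<bar>quasi k K g t\<bar> \<le> C * real K * (\<integral>s. \<bar>g s\<bar> * indicator (cell K j) s \<partial>lborel)"
      by (rule quasi_bound[OF k], rule that, assumption, assumption)
    show ?thesis
    proof (rule L2_fun_bounded[OF finite_measure_unif, of _ "C * real K * (\<integral>s. \<bar>g s\<bar> \<partial>lborel)"])
      show "AE t in unif. \<bar>quasi k K g (grid_floor (2 ^ n) t)\<bar> \<le> C * real K * (\<integral>s. \<bar>g s\<bar> \<partial>lborel)"
      proof (rule AE_I2)
        fix t assume "t \<in> space unif"
        then have "grid_floor (2 ^ n) t \<in> {0..<1}" using gfc by simp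
        then obtain j where j: "j < K" "grid_floor (2 ^ n) t \<in> cell K j" by (rule cell_exists[OF K])
        have "(\<integral>s. \<bar>g s\<bar> * indicator (cell K j) s \<partial>lborel) \<le> (\<integral>s. \<bar>g s\<bar> \<partial>lborel)"
          using g by (intro integral_mono integrable_times_indicator) (auto simp: indicator_def)
        then have "C * real K * (\<integral>s. \<bar>g s\<bar> * indicator (cell K j) s \<partial>lborel) \<le> C * real K * (\<integral>s. \<bar>g s\<bar> \<partial>lborel)"
          using \<open>C \<ge> 0\<close> by (intro mult_left_mono) auto
        with C[OF K g j] show "\<bar>quasi k K g (grid_floor (2 ^ n) t)\<bar> \<le> C * real K * (\<integral>s. \<bar>g s\<bar> \<partial>lborel)"
          by linarith
      qed
    qed measurable
  qed
  have H_step: "H (Suc m) n \<le> H m n + C * (2 ^ m / 2 ^ n) * ?q ^ m" if "m < n" for m n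
  proof -
    have eq: "(\<lambda>t. quasi k (2 ^ Suc m) g t - quasi k (2 ^ Suc m) g (grid_floor (2 ^ n) t)) =
      (\<lambda>t. (quasi k (2 ^ m) g t - quasi k (2 ^ m) g (grid_floor (2 ^ n) t)) -
         ((quasi k (2 ^ m) g t - quasi k (2 ^ Suc m) g t) -
        (quasi k (2 ^ m) g (grid_floor (2 ^ n) t) - quasi k (2 ^ Suc m) g (grid_floor (2 ^ n) t))))"
      by auto
    have m1: "(\<lambda>t. quasi k (2 ^ m) g t - quasi k (2 ^ m) g (grid_floor (2 ^ n) t)) \<in> L2_fun unif"
      by (intro L2_fun_diff quasi_L2 k g qf) auto
    have m2: "(\<lambda>t. ((quasi k (2 ^ m) g t - quasi k (2 ^ Suc m) g t) -
        (quasi k (2 ^ m) g (grid_floor (2 ^ n) t) - quasi k (2 ^ Suc m) g (grid_floor (2 ^ n) t)))) \<in> L2_fun unif"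
      by (intro L2_fun_diff quasi_L2 k g qf) auto
    have "H (Suc m) n \<le> H m n + C * (2 ^ m / 2 ^ n) * (2 powr - \<alpha>) ^ m"
      unfolding H_def eq using l2_diff_le[OF m1 m2] C2[OF that] by linarith
    also have "\<dots> \<le> H m n + C * (2 ^ m / 2 ^ n) * ?q ^ m"
      using C qa by (intro add_left_mono mult_left_mono) auto
    finally show ?thesis .
  qed
  \<comment> \<open>At level 0 there is a single polynomial on [0,1), and sampling a Lipschitz
    function on a grid of width 1 / 2 ^ n costs O(1 / 2 ^ n).\<close>
  obtain c where c: "c \<ge> 0" and H0: "\<And>n. H 0 n \<le> c / 2 ^ n"
  proof -
    let ?p = "pcompose (pderiv (interpolant k (local_primitive k 1 g 0))) [:0, 1 / mesh k 1:]"
    obtain c where c: "c \<ge> 0" "\<And>z w. z \<in> {0..1} \<Longrightarrow> w \<in> {0..1} \<Longrightarrow> \<bar>poly ?p z - poly ?p w\<bar> \<le> c * \<bar>z - w\<bar>"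
      using poly_bounds_on_interval[of 0 1 ?p] by blast
    have q1: "quasi k 1 g t = poly ?p t" if "t \<in> {0..<1}" for t
      using quasi_cell[of 0 1 t k g] that by (simp add: cell_def poly_pcompose)
    have "H 0 n \<le> c / 2 ^ n" for n
    proof -
      have "(l2 unif (\<lambda>t. quasi k 1 g t - quasi k 1 g (grid_floor (2 ^ n) t)))\<^sup>2 \<le> (\<Sum>j<(1::nat). (c / 2 ^ n)\<^sup>2) / real (1::nat)"
      proof (rule step_function_L2(2))
        fix j :: nat and t assume "j < 1" "t \<in> cell 1 j"
        then have t: "t \<in> cell 1 0" "t \<in> {0..<1}" by (auto simp: cell_def)
        have "\<bar>t - grid_floor (2 ^ n) t\<bar> \<le> 1 / 2 ^ n"
          using grid_floor_in_cell(2)[OF _ _ _ t(1), of "2 ^ n"] by simp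
        then have "c * \<bar>t - grid_floor (2 ^ n) t\<bar> \<le> c * (1 / 2 ^ n)" by (rule mult_left_mono[OF _ c(1)])
        then have "\<bar>quasi k 1 g t - quasi k 1 g (grid_floor (2 ^ n) t)\<bar> \<le> c / 2 ^ n"
          unfolding q1[OF t(2)] q1[OF gfc[OF t(2)]]
          using c(2)[of t "grid_floor (2 ^ n) t"] t(2) gfc[OF t(2), of n] by simp
        from power_mono[OF this, of 2]
        show "(quasi k 1 g t - quasi k 1 g (grid_floor (2 ^ n) t))\<^sup>2 \<le> (c / 2 ^ n)\<^sup>2" by simp
      qed auto
      then show ?thesis using c(1) unfolding H_def by (auto intro: power2_le_imp_le)
    qed
    with c(1) show ?thesis by (rule that)
  qed
  \<comment> \<open>Chosen so that B >= c starts the induction at level 0 and C <= B (s - 1), with s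
    = 2 powr (1/4), closes it: B s ^ m + C s ^ m <= B s ^ (m + 1).\<close>
  define B where "B = c + C / (?s - 1)"
  have B: "B \<ge> 0" "C \<le> B * (?s - 1)"
  proof -
    show "B \<ge> 0" unfolding B_def using c C s1 by (intro add_nonneg_nonneg divide_nonneg_pos) auto
    have "B * (?s - 1) = c * (?s - 1) + C" using s1 by (simp add: B_def distrib_right)
    moreover have "0 \<le> c * (?s - 1)" using c less_imp_le[OF s1] by (intro mult_nonneg_nonneg) auto
    ultimately show "C \<le> B * (?s - 1)" by linarith
  qed
  have Hb: "H m n \<le> B * ?s ^ m / 2 ^ n" if "m \<le> n" for m n
    using that
  proof (induction m)
    case 0
    have "c \<le> B" using divide_nonneg_pos[OF C, of "?s - 1"] s1 by (simp add: B_def)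
    then have "c / 2 ^ n \<le> B / 2 ^ n" by (simp add: divide_right_mono)
    then show ?case using H0[of n] by simp
  next
    case (Suc m)
    have "H (Suc m) n \<le> B * ?s ^ m / 2 ^ n + C * (2 ^ m / 2 ^ n) * ?q ^ m"
      using H_step[of m n] Suc by simp
    also have "C * (2 ^ m / 2 ^ n) * ?q ^ m = C * ?s ^ m / 2 ^ n"
      by (simp add: sq[symmetric] power_mult_distrib)
    also have "B * ?s ^ m / 2 ^ n + C * ?s ^ m / 2 ^ n \<le> B * ?s ^ m / 2 ^ n + (B * (?s - 1)) * ?s ^ m / 2 ^ n"
      by (intro add_left_mono divide_right_mono mult_right_mono B) auto
    also have "\<dots> = B * ?s ^ Suc m / 2 ^ n" by (simp add: field_simps)
    finally show ?case .
  qed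
  show ?thesis
  proof (rule that[of "C0 + B"])
    show "0 \<le> C0 + B" using C0 B by simp
    fix n :: nat
    define v where "v t = (\<Sum>j<2 ^ n. poly [:quasi k (2 ^ n) g (real j / real (2 ^ n)):] t * indicator (cell (2 ^ n) j) t)" for t
    have v: "v \<in> pw_poly 1 (2 ^ n)"
      unfolding pw_poly_cell_iff v_def[abs_def]
      by (intro exI[of _ "\<lambda>j. [:quasi k (2 ^ n) g (real j / real (2 ^ n)):]"] conjI allI impI) auto
    have vt: "v t = quasi k (2 ^ n) g (grid_floor (2 ^ n) t)" if t: "t \<in> {0..<1}" for t
    proof -
      obtain j where j: "j < 2 ^ n" "t \<in> cell (2 ^ n) j" by (rule cell_exists[OF _ t, of "2 ^ n"]) auto
      have "v t = quasi k (2 ^ n) g (real j / real (2 ^ n))"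
        unfolding v_def using sum_cell_indicator[OF j, of "\<lambda>j. poly [:quasi k (2 ^ n) g (real j / real (2 ^ n)):] t"] by simp
      then show ?thesis using grid_floor_cell[OF _ j(2)] by simp
    qed
    have "l2 unif (\<lambda>t. g t - v t) = l2 unif (\<lambda>t. g t - quasi k (2 ^ n) g (grid_floor (2 ^ n) t))"
      unfolding l2_def by (intro arg_cong[where f=sqrt] Bochner_Integration.integral_cong) (auto simp: vt)
    also have "\<dots> \<le> l2 unif (\<lambda>t. g t - quasi k (2 ^ n) g t) + H n n"
      unfolding H_def by (intro l2_triangle_diff L2_fun_unif g2 quasi_L2 k g qf) auto
    also have "\<dots> \<le> C0 * ?q ^ n + B * ?q ^ n"
    proof (rule add_mono)
      show "l2 unif (\<lambda>t. g t - quasi k (2 ^ n) g t) \<le> C0 * ?q ^ n"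
        using e0[of n] mult_left_mono[OF qa[of n] C0] by linarith
      have "?s ^ n / 2 ^ n = ?q ^ n" unfolding sq[symmetric] power_mult_distrib by simp
      then have "B * ?s ^ n / 2 ^ n = B * ?q ^ n" by (simp only: times_divide_eq_right[symmetric])
      then show "H n n \<le> B * ?q ^ n" using Hb[of n n] by simp
    qed
    finally have "l2 unif (\<lambda>t. g t - v t) \<le> (C0 + B) * ?q ^ n" by (simp add: distrib_right)
    then show "\<exists>v\<in>pw_poly 1 (2 ^ n). l2 unif (\<lambda>t. g t - v t) \<le> (C0 + B) * ?q ^ n" using v by blast
  qed
qed

section \<open>The design\<close>

lemma snd_borel [measurable]: "snd \<in> (borel :: ('a::second_countable_topology \<times> 'b::second_countable_topology) measure) \<rightarrow>\<^sub>M borel"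
  by (intro borel_measurable_continuous_onI continuous_intros)

lemma fst_borel [measurable]: "fst \<in> (borel :: ('a::second_countable_topology \<times> 'b::second_countable_topology) measure) \<rightarrow>\<^sub>M borel"
  by (intro borel_measurable_continuous_onI continuous_intros)

lemma fst_component_borel [measurable]: "(\<lambda>z. fst z $ j) \<in> borel_measurable (borel :: ((real ^ 'q) \<times> 'b::second_countable_topology) measure)"
  unfolding cart_eq_inner_axis by measurable

text \<open>Second countability: the complement of the support is covered by countably many basis
  sets of measure zero.\<close>

lemma AE_in_measure_support:
  fixes \<nu> :: "'a::second_countable_topology measure"
  assumes s: "sets \<nu> = sets borel"
  shows "AE z in \<nu>. z \<in> measure_support \<nu>"
proof -
  obtain B :: "'a set set" where B: "countable B" "topological_basis B" using ex_countable_basis by blast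
  let ?B = "{U \<in> B. emeasure \<nu> U = 0}"
  have "- measure_support \<nu> \<subseteq> \<Union> ?B"
  proof
    fix z assume "z \<in> - measure_support \<nu>"
    then obtain U where U: "open U" "z \<in> U" "emeasure \<nu> U = 0"
      by (auto simp: measure_support_def)
    from topological_basisE[OF B(2) U(1,2)] obtain V where V: "V \<in> B" "z \<in> V" "V \<subseteq> U" by blast
    have "emeasure \<nu> V \<le> emeasure \<nu> U" using V U(1) s by (intro emeasure_mono) auto
    then have "emeasure \<nu> V = 0" using U(3) by simp
    then show "z \<in> \<Union> ?B" using V by blast
  qed
  moreover have "\<Union> ?B \<in> null_sets \<nu>"
  proof -
    have "(\<Union>U\<in>?B. U) \<in> null_sets \<nu>"
      using B s topological_basis_open[OF B(2)] by (intro null_sets_UN') (auto simp: null_sets_def)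
    then show ?thesis by simp
  qed
  ultimately show ?thesis
    by (intro AE_I'[of "\<Union> ?B"]) auto
qed

locale design =
  fixes \<mu> :: "((real ^ 'q) \<times> real) measure" and \<kappa> :: "real \<Rightarrow> (real ^ 'q) measure"
    and \<K> :: "(real ^ 'q) set" and h0 h1 :: real
  assumes law: "prob_space \<mu>" and sets_mu: "sets \<mu> = sets borel"
    and cond: "conditional_law \<mu> \<kappa>"
    and A1: "design_density \<mu> \<K> h0 h1"
    and A3: "nondegenerate_given_T \<kappa>"
begin

sublocale prob_space \<mu> by (rule law)

declare sets_mu [measurable_cong]

lemma space_mu [simp]: "space \<mu> = UNIV"
  using sets_eq_imp_space_eq[OF sets_mu] by simp

lemma h0_pos: "h0 > 0" and compact_K: "compact \<K>"
  using A1 by (auto simp: design_density_def)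

lemma AE_K: "AE z in \<mu>. fst z \<in> \<K> \<and> snd z \<in> {0..1}"
  using AE_in_measure_support[OF sets_mu] A1 by (auto simp: design_density_def elim!: eventually_mono)

lemma K_borel [measurable]: "\<K> \<in> sets borel"
  using compact_K by (intro borel_closed compact_imp_closed)

definition phi :: "(real ^ 'q) \<times> real \<Rightarrow> real" where
  "phi = (SOME \<phi>. \<phi> \<in> borel_measurable borel \<and> \<mu> = density lborel (\<lambda>z. ennreal (\<phi> z)) \<and>
     (\<forall>z \<in> \<K> \<times> {0..1}. h0 \<le> \<phi> z \<and> \<phi> z \<le> h1))"

lemma phi: "phi \<in> borel_measurable borel" "\<mu> = density lborel (\<lambda>z. ennreal (phi z))"
  "z \<in> \<K> \<times> {0..1} \<Longrightarrow> h0 \<le> phi z" "z \<in> \<K> \<times> {0..1} \<Longrightarrow> phi z \<le> h1"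
proof -
  have "\<exists>\<phi>. \<phi> \<in> borel_measurable borel \<and> \<mu> = density lborel (\<lambda>z. ennreal (\<phi> z)) \<and>
     (\<forall>z \<in> \<K> \<times> {0..1}. h0 \<le> \<phi> z \<and> \<phi> z \<le> h1)"
    using A1 unfolding design_density_def by blast
  from someI_ex[OF this, folded phi_def]
  show "phi \<in> borel_measurable borel" "\<mu> = density lborel (\<lambda>z. ennreal (phi z))"
    "z \<in> \<K> \<times> {0..1} \<Longrightarrow> h0 \<le> phi z" "z \<in> \<K> \<times> {0..1} \<Longrightarrow> phi z \<le> h1"
    by auto
qed

lemma KI_borel [measurable]: "\<K> \<times> {0..1::real} \<in> sets borel"
  by (simp add: borel_prod[symmetric])

text \<open>\<open>phi\<close> is controlled only on \<K> times [0,1]. Since \<open>\<mu>\<close> is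
  concentrated there, the integral is cut down to that set before the bounds on \<open>phi\<close>
  are applied.\<close>

lemma nn_integral_mu:
  assumes [measurable]: "F \<in> borel_measurable borel"
  shows "(\<integral>\<^sup>+z. F z \<partial>\<mu>) = (\<integral>\<^sup>+z. ennreal (phi z) * F z * indicator (\<K> \<times> {0..1}) z \<partial>lborel)"
proof -
  note [measurable] = phi(1)
  have "(\<integral>\<^sup>+z. F z \<partial>\<mu>) = (\<integral>\<^sup>+z. F z * indicator (\<K> \<times> {0..1}) z \<partial>\<mu>)"
  proof (rule nn_integral_cong_AE)
    show "AE z in \<mu>. F z = F z * indicator (\<K> \<times> {0..1}) z"
      using AE_K by eventually_elim (simp add: indicator_def mem_Times_iff)
  qed
  also have "\<dots> = (\<integral>\<^sup>+z. ennreal (phi z) * (F z * indicator (\<K> \<times> {0..1}) z) \<partial>lborel)"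
    by (subst phi(2), subst nn_integral_density) auto
  finally show ?thesis by (simp add: mult.assoc)
qed

lemma nn_integral_mu_lower:
  assumes [measurable]: "F \<in> borel_measurable borel"
  shows "ennreal h0 * (\<integral>\<^sup>+z. F z * indicator (\<K> \<times> {0..1}) z \<partial>lborel) \<le> (\<integral>\<^sup>+z. F z \<partial>\<mu>)"
  unfolding nn_integral_mu[OF assms]
  by (subst nn_integral_cmult[symmetric])
    (auto intro!: nn_integral_mono mult_right_mono ennreal_leI phi(3) simp: indicator_def)

lemma nn_integral_mu_upper:
  assumes [measurable]: "F \<in> borel_measurable borel"
  shows "(\<integral>\<^sup>+z. F z \<partial>\<mu>) \<le> ennreal h1 * (\<integral>\<^sup>+z. F z * indicator (\<K> \<times> {0..1}) z \<partial>lborel)"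
  unfolding nn_integral_mu[OF assms]
  by (subst nn_integral_cmult[symmetric])
    (auto intro!: nn_integral_mono mult_right_mono ennreal_leI phi(4) simp: indicator_def)

definition vol :: real where "vol = measure lborel \<K>"

lemma nn_integral_product:
  fixes g :: "real \<Rightarrow> ennreal"
  assumes [measurable]: "g \<in> borel_measurable borel"
  shows "(\<integral>\<^sup>+z. g (snd z) * indicator (\<K> \<times> {0..1}) z \<partial>lborel) =
    ennreal vol * (\<integral>\<^sup>+t. g t * indicator {0..1} t \<partial>lborel)"
proof -
  have e: "emeasure lborel \<K> = ennreal vol"
    unfolding vol_def using emeasure_compact_finite[OF compact_K] by (intro emeasure_eq_ennreal_measure) auto
  have "(\<integral>\<^sup>+z. g (snd z) * indicator (\<K> \<times> {0..1}) z \<partial>lborel) =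
     (\<integral>\<^sup>+z. indicator \<K> (fst z) * (g (snd z) * indicator {0..1} (snd z)) \<partial>(lborel \<Otimes>\<^sub>M lborel))"
    unfolding lborel_prod by (intro nn_integral_cong) (auto simp: indicator_def)
  also have "\<dots> = (\<integral>\<^sup>+x. \<integral>\<^sup>+t. indicator \<K> x * (g t * indicator {0..1} t) \<partial>lborel \<partial>lborel)"
    by (subst lborel.nn_integral_fst[symmetric]) auto
  also have "\<dots> = (\<integral>\<^sup>+x. indicator \<K> x * (\<integral>\<^sup>+t. g t * indicator {0..1} t \<partial>lborel) \<partial>lborel)"
    by (intro nn_integral_cong nn_integral_cmult) auto
  also have "\<dots> = (\<integral>\<^sup>+x. indicator \<K> x \<partial>lborel) * (\<integral>\<^sup>+t. g t * indicator {0..1} t \<partial>lborel)"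
    by (rule nn_integral_multc) simp
  finally show ?thesis by (simp add: e)
qed

text \<open>Total mass one and the upper density bound give 1 <= h1 * vol, which forces both factors
  to be positive.\<close>

lemma vol_pos: "vol > 0" and h1_pos: "h1 > 0"
proof -
  have "1 = (\<integral>\<^sup>+z. 1 \<partial>\<mu>)" using emeasure_space_1 by simp
  also have "\<dots> \<le> ennreal h1 * (\<integral>\<^sup>+z. 1 * indicator (\<K> \<times> {0..1::real}) z \<partial>lborel)"
    by (rule nn_integral_mu_upper[of "\<lambda>_. 1", OF borel_measurable_const])
  also have "\<dots> = ennreal h1 * ennreal vol"
    using nn_integral_product[of "\<lambda>_. 1"] by simp
  finally have le: "1 \<le> ennreal h1 * ennreal vol" .
  have "vol \<ge> 0" by (simp add: vol_def)
  moreover have "vol \<noteq> 0" using le by auto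
  ultimately show "vol > 0" by simp
  show "h1 > 0"
  proof (rule ccontr)
    assume "\<not> h1 > 0"
    then have "ennreal h1 = 0" by (simp add: ennreal_neg)
    with le show False by simp
  qed
qed

abbreviation P_T :: "real measure" where "P_T \<equiv> law_T \<mu>"

lemma sets_PT [simp, measurable_cong]: "sets P_T = sets borel"
  by (simp add: law_T_def)

lemma space_PT [simp]: "space P_T = UNIV"
  by (simp add: law_T_def)

lemma prob_space_PT: "prob_space P_T"
  unfolding law_T_def by (rule prob_space_distr) simp

lemma nn_integral_PT: "g \<in> borel_measurable borel \<Longrightarrow> (\<integral>\<^sup>+t. g t \<partial>P_T) = (\<integral>\<^sup>+z. g (snd z) \<partial>\<mu>)"
  unfolding law_T_def by (rule nn_integral_distr) auto

text \<open>The law of \<open>T\<close> and Lebesgue measure on [0,1] have equivalent norms. The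
  lower bound turns smoothness under the law of \<open>T\<close> into smoothness under Lebesgue
  measure; the upper bound carries the approximation results back.\<close>

lemma nn_integral_PT_bounds:
  assumes g[measurable]: "g \<in> borel_measurable borel"
  shows "ennreal (h0 * vol) * (\<integral>\<^sup>+t. g t * indicator {0..1} t \<partial>lborel) \<le> (\<integral>\<^sup>+t. g t \<partial>P_T)"
    "(\<integral>\<^sup>+t. g t \<partial>P_T) \<le> ennreal (h1 * vol) * (\<integral>\<^sup>+t. g t * indicator {0..1} t \<partial>lborel)"
proof -
  have m: "(\<lambda>z::(real^'q) \<times> real. g (snd z)) \<in> borel_measurable borel" by measurable
  show "ennreal (h0 * vol) * (\<integral>\<^sup>+t. g t * indicator {0..1} t \<partial>lborel) \<le> (\<integral>\<^sup>+t. g t \<partial>P_T)"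
    "(\<integral>\<^sup>+t. g t \<partial>P_T) \<le> ennreal (h1 * vol) * (\<integral>\<^sup>+t. g t * indicator {0..1} t \<partial>lborel)"
    using nn_integral_mu_lower[OF m] nn_integral_mu_upper[OF m] h0_pos h1_pos vol_pos
    by (auto simp: nn_integral_PT[OF g] nn_integral_product[OF g] ennreal_mult mult.assoc)
qed

text \<open>The endpoint 1 has to be excluded: the cells are half-open, so every element of
  \<open>pw_poly\<close> vanishes there.\<close>

lemma AE_PT: "AE t in P_T. t \<in> {0..<1}"
proof -
  have "(\<integral>\<^sup>+t. indicator (- {0..<1}) t \<partial>P_T) \<le> ennreal (h1 * vol) * (\<integral>\<^sup>+t. indicator (- {0..<1}) t * indicator {0..1::real} t \<partial>lborel)"
    by (rule nn_integral_PT_bounds(2)) simp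
  also have "(\<integral>\<^sup>+t. indicator (- {0..<1}) t * indicator {0..1::real} t \<partial>lborel) = (\<integral>\<^sup>+t. indicator {1::real} t \<partial>lborel)"
    by (intro nn_integral_cong) (auto simp: indicator_def)
  also have "\<dots> = 0" by simp
  finally have "emeasure P_T (- {0..<1}) = 0" by simp
  then show ?thesis by (intro AE_I[of _ _ "- {0..<1}"]) auto
qed

lemma AE_T: "AE z in \<mu>. snd z \<in> {0..<1}"
  using AE_PT unfolding law_T_def by (subst (asm) AE_distr_iff) auto

definition bnd :: real where "bnd = (SOME B. B > 0 \<and> (\<forall>x\<in>\<K>. norm x \<le> B))"

lemma bnd: "bnd > 0" "x \<in> \<K> \<Longrightarrow> norm x \<le> bnd"
proof -
  have "\<exists>B. B > 0 \<and> (\<forall>x\<in>\<K>. norm x \<le> B)"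
    using compact_imp_bounded[OF compact_K] by (auto simp: bounded_pos)
  from someI_ex[OF this, folded bnd_def] show "bnd > 0" "x \<in> \<K> \<Longrightarrow> norm x \<le> bnd" by auto
qed

lemma bnd_component: "x \<in> \<K> \<Longrightarrow> \<bar>x $ k\<bar> \<le> bnd"
  using bnd(2)[of x] component_le_norm_cart[of x k] by simp

lemma kernel: "\<kappa> \<in> borel \<rightarrow>\<^sub>M subprob_algebra borel" "prob_space (\<kappa> t)" "sets (\<kappa> t) = sets borel" "space (\<kappa> t) = UNIV"
proof -
  have k: "\<kappa> \<in> borel \<rightarrow>\<^sub>M prob_algebra borel" using cond by (simp add: conditional_law_def)
  show "\<kappa> \<in> borel \<rightarrow>\<^sub>M subprob_algebra borel" by (rule measurable_prob_algebraD[OF k])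
  from measurable_space[OF k, of t] have "\<kappa> t \<in> space (prob_algebra borel)" by simp
  then show "prob_space (\<kappa> t)" "sets (\<kappa> t) = sets borel" by (auto simp: space_prob_algebra)
  then show "space (\<kappa> t) = UNIV" using sets_eq_imp_space_eq by fastforce
qed

text \<open>\<open>conditional_law\<close> prescribes \<open>\<mu>\<close> on rectangles only. These
  generate the product sets and are closed under intersection, so \<open>\<mu>\<close> is the
  composition of the law of \<open>T\<close> with the kernel.\<close>

lemma disintegration:
  assumes [measurable]: "F \<in> borel_measurable borel"
  shows "(\<integral>\<^sup>+z. F z \<partial>\<mu>) = (\<integral>\<^sup>+t. \<integral>\<^sup>+x. F (x, t) \<partial>\<kappa> t \<partial>P_T)"
proof -
  note [measurable] = kernel(1)
  let ?k = "\<lambda>t. distr (\<kappa> t) borel (\<lambda>x. (x, t))"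
  have km: "\<kappa> \<in> P_T \<rightarrow>\<^sub>M subprob_algebra borel" using kernel(1) by measurable
  have k: "?k \<in> P_T \<rightarrow>\<^sub>M subprob_algebra borel"
    by (rule measurable_distr2[OF _ km]) (simp add: split_beta borel_prod[symmetric])
  let ?N = "P_T \<bind> ?k"
  have sN: "sets ?N = sets borel" by (rule sets_bind) (auto simp: )
  have eN: "emeasure ?N (A \<times> B) = (\<integral>\<^sup>+t. emeasure (\<kappa> t) A * indicator B t \<partial>P_T)"
    if [measurable]: "A \<in> sets borel" "B \<in> sets borel" for A B
  proof -
    have AB[measurable]: "A \<times> B \<in> sets (borel :: ((real^'q) \<times> real) measure)" by (simp add: borel_prod[symmetric])
    have "emeasure ?N (A \<times> B) = (\<integral>\<^sup>+t. emeasure (?k t) (A \<times> B) \<partial>P_T)"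
      by (rule emeasure_bind[OF _ k AB]) simp
    also have "\<dots> = (\<integral>\<^sup>+t. emeasure (\<kappa> t) A * indicator B t \<partial>P_T)"
    proof (intro nn_integral_cong)
      fix t
      have [measurable_cong]: "sets (\<kappa> t) = sets borel" by (rule kernel)
      have "emeasure (?k t) (A \<times> B) = emeasure (\<kappa> t) ((\<lambda>x. (x, t)) -` (A \<times> B) \<inter> space (\<kappa> t))"
        by (rule emeasure_distr) (auto simp: borel_prod[symmetric])
      also have "(\<lambda>x. (x, t)) -` (A \<times> B) \<inter> space (\<kappa> t) = (if t \<in> B then A else {})"
        using kernel(4) by auto
      finally show "emeasure (?k t) (A \<times> B) = emeasure (\<kappa> t) A * indicator B t"
        by (simp add: indicator_def)
    qed
    finally show ?thesis .
  qed
  let ?E = "{a \<times> b | a b. a \<in> sets (borel :: (real^'q) measure) \<and> b \<in> sets (borel :: real measure)}"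
  have sE: "sets (borel :: ((real^'q) \<times> real) measure) = sigma_sets UNIV ?E"
    using sets_pair_measure[of "borel :: (real^'q) measure" "borel :: real measure"] unfolding borel_prod by simp
  have "\<mu> = ?N"
  proof (rule measure_eqI_generator_eq[where E="?E" and \<Omega>=UNIV and A="\<lambda>_. UNIV"])
    show "Int_stable ?E"
    proof (rule Int_stableI)
      fix a b assume "a \<in> ?E" "b \<in> ?E"
      then obtain a1 a2 b1 b2 where "a = a1 \<times> a2" "b = b1 \<times> b2" "a1 \<in> sets borel" "a2 \<in> sets borel" "b1 \<in> sets borel" "b2 \<in> sets borel"
        by blast
      then show "a \<inter> b \<in> ?E" by (auto simp: Times_Int_Times intro!: exI[of _ "a1 \<inter> b1"] exI[of _ "a2 \<inter> b2"])
    qed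
    show "emeasure \<mu> X = emeasure ?N X" if "X \<in> ?E" for X
      using that cond eN by (auto simp: conditional_law_def)
    show "range (\<lambda>_::nat. UNIV) \<subseteq> ?E" by (auto intro!: exI[of _ UNIV])
  qed (auto simp: sE sets_mu sN)
  then have "(\<integral>\<^sup>+z. F z \<partial>\<mu>) = (\<integral>\<^sup>+z. F z \<partial>?N)" by simp
  also have "\<dots> = (\<integral>\<^sup>+t. \<integral>\<^sup>+z. F z \<partial>?k t \<partial>P_T)"
    by (rule nn_integral_bind[OF _ k]) simp
  also have "\<dots> = (\<integral>\<^sup>+t. \<integral>\<^sup>+x. F (x, t) \<partial>\<kappa> t \<partial>P_T)"
  proof (intro nn_integral_cong)
    fix t
    have [measurable_cong]: "sets (\<kappa> t) = sets borel" by (rule kernel)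
    show "(\<integral>\<^sup>+z. F z \<partial>?k t) = (\<integral>\<^sup>+x. F (x, t) \<partial>\<kappa> t)"
    proof (rule nn_integral_distr)
      have "(\<lambda>x. (x, t)) \<in> (borel :: (real^'q) measure) \<rightarrow>\<^sub>M borel"
        by (intro borel_measurable_continuous_onI continuous_intros)
      then show "(\<lambda>x. (x, t)) \<in> \<kappa> t \<rightarrow>\<^sub>M borel" by measurable
    qed measurable
  qed
  finally show ?thesis .
qed

section \<open>Conditional means and the projection residual\<close>

lemma AE_kernel: "AE t in P_T. AE x in \<kappa> t. x \<in> \<K>"
proof -
  have K1: "(\<integral>\<^sup>+z. indicator (- \<K>) (fst z) \<partial>\<mu>) = 0"
    using AE_K by (subst nn_integral_0_iff_AE) (auto elim!: eventually_mono)
  have "(\<lambda>z. indicator (- \<K>) (fst z) :: ennreal) \<in> borel_measurable (borel :: ((real^'q) \<times> real) measure)"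
    by (simp add: borel_prod[symmetric])
  from disintegration[OF this] K1
  have "(\<integral>\<^sup>+t. emeasure (\<kappa> t) (- \<K>) \<partial>P_T) = 0" by (simp add: kernel)
  then have "AE t in P_T. emeasure (\<kappa> t) (- \<K>) = 0"
    using measurable_emeasure_kernel[OF kernel(1), of "- \<K>"]
    by (subst (asm) nn_integral_0_iff_AE) (auto cong: measurable_cong_sets)
  then show ?thesis
    by eventually_elim (rule AE_I[of _ _ "- \<K>"], auto simp: kernel)
qed

lemma cond_mean_measurable [measurable]: "cond_mean \<kappa> j \<in> borel_measurable borel"
proof -
  note [measurable] = kernel(1)
  show ?thesis unfolding cond_mean_def
    by (rule measurable_compose[OF kernel(1) integral_measurable_subprob_algebra]) simp
qed

text \<open>The shifted component x $ j + bnd is nonnegative almost surely; in this form the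
  conditional mean fits \<open>disintegration\<close>, which speaks of nonnegative
  integrals.\<close>

lemma cond_mean_bound: "AE t in P_T. \<forall>j. \<bar>cond_mean \<kappa> j t\<bar> \<le> bnd \<and>
    (\<integral>\<^sup>+x. ennreal (x $ j + bnd) \<partial>\<kappa> t) = ennreal (cond_mean \<kappa> j t + bnd) \<and> integrable (\<kappa> t) (\<lambda>x. x $ j)"
  using AE_kernel
proof eventually_elim
  case (elim t)
  interpret k: prob_space "\<kappa> t" by (rule kernel)
  note [measurable_cong] = kernel(3)[of t]
  show ?case
  proof
    fix j
    have ab: "AE x in \<kappa> t. \<bar>x $ j\<bar> \<le> bnd" using elim bnd_component by (auto elim!: eventually_mono)
    have i: "integrable (\<kappa> t) (\<lambda>x. x $ j)" by (rule k.integrable_const_bound[of _ bnd]) (use ab in auto)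
    have "\<bar>cond_mean \<kappa> j t\<bar> \<le> (\<integral>x. \<bar>x $ j\<bar> \<partial>\<kappa> t)" unfolding cond_mean_def by (rule integral_abs_bound)
    also have "\<dots> \<le> (\<integral>x. bnd \<partial>\<kappa> t)" by (rule integral_mono_AE) (use i ab in auto)
    finally have 1: "\<bar>cond_mean \<kappa> j t\<bar> \<le> bnd" by (simp add: k.prob_space)
    have "(\<integral>\<^sup>+x. ennreal (x $ j + bnd) \<partial>\<kappa> t) = ennreal (\<integral>x. x $ j + bnd \<partial>\<kappa> t)"
      by (rule nn_integral_eq_integral) (use i ab in \<open>auto elim!: eventually_mono\<close>)
    also have "(\<integral>x. x $ j + bnd \<partial>\<kappa> t) = cond_mean \<kappa> j t + bnd"
      using i by (simp add: cond_mean_def k.prob_space)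
    finally show "\<bar>cond_mean \<kappa> j t\<bar> \<le> bnd \<and>
      (\<integral>\<^sup>+x. ennreal (x $ j + bnd) \<partial>\<kappa> t) = ennreal (cond_mean \<kappa> j t + bnd) \<and> integrable (\<kappa> t) (\<lambda>x. x $ j)"
      using 1 i by simp
  qed
qed

lemma AE_cond_mean: "AE z in \<mu>. \<forall>j. \<bar>cond_mean \<kappa> j (snd z)\<bar> \<le> bnd"
proof -
  have "AE t in P_T. \<forall>j. \<bar>cond_mean \<kappa> j t\<bar> \<le> bnd" using cond_mean_bound by (auto elim!: eventually_mono)
  then show ?thesis unfolding law_T_def by (subst (asm) AE_distr_iff) auto
qed

lemma L2_component: "(\<lambda>z. fst z $ j) \<in> L2_fun \<mu>"
  by (rule L2_fun_bounded[where B=bnd]) (use AE_K bnd_component in \<open>auto elim!: eventually_mono intro: finite_measure_axioms\<close>)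

lemma L2_cond_mean: "(\<lambda>z. cond_mean \<kappa> j (snd z)) \<in> L2_fun \<mu>"
  by (rule L2_fun_bounded[where B=bnd]) (use AE_cond_mean in \<open>auto elim!: eventually_mono intro: finite_measure_axioms\<close>)

lemma tower_nonneg:
  assumes [measurable]: "\<psi> \<in> borel_measurable borel" and p: "\<And>t. 0 \<le> \<psi> t"
  shows "(\<integral>\<^sup>+z. ennreal ((fst z $ j + bnd) * \<psi> (snd z)) \<partial>\<mu>) = (\<integral>\<^sup>+z. ennreal ((cond_mean \<kappa> j (snd z) + bnd) * \<psi> (snd z)) \<partial>\<mu>)"
proof -
  have "(\<integral>\<^sup>+z. ennreal ((fst z $ j + bnd) * \<psi> (snd z)) \<partial>\<mu>) = (\<integral>\<^sup>+t. \<integral>\<^sup>+x. ennreal ((x $ j + bnd) * \<psi> t) \<partial>\<kappa> t \<partial>P_T)"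
    by (subst disintegration) auto
  also have "\<dots> = (\<integral>\<^sup>+t. ennreal ((cond_mean \<kappa> j t + bnd) * \<psi> t) \<partial>P_T)"
  proof (rule nn_integral_cong_AE)
    show "AE t in P_T. (\<integral>\<^sup>+x. ennreal ((x $ j + bnd) * \<psi> t) \<partial>\<kappa> t) = ennreal ((cond_mean \<kappa> j t + bnd) * \<psi> t)"
      using cond_mean_bound
    proof eventually_elim
      case (elim t)
      note [measurable_cong] = kernel(3)[of t]
      have "(\<integral>\<^sup>+x. ennreal ((x $ j + bnd) * \<psi> t) \<partial>\<kappa> t) = (\<integral>\<^sup>+x. ennreal (x $ j + bnd) * ennreal (\<psi> t) \<partial>\<kappa> t)"
        by (intro nn_integral_cong ennreal_mult'' p)
      also have "\<dots> = ennreal (cond_mean \<kappa> j t + bnd) * ennreal (\<psi> t)"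
        using elim by (subst nn_integral_multc) auto
      finally show ?case by (simp add: ennreal_mult'' p)
    qed
  qed
  also have "\<dots> = (\<integral>\<^sup>+z. ennreal ((cond_mean \<kappa> j (snd z) + bnd) * \<psi> (snd z)) \<partial>\<mu>)"
    by (rule nn_integral_PT) simp
  finally show ?thesis .
qed

text \<open>Reduced to nonnegative factors by the shift by \<open>bnd\<close> and by splitting
  \<psi> into its positive and negative parts.\<close>

lemma tower:
  assumes m[measurable]: "\<psi> \<in> borel_measurable borel" and L2: "(\<lambda>z. \<psi> (snd z)) \<in> L2_fun \<mu>"
  shows "(\<integral>z. fst z $ j * \<psi> (snd z) \<partial>\<mu>) = (\<integral>z. cond_mean \<kappa> j (snd z) * \<psi> (snd z) \<partial>\<mu>)"
proof -
  have i1: "integrable \<mu> (\<lambda>z. \<psi> (snd z))"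
    by (rule L2_fun_integrable[OF _ L2]) (rule finite_measure_axioms)
  have pos: "(\<integral>z. fst z $ j * \<psi> (snd z) \<partial>\<mu>) = (\<integral>z. cond_mean \<kappa> j (snd z) * \<psi> (snd z) \<partial>\<mu>)"
    if [measurable]: "\<psi> \<in> borel_measurable borel" and p: "\<And>t. 0 \<le> \<psi> t" and L2: "(\<lambda>z. \<psi> (snd z)) \<in> L2_fun \<mu>" for \<psi>
  proof -
    have i1: "integrable \<mu> (\<lambda>z. \<psi> (snd z))"
      by (rule L2_fun_integrable[OF _ L2]) (rule finite_measure_axioms)
    have i2: "integrable \<mu> (\<lambda>z. fst z $ j * \<psi> (snd z))" by (rule L2_fun_mult[OF L2_component L2])
    have i3: "integrable \<mu> (\<lambda>z. cond_mean \<kappa> j (snd z) * \<psi> (snd z))" by (rule L2_fun_mult[OF L2_cond_mean L2])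
    have a1: "AE z in \<mu>. 0 \<le> (fst z $ j + bnd) * \<psi> (snd z)"
      using AE_K
    proof eventually_elim
      case (elim z)
      then show ?case using bnd_component[of "fst z" j] p by (intro mult_nonneg_nonneg) auto
    qed
    have a2: "AE z in \<mu>. 0 \<le> (cond_mean \<kappa> j (snd z) + bnd) * \<psi> (snd z)"
      using AE_cond_mean
    proof eventually_elim
      case (elim z)
      then have "\<bar>cond_mean \<kappa> j (snd z)\<bar> \<le> bnd" by blast
      then show ?case using p by (intro mult_nonneg_nonneg) auto
    qed
    have e1: "(\<integral>\<^sup>+z. ennreal ((fst z $ j + bnd) * \<psi> (snd z)) \<partial>\<mu>) = ennreal (\<integral>z. (fst z $ j + bnd) * \<psi> (snd z) \<partial>\<mu>)"
      by (rule nn_integral_eq_integral[OF _ a1]) (use i1 i2 in \<open>simp add: distrib_right\<close>)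
    have e2: "(\<integral>\<^sup>+z. ennreal ((cond_mean \<kappa> j (snd z) + bnd) * \<psi> (snd z)) \<partial>\<mu>) = ennreal (\<integral>z. (cond_mean \<kappa> j (snd z) + bnd) * \<psi> (snd z) \<partial>\<mu>)"
      by (rule nn_integral_eq_integral[OF _ a2]) (use i1 i3 in \<open>simp add: distrib_right\<close>)
    have "(\<integral>z. (fst z $ j + bnd) * \<psi> (snd z) \<partial>\<mu>) = (\<integral>z. (cond_mean \<kappa> j (snd z) + bnd) * \<psi> (snd z) \<partial>\<mu>)"
      using tower_nonneg[OF that(1) p, of j] unfolding e1 e2
      by (subst (asm) ennreal_inj) (auto intro!: integral_nonneg_AE a1 a2)
    then show ?thesis using i1 i2 i3 by (simp add: distrib_right)
  qed
  define p n where "p t = max 0 (\<psi> t)" and "n t = max 0 (- \<psi> t)" for t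
  have [measurable]: "p \<in> borel_measurable borel" "n \<in> borel_measurable borel"
    unfolding p_def[abs_def] n_def[abs_def] by measurable
  have Lp: "(\<lambda>z. p (snd z)) \<in> L2_fun \<mu>" by (rule l2_mono(2)[OF _ L2]) (auto simp: p_def)
  have Ln: "(\<lambda>z. n (snd z)) \<in> L2_fun \<mu>" by (rule l2_mono(2)[OF _ L2]) (auto simp: n_def)
  have eq: "\<psi> t = p t - n t" for t by (auto simp: p_def n_def)
  have "(\<integral>z. fst z $ j * p (snd z) \<partial>\<mu>) = (\<integral>z. cond_mean \<kappa> j (snd z) * p (snd z) \<partial>\<mu>)"
    by (rule pos) (auto simp: Lp, simp add: p_def)
  moreover have "(\<integral>z. fst z $ j * n (snd z) \<partial>\<mu>) = (\<integral>z. cond_mean \<kappa> j (snd z) * n (snd z) \<partial>\<mu>)"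
    by (rule pos) (auto simp: Ln, simp add: n_def)
  ultimately show ?thesis
    unfolding eq right_diff_distrib
    by (simp add: L2_fun_mult[OF L2_component Lp] L2_fun_mult[OF L2_component Ln]
        L2_fun_mult[OF L2_cond_mean Lp] L2_fun_mult[OF L2_cond_mean Ln])
qed

end

context design
begin

definition resid :: "(real ^ 'q) \<times> real \<Rightarrow> real ^ 'q" where
  "resid z = (\<chi> j. fst z $ j - cond_mean \<kappa> j (snd z))"

lemma resid_component [simp]: "resid z $ j = fst z $ j - cond_mean \<kappa> j (snd z)"
  by (simp add: resid_def)

lemma resid_measurable [measurable]: "(\<lambda>z. resid z $ j) \<in> borel_measurable borel"
  unfolding resid_component by measurable

lemma L2_resid: "(\<lambda>z. resid z $ j) \<in> L2_fun \<mu>"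
  unfolding resid_component by (rule L2_fun_diff[OF L2_component L2_cond_mean])

lemma AE_resid: "AE z in \<mu>. \<forall>j. \<bar>resid z $ j\<bar> \<le> 2 * bnd"
  using AE_cond_mean AE_K
proof eventually_elim
  case (elim z)
  show ?case
  proof
    fix j
    have "\<bar>cond_mean \<kappa> j (snd z)\<bar> \<le> bnd" using elim by blast
    moreover have "\<bar>fst z $ j\<bar> \<le> bnd" using elim bnd_component by blast
    ultimately show "\<bar>resid z $ j\<bar> \<le> 2 * bnd" by simp
  qed
qed

lemma resid_orthogonal:
  assumes "\<psi> \<in> borel_measurable borel" "(\<lambda>z. \<psi> (snd z)) \<in> L2_fun \<mu>"
  shows "(\<integral>z. resid z $ j * \<psi> (snd z) \<partial>\<mu>) = 0"
  using tower[OF assms, of j] L2_fun_mult[OF L2_component assms(2)] L2_fun_mult[OF L2_cond_mean assms(2)]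
  by (simp add: left_diff_distrib)

text \<open>The mixed form, component k times residual j, is the one that arises in the normal
  equation. It equals the covariance of the residuals because residual j is orthogonal to functions
  of \<open>T\<close>.\<close>

lemma Sigma_component_resid: "Sigma_mat \<mu> \<kappa> $ k $ j = (\<integral>z. fst z $ k * resid z $ j \<partial>\<mu>)"
proof -
  let ?X = "\<lambda>k z. fst z $ k :: real" and ?\<theta> = "\<lambda>k z. cond_mean \<kappa> k (snd z)"
  have fin: "finite_measure \<mu>" by (rule finite_measure_axioms)
  have cov: "covar \<mu> g h = (\<integral>z. g z * h z \<partial>\<mu>) - (\<integral>z. g z \<partial>\<mu>) * (\<integral>z. h z \<partial>\<mu>)"
    if g: "g \<in> L2_fun \<mu>" and h: "h \<in> L2_fun \<mu>" for g h
  proof -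
    note i = L2_fun_mult[OF g h] L2_fun_integrable[OF fin g] L2_fun_integrable[OF fin h]
    have "covar \<mu> g h = (\<integral>z. g z * h z - (\<integral>y. h y \<partial>\<mu>) * g z - (\<integral>y. g y \<partial>\<mu>) * h z + (\<integral>y. g y \<partial>\<mu>) * (\<integral>y. h y \<partial>\<mu>) \<partial>\<mu>)"
      unfolding covar_def by (simp add: algebra_simps)
    also have "\<dots> = (\<integral>z. g z * h z \<partial>\<mu>) - (\<integral>z. g z \<partial>\<mu>) * (\<integral>z. h z \<partial>\<mu>)"
      using i by (simp add: prob_space[unfolded space_mu] mult.commute)
    finally show ?thesis .
  qed
  have one: "(\<lambda>z. 1) \<in> L2_fun \<mu>" by (simp add: L2_fun_def)
  have m: "(\<integral>z. ?X i z \<partial>\<mu>) = (\<integral>z. ?\<theta> i z \<partial>\<mu>)" for i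
    using tower[of "\<lambda>_. 1" i] one by simp
  have "Sigma_mat \<mu> \<kappa> $ k $ j = (\<integral>z. ?X k z * ?X j z \<partial>\<mu>) - (\<integral>z. ?\<theta> k z * ?\<theta> j z \<partial>\<mu>)"
    by (simp add: Sigma_mat_def cov[OF L2_component L2_component] cov[OF L2_cond_mean L2_cond_mean] m)
  also have "(\<integral>z. ?\<theta> k z * ?\<theta> j z \<partial>\<mu>) = (\<integral>z. ?X k z * ?\<theta> j z \<partial>\<mu>)"
    by (rule tower[symmetric]) (auto intro: L2_cond_mean)
  also have "(\<integral>z. ?X k z * ?X j z \<partial>\<mu>) - (\<integral>z. ?X k z * ?\<theta> j z \<partial>\<mu>) = (\<integral>z. ?X k z * resid z $ j \<partial>\<mu>)"
    using L2_fun_mult[OF L2_component L2_component, of k j] L2_fun_mult[OF L2_component L2_cond_mean, of k j]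
    by (simp add: right_diff_distrib)
  finally show ?thesis .
qed

lemma Sigma_component: "Sigma_mat \<mu> \<kappa> $ k $ j = (\<integral>z. resid z $ k * resid z $ j \<partial>\<mu>)"
proof -
  have "(\<integral>z. resid z $ k * resid z $ j \<partial>\<mu>) = (\<integral>z. fst z $ k * resid z $ j - resid z $ j * cond_mean \<kappa> k (snd z) \<partial>\<mu>)"
    by (simp add: algebra_simps)
  also have "\<dots> = (\<integral>z. fst z $ k * resid z $ j \<partial>\<mu>) - (\<integral>z. resid z $ j * cond_mean \<kappa> k (snd z) \<partial>\<mu>)"
    by (rule Bochner_Integration.integral_diff[OF L2_fun_mult[OF L2_component L2_resid] L2_fun_mult[OF L2_resid L2_cond_mean]])
  also have "(\<integral>z. resid z $ j * cond_mean \<kappa> k (snd z) \<partial>\<mu>) = 0"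
    by (rule resid_orthogonal[OF cond_mean_measurable L2_cond_mean])
  finally show ?thesis by (simp add: Sigma_component_resid)
qed

lemma Sigma_sym: "transpose (Sigma_mat \<mu> \<kappa>) = Sigma_mat \<mu> \<kappa>"
  by (simp add: vec_eq_iff transpose_def Sigma_component mult.commute)

lemma L2_inner_resid: "(\<lambda>z. l \<bullet> resid z) \<in> L2_fun \<mu>"
  unfolding inner_vec_def inner_real_def by (intro L2_fun_sum L2_fun_cmult L2_resid)

lemma Sigma_quadratic: "l \<bullet> (Sigma_mat \<mu> \<kappa> *v l) = (\<integral>z. (l \<bullet> resid z)\<^sup>2 \<partial>\<mu>)"
proof -
  have "(\<integral>z. (l \<bullet> resid z)\<^sup>2 \<partial>\<mu>) = (\<integral>z. (\<Sum>i\<in>UNIV. \<Sum>j\<in>UNIV. (l $ i * l $ j) * (resid z $ i * resid z $ j)) \<partial>\<mu>)"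
    unfolding inner_vec_def inner_real_def power2_eq_square sum_product
    by (intro Bochner_Integration.integral_cong refl sum.cong) (simp add: mult_ac)
  also have "\<dots> = (\<Sum>i\<in>UNIV. \<integral>z. (\<Sum>j\<in>UNIV. (l $ i * l $ j) * (resid z $ i * resid z $ j)) \<partial>\<mu>)"
    by (rule Bochner_Integration.integral_sum)
      (intro Bochner_Integration.integrable_sum integrable_mult_right L2_fun_mult[OF L2_resid L2_resid])
  also have "\<dots> = (\<Sum>i\<in>UNIV. \<Sum>j\<in>UNIV. \<integral>z. (l $ i * l $ j) * (resid z $ i * resid z $ j) \<partial>\<mu>)"
    by (intro sum.cong refl Bochner_Integration.integral_sum integrable_mult_right L2_fun_mult[OF L2_resid L2_resid])
  also have "\<dots> = (\<Sum>i\<in>UNIV. \<Sum>j\<in>UNIV. (l $ i * l $ j) * Sigma_mat \<mu> \<kappa> $ i $ j)"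
    unfolding Sigma_component by (intro sum.cong refl) (simp del: resid_component)
  also have "\<dots> = l \<bullet> (Sigma_mat \<mu> \<kappa> *v l)"
    by (simp add: inner_vec_def matrix_vector_mult_def sum_distrib_left mult_ac)
  finally show ?thesis ..
qed

text \<open>If the integral vanished, the linear form l would be constant under the conditional law
  at almost every t, against (A3) at some t in [0,1).\<close>

lemma resid_variance_pos:
  assumes l: "l \<noteq> 0"
  shows "(\<integral>z. (l \<bullet> resid z)\<^sup>2 \<partial>\<mu>) > 0"
proof (rule ccontr)
  assume "\<not> ?thesis"
  moreover have "(\<integral>z. (l \<bullet> resid z)\<^sup>2 \<partial>\<mu>) \<ge> 0" by simp
  ultimately have "(\<integral>z. (l \<bullet> resid z)\<^sup>2 \<partial>\<mu>) = 0" by linarith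
  then have "AE z in \<mu>. (l \<bullet> resid z)\<^sup>2 = 0"
    by (subst (asm) integral_nonneg_eq_0_iff_AE[OF L2_fun_integrable_sq[OF L2_inner_resid]]) auto
  then have z: "(\<integral>\<^sup>+z. ennreal ((l \<bullet> resid z)\<^sup>2) \<partial>\<mu>) = 0"
    using L2_fun_measurable[OF L2_inner_resid[of l]] by (subst nn_integral_0_iff_AE) auto
  have m: "(\<lambda>z. l \<bullet> resid z) \<in> borel_measurable borel"
    unfolding inner_vec_def inner_real_def by measurable
  have km: "\<kappa> \<in> P_T \<rightarrow>\<^sub>M subprob_algebra borel" using kernel(1) by measurable
  have "(\<integral>\<^sup>+t. \<integral>\<^sup>+x. ennreal ((l \<bullet> resid (x, t))\<^sup>2) \<partial>\<kappa> t \<partial>P_T) = 0"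
    using z m by (subst (asm) disintegration) auto
  moreover have "(\<lambda>t. \<integral>\<^sup>+x. ennreal ((l \<bullet> resid (x, t))\<^sup>2) \<partial>\<kappa> t) \<in> borel_measurable P_T"
  proof (rule nn_integral_measurable_subprob_algebra2[OF _ km])
    have "(\<lambda>p. (snd p, fst p)) \<in> (borel :: (real \<times> (real^'q)) measure) \<rightarrow>\<^sub>M borel"
      by (intro borel_measurable_continuous_onI continuous_intros)
    then have "(\<lambda>p. (snd p, fst p)) \<in> P_T \<Otimes>\<^sub>M (borel :: (real^'q) measure) \<rightarrow>\<^sub>M borel"
      by (simp add: borel_prod[symmetric] cong: measurable_cong_sets)
    then have [measurable]: "(\<lambda>p. l \<bullet> resid (snd p, fst p)) \<in> borel_measurable (P_T \<Otimes>\<^sub>M (borel :: (real^'q) measure))"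
      by (rule measurable_compose[OF _ m])
    show "(\<lambda>(t, x). ennreal ((l \<bullet> resid (x, t))\<^sup>2)) \<in> borel_measurable (P_T \<Otimes>\<^sub>M (borel :: (real^'q) measure))"
      unfolding split_beta by measurable
  qed
  ultimately have "AE t in P_T. (\<integral>\<^sup>+x. ennreal ((l \<bullet> resid (x, t))\<^sup>2) \<partial>\<kappa> t) = 0"
    by (subst (asm) nn_integral_0_iff_AE) auto
  with AE_PT have "AE t in P_T. False"
  proof eventually_elim
    case (elim t)
    interpret k: prob_space "\<kappa> t" by (rule kernel)
    note [measurable_cong] = kernel(3)[of t]
    define c where "c = (\<Sum>j\<in>UNIV. l $ j * cond_mean \<kappa> j t)"
    have eq: "l \<bullet> resid (x, t) = l \<bullet> x - c" for x
      by (simp add: inner_vec_def c_def right_diff_distrib sum_subtractf)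
    have "AE x in \<kappa> t. l \<bullet> x = c"
      using elim(2) unfolding eq by (subst (asm) nn_integral_0_iff_AE) (auto elim!: eventually_mono)
    then have ae: "AE x in \<kappa> t. l \<bullet> x = c" .
    have e: "k.expectation (\<lambda>x. l \<bullet> x) = c"
    proof -
      have "k.expectation (\<lambda>x. l \<bullet> x) = k.expectation (\<lambda>x. c)"
        using ae by (intro integral_cong_AE) auto
      then show ?thesis by (simp add: k.prob_space)
    qed
    have "k.variance (\<lambda>x. l \<bullet> x) = k.expectation (\<lambda>x. 0)"
      unfolding e using ae by (intro integral_cong_AE) auto
    moreover have "k.variance (\<lambda>x. l \<bullet> x) > 0"
      using A3 l elim(1) by (auto simp: nondegenerate_given_T_def)
    ultimately show False by simp
  qed
  then show False using prob_space.AE_False[OF prob_space_PT] by simp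
qed

lemma Sigma_posdef: "l \<noteq> 0 \<Longrightarrow> l \<bullet> (Sigma_mat \<mu> \<kappa> *v l) > 0"
  unfolding Sigma_quadratic by (rule resid_variance_pos)

text \<open>The quadratic form attains a positive minimum on the unit sphere; homogeneity extends
  the bound to all l.\<close>

lemma resid_coercive: "\<exists>c>0. \<forall>l. c * (norm l)\<^sup>2 \<le> (\<integral>z. (l \<bullet> resid z)\<^sup>2 \<partial>\<mu>)"
proof -
  let ?q = "\<lambda>l. l \<bullet> (Sigma_mat \<mu> \<kappa> *v l)"
  have "continuous_on (sphere 0 1) ?q"
    by (intro continuous_intros linear_continuous_on linear_linear[THEN iffD2] matrix_vector_mul_linear)
  then obtain x where x: "x \<in> sphere 0 1" "\<And>y. y \<in> sphere 0 1 \<Longrightarrow> ?q x \<le> ?q y"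
    using continuous_attains_inf[of "sphere (0::real^'q) 1" ?q] by (auto simp: compact_sphere)
  have "?q x > 0" using x(1) by (intro Sigma_posdef) auto
  moreover have "?q x * (norm l)\<^sup>2 \<le> ?q l" for l
  proof (cases "l = 0")
    case False
    have "?q x \<le> ?q (l /\<^sub>R norm l)" using False by (intro x(2)) simp
    also have "\<dots> = ?q l / (norm l)\<^sup>2"
      by (simp add: matrix_vector_mult_scaleR power2_eq_square divide_inverse mult_ac)
    finally show ?thesis using False by (simp add: field_simps)
  qed simp
  ultimately show ?thesis unfolding Sigma_quadratic by blast
qed

text \<open>The endpoint 1, which \<open>unif\<close> omits, is a Lebesgue null set, so
  \<open>nn_integral_PT_bounds\<close> compares the two norms in both directions.\<close>

lemma l2_unif_mu:
  assumes w[measurable]: "w \<in> borel_measurable borel" and L: "w \<in> L2_fun unif"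
  shows "(\<lambda>z. w (snd z)) \<in> L2_fun \<mu>" "(l2 \<mu> (\<lambda>z. w (snd z)))\<^sup>2 \<le> h1 * vol * (l2 unif w)\<^sup>2"
    "h0 * vol * (l2 unif w)\<^sup>2 \<le> (l2 \<mu> (\<lambda>z. w (snd z)))\<^sup>2"
proof -
  have eq: "(\<integral>\<^sup>+t. ennreal ((w t)\<^sup>2) * indicator {0..1} t \<partial>lborel) = ennreal ((l2 unif w)\<^sup>2)"
  proof -
    have "(\<integral>\<^sup>+t. ennreal ((w t)\<^sup>2) * indicator {0..1} t \<partial>lborel) = (\<integral>\<^sup>+t. ennreal ((w t)\<^sup>2) * indicator {0..<1} t \<partial>lborel)"
    proof (rule nn_integral_cong_AE)
      have "AE t in lborel. t \<noteq> (1::real)" by (rule AE_lborel_singleton)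
      then show "AE t in lborel. ennreal ((w t)\<^sup>2) * indicator {0..1} t = ennreal ((w t)\<^sup>2) * indicator {0..<1} t"
        by eventually_elim (auto simp: indicator_def)
    qed
    also have "\<dots> = (\<integral>\<^sup>+t. ennreal ((w t)\<^sup>2) \<partial>unif)"
      unfolding unif_def by (subst nn_integral_restrict_space) auto
    also have "\<dots> = ennreal ((l2 unif w)\<^sup>2)"
      unfolding l2_sq by (rule nn_integral_eq_integral[OF L2_fun_integrable_sq[OF L]]) auto
    finally show ?thesis .
  qed
  have wm: "(\<lambda>t. ennreal ((w t)\<^sup>2)) \<in> borel_measurable borel" by measurable
  have up: "(\<integral>\<^sup>+z. ennreal ((w (snd z))\<^sup>2) \<partial>\<mu>) \<le> ennreal (h1 * vol * (l2 unif w)\<^sup>2)"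
    using nn_integral_PT_bounds(2)[OF wm] h1_pos vol_pos
    by (simp add: nn_integral_PT[OF wm] eq ennreal_mult)
  have lo: "ennreal (h0 * vol * (l2 unif w)\<^sup>2) \<le> (\<integral>\<^sup>+z. ennreal ((w (snd z))\<^sup>2) \<partial>\<mu>)"
    using nn_integral_PT_bounds(1)[OF wm] h0_pos vol_pos
    by (simp add: nn_integral_PT[OF wm] eq ennreal_mult)
  have i: "integrable \<mu> (\<lambda>z. (w (snd z))\<^sup>2)"
  proof (rule integrableI_bounded)
    show "(\<integral>\<^sup>+z. ennreal (norm ((w (snd z))\<^sup>2)) \<partial>\<mu>) < \<infinity>"
      using up by (simp add: order_le_less_trans ennreal_less_top)
  qed measurable
  then show "(\<lambda>z. w (snd z)) \<in> L2_fun \<mu>" by (simp add: L2_fun_def)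
  have e: "(\<integral>\<^sup>+z. ennreal ((w (snd z))\<^sup>2) \<partial>\<mu>) = ennreal ((l2 \<mu> (\<lambda>z. w (snd z)))\<^sup>2)"
    unfolding l2_sq by (rule nn_integral_eq_integral[OF i]) auto
  show "(l2 \<mu> (\<lambda>z. w (snd z)))\<^sup>2 \<le> h1 * vol * (l2 unif w)\<^sup>2"
    using up h1_pos vol_pos unfolding e by (subst (asm) ennreal_le_iff) auto
  show "h0 * vol * (l2 unif w)\<^sup>2 \<le> (l2 \<mu> (\<lambda>z. w (snd z)))\<^sup>2"
    using lo unfolding e by (subst (asm) ennreal_le_iff) auto
qed

section \<open>Approximation of functions in the Lipschitz balls\<close>

definition cut01 :: "(real \<Rightarrow> real) \<Rightarrow> real \<Rightarrow> real" where
  "cut01 g t = indicator {0..1} t * g t"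

text \<open>Membership in a Lipschitz ball constrains a function on [0,1] only, so it is replaced by
  its cut-off, which is measurable on the whole line. The factor 1 / (h0 * vol) is the price of
  passing from the law of \<open>T\<close> to Lebesgue measure.\<close>

lemma Lip_ball_lborel:
  assumes g: "g \<in> Lip_ball P_T \<alpha> A" and A: "A \<ge> 0"
  defines "k \<equiv> nat \<lfloor>\<alpha>\<rfloor> + 1"
  shows "cut01 g \<in> borel_measurable borel" "cut01 g \<in> L2_fun lborel" "integrable lborel (cut01 g)"
    "u > 0 \<Longrightarrow> (\<integral>s. (finite_diff k u (cut01 g) s)\<^sup>2 * indicator {0..1 - real k * u} s \<partial>lborel)
       \<le> A\<^sup>2 / (h0 * vol) * u powr (2 * \<alpha>)"
proof -
  have L: "g \<in> L2_fun (restrict_space P_T {0..1})" and S: "Lip_seminorm P_T \<alpha> g \<le> ennreal A"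
    using g by (auto simp: Lip_ball_def Lip_star_def)
  have hv: "h0 * vol > 0" using h0_pos vol_pos by simp
  show m[measurable]: "cut01 g \<in> borel_measurable borel"
    using L unfolding L2_fun_def
    by (simp add: borel_measurable_restrict_space_iff cut01_def[abs_def] cong: measurable_cong_sets)
  have "integrable P_T (\<lambda>t. indicator {0..1} t *\<^sub>R (g t)\<^sup>2)"
    using L unfolding L2_fun_def by (simp add: integrable_restrict_space)
  moreover have "(\<lambda>t. indicator {0..1} t *\<^sub>R (g t)\<^sup>2) = (\<lambda>t. (cut01 g t)\<^sup>2)"
    by (auto simp: cut01_def indicator_def)
  ultimately have iP: "integrable P_T (\<lambda>t. (cut01 g t)\<^sup>2)" by simp
  have c1: "(\<lambda>t. ennreal ((cut01 g t)\<^sup>2) * indicator {0..1} t) = (\<lambda>t. ennreal ((cut01 g t)\<^sup>2))"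
    by (auto simp: cut01_def indicator_def)
  have fin: "ennreal (h0 * vol) * (\<integral>\<^sup>+t. ennreal ((cut01 g t)\<^sup>2) \<partial>lborel) < \<infinity>"
  proof -
    have "ennreal (h0 * vol) * (\<integral>\<^sup>+t. ennreal ((cut01 g t)\<^sup>2) \<partial>lborel) \<le> (\<integral>\<^sup>+t. ennreal ((cut01 g t)\<^sup>2) \<partial>P_T)"
      using nn_integral_PT_bounds(1)[of "\<lambda>t. ennreal ((cut01 g t)\<^sup>2)"] unfolding c1 by simp
    also have "\<dots> < \<infinity>" using iP unfolding integrable_iff_bounded by simp
    finally show ?thesis .
  qed
  have i2: "integrable lborel (\<lambda>t. (cut01 g t)\<^sup>2)"
  proof (rule integrableI_bounded)
    show "(\<integral>\<^sup>+t. ennreal (norm ((cut01 g t)\<^sup>2)) \<partial>lborel) < \<infinity>"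
      using fin hv by (auto simp: ennreal_mult_less_top ennreal_zero_less_mult_iff)
  qed measurable
  then show L2: "cut01 g \<in> L2_fun lborel" by (simp add: L2_fun_def)
  have i1: "integrable lborel (\<lambda>t. (cut01 g t)\<^sup>2 + indicator {0..1} t)"
    by (intro Bochner_Integration.integrable_add i2 integrable_real_indicator) auto
  show "integrable lborel (cut01 g)"
  proof (rule Bochner_Integration.integrable_bound[OF i1])
    have "\<bar>x\<bar> \<le> x\<^sup>2 + 1" for x :: real
    proof -
      have "0 \<le> x\<^sup>2 + 1 - 2 * \<bar>x\<bar>" using zero_le_power2[of "\<bar>x\<bar> - 1"] by (simp add: power2_diff)
      then show ?thesis using abs_ge_zero[of x] by linarith
    qed
    then show "AE t in lborel. norm (cut01 g t) \<le> norm ((cut01 g t)\<^sup>2 + indicator {0..1} t)"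
      by (auto simp: cut01_def indicator_def)
  qed measurable
  assume u: "u > 0"
  let ?J = "\<integral>\<^sup>+t. ennreal ((finite_diff k u g t)\<^sup>2) \<partial>restrict_space P_T {0..1 - real k * u}"
  have "ennreal (u powr - \<alpha>) * L2_norm (restrict_space P_T {0..1 - real k * u}) (finite_diff k u g)
     \<le> ennreal (u powr - \<alpha>) * smoothness_modulus P_T k g u"
    unfolding smoothness_modulus_def using u by (intro mult_left_mono SUP_upper) auto
  also have "\<dots> \<le> Lip_seminorm P_T \<alpha> g"
    unfolding Lip_seminorm_def k_def using u by (intro SUP_upper) auto
  also note S
  finally have "ennreal (u powr \<alpha>) * (ennreal (u powr - \<alpha>) * L2_norm (restrict_space P_T {0..1 - real k * u}) (finite_diff k u g))
     \<le> ennreal (u powr \<alpha>) * ennreal A" by (rule mult_left_mono) simp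
  moreover have "ennreal (u powr \<alpha>) * ennreal (u powr - \<alpha>) = 1"
    using u by (simp add: ennreal_mult[symmetric] powr_add[symmetric])
  ultimately have N: "L2_norm (restrict_space P_T {0..1 - real k * u}) (finite_diff k u g) \<le> ennreal (u powr \<alpha> * A)"
    using A by (simp add: mult.assoc[symmetric] ennreal_mult)
  have Jfin: "?J \<noteq> \<infinity>"
    using N by (auto simp: L2_norm_def Let_def top_unique)
  then have "ennreal (sqrt (enn2real ?J)) \<le> ennreal (u powr \<alpha> * A)"
    using N by (simp add: L2_norm_def Let_def)
  then have "sqrt (enn2real ?J) \<le> u powr \<alpha> * A"
    using A by (subst (asm) ennreal_le_iff) auto
  then have "enn2real ?J \<le> (u powr \<alpha> * A)\<^sup>2"
    by (metis enn2real_nonneg real_sqrt_ge_0_iff real_sqrt_pow2 power_mono)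
  then have J: "?J \<le> ennreal ((u powr \<alpha> * A)\<^sup>2)"
    using Jfin by (metis ennreal_enn2real_if ennreal_leI infinity_ennreal_def)
  let ?F = "\<lambda>t. ennreal ((finite_diff k u (cut01 g) t)\<^sup>2) * indicator {0..1 - real k * u} t"
  \<comment> \<open>For these t all points t + i u with i <= k lie in [0,1], where the cut-off
    changes nothing.\<close>
  have same: "finite_diff k u g t = finite_diff k u (cut01 g) t" if t: "t \<in> {0..1 - real k * u}" for t
    unfolding finite_diff_def
  proof (intro sum.cong refl arg_cong2[where f="(*)"])
    fix i assume "i \<in> {..k}"
    then have "real i * u \<le> real k * u" using u by (intro mult_right_mono) auto
    moreover have "0 \<le> real i * u" using u by simp
    ultimately have "t + real i * u \<in> {0..1}" using t unfolding atLeastAtMost_iff by linarith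
    then show "g (t + real i * u) = cut01 g (t + real i * u)" by (simp add: cut01_def)
  qed
  have fm[measurable]: "finite_diff k u (cut01 g) \<in> borel_measurable borel"
    using finite_diff_L2[OF L2, of k u] by (simp add: L2_fun_def)
  have "?J = (\<integral>\<^sup>+t. ennreal ((finite_diff k u g t)\<^sup>2) * indicator {0..1 - real k * u} t \<partial>P_T)"
    by (rule nn_integral_restrict_space) simp
  also have "\<dots> = (\<integral>\<^sup>+t. ?F t \<partial>P_T)"
    by (intro nn_integral_cong) (auto simp: indicator_def same)
  finally have JF: "?J = (\<integral>\<^sup>+t. ?F t \<partial>P_T)" .
  have F1: "(\<lambda>t. ?F t * indicator {0..1} t) = ?F"
  proof
    fix t
    have "0 \<le> real k * u" using u by simp
    then show "?F t * indicator {0..1} t = ?F t" by (auto simp: indicator_def)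
  qed
  have "ennreal (h0 * vol) * (\<integral>\<^sup>+t. ?F t \<partial>lborel) \<le> ennreal ((u powr \<alpha> * A)\<^sup>2)"
  proof -
    have "?F \<in> borel_measurable borel" by measurable
    from nn_integral_PT_bounds(1)[OF this]
    have "ennreal (h0 * vol) * (\<integral>\<^sup>+t. ?F t \<partial>lborel) \<le> (\<integral>\<^sup>+t. ?F t \<partial>P_T)" unfolding F1 .
    from order_trans[OF this J[unfolded JF]] show ?thesis .
  qed
  then have "ennreal (1 / (h0 * vol)) * (ennreal (h0 * vol) * (\<integral>\<^sup>+t. ?F t \<partial>lborel)) \<le> ennreal (1 / (h0 * vol)) * ennreal ((u powr \<alpha> * A)\<^sup>2)"
    by (rule mult_left_mono) simp
  moreover have "ennreal (1 / (h0 * vol)) * ennreal (h0 * vol) = 1"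
  proof -
    have e1: "1 / c * c = 1" if "c > 0" for c :: real using that by simp
    have "ennreal (1 / (h0 * vol)) * ennreal (h0 * vol) = ennreal (1 / (h0 * vol) * (h0 * vol))"
      using hv by (intro ennreal_mult[symmetric]) auto
    then show ?thesis by (simp only: e1[OF hv] ennreal_1)
  qed
  ultimately have le: "(\<integral>\<^sup>+t. ?F t \<partial>lborel) \<le> ennreal (1 / (h0 * vol) * (u powr \<alpha> * A)\<^sup>2)"
  proof -
    have "ennreal (1 / (h0 * vol)) * ennreal ((u powr \<alpha> * A)\<^sup>2) = ennreal (1 / (h0 * vol) * (u powr \<alpha> * A)\<^sup>2)"
      using hv by (intro ennreal_mult[symmetric]) auto
    moreover assume "ennreal (1 / (h0 * vol)) * (ennreal (h0 * vol) * (\<integral>\<^sup>+t. ?F t \<partial>lborel)) \<le> ennreal (1 / (h0 * vol)) * ennreal ((u powr \<alpha> * A)\<^sup>2)"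
      and "ennreal (1 / (h0 * vol)) * ennreal (h0 * vol) = 1"
    ultimately show ?thesis by (simp only: mult.assoc[symmetric] mult_1_left)
  qed
  have "(\<integral>s. (finite_diff k u (cut01 g) s)\<^sup>2 * indicator {0..1 - real k * u} s \<partial>lborel)
     = enn2real (\<integral>\<^sup>+s. ennreal ((finite_diff k u (cut01 g) s)\<^sup>2 * indicator {0..1 - real k * u} s) \<partial>lborel)"
    by (rule integral_eq_nn_integral) auto
  also have "(\<lambda>s. ennreal ((finite_diff k u (cut01 g) s)\<^sup>2 * indicator {0..1 - real k * u} s)) = ?F"
    by (auto simp: indicator_def)
  also have "enn2real (\<integral>\<^sup>+t. ?F t \<partial>lborel) \<le> 1 / (h0 * vol) * (u powr \<alpha> * A)\<^sup>2"
    using le hv by (intro enn2real_leI) auto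
  also have "\<dots> = A\<^sup>2 / (h0 * vol) * u powr (2 * \<alpha>)"
    using u by (simp add: power_mult_distrib powr_add[symmetric] power2_eq_square[of "u powr \<alpha>"])
  finally show "(\<integral>s. (finite_diff k u (cut01 g) s)\<^sup>2 * indicator {0..1 - real k * u} s \<partial>lborel)
       \<le> A\<^sup>2 / (h0 * vol) * u powr (2 * \<alpha>)" .
qed

abbreviation approximable :: "nat \<Rightarrow> nat \<Rightarrow> (real \<Rightarrow> real) \<Rightarrow> real \<Rightarrow> bool" where
  "approximable r K h e \<equiv> \<exists>v\<in>pw_poly r K. (\<lambda>z. cut01 h (snd z) - v (snd z)) \<in> L2_fun \<mu> \<and>
     (l2 \<mu> (\<lambda>z. cut01 h (snd z) - v (snd z)))\<^sup>2 \<le> e"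

lemma Lip_ball_approx:
  assumes g: "g \<in> Lip_ball P_T \<alpha> A" and A: "A \<ge> 0" and \<alpha>: "0 < \<alpha>" "\<alpha> < real r"
  obtains C where "C \<ge> 0" "\<And>m. approximable r (2 ^ m) g (C * ((2 powr - \<alpha>) ^ m)\<^sup>2)"
proof -
  define k where "k = nat \<lfloor>\<alpha>\<rfloor> + 1"
  have k0: "k > 0" by (simp add: k_def)
  \<comment> \<open>Since \<alpha> < r and \<open>r\<close> is an integer, the order [\<alpha>] + 1
    of the modulus is at most \<open>r\<close>, so the local polynomials have admissible
    degree.\<close>
  have kr: "k \<le> r" using \<alpha> unfolding k_def by linarith
  note lb = Lip_ball_lborel[OF g A]
  have A': "A\<^sup>2 / (h0 * vol) \<ge> 0" using h0_pos vol_pos by simp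
  obtain C where C: "C \<ge> 0" "\<And>m. l2 unif (\<lambda>t. cut01 g t - quasi k (2 ^ m) (cut01 g) t) \<le> C * (2 powr - \<alpha>) ^ m"
    by (rule quasi_error[OF k0 \<alpha>(1) lb(2,3) A' lb(4)[folded k_def]], assumption, rule that, assumption, assumption)
  show ?thesis
  proof (rule that[of "h1 * vol * C\<^sup>2"])
    show "0 \<le> h1 * vol * C\<^sup>2" using h1_pos vol_pos by simp
    fix m :: nat
    let ?v = "quasi k (2 ^ m) (cut01 g)"
    let ?w = "\<lambda>t. cut01 g t - ?v t"
    have wm: "?w \<in> borel_measurable borel" using lb(1) by measurable
    have wL: "?w \<in> L2_fun unif" by (intro L2_fun_diff L2_fun_unif lb(2) quasi_L2 k0 lb(3)) simp
    have "(l2 \<mu> (\<lambda>z. ?w (snd z)))\<^sup>2 \<le> h1 * vol * (l2 unif ?w)\<^sup>2" by (rule l2_unif_mu[OF wm wL])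
    also have "\<dots> \<le> h1 * vol * (C * (2 powr - \<alpha>) ^ m)\<^sup>2"
      using h1_pos vol_pos C by (intro mult_left_mono power_mono) auto
    finally have "(l2 \<mu> (\<lambda>z. ?w (snd z)))\<^sup>2 \<le> h1 * vol * C\<^sup>2 * ((2 powr - \<alpha>) ^ m)\<^sup>2"
      by (simp add: power_mult_distrib)
    moreover have "?v \<in> pw_poly r (2 ^ m)" using quasi_in_pw_poly pw_poly_mono[OF kr] by blast
    ultimately show "approximable r (2 ^ m) g (h1 * vol * C\<^sup>2 * ((2 powr - \<alpha>) ^ m)\<^sup>2)"
      using l2_unif_mu(1)[OF wm wL] by blast
  qed
qed

text \<open>Uses degree 0 only, so it applies for every r >= 1 no matter how large \<alpha> is
  compared with \<open>r\<close>. It serves the conditional means.\<close>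

lemma Lip_ball_approx_const:
  assumes g: "g \<in> Lip_ball P_T \<alpha> A" and A: "A \<ge> 0" and \<alpha>: "3 / 4 \<le> \<alpha>" and r: "r \<ge> 1"
  obtains C where "C \<ge> 0" "\<And>m. approximable r (2 ^ m) g (C * ((2 powr - (3/4)) ^ m)\<^sup>2)"
proof -
  define k where "k = nat \<lfloor>\<alpha>\<rfloor> + 1"
  have k0: "k > 0" by (simp add: k_def)
  note lb = Lip_ball_lborel[OF g A]
  have A': "A\<^sup>2 / (h0 * vol) \<ge> 0" using h0_pos vol_pos by simp
  obtain C where C: "C \<ge> 0" "\<And>n. \<exists>v\<in>pw_poly 1 (2 ^ n). l2 unif (\<lambda>t. cut01 g t - v t) \<le> C * (2 powr - (3/4)) ^ n"
    by (rule piecewise_constant_error[OF k0 \<alpha> lb(2,3) A' lb(4)[folded k_def]], assumption, rule that, assumption, assumption)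
  show ?thesis
  proof (rule that[of "h1 * vol * C\<^sup>2"])
    show "0 \<le> h1 * vol * C\<^sup>2" using h1_pos vol_pos by simp
    fix m :: nat
    obtain v where v: "v \<in> pw_poly 1 (2 ^ m)" "l2 unif (\<lambda>t. cut01 g t - v t) \<le> C * (2 powr - (3/4)) ^ m"
      using C(2) by blast
    let ?w = "\<lambda>t. cut01 g t - v t"
    have vm: "v \<in> borel_measurable borel" by (rule pw_poly_measurable[OF v(1)])
    have wm: "?w \<in> borel_measurable borel" using lb(1) vm by measurable
    have "v \<in> L2_fun unif"
    proof -
      obtain P where P: "\<And>j. j < 2 ^ m \<Longrightarrow> degree (P j) \<le> 0" "v = (\<lambda>t. \<Sum>j<2 ^ m. poly (P j) t * indicator (cell (2 ^ m) j) t)"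
        using v(1) unfolding pw_poly_cell_iff by auto
      show ?thesis
      proof (rule step_function_L2(1)[OF vm])
        fix j t assume j: "j < 2 ^ m" and t: "t \<in> cell (2 ^ m) j"
        have "v t = poly (P j) t" unfolding P(2) by (rule sum_cell_indicator[OF j t, of "\<lambda>j. poly (P j) t"])
        also have "\<dots> = poly (P j) 0" using P(1)[OF j] by (auto elim: degree_eq_zeroE)
        finally show "(v t)\<^sup>2 \<le> (poly (P j) 0)\<^sup>2" by simp
      qed simp
    qed
    from L2_fun_diff[OF L2_fun_unif[OF lb(2)] this] have wL: "?w \<in> L2_fun unif" .
    have "(l2 \<mu> (\<lambda>z. ?w (snd z)))\<^sup>2 \<le> h1 * vol * (l2 unif ?w)\<^sup>2" by (rule l2_unif_mu[OF wm wL])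
    also have "\<dots> \<le> h1 * vol * (C * (2 powr - (3/4)) ^ m)\<^sup>2"
      using h1_pos vol_pos v(2) by (intro mult_left_mono power_mono) auto
    finally have "(l2 \<mu> (\<lambda>z. ?w (snd z)))\<^sup>2 \<le> h1 * vol * C\<^sup>2 * ((2 powr - (3/4)) ^ m)\<^sup>2"
      by (simp add: power_mult_distrib)
    moreover have "v \<in> pw_poly r (2 ^ m)" using v(1) pw_poly_mono[OF r] by blast
    ultimately show "approximable r (2 ^ m) g (h1 * vol * C\<^sup>2 * ((2 powr - (3/4)) ^ m)\<^sup>2)"
      using l2_unif_mu(1)[OF wm wL] by blast
  qed
qed

end

section \<open>Positive definite matrices and the limit normal law\<close>

lemma orthonormal_wrt_posdef:
  fixes A :: "real ^ 'q ^ 'q"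
  assumes pos: "\<And>l. l \<noteq> 0 \<Longrightarrow> l \<bullet> (A *v l) > 0" and sym: "transpose A = A" and "n \<le> CARD('q)"
  shows "\<exists>S. finite S \<and> card S = n \<and> (\<forall>x\<in>S. \<forall>y\<in>S. x \<bullet> (A *v y) = (if x = y then 1 else 0))"
  using assms(3)
proof (induction n)
  case 0
  then show ?case by (intro exI[of _ "{}"]) simp
next
  case (Suc n)
  then obtain S where S: "finite S" "card S = n" "\<And>x y. x \<in> S \<Longrightarrow> y \<in> S \<Longrightarrow> x \<bullet> (A *v y) = (if x = y then 1 else 0)"
    by auto
  have symm: "x \<bullet> (A *v y) = y \<bullet> (A *v x)" for x y
    using dot_lmul_matrix[of x A y] sym by (metis inner_commute transpose_matrix_vector)
  have "dim ((*v) A ` S) \<le> card ((*v) A ` S)" by (rule dim_le_card') (use S in auto)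
  also have "\<dots> \<le> n" using S card_image_le by blast
  also have "n < DIM(real^'q)" using Suc.prems by simp
  \<comment> \<open>Gram-Schmidt by dimension count: fewer than q vectors A y leave a nonzero x
    orthogonal to all of them, and positivity of the form allows it to be normalized.\<close>
  finally obtain x where x: "x \<noteq> 0" "\<And>y. y \<in> span ((*v) A ` S) \<Longrightarrow> orthogonal x y"
    using orthogonal_to_subspace_exists by blast
  have ox: "x \<bullet> (A *v y) = 0" if "y \<in> S" for y
    using x(2)[OF span_base, of "A *v y"] that by (auto simp: orthogonal_def)
  define c where "c = x \<bullet> (A *v x)"
  have c: "c > 0" unfolding c_def by (rule pos[OF x(1)])
  define e where "e = (1 / sqrt c) *\<^sub>R x"
  have ee: "e \<bullet> (A *v e) = 1"
    using c by (simp add: e_def matrix_vector_mult_scaleR c_def[symmetric] field_simps)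
  have oe: "e \<bullet> (A *v y) = 0" "y \<bullet> (A *v e) = 0" if "y \<in> S" for y
    using ox[OF that] symm[of y e] by (simp_all add: e_def)
  have "e \<notin> S" using oe(1)[of e] ee by auto
  then show ?case
    using S ee oe by (intro exI[of _ "insert e S"]) auto
qed

text \<open>If the columns of \<open>G\<close> are orthonormal for the form of \<open>A\<close>,
  then transpose G ** A ** G is the identity; a one-sided inverse of a square matrix is
  two-sided.\<close>

lemma posdef_factor:
  fixes A :: "real ^ 'q ^ 'q"
  assumes pos: "\<And>l. l \<noteq> 0 \<Longrightarrow> l \<bullet> (A *v l) > 0" and sym: "transpose A = A"
  shows "\<exists>G :: real ^ 'q ^ 'q. A ** (G ** transpose G) = mat 1 \<and> (G ** transpose G) ** A = mat 1"
proof -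
  obtain S where S: "finite S" "card S = CARD('q)" "\<And>x y. x \<in> S \<Longrightarrow> y \<in> S \<Longrightarrow> x \<bullet> (A *v y) = (if x = y then 1 else 0)"
    using orthonormal_wrt_posdef[OF assms order_refl] by blast
  obtain e :: "'q \<Rightarrow> real^'q" where e: "bij_betw e UNIV S"
    using finite_same_card_bij[of "UNIV :: 'q set" S] S by auto
  define G :: "real^'q^'q" where "G = transpose (\<chi> j. e j)"
  have col: "column j G = e j" for j by (simp add: G_def column_def transpose_def vec_eq_iff)
  have tG: "transpose G = (\<chi> j. e j)" by (simp add: G_def)
  have "transpose G ** (A ** G) = mat 1"
  proof -
    have "(transpose G ** (A ** G)) $ i $ j = (mat 1 :: real^'q^'q) $ i $ j" for i j
    proof -
      have "(transpose G ** (A ** G)) $ i $ j = (\<Sum>k\<in>UNIV. e i $ k * (A ** G) $ k $ j)"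
        by (simp add: matrix_matrix_mult_def tG)
      also have "\<dots> = (\<Sum>k\<in>UNIV. e i $ k * (A *v e j) $ k)"
        by (simp add: matrix_matrix_mult_def matrix_vector_mult_def G_def transpose_def)
      also have "\<dots> = e i \<bullet> (A *v e j)" by (simp add: inner_vec_def)
      also have "\<dots> = (if e i = e j then 1 else 0)"
        using e by (intro S(3)) (auto simp: bij_betw_def)
      also have "\<dots> = (mat 1 :: real^'q^'q) $ i $ j"
        using e by (auto simp: mat_def bij_betw_def inj_on_def)
      finally show ?thesis .
    qed
    then show ?thesis by (simp add: vec_eq_iff)
  qed
  then have "(transpose G ** A) ** G = mat 1" by (simp add: matrix_mul_assoc)
  then have "G ** (transpose G ** A) = mat 1" using matrix_left_right_inverse by blast
  then have 1: "(G ** transpose G) ** A = mat 1" by (simp add: matrix_mul_assoc)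
  then have "A ** (G ** transpose G) = mat 1" using matrix_left_right_inverse by blast
  with 1 show ?thesis by (intro exI[of _ G]) simp
qed

text \<open>The block is completed by the identity to a positive definite matrix \<open>A'\<close>,
  so that matrices of full size suffice. The inverse of \<open>A'\<close> is G times its transpose:
  its block is the block inverse, and the rows of s G with index in \<open>I\<close> give the square
  root that \<open>mv_normal\<close> asks for.\<close>

lemma block_inv_factor:
  fixes A :: "real ^ 'q ^ 'q" and I :: "'q set"
  assumes pos: "\<And>l. l \<noteq> 0 \<Longrightarrow> l \<bullet> (A *v l) > 0" and sym: "transpose A = A"
  defines "B \<equiv> block_inv I A"
  shows "\<And>i j. i \<in> I \<Longrightarrow> j \<in> I \<Longrightarrow> (\<Sum>k\<in>I. B $ i $ k * A $ k $ j) = (if i = j then 1 else 0)"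
    and "\<exists>R :: real ^ 'q ^ 'q. R ** transpose R = (\<chi> i j. if i \<in> I \<and> j \<in> I then s\<^sup>2 * B $ i $ j else 0)"
proof -
  define A' :: "real^'q^'q" where "A' = (\<chi> i j. if i \<in> I \<and> j \<in> I then A $ i $ j else if i = j then 1 else 0)"
  have As: "A $ i $ j = A $ j $ i" for i j using sym by (metis transpose_def vec_lambda_beta)
  have A'_sym: "transpose A' = A'" by (auto simp: A'_def transpose_def vec_eq_iff As)
  have A'_pos: "l \<bullet> (A' *v l) > 0" if "l \<noteq> 0" for l
  proof -
    define m n :: "real^'q" where "m = (\<chi> i. if i \<in> I then l $ i else 0)" and "n = (\<chi> i. if i \<in> I then 0 else l $ i)"
    have "l \<bullet> (A' *v l) = (\<Sum>i\<in>UNIV. \<Sum>j\<in>UNIV. l $ i * A' $ i $ j * l $ j)"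
      by (simp add: inner_vec_def matrix_vector_mult_def sum_distrib_left mult.assoc)
    also have "\<dots> = (\<Sum>i\<in>UNIV. \<Sum>j\<in>UNIV. m $ i * A $ i $ j * m $ j + (if i = j then n $ i * n $ j else 0))"
      by (intro sum.cong refl) (auto simp: A'_def m_def n_def)
    also have "\<dots> = m \<bullet> (A *v m) + n \<bullet> n"
      by (simp add: sum.distrib inner_vec_def matrix_vector_mult_def sum_distrib_left mult.assoc)
    finally have eq: "l \<bullet> (A' *v l) = m \<bullet> (A *v m) + n \<bullet> n" .
    have "l = m + n" by (auto simp: m_def n_def vec_eq_iff)
    then have "m \<noteq> 0 \<or> n \<noteq> 0" using that by auto
    then show ?thesis
      using pos[of m] inner_ge_zero[of n] unfolding eq by (cases "m = 0") (auto intro: add_pos_nonneg)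
  qed
  have "\<exists>G :: real^'q^'q. A' ** (G ** transpose G) = mat 1 \<and> (G ** transpose G) ** A' = mat 1"
    by (rule posdef_factor[OF A'_pos A'_sym])
  then obtain G :: "real^'q^'q" where G: "A' ** (G ** transpose G) = mat 1" "(G ** transpose G) ** A' = mat 1"
    by blast
  define C where "C = G ** transpose G"
  have AC: "(\<Sum>k\<in>I. A $ i $ k * C $ k $ j) = (if i = j then 1 else 0)" if "i \<in> I" "j \<in> I" for i j
  proof -
    have "(if i = j then 1 else 0) = (A' ** C) $ i $ j" unfolding C_def G by (simp add: mat_def)
    also have "\<dots> = (\<Sum>k\<in>UNIV. A' $ i $ k * C $ k $ j)" by (simp add: matrix_matrix_mult_def)
    also have "\<dots> = (\<Sum>k\<in>I. A $ i $ k * C $ k $ j)"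
      using that by (intro sum.mono_neutral_cong_right) (auto simp: A'_def)
    finally show ?thesis by simp
  qed
  have CA: "(\<Sum>k\<in>I. C $ i $ k * A $ k $ j) = (if i = j then 1 else 0)" if "i \<in> I" "j \<in> I" for i j
  proof -
    have "(if i = j then 1 else 0) = (C ** A') $ i $ j" unfolding C_def G by (simp add: mat_def)
    also have "\<dots> = (\<Sum>k\<in>UNIV. C $ i $ k * A' $ k $ j)" by (simp add: matrix_matrix_mult_def)
    also have "\<dots> = (\<Sum>k\<in>I. C $ i $ k * A $ k $ j)"
      using that by (intro sum.mono_neutral_cong_right) (auto simp: A'_def)
    finally show ?thesis by simp
  qed
  let ?P = "\<lambda>B :: real^'q^'q. (\<forall>i\<in>I. \<forall>j\<in>I. (\<Sum>k\<in>I. A $ i $ k * B $ k $ j) = (if i = j then 1 else 0) \<and>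
                   (\<Sum>k\<in>I. B $ i $ k * A $ k $ j) = (if i = j then 1 else 0)) \<and>
     (\<forall>i j. \<not> (i \<in> I \<and> j \<in> I) \<longrightarrow> B $ i $ j = 0)"
  have "?P (\<chi> i j. if i \<in> I \<and> j \<in> I then C $ i $ j else 0)"
    using AC CA by simp
  then have P: "?P B" unfolding B_def block_inv_def by (rule someI)
  then show BA: "(\<Sum>k\<in>I. B $ i $ k * A $ k $ j) = (if i = j then 1 else 0)" if "i \<in> I" "j \<in> I" for i j
    using that by blast
  \<comment> \<open>A left inverse and a right inverse of the block coincide, so the matrix picked
    by \<open>SOME\<close> in \<open>block_inv\<close> is determined.\<close>
  have BC: "B $ i $ j = C $ i $ j" if i: "i \<in> I" and j: "j \<in> I" for i j
  proof -
    have "B $ i $ j = (\<Sum>k\<in>I. if i = k then B $ k $ j else 0)" using i by (simp add: sum.delta)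
    also have "\<dots> = (\<Sum>k\<in>I. (if i = k then 1 else 0) * B $ k $ j)" by (intro sum.cong) auto
    also have "\<dots> = (\<Sum>k\<in>I. (\<Sum>l\<in>I. C $ i $ l * A $ l $ k) * B $ k $ j)"
      using CA[OF i] by (intro sum.cong) auto
    also have "\<dots> = (\<Sum>l\<in>I. C $ i $ l * (\<Sum>k\<in>I. A $ l $ k * B $ k $ j))"
      unfolding sum_distrib_left sum_distrib_right by (subst sum.swap) (simp add: mult.assoc)
    also have "\<dots> = (\<Sum>l\<in>I. C $ i $ l * (if l = j then 1 else 0))"
      using P j by (intro sum.cong refl arg_cong2[where f="(*)"]) auto
    also have "\<dots> = (\<Sum>l\<in>I. if l = j then C $ i $ l else 0)" by (intro sum.cong) auto
    also have "\<dots> = C $ i $ j" using j by (simp add: sum.delta)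
    finally show ?thesis .
  qed
  define R :: "real^'q^'q" where "R = (\<chi> i j. if i \<in> I then s * G $ i $ j else 0)"
  have "(R ** transpose R) $ i $ l = (if i \<in> I \<and> l \<in> I then s\<^sup>2 * B $ i $ l else 0)" for i l
  proof -
    have "(R ** transpose R) $ i $ l = (\<Sum>k\<in>UNIV. R $ i $ k * R $ l $ k)"
      by (simp add: matrix_matrix_mult_def transpose_def)
    also have "\<dots> = (if i \<in> I \<and> l \<in> I then s\<^sup>2 * (\<Sum>k\<in>UNIV. G $ i $ k * G $ l $ k) else 0)"
      by (auto simp: R_def sum_distrib_left power2_eq_square mult_ac)
    also have "(\<Sum>k\<in>UNIV. G $ i $ k * G $ l $ k) = C $ i $ l"
      by (simp add: C_def matrix_matrix_mult_def transpose_def)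
    finally show ?thesis using BC by auto
  qed
  then show "\<exists>R :: real ^ 'q ^ 'q. R ** transpose R = (\<chi> i j. if i \<in> I \<and> j \<in> I then s\<^sup>2 * B $ i $ j else 0)"
    by (intro exI[of _ R]) (simp add: vec_eq_iff)
qed

lemma matrix_vector_borel: "(\<lambda>z. A *v z) \<in> borel_measurable borel" for A :: "real^'q^'p"
  by (intro borel_measurable_continuous_onI linear_continuous_on linear_linear[THEN iffD2] matrix_vector_mul_linear)

text \<open>The characteristic function depends on the chosen factor \<open>B\<close> only through B
  ** transpose B = V. For the last claim, a diagonal entry of \<open>V\<close> is the sum of the
  squares of a row of \<open>B\<close>, so the row vanishes with it.\<close>

lemma mv_normal_0:
  fixes V :: "real^'q^'q"
  assumes "\<exists>B :: real^'q^'q. B ** transpose B = V"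
  shows "prob_space (mv_normal 0 V)" "sets (mv_normal 0 V) = sets borel"
    "mv_char (mv_normal 0 V) t = exp (- (t \<bullet> (V *v t)) / 2)"
    "(\<And>j. j \<notin> I \<Longrightarrow> V $ j $ j = 0) \<Longrightarrow> AE v in mv_normal 0 V. \<forall>j. j \<notin> I \<longrightarrow> v $ j = 0"
proof -
  interpret S: prob_space "std_mv_normal :: (real^'q) measure" by (rule prob_space_std_mv_normal)
  define B :: "real^'q^'q" where "B = (SOME B. B ** transpose B = V)"
  have B: "B ** transpose B = V" unfolding B_def using assms by (rule someI_ex)
  have N: "mv_normal 0 V = distr std_mv_normal borel (\<lambda>z. B *v z)"
    by (simp add: mv_normal_def B_def)
  have m[measurable]: "(\<lambda>z. B *v z) \<in> borel_measurable borel" by (rule matrix_vector_borel)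
  show "prob_space (mv_normal 0 V)" unfolding N by (rule S.prob_space_distr) simp
  show "sets (mv_normal 0 V) = sets borel" by (simp add: N)
  have "mv_char (mv_normal 0 V) t = (CLINT z|std_mv_normal. iexp (t \<bullet> (B *v z)))"
    unfolding mv_char_def N by (rule integral_distr) auto
  also have "\<dots> = mv_char std_mv_normal (transpose B *v t)"
    unfolding mv_char_def by (simp add: dot_lmul_matrix transpose_matrix_vector)
  also have "\<dots> = exp (- (norm (transpose B *v t))\<^sup>2 / 2)" by (rule mv_char_std_mv_normal)
  also have "(norm (transpose B *v t))\<^sup>2 = t \<bullet> (V *v t)"
    unfolding power2_norm_eq_inner B[symmetric]
    by (simp add: matrix_vector_mul_assoc[symmetric] dot_lmul_matrix[symmetric] transpose_matrix_vector)
  finally show "mv_char (mv_normal 0 V) t = exp (- (t \<bullet> (V *v t)) / 2)" .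
  assume V0: "\<And>j. j \<notin> I \<Longrightarrow> V $ j $ j = 0"
  have row0: "B $ j $ k = 0" if "j \<notin> I" for j k
  proof -
    have "0 = (\<Sum>k\<in>UNIV. (B $ j $ k)\<^sup>2)"
      using V0[OF that] unfolding B[symmetric] by (simp add: matrix_matrix_mult_def transpose_def power2_eq_square)
    then have "\<forall>k\<in>UNIV. (B $ j $ k)\<^sup>2 = 0" by (subst sum_nonneg_eq_0_iff[symmetric]) auto
    then show ?thesis by simp
  qed
  have "closed {v :: real^'q. \<forall>j. j \<notin> I \<longrightarrow> v $ j = 0}"
    by (intro closed_Collect_all closed_Collect_imp open_Collect_const closed_Collect_eq continuous_intros)
  then have ms: "{v :: real^'q. \<forall>j. j \<notin> I \<longrightarrow> v $ j = 0} \<in> sets borel" by (rule borel_closed)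
  show "AE v in mv_normal 0 V. \<forall>j. j \<notin> I \<longrightarrow> v $ j = 0"
    unfolding N by (subst AE_distr_iff) (use ms row0 in \<open>auto simp: matrix_vector_mult_def\<close>)
qed

section \<open>Least squares for a fixed sample\<close>

lemma poly_antiderivative: "\<exists>F. pderiv F = p" for p :: "real poly"
proof -
  let ?F = "\<Sum>i\<le>degree p. monom (coeff p i / real (Suc i)) (Suc i)"
  have "pderiv ?F = (\<Sum>i\<le>degree p. monom (coeff p i) i)"
    unfolding pderiv_sum' by (intro sum.cong refl) (simp add: pderiv_monom del: of_nat_Suc)
  also have "\<dots> = p" by (rule poly_as_sum_of_monoms)
  finally show ?thesis by blast
qed

text \<open>A polynomial piece is the derivative of a primitive of degree at most r that vanishes at
  the left end of the cell. The Lagrange formula for this primitive at the nodes 0, ..., r,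
  differentiated, gives these functions; node 0 drops out, which leaves r per cell.\<close>

definition local_basis :: "nat \<Rightarrow> nat \<Rightarrow> nat \<Rightarrow> nat \<Rightarrow> real \<Rightarrow> real" where
  "local_basis r K j m t = poly (pderiv (lagrange_poly r m)) ((t - real j / real K) * (real r * real K)) * indicator (cell K j) t"

text \<open>The coefficient of \<open>local_basis r K j m\<close> is \<open>r K\<close> times the integral of \<open>v\<close> over the first \<open>m\<close> of
  \<open>r\<close> equal parts of the cell, so that the coefficients are controlled by the norm of \<open>v\<close>.\<close>

lemma pw_poly_local_basis:
  assumes v: "v \<in> pw_poly r K" and r: "r > 0" and K: "K > 0"
  obtains d where "v = (\<lambda>t. \<Sum>j<K. \<Sum>m=1..r. d j m * local_basis r K j m t)"
    "(\<Sum>j<K. \<Sum>m=1..r. (d j m)\<^sup>2) \<le> real r ^ 3 * real K * (l2 unif v)\<^sup>2" "v \<in> L2_fun unif"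
proof -
  obtain P where P: "\<And>j. j < K \<Longrightarrow> degree (P j) \<le> r - 1" "v = (\<lambda>t. \<Sum>j<K. poly (P j) t * indicator (cell K j) t)"
    using v unfolding pw_poly_cell_iff by blast
  have "\<forall>j. \<exists>F. pderiv F = P j" using poly_antiderivative by blast
  then obtain F where F: "\<And>j. pderiv (F j) = P j" by metis
  define u where "u = 1 / (real r * real K)"
  have u: "u > 0" using r K by (simp add: u_def)
  define d where "d j m = (poly (F j) (real j / real K + real m * u) - poly (F j) (real j / real K)) / u" for j m :: nat
  have vP: "v t = poly (P j) t" if "j < K" "t \<in> cell K j" for j t
    unfolding P(2) by (rule sum_cell_indicator[OF that, of "\<lambda>j. poly (P j) t"])
  have pc: "poly (P j) t = (\<Sum>m=1..r. d j m * poly (pderiv (lagrange_poly r m)) ((t - real j / real K) * (real r * real K)))" if j: "j < K" for j t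
  proof -
    let ?x = "real j / real K"
    \<comment> \<open>The primitive in the local coordinate, made zero at node 0 and rescaled so
      that its derivative is the polynomial piece again. Its degree is at most r, so interpolation
      at 0, ..., r is exact.\<close>
    define A where "A = smult (1 / u) (pcompose (F j) [:?x, u:] - [:poly (F j) ?x:])"
    have "degree (F j) \<le> r" using P(1)[OF j] r unfolding F[symmetric] by (simp add: degree_pderiv)
    then have dA: "degree A \<le> r"
      unfolding A_def by (intro order_trans[OF degree_smult_le] degree_diff_le) (auto simp: degree_pcompose intro: order_trans[OF degree_pcompose_le])
    have Am: "poly A (real m) = d j m" for m
      by (simp add: A_def d_def poly_pcompose mult.commute)
    have "poly (pderiv A) y = poly (P j) (?x + y * u)" for y
      using u by (simp add: A_def pderiv_smult pderiv_diff pderiv_pcompose pderiv_pCons F poly_pcompose mult.commute)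
    from this[of "(t - ?x) * (real r * real K)"] have "poly (P j) t = poly (pderiv A) ((t - ?x) * (real r * real K))"
      using r K by (simp add: u_def)
    also have "\<dots> = (\<Sum>m\<le>r. poly A (real m) * poly (pderiv (lagrange_poly r m)) ((t - ?x) * (real r * real K)))"
      by (subst interpolant_poly[OF dA, symmetric]) (rule poly_pderiv_interpolant)
    also have "\<dots> = (\<Sum>m=1..r. d j m * poly (pderiv (lagrange_poly r m)) ((t - ?x) * (real r * real K)))"
    proof -
      have "d j 0 = 0" by (simp add: d_def)
      then show ?thesis unfolding Am
        by (intro sum.mono_neutral_right) (auto simp: not_le)
    qed
    finally show ?thesis .
  qed
  have "v = (\<lambda>t. \<Sum>j<K. \<Sum>m=1..r. d j m * local_basis r K j m t)"
    unfolding P(2) local_basis_def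
    by (intro ext sum.cong refl) (simp add: pc sum_distrib_right mult.assoc)
  note veq = this
  have vm[measurable]: "v \<in> borel_measurable borel" by (rule pw_poly_measurable[OF v])
  have "\<exists>B. \<forall>j<K. \<forall>t\<in>cell K j. (poly (P j) t)\<^sup>2 \<le> B"
  proof -
    have "\<forall>j. \<exists>C\<ge>0. \<forall>t\<in>{0..1}. \<bar>poly (P j) t\<bar> \<le> C" using poly_bounds_on_interval by blast
    then obtain C where C: "\<And>j. C j \<ge> 0" "\<And>j t. t \<in> {0..1} \<Longrightarrow> \<bar>poly (P j) t\<bar> \<le> C j" by metis
    show ?thesis
    proof (intro exI[of _ "\<Sum>j<K. (C j)\<^sup>2"] allI impI ballI)
      fix j t assume j: "j < K" and t: "t \<in> cell K j"
      have "\<bar>poly (P j) t\<bar> \<le> C j" using C(2)[of t j] cell_subset[OF j] t by auto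
      then have "(poly (P j) t)\<^sup>2 \<le> (C j)\<^sup>2" using power_mono[of "\<bar>poly (P j) t\<bar>" _ 2] by simp
      also have "\<dots> \<le> (\<Sum>j<K. (C j)\<^sup>2)" using j by (intro member_le_sum) auto
      finally show "(poly (P j) t)\<^sup>2 \<le> (\<Sum>j<K. (C j)\<^sup>2)" .
    qed
  qed
  then obtain B where B0: "\<forall>j<K. \<forall>t\<in>cell K j. (poly (P j) t)\<^sup>2 \<le> B" by (elim exE)
  then have B: "(v t)\<^sup>2 \<le> B" if "j < K" "t \<in> cell K j" for j t
    using vP[OF that] that by simp
  have vu: "v \<in> L2_fun unif" by (rule step_function_L2(1)[OF vm K]) (rule B)
  define v0 where "v0 t = v t * indicator {0..<1} t" for t
  have v0: "v0 \<in> L2_fun lborel"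
  proof -
    have "integrable lborel (\<lambda>t. indicator {0..<1} t *\<^sub>R (v t)\<^sup>2)"
      using L2_fun_integrable_sq[OF vu] unfolding unif_def by (subst (asm) integrable_restrict_space) auto
    moreover have "(\<lambda>t. indicator {0..<1} t *\<^sub>R (v t)\<^sup>2) = (\<lambda>t. (v0 t)\<^sup>2)"
      by (auto simp: v0_def indicator_def)
    moreover have "v0 \<in> borel_measurable lborel" unfolding v0_def[abs_def] by measurable
    ultimately show ?thesis by (simp add: L2_fun_def)
  qed
  let ?Q = "\<lambda>j. \<integral>t. (v0 t)\<^sup>2 * indicator (cell K j) t \<partial>lborel"
  \<comment> \<open>The coefficient is an integral over part of the cell divided by u = 1 / (r K).
    Cauchy-Schwarz on a length of at most 1 / K gives r^2 K, and the r coefficients per cell add the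
    third factor r.\<close>
  have dm: "(d j m)\<^sup>2 \<le> (real r)\<^sup>2 * real K * ?Q j" if j: "j < K" and m: "m \<in> {1..r}" for j m
  proof -
    let ?x = "real j / real K"
    have mu: "real m * u \<le> 1 / real K" using m r K by (simp add: u_def field_simps)
    have sub: "{?x..<?x + real m * u} \<subseteq> cell K j"
      using mu by (auto simp: cell_def add_divide_distrib)
    have "(\<integral>t. poly (P j) t * indicator {?x..?x + real m * u} t \<partial>lborel) = poly (F j) (?x + real m * u) - poly (F j) ?x"
      using u F by (intro integral_FTC_Icc_real) (auto intro!: poly_DERIV[THEN DERIV_cong] continuous_intros)
    also have "(\<integral>t. poly (P j) t * indicator {?x..?x + real m * u} t \<partial>lborel) = (\<integral>t. v0 t * indicator {?x..<?x + real m * u} t \<partial>lborel)"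
    proof (rule integral_cong_AE)
      show "(\<lambda>t. v0 t * indicator {?x..<?x + real m * u} t) \<in> borel_measurable lborel" using v0 by measurable
      have [measurable]: "poly (P j) \<in> borel_measurable borel" by (intro borel_measurable_continuous_onI continuous_intros)
      show "(\<lambda>t. poly (P j) t * indicator {?x..?x + real m * u} t) \<in> borel_measurable lborel" by measurable
      have "AE t in lborel. t \<noteq> ?x + real m * u" by (rule AE_lborel_singleton)
      then show "AE t in lborel. poly (P j) t * indicator {?x..?x + real m * u} t = v0 t * indicator {?x..<?x + real m * u} t"
      proof eventually_elim
        case (elim t)
        show ?case
        proof (cases "t \<in> {?x..<?x + real m * u}")
          case True
          then have "t \<in> cell K j" using sub by auto
          then have "v0 t = poly (P j) t" using cell_subset[OF j] vP[OF j] by (auto simp: v0_def)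
          then show ?thesis using True by simp
        next
          case False
          then have "t \<notin> {?x..?x + real m * u}" using elim by auto
          then show ?thesis using False by simp
        qed
      qed
    qed
    finally have de: "d j m = (\<integral>t. v0 t * indicator {?x..<?x + real m * u} t \<partial>lborel) / u" by (simp add: d_def)
    have "\<bar>\<integral>t. v0 t * indicator {?x..<?x + real m * u} t \<partial>lborel\<bar> \<le> (\<integral>t. \<bar>v0 t\<bar> * indicator {?x..<?x + real m * u} t \<partial>lborel)"
      by (rule order_trans[OF integral_abs_bound]) (simp add: abs_mult)
    then have "(\<integral>t. v0 t * indicator {?x..<?x + real m * u} t \<partial>lborel)\<^sup>2 \<le> (\<integral>t. \<bar>v0 t\<bar> * indicator {?x..<?x + real m * u} t \<partial>lborel)\<^sup>2"
      using power_mono[of "\<bar>\<integral>t. v0 t * indicator {?x..<?x + real m * u} t \<partial>lborel\<bar>" _ 2] by simp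
    also have "\<dots> \<le> (real m * u) * (\<integral>t. (v0 t)\<^sup>2 * indicator {?x..<?x + real m * u} t \<partial>lborel)"
      using integral_interval_Cauchy_Schwarz[OF v0, of ?x "?x + real m * u"] u by simp
    also have "\<dots> \<le> (1 / real K) * ?Q j"
    proof (intro mult_mono mu)
      show "(\<integral>t. (v0 t)\<^sup>2 * indicator {?x..<?x + real m * u} t \<partial>lborel) \<le> ?Q j"
        using sub by (intro integral_mono integrable_times_indicator L2_fun_integrable_sq[OF v0]) (auto simp: indicator_def)
    qed (auto intro: Bochner_Integration.integral_nonneg)
    finally have "(d j m)\<^sup>2 \<le> ((1 / real K) * ?Q j) / u\<^sup>2"
      unfolding de power_divide by (intro divide_right_mono) auto
    also have "\<dots> = (real r)\<^sup>2 * real K * ?Q j"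
      using r K by (simp add: u_def power2_eq_square field_simps)
    finally show ?thesis .
  qed
  have "(\<Sum>j<K. \<Sum>m=1..r. (d j m)\<^sup>2) \<le> (\<Sum>j<K. \<Sum>m=1..r. (real r)\<^sup>2 * real K * ?Q j)"
    by (intro sum_mono dm) auto
  also have "\<dots> = real r ^ 3 * real K * (\<Sum>j<K. ?Q j)"
    by (simp add: sum_distrib_left[symmetric] power2_eq_square power3_eq_cube)
  also have "\<dots> \<le> real r ^ 3 * real K * (\<integral>t. (v0 t)\<^sup>2 * indicator {0..<1} t \<partial>lborel)"
    using cell_subset by (intro mult_left_mono sum_integral_cells_le L2_fun_integrable_sq[OF v0] K) auto
  also have "(\<integral>t. (v0 t)\<^sup>2 * indicator {0..<1} t \<partial>lborel) = (l2 unif v)\<^sup>2"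
    unfolding l2_sq integral_unif by (intro Bochner_Integration.integral_cong) (auto simp: v0_def indicator_def)
  finally have "(\<Sum>j<K. \<Sum>m=1..r. (d j m)\<^sup>2) \<le> real r ^ 3 * real K * (l2 unif v)\<^sup>2" .
  then show ?thesis using veq vu by (intro that)
qed

definition basis_index :: "nat \<Rightarrow> nat \<Rightarrow> ('q + nat \<times> nat) set" where
  "basis_index r K = Inl ` UNIV \<union> Inr ` ({..<K} \<times> {1..r})"

fun basis_fun :: "nat \<Rightarrow> nat \<Rightarrow> 'q + nat \<times> nat \<Rightarrow> (real ^ 'q) \<times> real \<Rightarrow> real" where
  "basis_fun r K (Inl k) z = fst z $ k"
| "basis_fun r K (Inr (j, m)) z = local_basis r K j m (snd z)"

lemma finite_basis_index [simp]: "finite (basis_index r K :: ('q::finite + nat \<times> nat) set)"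
  by (simp add: basis_index_def)

lemma sum_basis_index:
  "(\<Sum>a\<in>basis_index r K. h a) = (\<Sum>k\<in>UNIV. h (Inl k)) + (\<Sum>j<K. \<Sum>m=1..r. h (Inr (j, m)))"
  for h :: "'q::finite + nat \<times> nat \<Rightarrow> real"
proof -
  have "(\<Sum>a\<in>basis_index r K. h a) = (\<Sum>a\<in>Inl ` UNIV. h a) + (\<Sum>a\<in>Inr ` ({..<K} \<times> {1..r}). h a)"
    unfolding basis_index_def by (rule sum.union_disjoint) auto
  also have "(\<Sum>a\<in>Inl ` UNIV. h a) = (\<Sum>k\<in>UNIV. h (Inl k))" by (simp add: sum.reindex)
  also have "(\<Sum>a\<in>Inr ` ({..<K} \<times> {1..r}). h a) = (\<Sum>p\<in>{..<K} \<times> {1..r}. h (Inr p))"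
    by (subst sum.reindex) auto
  also have "\<dots> = (\<Sum>j<K. \<Sum>m=1..r. h (Inr (j, m)))"
    by (simp add: sum.cartesian_product)
  finally show ?thesis .
qed

lemma local_basis_measurable [measurable]: "local_basis r K j m \<in> borel_measurable borel"
proof -
  have [measurable]: "poly p \<in> borel_measurable borel" for p :: "real poly"
    by (intro borel_measurable_continuous_onI continuous_intros)
  show ?thesis unfolding local_basis_def by measurable
qed

lemma basis_fun_measurable [measurable]: "basis_fun r K a \<in> borel_measurable borel"
  by (cases a rule: sum.exhaust; (cases "projr a")?) (auto simp: basis_fun.simps[abs_def] split: prod.splits)

text \<open>At each t only the r functions of one cell are nonzero, so the bound does not grow with
  \<open>K\<close>. This is why the expected squared error of the whole Gram matrix is of order 1 /
  n in every dimension.\<close>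

lemma local_basis_bound:
  obtains c where "c \<ge> 0" "\<And>K t. K > 0 \<Longrightarrow> (\<Sum>j<K. \<Sum>m=1..r. (local_basis r K j m t)\<^sup>2) \<le> c"
proof -
  obtain c where c: "c \<ge> 0" "\<And>j z. j \<le> r \<Longrightarrow> z \<in> {0..2 * real r} \<Longrightarrow> \<bar>poly (pderiv (lagrange_poly r j)) z\<bar> \<le> c"
    using lagrange_deriv_bounds[of r] by blast
  show ?thesis
  proof (rule that[of "real r * c\<^sup>2"])
    fix K :: nat and t :: real assume K: "K > 0"
    have le: "(\<Sum>m=1..r. (local_basis r K j m t)\<^sup>2) \<le> (real r * c\<^sup>2) * indicator (cell K j) t" for j
    proof (cases "t \<in> cell K j")
      case True
      have "(t - real j / real K) * (real r * real K) \<in> {0..2 * real r}"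
      proof -
        have "0 \<le> t - real j / real K" "t - real j / real K \<le> 1 / real K"
          using True by (auto simp: cell_def add_divide_distrib)
        then have "0 \<le> (t - real j / real K) * (real r * real K)" "(t - real j / real K) * (real r * real K) \<le> (1 / real K) * (real r * real K)"
          by (intro mult_nonneg_nonneg mult_right_mono; simp)+
        moreover have "(1 / real K) * (real r * real K) \<le> 2 * real r" using K by simp
        ultimately show ?thesis by simp
      qed
      then have "(local_basis r K j m t)\<^sup>2 \<le> c\<^sup>2" if "m \<in> {1..r}" for m
        using power_mono[OF c(2)[of m "(t - real j / real K) * (real r * real K)"], of 2] that True
        by (simp add: local_basis_def)
      from sum_mono[of "{1..r}" "\<lambda>m. (local_basis r K j m t)\<^sup>2" "\<lambda>_. c\<^sup>2", OF this] True
      show ?thesis by simp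
    qed (simp add: local_basis_def)
    show "(\<Sum>j<K. \<Sum>m=1..r. (local_basis r K j m t)\<^sup>2) \<le> real r * c\<^sup>2"
    proof (cases "t \<in> {0..<1}")
      case True
      then obtain j where j: "j < K" "t \<in> cell K j" by (rule cell_exists[OF K])
      have "(\<Sum>j<K. \<Sum>m=1..r. (local_basis r K j m t)\<^sup>2) \<le> (\<Sum>j<K. (real r * c\<^sup>2) * indicator (cell K j) t)"
        by (rule sum_mono) (rule le)
      then show ?thesis using sum_cell_indicator[OF j, of "\<lambda>_. real r * c\<^sup>2"] by simp
    next
      case False
      have "(\<Sum>j<K. \<Sum>m=1..r. (local_basis r K j m t)\<^sup>2) \<le> (\<Sum>j<K. (real r * c\<^sup>2) * indicator (cell K j) t)"
        by (rule sum_mono) (rule le)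
      also have "(\<Sum>j<K. (real r * c\<^sup>2) * indicator (cell K j) t) = 0"
        by (rule sum_cell_indicator_outside[OF False])
      also have "0 \<le> real r * c\<^sup>2" by simp
      finally show ?thesis .
    qed
  qed simp
qed

lemma reg_fun_basis:
  fixes l :: "real ^ 'q"
  assumes v: "v = (\<lambda>t. \<Sum>j<K. \<Sum>m=1..r. d j m * local_basis r K j m t)"
  shows "reg_fun l v z = (\<Sum>a\<in>basis_index r K. (case a of Inl k \<Rightarrow> l $ k | Inr (j, m) \<Rightarrow> d j m) * basis_fun r K a z)"
  unfolding sum_basis_index v by (simp add: reg_fun_def split_beta inner_vec_def)

section \<open>Coercivity of the basis expansion\<close>

context design
begin

lemma L2_pw_poly:
  assumes "v \<in> pw_poly r K" "r > 0" "K > 0"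
  shows "(\<lambda>z. v (snd z)) \<in> L2_fun \<mu>"
proof -
  have "v \<in> L2_fun unif" by (rule pw_poly_local_basis[OF assms])
  then show ?thesis by (rule l2_unif_mu(1)[OF pw_poly_measurable[OF assms(1)]])
qed

lemma L2_inner_component: "(\<lambda>z. l \<bullet> fst z) \<in> L2_fun \<mu>"
  unfolding inner_vec_def inner_real_def by (intro L2_fun_sum L2_fun_cmult L2_component)

lemma L2_reg_fun: "(\<lambda>z. v (snd z)) \<in> L2_fun \<mu> \<Longrightarrow> reg_fun l v \<in> L2_fun \<mu>"
  using L2_fun_add[OF L2_inner_component[of l], of "\<lambda>z. v (snd z)"] by (simp add: reg_fun_def split_beta')

definition lam :: real where "lam = (SOME c. c > 0 \<and> (\<forall>l. c * (norm l)\<^sup>2 \<le> (\<integral>z. (l \<bullet> resid z)\<^sup>2 \<partial>\<mu>)))"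

lemma lam: "lam > 0" "lam * (norm l)\<^sup>2 \<le> (\<integral>z. (l \<bullet> resid z)\<^sup>2 \<partial>\<mu>)"
  using someI_ex[OF resid_coercive, folded lam_def] by auto

text \<open>The function splits into l applied to the residual and a function of \<open>T\<close>.
  The two parts are orthogonal, so the norm controls l whatever v is.\<close>

lemma linear_part_bound:
  assumes vm[measurable]: "v \<in> borel_measurable borel" and v: "(\<lambda>z. v (snd z)) \<in> L2_fun \<mu>"
  shows "lam * (norm l)\<^sup>2 \<le> (\<integral>z. (reg_fun l v z)\<^sup>2 \<partial>\<mu>)"
proof -
  let ?m = "\<lambda>t. (\<Sum>j\<in>UNIV. l $ j * cond_mean \<kappa> j t) + v t"
  have m[measurable]: "?m \<in> borel_measurable borel" by measurable
  have mL: "(\<lambda>z. ?m (snd z)) \<in> L2_fun \<mu>"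
    by (intro L2_fun_add L2_fun_sum L2_fun_cmult L2_cond_mean v)
  have orth: "(\<integral>z. (l \<bullet> resid z) * ?m (snd z) \<partial>\<mu>) = 0"
  proof -
    have "(\<integral>z. (l \<bullet> resid z) * ?m (snd z) \<partial>\<mu>) = (\<integral>z. (\<Sum>j\<in>UNIV. l $ j * (resid z $ j * ?m (snd z))) \<partial>\<mu>)"
      by (intro Bochner_Integration.integral_cong refl) (simp add: inner_vec_def sum_distrib_right mult.assoc)
    also have "\<dots> = (\<Sum>j\<in>UNIV. \<integral>z. l $ j * (resid z $ j * ?m (snd z)) \<partial>\<mu>)"
      by (rule Bochner_Integration.integral_sum) (intro integrable_mult_right L2_fun_mult[OF L2_resid mL])
    also have "\<dots> = (\<Sum>j\<in>UNIV. l $ j * (\<integral>z. resid z $ j * ?m (snd z) \<partial>\<mu>))" by simp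
    also have "\<dots> = 0" using resid_orthogonal[OF m mL] by (simp del: resid_component)
    finally show ?thesis .
  qed
  have eq: "reg_fun l v z = l \<bullet> resid z + ?m (snd z)" for z
    by (simp add: reg_fun_def split_beta inner_vec_def right_diff_distrib sum_subtractf)
  have "(\<integral>z. (reg_fun l v z)\<^sup>2 \<partial>\<mu>) = (\<integral>z. (l \<bullet> resid z)\<^sup>2 + (?m (snd z))\<^sup>2 + 2 * ((l \<bullet> resid z) * ?m (snd z)) \<partial>\<mu>)"
    unfolding eq power2_sum by (simp add: mult.assoc)
  also have "\<dots> = (\<integral>z. (l \<bullet> resid z)\<^sup>2 \<partial>\<mu>) + (\<integral>z. (?m (snd z))\<^sup>2 \<partial>\<mu>) + 2 * (\<integral>z. (l \<bullet> resid z) * ?m (snd z) \<partial>\<mu>)"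
    using L2_fun_integrable_sq[OF L2_inner_resid[of l]] L2_fun_integrable_sq[OF mL] L2_fun_mult[OF L2_inner_resid[of l] mL]
    by (simp del: resid_component)
  finally have "(\<integral>z. (reg_fun l v z)\<^sup>2 \<partial>\<mu>) = (\<integral>z. (l \<bullet> resid z)\<^sup>2 \<partial>\<mu>) + (\<integral>z. (?m (snd z))\<^sup>2 \<partial>\<mu>)"
    unfolding orth by simp
  moreover have "0 \<le> (\<integral>z. (?m (snd z))\<^sup>2 \<partial>\<mu>)" by simp
  ultimately show ?thesis using lam(2)[of l] by linarith
qed

abbreviation basis_bounded :: "nat \<Rightarrow> nat \<Rightarrow> real \<Rightarrow> (real \<Rightarrow> real) \<Rightarrow> real ^ 'q \<Rightarrow> bool" where
  "basis_bounded r K C2 v l \<equiv> \<exists>d. v = (\<lambda>t. \<Sum>j<K. \<Sum>m=1..r. d j m * local_basis r K j m t) \<and>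
       (\<Sum>a\<in>basis_index r K. (case a of Inl k \<Rightarrow> l $ k | Inr (j, m) \<Rightarrow> d j m)\<^sup>2) \<le> C2 * real K * (\<integral>z. (reg_fun l v z)\<^sup>2 \<partial>\<mu>)"

text \<open>The coefficients of v cost \<open>K\<close> times its squared norm, and v is what
  remains after subtracting the linear part, whose size \<open>linear_part_bound\<close> controls.
  In matrix terms, the smallest eigenvalue of the Gram matrix is at least 1 / (C2 K).\<close>

lemma basis_coercive:
  assumes r: "r > 0"
  obtains C2 where "C2 > 0" "\<And>K v l. K > 0 \<Longrightarrow> v \<in> pw_poly r K \<Longrightarrow> basis_bounded r K C2 v l"
proof -
  \<comment> \<open>The first term bounds the linear coefficients. The second comes from
    \<open>pw_poly_local_basis\<close>, the lower density bound, and the bound (2 + 2 bnd^2 / lam) N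
    for the squared norm of v, where N is the squared norm of the whole function.\<close>
  define C2 where "C2 = 1 / lam + real r ^ 3 / (h0 * vol) * (2 + 2 * bnd\<^sup>2 / lam)"
  have hv: "h0 * vol > 0" using h0_pos vol_pos by simp
  show ?thesis
  proof (rule that[of C2])
    show "C2 > 0" unfolding C2_def using lam(1) hv by (intro add_pos_nonneg) auto
    fix K :: nat and v :: "real \<Rightarrow> real" and l :: "real ^ 'q"
    assume K: "K > 0" and v: "v \<in> pw_poly r K"
    obtain d where d: "v = (\<lambda>t. \<Sum>j<K. \<Sum>m=1..r. d j m * local_basis r K j m t)"
      "(\<Sum>j<K. \<Sum>m=1..r. (d j m)\<^sup>2) \<le> real r ^ 3 * real K * (l2 unif v)\<^sup>2" "v \<in> L2_fun unif"
      by (rule pw_poly_local_basis[OF v r K])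
    have vm: "v \<in> borel_measurable borel" by (rule pw_poly_measurable[OF v])
    have vL: "(\<lambda>z. v (snd z)) \<in> L2_fun \<mu>" by (rule L2_pw_poly[OF v r K])
    define N where "N = (\<integral>z. (reg_fun l v z)\<^sup>2 \<partial>\<mu>)"
    have N0: "N \<ge> 0" by (simp add: N_def)
    have l: "(norm l)\<^sup>2 \<le> N / lam"
      using linear_part_bound[OF vm vL, of l] lam(1) by (simp add: N_def field_simps)
    have "(l2 \<mu> (\<lambda>z. v (snd z)))\<^sup>2 \<le> (\<integral>z. 2 * (reg_fun l v z)\<^sup>2 + 2 * (bnd\<^sup>2 * (norm l)\<^sup>2) \<partial>\<mu>)"
      unfolding l2_sq
    proof (rule integral_mono_AE)
      show "AE z in \<mu>. (v (snd z))\<^sup>2 \<le> 2 * (reg_fun l v z)\<^sup>2 + 2 * (bnd\<^sup>2 * (norm l)\<^sup>2)"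
        using AE_K
      proof eventually_elim
        case (elim z)
        have "\<bar>l \<bullet> fst z\<bar> \<le> norm l * bnd"
          using Cauchy_Schwarz_ineq2[of l "fst z"] mult_left_mono[OF bnd(2)[of "fst z"] norm_ge_zero[of l]] elim by linarith
        from power_mono[OF this, of 2] have a: "(l \<bullet> fst z)\<^sup>2 \<le> bnd\<^sup>2 * (norm l)\<^sup>2"
          by (simp add: power_mult_distrib mult.commute)
        have "v (snd z) = reg_fun l v z - l \<bullet> fst z" by (simp add: reg_fun_def split_beta)
        then have "(v (snd z))\<^sup>2 \<le> 2 * (reg_fun l v z)\<^sup>2 + 2 * (l \<bullet> fst z)\<^sup>2"
          using sum_squares_bound[of "reg_fun l v z" "- (l \<bullet> fst z)"] by (simp add: power2_diff)
        with a show ?case by linarith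
      qed
    qed (use L2_fun_integrable_sq[OF vL] L2_fun_integrable_sq[OF L2_reg_fun[OF vL]] in auto)
    also have "\<dots> = 2 * N + 2 * (bnd\<^sup>2 * (norm l)\<^sup>2)"
      using L2_fun_integrable_sq[OF L2_reg_fun[OF vL]] prob_space by (simp add: N_def)
    also have "\<dots> \<le> 2 * N + 2 * (bnd\<^sup>2 * (N / lam))" using l by (intro add_left_mono mult_left_mono) auto
    finally have v2: "(l2 \<mu> (\<lambda>z. v (snd z)))\<^sup>2 \<le> (2 + 2 * bnd\<^sup>2 / lam) * N" by (simp add: algebra_simps)
    have "(l2 unif v)\<^sup>2 \<le> (2 + 2 * bnd\<^sup>2 / lam) * N / (h0 * vol)"
      using order_trans[OF l2_unif_mu(3)[OF vm d(3)] v2] hv by (simp add: pos_le_divide_eq mult.commute)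
    then have "real r ^ 3 * real K * (l2 unif v)\<^sup>2 \<le> real r ^ 3 * real K * ((2 + 2 * bnd\<^sup>2 / lam) * N / (h0 * vol))"
      by (intro mult_left_mono) auto
    then have pw: "(\<Sum>j<K. \<Sum>m=1..r. (d j m)\<^sup>2) \<le> real r ^ 3 / (h0 * vol) * (2 + 2 * bnd\<^sup>2 / lam) * real K * N"
      using d(2) by (simp add: mult_ac)
    have "(\<Sum>k\<in>UNIV. (l $ k)\<^sup>2) = (norm l)\<^sup>2"
      unfolding power2_norm_eq_inner by (simp add: inner_vec_def power2_eq_square)
    also have "\<dots> \<le> (1 / lam) * real K * N"
    proof -
      have "1 * N / lam \<le> real K * N / lam" using K N0 lam(1) by (intro divide_right_mono mult_right_mono) auto
      then show ?thesis using l by simp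
    qed
    finally have lin: "(\<Sum>k\<in>UNIV. (l $ k)\<^sup>2) \<le> (1 / lam) * real K * N" .
    have "(\<Sum>a\<in>basis_index r K. (case a of Inl k \<Rightarrow> l $ k | Inr (j, m) \<Rightarrow> d j m)\<^sup>2) \<le> C2 * real K * N"
      unfolding sum_basis_index C2_def distrib_right using lin pw by simp
    then show "basis_bounded r K C2 v l"
      using d(1) unfolding N_def by blast
  qed
qed

end

section \<open>Empirical averages\<close>

definition avg :: "nat \<Rightarrow> (nat \<Rightarrow> real) \<Rightarrow> real" where
  "avg n a = (\<Sum>i=1..n. a i) / real n"

lemma avg_add: "avg n (\<lambda>i. a i + b i) = avg n a + avg n b"
  by (simp add: avg_def sum.distrib add_divide_distrib)

lemma avg_diff: "avg n (\<lambda>i. a i - b i) = avg n a - avg n b"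
  by (simp add: avg_def sum_subtractf diff_divide_distrib)

lemma avg_cmult: "avg n (\<lambda>i. c * a i) = c * avg n a"
  by (simp add: avg_def sum_distrib_left)

lemma avg_sum: "avg n (\<lambda>i. \<Sum>k\<in>A. a k i) = (\<Sum>k\<in>A. avg n (a k))"
  unfolding avg_def by (subst sum.swap) (simp add: sum_divide_distrib)

lemma avg_nonneg: "(\<And>i. 0 \<le> a i) \<Longrightarrow> 0 \<le> avg n a"
  by (simp add: avg_def sum_nonneg)

lemma avg_mono: "(\<And>i. a i \<le> b i) \<Longrightarrow> avg n a \<le> avg n b"
  by (simp add: avg_def sum_mono divide_right_mono)

lemma avg_cong: "(\<And>i. i \<in> {1..n} \<Longrightarrow> a i = b i) \<Longrightarrow> avg n a = avg n b"
  unfolding avg_def by (intro arg_cong2[where f="(/)"] sum.cong) auto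

lemma avg_Cauchy_Schwarz: "(avg n (\<lambda>i. a i * b i))\<^sup>2 \<le> avg n (\<lambda>i. (a i)\<^sup>2) * avg n (\<lambda>i. (b i)\<^sup>2)"
proof -
  have "(\<Sum>i=1..n. a i * b i)\<^sup>2 \<le> (\<Sum>i=1..n. (a i)\<^sup>2) * (\<Sum>i=1..n. (b i)\<^sup>2)"
    by (rule Cauchy_Schwarz_ineq_sum)
  then have "(\<Sum>i=1..n. a i * b i)\<^sup>2 / (real n)\<^sup>2 \<le> (\<Sum>i=1..n. (a i)\<^sup>2) * (\<Sum>i=1..n. (b i)\<^sup>2) / (real n)\<^sup>2"
    by (rule divide_right_mono) simp
  then show ?thesis by (simp add: avg_def power_divide power2_eq_square)
qed

lemma avg_abs_le:
  assumes "avg n (\<lambda>i. (a i)\<^sup>2) \<le> x" "avg n (\<lambda>i. (b i)\<^sup>2) \<le> y"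
  shows "\<bar>avg n (\<lambda>i. a i * b i)\<bar> \<le> sqrt (x * y)"
proof (rule real_le_rsqrt)
  have 0: "0 \<le> avg n (\<lambda>i. (a i)\<^sup>2)" "0 \<le> avg n (\<lambda>i. (b i)\<^sup>2)" by (auto intro: avg_nonneg)
  have "(avg n (\<lambda>i. a i * b i))\<^sup>2 \<le> avg n (\<lambda>i. (a i)\<^sup>2) * avg n (\<lambda>i. (b i)\<^sup>2)" by (rule avg_Cauchy_Schwarz)
  also have "\<dots> \<le> x * y" using assms 0 by (intro mult_mono) auto
  finally show "\<bar>avg n (\<lambda>i. a i * b i)\<bar>\<^sup>2 \<le> x * y" by simp
qed

text \<open>Cauchy-Schwarz over pairs of indices: a quadratic form is at most the Frobenius norm of
  its matrix times the squared norm of the coefficients.\<close>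

lemma empirical_form_deviation:
  fixes d :: "'i \<Rightarrow> real"
  assumes A: "finite A"
  shows "\<bar>avg n (\<lambda>i. (\<Sum>a\<in>A. d a * \<phi> a i)\<^sup>2) - (\<Sum>a\<in>A. \<Sum>b\<in>A. d a * d b * G a b)\<bar>
     \<le> (\<Sum>a\<in>A. (d a)\<^sup>2) * sqrt (\<Sum>a\<in>A. \<Sum>b\<in>A. (avg n (\<lambda>i. \<phi> a i * \<phi> b i) - G a b)\<^sup>2)"
proof -
  let ?\<Delta> = "\<lambda>a b. avg n (\<lambda>i. \<phi> a i * \<phi> b i) - G a b"
  have "avg n (\<lambda>i. (\<Sum>a\<in>A. d a * \<phi> a i)\<^sup>2) = avg n (\<lambda>i. \<Sum>a\<in>A. \<Sum>b\<in>A. (d a * d b) * (\<phi> a i * \<phi> b i))"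
    unfolding power2_eq_square sum_product by (intro avg_cong sum.cong refl) (simp add: mult_ac)
  also have "\<dots> = (\<Sum>a\<in>A. \<Sum>b\<in>A. (d a * d b) * avg n (\<lambda>i. \<phi> a i * \<phi> b i))"
    by (simp add: avg_sum avg_cmult)
  finally have eq: "avg n (\<lambda>i. (\<Sum>a\<in>A. d a * \<phi> a i)\<^sup>2) - (\<Sum>a\<in>A. \<Sum>b\<in>A. d a * d b * G a b) = (\<Sum>(a, b)\<in>A \<times> A. (d a * d b) * ?\<Delta> a b)"
    by (simp add: sum_subtractf[symmetric] right_diff_distrib sum.cartesian_product)
  have "(\<Sum>(a, b)\<in>A \<times> A. (d a * d b) * ?\<Delta> a b)\<^sup>2 \<le> (\<Sum>(a, b)\<in>A \<times> A. (d a * d b)\<^sup>2) * (\<Sum>(a, b)\<in>A \<times> A. (?\<Delta> a b)\<^sup>2)"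
    unfolding split_beta by (rule Cauchy_Schwarz_ineq_sum)
  also have "(\<Sum>(a, b)\<in>A \<times> A. (d a * d b)\<^sup>2) = (\<Sum>a\<in>A. (d a)\<^sup>2)\<^sup>2"
    by (simp add: sum.cartesian_product[symmetric] power_mult_distrib power2_eq_square[of "sum _ _"] sum_product)
  also have "(\<Sum>(a, b)\<in>A \<times> A. (?\<Delta> a b)\<^sup>2) = (\<Sum>a\<in>A. \<Sum>b\<in>A. (?\<Delta> a b)\<^sup>2)"
    by (simp add: sum.cartesian_product)
  finally have "\<bar>\<Sum>(a, b)\<in>A \<times> A. (d a * d b) * ?\<Delta> a b\<bar> \<le> sqrt ((\<Sum>a\<in>A. (d a)\<^sup>2)\<^sup>2 * (\<Sum>a\<in>A. \<Sum>b\<in>A. (?\<Delta> a b)\<^sup>2))"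
    by (intro real_le_rsqrt) simp
  then show ?thesis unfolding eq by (simp add: real_sqrt_mult sum_nonneg)
qed

lemma empirical_linear_bound:
  fixes d :: "'i \<Rightarrow> real"
  shows "\<bar>avg n (\<lambda>i. w i * (\<Sum>a\<in>A. d a * \<phi> a i))\<bar> \<le> sqrt ((\<Sum>a\<in>A. (d a)\<^sup>2) * (\<Sum>a\<in>A. (avg n (\<lambda>i. w i * \<phi> a i))\<^sup>2))"
proof (rule real_le_rsqrt)
  have "avg n (\<lambda>i. w i * (\<Sum>a\<in>A. d a * \<phi> a i)) = avg n (\<lambda>i. \<Sum>a\<in>A. d a * (w i * \<phi> a i))"
    by (intro avg_cong) (simp add: sum_distrib_left mult_ac)
  also have "\<dots> = (\<Sum>a\<in>A. d a * avg n (\<lambda>i. w i * \<phi> a i))" by (simp add: avg_sum avg_cmult)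
  finally show "\<bar>avg n (\<lambda>i. w i * (\<Sum>a\<in>A. d a * \<phi> a i))\<bar>\<^sup>2 \<le> (\<Sum>a\<in>A. (d a)\<^sup>2) * (\<Sum>a\<in>A. (avg n (\<lambda>i. w i * \<phi> a i))\<^sup>2)"
    using Cauchy_Schwarz_ineq_sum[of d "\<lambda>a. avg n (\<lambda>i. w i * \<phi> a i)" A] by simp
qed

section \<open>Selection, uniqueness and the normal equation\<close>

lemma pw_poly_lincomb:
  assumes "v \<in> pw_poly r K" "w \<in> pw_poly r K"
  shows "(\<lambda>t. a * v t + b * w t) \<in> pw_poly r K"
proof -
  obtain P Q where P: "\<forall>j<K. degree (P j) \<le> r - 1" "v = (\<lambda>t. \<Sum>j<K. poly (P j) t * indicator (cell K j) t)"
    and Q: "\<forall>j<K. degree (Q j) \<le> r - 1" "w = (\<lambda>t. \<Sum>j<K. poly (Q j) t * indicator (cell K j) t)"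
    using assms unfolding pw_poly_cell_iff by blast
  show ?thesis unfolding pw_poly_cell_iff
  proof (intro exI[of _ "\<lambda>j. smult a (P j) + smult b (Q j)"] conjI allI impI)
    show "degree (smult a (P j) + smult b (Q j)) \<le> r - 1" if "j < K" for j
      using P(1) Q(1) that by (intro degree_add_le order_trans[OF degree_smult_le]) auto
    show "(\<lambda>t. a * v t + b * w t) = (\<lambda>t. \<Sum>j<K. poly (smult a (P j) + smult b (Q j)) t * indicator (cell K j) t)"
      unfolding P(2) Q(2) sum_distrib_left sum.distrib[symmetric]
      by (intro ext sum.cong refl) (simp add: algebra_simps)
  qed
qed

lemma approx_spaceI: "(\<forall>j. j \<notin> I \<longrightarrow> c $ j = 0) \<Longrightarrow> v \<in> pw_poly r K \<Longrightarrow> reg_fun c v \<in> approx_space r I K"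
  unfolding approx_space_def by blast

text \<open>The test value s = A / (B + 1) makes the quadratic negative unless A = 0; the added 1
  covers B = 0.\<close>

lemma quadratic_nonneg_imp_0:
  fixes A B :: real
  assumes B: "0 \<le> B" and q: "\<And>s. 0 \<le> s\<^sup>2 * B - 2 * s * A"
  shows "A = 0"
proof (rule ccontr)
  assume A: "A \<noteq> 0"
  have "0 \<le> (A / (B + 1))\<^sup>2 * B - 2 * (A / (B + 1)) * A" by (rule q)
  also have "\<dots> = - (A\<^sup>2 * (B + 2)) / (B + 1)\<^sup>2"
  proof -
    have "(A / D)\<^sup>2 * B - 2 * (A / D) * A = (A\<^sup>2 * B - 2 * A\<^sup>2 * D) / D\<^sup>2" if "D \<noteq> 0" for D
      using that by (simp add: power2_eq_square field_simps)
    from this[of "B + 1"] show ?thesis using B by (simp add: algebra_simps)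
  qed
  also have "\<dots> < 0" using A B by (intro divide_neg_pos) (auto intro!: mult_pos_pos)
  finally show False by simp
qed

text \<open>Everything random is frozen here: x i, t i, w i are fixed values. The assumptions from
  \<open>gram\<close> to \<open>cov_dev\<close> are the inequalities that hold on the good event,
  with \<open>L\<close> the level that its probability buys; \<open>big1\<close> to
  \<open>big5\<close> hold for all large n. The conclusions of the locale are then
  deterministic.\<close>

locale fit = design \<mu> \<kappa> \<K> h0 h1
  for \<mu> :: "((real ^ 'q) \<times> real) measure" and \<kappa> :: "real \<Rightarrow> (real ^ 'q) measure"
    and \<K> :: "(real ^ 'q) set" and h0 h1 :: real +
  fixes n r K :: nat and x :: "nat \<Rightarrow> real ^ 'q" and t w :: "nat \<Rightarrow> real"
    and \<beta> :: "real ^ 'q" and f fK :: "real \<Rightarrow> real" and g :: "'q \<Rightarrow> real \<Rightarrow> real"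
    and L \<epsilon> C2 bmin S :: real and I0 :: "'q set"
  assumes n: "n \<ge> 2" and r: "r > 0" and K: "K > 0" and I0: "I0 = {j. \<beta> $ j \<noteq> 0}"
    and fK: "fK \<in> pw_poly r K" and g: "\<And>j. g j \<in> pw_poly r K"
    and bmin: "bmin > 0" "\<And>j. j \<in> I0 \<Longrightarrow> bmin \<le> \<bar>\<beta> $ j\<bar>"
    and C2: "C2 > 0" "\<And>v l. v \<in> pw_poly r K \<Longrightarrow> basis_bounded r K C2 v l"
    and L: "L \<ge> 0" and \<epsilon>: "\<epsilon> \<ge> 0"
    and gram: "(\<Sum>a\<in>basis_index r K. \<Sum>b\<in>basis_index r K. (avg n (\<lambda>i. basis_fun r K a (x i, t i) * basis_fun r K b (x i, t i))
       - (\<integral>z. basis_fun r K a z * basis_fun r K b z \<partial>\<mu>))\<^sup>2) \<le> L / real n"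
    and noise_basis: "(\<Sum>a\<in>basis_index r K. (avg n (\<lambda>i. w i * basis_fun r K a (x i, t i)))\<^sup>2) \<le> L / real n"
    and resid_basis: "\<And>k. (\<Sum>j<K. \<Sum>m=1..r. (avg n (\<lambda>i. resid (x i, t i) $ k * local_basis r K j m (t i)))\<^sup>2) \<le> L / real n"
    and bias: "avg n (\<lambda>i. (f (t i) - fK (t i))\<^sup>2) \<le> L * real K / real n"
    and bias_theta: "\<And>j. avg n (\<lambda>i. (cond_mean \<kappa> j (t i) - g j (t i))\<^sup>2) \<le> L * \<epsilon> / real K"
    and noise_theta: "\<And>j. (avg n (\<lambda>i. w i * (cond_mean \<kappa> j (t i) - g j (t i))))\<^sup>2 \<le> L * \<epsilon> / real n"
    and bias_resid: "\<And>j. (avg n (\<lambda>i. (f (t i) - fK (t i)) * resid (x i, t i) $ j))\<^sup>2 \<le> L * real K / (real n)\<^sup>2"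
    and cov_dev: "\<And>k j. (avg n (\<lambda>i. x i $ k * resid (x i, t i) $ j) - Sigma_mat \<mu> \<kappa> $ k $ j)\<^sup>2 \<le> L / real n"
    and S: "(\<integral>z. (reg_fun \<beta> fK z)\<^sup>2 \<partial>\<mu>) \<le> S"
    and big1: "C2 * real K * sqrt (L / real n) \<le> 1 / 2"
    and big2: "(16 + 64 * C2) * L < 16 * real r * ln (real n)"
    and big3: "(16 + 64 * C2) * L * real K / real n + 16 * (real CARD('q) + 1) * real r * real K * (ln (real n) / real n) < lam * bmin\<^sup>2"
    and big4: "(16 + 64 * C2) * L * real K / real n \<le> 1"
    and big5: "(2 * S + 2) / h0 \<le> (2 * exp ((ln (real n))\<^sup>2))\<^sup>2"
begin

abbreviation obs :: "nat \<Rightarrow> ((real ^ 'q) \<times> real) \<times> real" where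
  "obs \<equiv> \<lambda>i. ((x i, t i), reg_fun \<beta> f (x i, t i) + w i)"

definition pop :: "real ^ 'q \<Rightarrow> (real \<Rightarrow> real) \<Rightarrow> real" where
  "pop l v = (\<integral>z. (reg_fun l v z)\<^sup>2 \<partial>\<mu>)"

definition samp :: "real ^ 'q \<Rightarrow> (real \<Rightarrow> real) \<Rightarrow> real" where
  "samp l v = avg n (\<lambda>i. (reg_fun l v (x i, t i))\<^sup>2)"

lemma pop_nonneg: "0 \<le> pop l v" by (simp add: pop_def)

lemma L2_reg: "v \<in> pw_poly r K \<Longrightarrow> reg_fun l v \<in> L2_fun \<mu>"
  by (rule L2_reg_fun[OF L2_pw_poly[OF _ r K]])

lemma n_pos: "real n > 0" using n by simp

lemma L2_basis_fun: "a \<in> basis_index r K \<Longrightarrow> basis_fun r K a \<in> L2_fun \<mu>"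
proof (cases a)
  case (Inl k)
  then have "basis_fun r K a = (\<lambda>z. fst z $ k)" by auto
  then show ?thesis using L2_component[of k] by simp
next
  case (Inr p)
  obtain j m where p: "p = (j, m)" by (cases p)
  obtain c where c: "c \<ge> 0" "\<And>K t. K > 0 \<Longrightarrow> (\<Sum>j<K. \<Sum>m=1..r. (local_basis r K j m t)\<^sup>2) \<le> c"
    by (rule local_basis_bound[of r], rule that, assumption, assumption)
  assume a: "a \<in> basis_index r K"
  have jm: "j < K" "m \<in> {1..r}" using a by (auto simp: basis_index_def Inr p)
  have "(local_basis r K j m t)\<^sup>2 \<le> c" for t
  proof -
    have "(local_basis r K j m t)\<^sup>2 \<le> (\<Sum>m=1..r. (local_basis r K j m t)\<^sup>2)"
      using jm by (intro member_le_sum[of m]) auto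
    also have "\<dots> \<le> (\<Sum>j<K. \<Sum>m=1..r. (local_basis r K j m t)\<^sup>2)"
      using jm by (intro member_le_sum[of j "{..<K}" "\<lambda>j. \<Sum>m=1..r. (local_basis r K j m t)\<^sup>2"]) (auto intro: sum_nonneg)
    also have "\<dots> \<le> c" by (rule c(2)[OF K])
    finally show ?thesis .
  qed
  then have b: "\<bar>local_basis r K j m t\<bar> \<le> sqrt c" for t by (intro real_le_rsqrt) simp
  show ?thesis
  proof (rule L2_fun_bounded[OF finite_measure_axioms, of _ "sqrt c"])
    show "AE z in \<mu>. \<bar>basis_fun r K a z\<bar> \<le> sqrt c" using b by (simp add: Inr p)
  qed measurable
qed

text \<open>The first three claims expand the function in the basis and combine the coefficient
  bound \<open>C2\<close> with the Gram, noise and residual inequalities respectively; by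
  \<open>big1\<close> the Gram error is at most half of the population norm. In the last claim zero
  norm forces zero coefficients, so the function is 0 everywhere and not just almost
  everywhere.\<close>

lemma samp_pop:
  assumes v: "v \<in> pw_poly r K"
  shows "\<bar>samp l v - pop l v\<bar> \<le> pop l v / 2"
    "(\<And>i. a i = reg_fun l v (x i, t i)) \<Longrightarrow> \<bar>avg n (\<lambda>i. w i * a i)\<bar> \<le> sqrt (C2 * real K * pop l v * (L / real n))"
    "\<bar>avg n (\<lambda>i. resid (x i, t i) $ k * v (t i))\<bar> \<le> sqrt (C2 * real K * pop l v * (L / real n))"
    "pop l v = 0 \<Longrightarrow> reg_fun l v = (\<lambda>_. 0)"
proof -
  obtain d where d: "v = (\<lambda>t. \<Sum>j<K. \<Sum>m=1..r. d j m * local_basis r K j m t)"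
    and dd: "(\<Sum>a\<in>basis_index r K. (case a of Inl k \<Rightarrow> l $ k | Inr (j, m) \<Rightarrow> d j m)\<^sup>2) \<le> C2 * real K * pop l v"
    using C2(2)[OF v, of l] unfolding pop_def by blast
  define e where "e a = (case a of Inl k \<Rightarrow> l $ k | Inr (j, m) \<Rightarrow> d j m)" for a
  let ?IX = "basis_index r K :: ('q + nat \<times> nat) set"
  have e2: "(\<Sum>a\<in>?IX. (e a)\<^sup>2) \<le> C2 * real K * pop l v" using dd by (simp add: e_def)
  have rf: "reg_fun l v z = (\<Sum>a\<in>?IX. e a * basis_fun r K a z)" for z
    unfolding e_def by (rule reg_fun_basis[OF d])
  have popeq: "pop l v = (\<Sum>a\<in>?IX. \<Sum>b\<in>?IX. e a * e b * (\<integral>z. basis_fun r K a z * basis_fun r K b z \<partial>\<mu>))"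
  proof -
    have "pop l v = (\<integral>z. (\<Sum>a\<in>?IX. \<Sum>b\<in>?IX. (e a * e b) * (basis_fun r K a z * basis_fun r K b z)) \<partial>\<mu>)"
      unfolding pop_def rf power2_eq_square sum_product
      by (intro Bochner_Integration.integral_cong refl sum.cong) (simp add: mult_ac)
    also have "\<dots> = (\<Sum>a\<in>?IX. \<integral>z. (\<Sum>b\<in>?IX. (e a * e b) * (basis_fun r K a z * basis_fun r K b z)) \<partial>\<mu>)"
      by (rule Bochner_Integration.integral_sum)
        (intro Bochner_Integration.integrable_sum integrable_mult_right L2_fun_mult L2_basis_fun)
    also have "\<dots> = (\<Sum>a\<in>?IX. \<Sum>b\<in>?IX. \<integral>z. (e a * e b) * (basis_fun r K a z * basis_fun r K b z) \<partial>\<mu>)"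
      by (intro sum.cong refl Bochner_Integration.integral_sum integrable_mult_right L2_fun_mult L2_basis_fun)
    finally show ?thesis by simp
  qed
  have "\<bar>samp l v - pop l v\<bar> \<le> (\<Sum>a\<in>?IX. (e a)\<^sup>2) * sqrt (L / real n)"
    unfolding samp_def rf popeq
    by (rule order_trans[OF empirical_form_deviation]) (auto intro!: mult_left_mono real_sqrt_le_mono gram sum_nonneg)
  also have "\<dots> \<le> (C2 * real K * pop l v) * sqrt (L / real n)"
    using e2 L n_pos by (intro mult_right_mono) auto
  also have "\<dots> = pop l v * (C2 * real K * sqrt (L / real n))" by simp
  also have "\<dots> \<le> pop l v * (1 / 2)" by (intro mult_left_mono big1 pop_nonneg)
  finally show "\<bar>samp l v - pop l v\<bar> \<le> pop l v / 2" by simp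
  { assume a: "\<And>i. a i = reg_fun l v (x i, t i)"
    have "\<bar>avg n (\<lambda>i. w i * a i)\<bar> \<le> sqrt ((\<Sum>a\<in>?IX. (e a)\<^sup>2) * (\<Sum>a\<in>?IX. (avg n (\<lambda>i. w i * basis_fun r K a (x i, t i)))\<^sup>2))"
      unfolding a rf by (rule empirical_linear_bound)
    also have "\<dots> \<le> sqrt (C2 * real K * pop l v * (L / real n))"
      using e2 noise_basis C2(1) pop_nonneg by (intro real_sqrt_le_mono mult_mono) (auto intro: sum_nonneg)
    finally show "\<bar>avg n (\<lambda>i. w i * a i)\<bar> \<le> sqrt (C2 * real K * pop l v * (L / real n))" . }
  { have "v (t i) = (\<Sum>p\<in>{..<K} \<times> {1..r}. d (fst p) (snd p) * local_basis r K (fst p) (snd p) (t i))" for i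
      unfolding d by (simp add: sum.cartesian_product split_beta)
    then have "\<bar>avg n (\<lambda>i. resid (x i, t i) $ k * v (t i))\<bar> \<le> sqrt ((\<Sum>p\<in>{..<K} \<times> {1..r}. (d (fst p) (snd p))\<^sup>2) *
        (\<Sum>p\<in>{..<K} \<times> {1..r}. (avg n (\<lambda>i. resid (x i, t i) $ k * local_basis r K (fst p) (snd p) (t i)))\<^sup>2))"
      by (simp only: empirical_linear_bound)
    also have "\<dots> = sqrt ((\<Sum>j<K. \<Sum>m=1..r. (d j m)\<^sup>2) * (\<Sum>j<K. \<Sum>m=1..r. (avg n (\<lambda>i. resid (x i, t i) $ k * local_basis r K j m (t i)))\<^sup>2))"
      by (simp add: sum.cartesian_product split_beta del: resid_component)
    also have "\<dots> \<le> sqrt (C2 * real K * pop l v * (L / real n))"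
    proof (intro real_sqrt_le_mono mult_mono resid_basis)
      have "(\<Sum>j<K. \<Sum>m=1..r. (d j m)\<^sup>2) \<le> (\<Sum>a\<in>?IX. (e a)\<^sup>2)"
        unfolding sum_basis_index by (simp add: e_def sum_nonneg)
      then show "(\<Sum>j<K. \<Sum>m=1..r. (d j m)\<^sup>2) \<le> C2 * real K * pop l v" using e2 by linarith
    qed (use C2(1) pop_nonneg in \<open>auto intro!: sum_nonneg mult_nonneg_nonneg\<close>)
    finally show "\<bar>avg n (\<lambda>i. resid (x i, t i) $ k * v (t i))\<bar> \<le> sqrt (C2 * real K * pop l v * (L / real n))" . }
  { assume "pop l v = 0"
    then have "(\<Sum>a\<in>?IX. (e a)\<^sup>2) \<le> 0" using e2 by simp
    then have "(\<Sum>a\<in>?IX. (e a)\<^sup>2) = 0" by (simp add: order_antisym sum_nonneg)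
    then have "\<And>a. a \<in> ?IX \<Longrightarrow> e a = 0" by (simp add: sum_nonneg_eq_0_iff)
    then show "reg_fun l v = (\<lambda>_. 0)" by (intro ext) (simp add: rf) }
qed

text \<open>Collects 16 from the squared bias and 64 C2 from the noise term in
  \<open>basic_inequality\<close>.\<close>

definition C3 :: real where "C3 = 16 + 64 * C2"

lemma emp_risk_avg: "emp_risk n obs u = avg n (\<lambda>i. (reg_fun \<beta> f (x i, t i) + w i - u (x i, t i))\<^sup>2)"
  by (simp add: emp_risk_def avg_def)

text \<open>The competitor is \<beta> with \<open>fK\<close> on the true index set. Half of the
  empirical norm is absorbed against the bias and an eighth of the population norm against the
  noise. Since the empirical norm is at least half of the population norm, an eighth of the latter
  remains, hence the factor 8 on the penalties.\<close>

lemma basic_inequality: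
  assumes v: "v \<in> pw_poly r K" and min: "emp_risk n obs (reg_fun c v) + log_penalty n r I K \<le> emp_risk n obs (reg_fun \<beta> fK) + log_penalty n r I0 K"
  defines "gt \<equiv> (\<lambda>s. 1 * v s + (-1) * fK s)"
  shows "pop (c - \<beta>) gt \<le> C3 * L * real K / real n + 8 * (log_penalty n r I0 K - log_penalty n r I K)"
proof -
  \<comment> \<open>The form 1 * v + (-1) * fK is an instance of \<open>pw_poly_lincomb\<close> as
    it stands.\<close>
  have gt: "gt \<in> pw_poly r K" unfolding gt_def by (rule pw_poly_lincomb[OF v fK])
  define e b where "e i = reg_fun (c - \<beta>) gt (x i, t i)" and "b i = f (t i) - fK (t i)" for i
  let ?N = "pop (c - \<beta>) gt"
  have N0: "0 \<le> ?N" by (rule pop_nonneg)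
  have r1: "emp_risk n obs (reg_fun c v) = avg n (\<lambda>i. (b i + w i)\<^sup>2) - 2 * avg n (\<lambda>i. b i * e i) - 2 * avg n (\<lambda>i. w i * e i) + avg n (\<lambda>i. (e i)\<^sup>2)"
  proof -
    have "emp_risk n obs (reg_fun c v) = avg n (\<lambda>i. (b i + w i)\<^sup>2 - 2 * (b i * e i) - 2 * (w i * e i) + (e i)\<^sup>2)"
      unfolding emp_risk_avg
      by (intro avg_cong) (simp add: e_def b_def gt_def reg_fun_def inner_diff_left power2_eq_square algebra_simps)
    then show ?thesis by (simp only: avg_add avg_diff avg_cmult)
  qed
  have r2: "emp_risk n obs (reg_fun \<beta> fK) = avg n (\<lambda>i. (b i + w i)\<^sup>2)"
    unfolding emp_risk_avg by (intro avg_cong) (simp add: b_def reg_fun_def algebra_simps)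
  have be: "2 * avg n (\<lambda>i. b i * e i) \<le> 2 * avg n (\<lambda>i. (b i)\<^sup>2) + (1 / 2) * avg n (\<lambda>i. (e i)\<^sup>2)"
  proof -
    have "2 * avg n (\<lambda>i. b i * e i) = avg n (\<lambda>i. 2 * (b i * e i))" by (simp add: avg_cmult)
    also have "\<dots> \<le> avg n (\<lambda>i. 2 * (b i)\<^sup>2 + (1 / 2) * (e i)\<^sup>2)"
    proof (rule avg_mono)
      fix i
      have "0 \<le> (2 * b i - e i)\<^sup>2" by simp
      then show "2 * (b i * e i) \<le> 2 * (b i)\<^sup>2 + (1 / 2) * (e i)\<^sup>2" by (simp add: power2_diff power_mult_distrib)
    qed
    finally show ?thesis by (simp only: avg_add avg_cmult)
  qed
  have bF: "avg n (\<lambda>i. (b i)\<^sup>2) \<le> L * real K / real n" unfolding b_def by (rule bias)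
  have we: "2 * avg n (\<lambda>i. w i * e i) \<le> ?N / 8 + 8 * (C2 * real K * (L / real n))"
  proof -
    define Q where "Q = C2 * real K * (L / real n)"
    have Q0: "0 \<le> Q" using C2(1) L by (simp add: Q_def)
    have "\<bar>avg n (\<lambda>i. w i * e i)\<bar> \<le> sqrt (C2 * real K * ?N * (L / real n))"
      by (rule samp_pop(2)[OF gt]) (simp add: e_def)
    also have "\<dots> = sqrt ((?N / 8) * (8 * Q))" by (simp add: Q_def mult_ac)
    also have "\<dots> \<le> (?N / 8 + 8 * Q) / 2"
      by (rule arith_geo_mean_sqrt) (use N0 Q0 in auto)
    finally have "avg n (\<lambda>i. w i * e i) \<le> (?N / 8 + 8 * Q) / 2" by (rule abs_le_D1)
    then show ?thesis unfolding Q_def[symmetric] by (simp add: pos_le_divide_eq mult.commute)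
  qed
  have "\<bar>samp (c - \<beta>) gt - ?N\<bar> \<le> ?N / 2" by (rule samp_pop(1)[OF gt])
  then have lo: "?N / 2 \<le> avg n (\<lambda>i. (e i)\<^sup>2)" unfolding samp_def e_def by linarith
  have "(1/2) * avg n (\<lambda>i. (e i)\<^sup>2) \<le> 2 * avg n (\<lambda>i. (b i)\<^sup>2) + 2 * avg n (\<lambda>i. w i * e i) + (log_penalty n r I0 K - log_penalty n r I K)"
    using min be unfolding r1 r2 by linarith
  then have "?N / 4 \<le> 2 * (L * real K / real n) + (?N / 8 + 8 * (C2 * real K * (L / real n))) + (log_penalty n r I0 K - log_penalty n r I K)"
    using lo bF we by linarith
  moreover have "y \<le> 16 * p + 64 * q + 8 * s" if "y / 4 \<le> 2 * p + (y / 8 + 8 * q) + s" for y p q s :: real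
    using that by linarith
  ultimately have "?N \<le> 16 * (L * real K / real n) + 64 * (C2 * real K * (L / real n)) + 8 * (log_penalty n r I0 K - log_penalty n r I K)"
    by blast
  also have "16 * (L * real K / real n) + 64 * (C2 * real K * (L / real n)) = C3 * L * real K / real n"
    by (simp add: C3_def algebra_simps add_divide_distrib)
  finally show ?thesis .
qed

lemma ln_n_pos: "ln (real n) > 0" using n by simp

text \<open>A set with more elements than \<open>I0\<close> makes the right-hand side of
  \<open>N\<close> negative; a set that misses some j in \<open>I0\<close> makes the left-hand side
  at least lam * bmin^2. The cardinality bound and the inclusion together force equality.\<close>

lemma selection_consistent:
  assumes v: "v \<in> pw_poly r K" and c: "\<forall>j. j \<notin> I \<longrightarrow> c $ j = 0"
    and N: "pop (c - \<beta>) gt \<le> C3 * L * real K / real n + 8 * (log_penalty n r I0 K - log_penalty n r I K)"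
    and gt: "gt \<in> pw_poly r K"
  shows "I = I0"
proof (rule card_seteq[symmetric])
  let ?u = "real r * real K * (ln (real n) / real n)"
  have u: "?u > 0" using r K n_pos ln_n_pos by simp
  have pen: "8 * (log_penalty n r I0 K - log_penalty n r I K) = 16 * (real (card I0) - real (card I)) * ?u"
    by (simp add: log_penalty_def algebra_simps)
  have C3L: "C3 * L * real K / real n < 16 * ?u"
  proof -
    have "C3 * L * (real K / real n) < (16 * real r * ln (real n)) * (real K / real n)"
      using big2 K n_pos unfolding C3_def by (intro mult_strict_right_mono) auto
    then show ?thesis by (simp add: mult_ac)
  qed
  show "card I \<le> card I0"
  proof (rule ccontr)
    assume "\<not> card I \<le> card I0"
    then have "real (card I0) - real (card I) \<le> -1" by linarith
    then have "16 * (real (card I0) - real (card I)) * ?u \<le> 16 * (-1) * ?u"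
      using u by (intro mult_right_mono mult_left_mono) auto
    then show False using N C3L pop_nonneg[of "c - \<beta>" gt] unfolding pen by linarith
  qed
  show "I0 \<subseteq> I"
  proof (rule ccontr)
    assume "\<not> I0 \<subseteq> I"
    then obtain j where j: "j \<in> I0" "j \<notin> I" by blast
    then have "bmin \<le> \<bar>(c - \<beta>) $ j\<bar>" using bmin(2) c by auto
    also have "\<dots> \<le> norm (c - \<beta>)" by (rule component_le_norm_cart)
    finally have "bmin\<^sup>2 \<le> (norm (c - \<beta>))\<^sup>2" using bmin(1) by (intro power_mono) auto
    then have "lam * bmin\<^sup>2 \<le> lam * (norm (c - \<beta>))\<^sup>2" using lam(1) by (intro mult_left_mono) auto
    also have "\<dots> \<le> pop (c - \<beta>) gt"
      unfolding pop_def by (rule linear_part_bound[OF pw_poly_measurable[OF gt] L2_pw_poly[OF gt r K]])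
    also note N
    also have "8 * (log_penalty n r I0 K - log_penalty n r I K) \<le> 16 * (real CARD('q) + 1) * ?u"
    proof -
      have "card I0 \<le> CARD('q)" by (rule card_mono) auto
      then have "real (card I0) - real (card I) \<le> real CARD('q) + 1" by linarith
      then show ?thesis unfolding pen using u by (intro mult_right_mono) auto
    qed
    finally show False using big3 unfolding C3_def by (simp add: mult_ac)
  qed
qed simp

end

context fit
begin

text \<open>Strict convexity at the midpoint of two minimizers: their difference has empirical norm
  0, hence population norm 0, hence zero coefficients. The last step gives equality as functions, as
  \<open>unique_least_squares\<close> demands.\<close>

lemma unique_fit:
  assumes u: "u \<in> approx_space r I K" and min: "\<And>u'. u' \<in> approx_space r I K \<Longrightarrow> emp_risk n obs u \<le> emp_risk n obs u'"
  shows "unique_least_squares n obs (approx_space r I K)"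
  unfolding unique_least_squares_def
proof (rule ex1I[of _ u])
  show "u \<in> approx_space r I K \<and> (\<forall>u'\<in>approx_space r I K. emp_risk n obs u \<le> emp_risk n obs u')"
    using u min by blast
  fix u2 assume u2: "u2 \<in> approx_space r I K \<and> (\<forall>u'\<in>approx_space r I K. emp_risk n obs u2 \<le> emp_risk n obs u')"
  obtain c1 v1 where 1: "u = reg_fun c1 v1" "\<forall>j. j \<notin> I \<longrightarrow> c1 $ j = 0" "v1 \<in> pw_poly r K"
    using u unfolding approx_space_def by blast
  obtain c2 v2 where 2: "u2 = reg_fun c2 v2" "\<forall>j. j \<notin> I \<longrightarrow> c2 $ j = 0" "v2 \<in> pw_poly r K"
    using u2 unfolding approx_space_def by blast
  define vm vd where "vm = (\<lambda>s. (1/2) * v1 s + (1/2) * v2 s)" and "vd = (\<lambda>s. 1 * v1 s + (-1) * v2 s)"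
  have vd: "vd \<in> pw_poly r K" unfolding vd_def by (rule pw_poly_lincomb[OF 1(3) 2(3)])
  have mid: "reg_fun ((1/2) *\<^sub>R (c1 + c2)) vm \<in> approx_space r I K"
    unfolding vm_def using 1(2) 2(2) by (intro approx_spaceI pw_poly_lincomb 1(3) 2(3)) simp
  let ?y = "\<lambda>i. reg_fun \<beta> f (x i, t i) + w i"
  have eq: "emp_risk n obs (reg_fun ((1/2) *\<^sub>R (c1 + c2)) vm) = (1/2) * emp_risk n obs u + (1/2) * emp_risk n obs u2 - (1/4) * samp (c1 - c2) vd"
  proof -
    have "emp_risk n obs (reg_fun ((1/2) *\<^sub>R (c1 + c2)) vm) = avg n (\<lambda>i. (1/2) * (?y i - u (x i, t i))\<^sup>2 + (1/2) * (?y i - u2 (x i, t i))\<^sup>2 - (1/4) * (reg_fun (c1 - c2) vd (x i, t i))\<^sup>2)"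
      unfolding emp_risk_avg
    proof (intro avg_cong)
      fix i
      have m: "reg_fun ((1/2) *\<^sub>R (c1 + c2)) vm (x i, t i) = (u (x i, t i) + u2 (x i, t i)) / 2"
        by (simp add: reg_fun_def vm_def 1(1) 2(1) inner_add_left algebra_simps)
      have d: "reg_fun (c1 - c2) vd (x i, t i) = u (x i, t i) - u2 (x i, t i)"
        by (simp add: reg_fun_def vd_def 1(1) 2(1) inner_diff_left)
      have "(a - (p + q) / 2)\<^sup>2 = (1/2) * (a - p)\<^sup>2 + (1/2) * (a - q)\<^sup>2 - (1/4) * (p - q)\<^sup>2" for a p q :: real
        by (simp add: power2_eq_square field_simps)
      then show "(?y i - reg_fun ((1/2) *\<^sub>R (c1 + c2)) vm (x i, t i))\<^sup>2 = (1/2) * (?y i - u (x i, t i))\<^sup>2 + (1/2) * (?y i - u2 (x i, t i))\<^sup>2 - (1/4) * (reg_fun (c1 - c2) vd (x i, t i))\<^sup>2"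
        unfolding m d by blast
    qed
    then show ?thesis unfolding emp_risk_avg samp_def by (simp only: avg_add avg_diff avg_cmult)
  qed
  have "emp_risk n obs u \<le> emp_risk n obs (reg_fun ((1/2) *\<^sub>R (c1 + c2)) vm)" by (rule min[OF mid])
  moreover have "emp_risk n obs u2 \<le> emp_risk n obs u" using u2 u by blast
  ultimately have s0: "samp (c1 - c2) vd \<le> 0" unfolding eq by linarith
  have "pop (c1 - c2) vd = 0"
    using samp_pop(1)[OF vd, of "c1 - c2"] s0 pop_nonneg[of "c1 - c2" vd] by linarith
  then have z: "reg_fun (c1 - c2) vd = (\<lambda>_. 0)" by (rule samp_pop(4)[OF vd])
  show "u2 = u"
  proof
    fix z
    have "reg_fun (c1 - c2) vd z = u z - u2 z"
      by (simp add: reg_fun_def vd_def 1(1) 2(1) inner_diff_left split_beta)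
    then show "u2 z = u z" using z by simp
  qed
qed

text \<open>Shows that the sample lies in the event \<Gamma> of the estimator: the squared norm
  under \<open>\<mu>\<close> is at most 2 S + 2, the lower density bound h0 turns it into a Lebesgue
  norm, and \<open>big5\<close> compares it with the growing threshold.\<close>

lemma norm_bound:
  assumes v: "v \<in> pw_poly r K" and N: "pop (c - \<beta>) (\<lambda>s. 1 * v s + (-1) * fK s) \<le> 1"
  shows "L2_norm (restrict_space lborel (\<K> \<times> {0..1})) (reg_fun c v) \<le> ennreal (2 * exp ((ln (real n))\<^sup>2))"
proof -
  let ?gt = "\<lambda>s. 1 * v s + (-1) * fK s" and ?E = "2 * exp ((ln (real n))\<^sup>2)"
  have gt: "?gt \<in> pw_poly r K" by (rule pw_poly_lincomb[OF v fK])
  have m: "reg_fun c v \<in> borel_measurable borel"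
  proof -
    have [measurable]: "v \<in> borel_measurable borel" by (rule pw_poly_measurable[OF v])
    have "(\<lambda>z. c \<bullet> fst z + v (snd z)) \<in> borel_measurable borel" by measurable
    then show ?thesis by (simp add: reg_fun_def split_beta')
  qed
  have i: "integrable \<mu> (\<lambda>z. (reg_fun c v z)\<^sup>2)" by (rule L2_fun_integrable_sq[OF L2_reg[OF v]])
  have i2: "integrable \<mu> (\<lambda>z. 2 * (reg_fun \<beta> fK z)\<^sup>2 + 2 * (reg_fun (c - \<beta>) ?gt z)\<^sup>2)"
    by (intro Bochner_Integration.integrable_add integrable_mult_right L2_fun_integrable_sq L2_reg fK gt)
  have "(\<integral>z. (reg_fun c v z)\<^sup>2 \<partial>\<mu>) \<le> (\<integral>z. 2 * (reg_fun \<beta> fK z)\<^sup>2 + 2 * (reg_fun (c - \<beta>) ?gt z)\<^sup>2 \<partial>\<mu>)"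
  proof (rule integral_mono[OF i i2])
    fix z
    have "reg_fun c v z = reg_fun \<beta> fK z + reg_fun (c - \<beta>) ?gt z"
      by (simp add: reg_fun_def split_beta inner_diff_left)
    then show "(reg_fun c v z)\<^sup>2 \<le> 2 * (reg_fun \<beta> fK z)\<^sup>2 + 2 * (reg_fun (c - \<beta>) ?gt z)\<^sup>2"
      using sum_squares_bound[of "reg_fun \<beta> fK z" "reg_fun (c - \<beta>) ?gt z"] by (simp add: power2_sum)
  qed
  also have "\<dots> = 2 * (\<integral>z. (reg_fun \<beta> fK z)\<^sup>2 \<partial>\<mu>) + 2 * pop (c - \<beta>) ?gt"
    unfolding pop_def using L2_fun_integrable_sq[OF L2_reg[OF fK]] L2_fun_integrable_sq[OF L2_reg[OF gt]] by simp
  also have "\<dots> \<le> 2 * S + 2" using S N by linarith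
  finally have u2: "(\<integral>z. (reg_fun c v z)\<^sup>2 \<partial>\<mu>) \<le> 2 * S + 2" .
  let ?J = "\<integral>\<^sup>+z. ennreal ((reg_fun c v z)\<^sup>2) \<partial>restrict_space lborel (\<K> \<times> {0..1})"
  have mm: "(\<lambda>z. ennreal ((reg_fun c v z)\<^sup>2)) \<in> borel_measurable borel" using m by measurable
  have Je: "?J = (\<integral>\<^sup>+z. ennreal ((reg_fun c v z)\<^sup>2) * indicator (\<K> \<times> {0..1}) z \<partial>lborel)"
    by (rule nn_integral_restrict_space) simp
  have "ennreal h0 * ?J \<le> (\<integral>\<^sup>+z. ennreal ((reg_fun c v z)\<^sup>2) \<partial>\<mu>)"
    unfolding Je by (rule nn_integral_mu_lower[OF mm])
  also have "\<dots> = ennreal (\<integral>z. (reg_fun c v z)\<^sup>2 \<partial>\<mu>)" by (rule nn_integral_eq_integral[OF i]) simp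
  also have "\<dots> \<le> ennreal (2 * S + 2)" by (rule ennreal_leI[OF u2])
  finally have "ennreal (1 / h0) * (ennreal h0 * ?J) \<le> ennreal (1 / h0) * ennreal (2 * S + 2)"
    by (rule mult_left_mono) simp
  moreover have "ennreal (1 / h0) * (ennreal h0 * ?J) = ?J"
  proof -
    have "ennreal (1 / h0) * ennreal h0 = ennreal (1 / h0 * h0)" using h0_pos by (intro ennreal_mult[symmetric]) auto
    then have "ennreal (1 / h0) * ennreal h0 = 1" using h0_pos by simp
    then show ?thesis by (simp only: mult.assoc[symmetric] mult_1_left)
  qed
  moreover have "ennreal (1 / h0) * ennreal (2 * S + 2) = ennreal ((2 * S + 2) / h0)"
  proof -
    have "0 \<le> S" using S by (rule order_trans[rotated]) simp
    then have "ennreal (1 / h0) * ennreal (2 * S + 2) = ennreal (1 / h0 * (2 * S + 2))"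
      using h0_pos by (intro ennreal_mult[symmetric]) auto
    then show ?thesis by simp
  qed
  ultimately have "?J \<le> ennreal ((2 * S + 2) / h0)" by simp
  also have "\<dots> \<le> ennreal (?E\<^sup>2)" by (rule ennreal_leI[OF big5])
  finally have J: "?J \<le> ennreal (?E\<^sup>2)" .
  then have "?J \<noteq> \<infinity>" by (auto simp: top_unique)
  then have "L2_norm (restrict_space lborel (\<K> \<times> {0..1})) (reg_fun c v) = ennreal (sqrt (enn2real ?J))"
    by (simp add: L2_norm_def Let_def)
  also have "enn2real ?J \<le> ?E\<^sup>2" using J by (intro enn2real_leI) auto
  then have "ennreal (sqrt (enn2real ?J)) \<le> ennreal ?E"
    by (intro ennreal_leI real_le_lsqrt) auto
  finally show ?thesis .
qed

text \<open>Moving by s times x j - g j stays in the space, because j belongs to \<open>I\<close>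
  and g j is piecewise polynomial; so the risk, a quadratic in s, is minimal at s = 0. Here g j
  stands in for \<theta> j, which need not be piecewise polynomial.\<close>

lemma normal_equation:
  assumes u: "u = reg_fun c v" "\<forall>j. j \<notin> I \<longrightarrow> c $ j = 0" "v \<in> pw_poly r K"
    and min: "\<And>u'. u' \<in> approx_space r I K \<Longrightarrow> emp_risk n obs u \<le> emp_risk n obs u'"
    and j: "j \<in> I"
  shows "avg n (\<lambda>i. (reg_fun \<beta> f (x i, t i) + w i - u (x i, t i)) * (x i $ j - g j (t i))) = 0"
proof (rule quadratic_nonneg_imp_0)
  let ?y = "\<lambda>i. reg_fun \<beta> f (x i, t i) + w i - u (x i, t i)" and ?h = "\<lambda>i. x i $ j - g j (t i)"
  show "0 \<le> avg n (\<lambda>i. (?h i)\<^sup>2)" by (rule avg_nonneg) simp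
  fix s :: real
  let ?v = "\<lambda>a. 1 * v a + (- s) * g j a"
  have "reg_fun (c + s *\<^sub>R axis j 1) ?v \<in> approx_space r I K"
    using u(2) j by (intro approx_spaceI pw_poly_lincomb u(3) g) (auto simp: axis_def)
  then have "emp_risk n obs u \<le> emp_risk n obs (reg_fun (c + s *\<^sub>R axis j 1) ?v)" by (rule min)
  also have "\<dots> = avg n (\<lambda>i. (?y i)\<^sup>2 - (2 * s) * (?y i * ?h i) + s\<^sup>2 * (?h i)\<^sup>2)"
    unfolding emp_risk_avg
  proof (intro avg_cong)
    fix i
    have "reg_fun (c + s *\<^sub>R axis j 1) ?v (x i, t i) = u (x i, t i) + s * ?h i"
      by (simp add: u(1) reg_fun_def inner_add_left inner_axis' algebra_simps)
    moreover have "(y - (p + s * h))\<^sup>2 = (y - p)\<^sup>2 - (2 * s) * ((y - p) * h) + s\<^sup>2 * h\<^sup>2" for y p h :: real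
      by (simp add: power2_eq_square algebra_simps)
    ultimately show "(reg_fun \<beta> f (x i, t i) + w i - reg_fun (c + s *\<^sub>R axis j 1) ?v (x i, t i))\<^sup>2 = (?y i)\<^sup>2 - (2 * s) * (?y i * ?h i) + s\<^sup>2 * (?h i)\<^sup>2"
      by presburger
  qed
  also have "\<dots> = emp_risk n obs u - 2 * s * avg n (\<lambda>i. ?y i * ?h i) + s\<^sup>2 * avg n (\<lambda>i. (?h i)\<^sup>2)"
    unfolding emp_risk_avg by (simp only: avg_add avg_diff avg_cmult)
  finally show "0 \<le> s\<^sup>2 * avg n (\<lambda>i. (?h i)\<^sup>2) - 2 * s * avg n (\<lambda>i. ?y i * ?h i)" by linarith
qed

text \<open>One term for each of the facts \<open>t1\<close> to \<open>t6\<close> in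
  \<open>score_equation\<close>, in this order: bias times residual, bias times \<eta>, noise times
  \<eta>, estimation error times \<eta>, sampling error of the covariance, residual times the error
  of the piecewise polynomial. Here \<eta> is the approximation error of \<theta> j.\<close>

definition err :: real where
  "err = sqrt (L * real K / (real n)\<^sup>2) + sqrt ((L * real K / real n) * (L * \<epsilon> / real K)) + sqrt (L * \<epsilon> / real n)
     + sqrt ((2 * (C3 * L * real K / real n)) * (L * \<epsilon> / real K))
     + real CARD('q) * (sqrt (C3 * L * real K / real n / lam) * sqrt (L / real n))
     + sqrt (C2 * real K * (C3 * L * real K / real n) * (L / real n))"

text \<open>The fit residual is b + w - e and the direction is \<rho> + \<eta>, with b the bias, e
  the estimation error and \<rho> the projection residual. Of the products, w \<rho> and the part of
  e \<rho> that is linear in c - \<beta> are kept; the others go into \<open>err\<close>, as does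
  the replacement of the empirical covariance by \<open>Sigma_mat\<close>.\<close>

lemma score_equation:
  assumes v: "v \<in> pw_poly r K" and N: "pop (c - \<beta>) gt \<le> C3 * L * real K / real n"
    and gt: "gt = (\<lambda>s. 1 * v s + (-1) * fK s)"
    and ne: "avg n (\<lambda>i. (reg_fun \<beta> f (x i, t i) + w i - reg_fun c v (x i, t i)) * (x i $ j - g j (t i))) = 0"
  shows "\<bar>(\<Sum>k\<in>UNIV. (c $ k - \<beta> $ k) * Sigma_mat \<mu> \<kappa> $ k $ j) - avg n (\<lambda>i. w i * resid (x i, t i) $ j)\<bar> \<le> err"
proof -
  have gtp: "gt \<in> pw_poly r K" unfolding gt by (rule pw_poly_lincomb[OF v fK])
  define b e \<rho> \<eta> where "b i = f (t i) - fK (t i)" and "e i = reg_fun (c - \<beta>) gt (x i, t i)"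
    and "\<rho> i = resid (x i, t i) $ j" and "\<eta> i = cond_mean \<kappa> j (t i) - g j (t i)" for i
  define \<delta> where "\<delta> k = c $ k - \<beta> $ k" for k
  let ?N = "pop (c - \<beta>) gt" and ?R = "C3 * L * real K / real n"
  have nL: "0 \<le> L / real n" using L n_pos by simp
  have 0: "avg n (\<lambda>i. b i * \<rho> i + b i * \<eta> i + w i * \<rho> i + w i * \<eta> i - e i * \<eta> i - ((\<Sum>k\<in>UNIV. \<delta> k * (x i $ k * \<rho> i)) + \<rho> i * gt (t i))) = 0"
  proof -
    have "(reg_fun \<beta> f (x i, t i) + w i - reg_fun c v (x i, t i)) * (x i $ j - g j (t i)) =
       b i * \<rho> i + b i * \<eta> i + w i * \<rho> i + w i * \<eta> i - e i * \<eta> i - ((\<Sum>k\<in>UNIV. \<delta> k * (x i $ k * \<rho> i)) + \<rho> i * gt (t i))" for i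
    proof -
      have 1: "reg_fun \<beta> f (x i, t i) + w i - reg_fun c v (x i, t i) = b i + w i - e i"
        by (simp add: reg_fun_def b_def e_def gt inner_diff_left)
      have 2: "x i $ j - g j (t i) = \<rho> i + \<eta> i" by (simp add: \<rho>_def \<eta>_def)
      have 3: "e i * \<rho> i = (\<Sum>k\<in>UNIV. \<delta> k * (x i $ k * \<rho> i)) + \<rho> i * gt (t i)"
        by (simp add: e_def reg_fun_def inner_vec_def \<delta>_def sum_distrib_left sum_distrib_right distrib_left distrib_right mult_ac)
      show ?thesis unfolding 1 2 3[symmetric] by (simp add: algebra_simps)
    qed
    then show ?thesis using ne by simp
  qed
  have eq: "(\<Sum>k\<in>UNIV. \<delta> k * avg n (\<lambda>i. x i $ k * \<rho> i)) = avg n (\<lambda>i. b i * \<rho> i) + avg n (\<lambda>i. b i * \<eta> i)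
     + avg n (\<lambda>i. w i * \<rho> i) + avg n (\<lambda>i. w i * \<eta> i) - avg n (\<lambda>i. e i * \<eta> i) - avg n (\<lambda>i. \<rho> i * gt (t i))"
    using 0 unfolding avg_add avg_diff avg_sum avg_cmult by linarith
  have t1: "\<bar>avg n (\<lambda>i. b i * \<rho> i)\<bar> \<le> sqrt (L * real K / (real n)\<^sup>2)"
    unfolding b_def \<rho>_def by (rule real_le_rsqrt) (use bias_resid[of j] in simp)
  have t2: "\<bar>avg n (\<lambda>i. b i * \<eta> i)\<bar> \<le> sqrt ((L * real K / real n) * (L * \<epsilon> / real K))"
    unfolding b_def \<eta>_def by (rule avg_abs_le[OF bias bias_theta])
  have t3: "\<bar>avg n (\<lambda>i. w i * \<eta> i)\<bar> \<le> sqrt (L * \<epsilon> / real n)"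
    unfolding \<eta>_def by (rule real_le_rsqrt) (use noise_theta[of j] in simp)
  have en: "avg n (\<lambda>i. (e i)\<^sup>2) \<le> 2 * ?R"
    using samp_pop(1)[OF gtp, of "c - \<beta>"] N pop_nonneg[of "c - \<beta>" gt] unfolding samp_def e_def by linarith
  have t4: "\<bar>avg n (\<lambda>i. e i * \<eta> i)\<bar> \<le> sqrt ((2 * ?R) * (L * \<epsilon> / real K))"
    using en unfolding \<eta>_def by (rule avg_abs_le[OF _ bias_theta])
  have t6: "\<bar>avg n (\<lambda>i. \<rho> i * gt (t i))\<bar> \<le> sqrt (C2 * real K * ?R * (L / real n))"
  proof -
    have "\<bar>avg n (\<lambda>i. \<rho> i * gt (t i))\<bar> \<le> sqrt (C2 * real K * ?N * (L / real n))"
      unfolding \<rho>_def by (rule samp_pop(3)[OF gtp])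
    also have "\<dots> \<le> sqrt (C2 * real K * ?R * (L / real n))"
      using N nL C2(1) by (intro real_sqrt_le_mono mult_right_mono mult_left_mono) auto
    finally show ?thesis .
  qed
  have nd: "norm (c - \<beta>) \<le> sqrt (?R / lam)"
  proof (rule real_le_rsqrt)
    have "lam * (norm (c - \<beta>))\<^sup>2 \<le> ?N"
      unfolding pop_def by (rule linear_part_bound[OF pw_poly_measurable[OF gtp] L2_pw_poly[OF gtp r K]])
    then have "lam * (norm (c - \<beta>))\<^sup>2 \<le> ?R" using N by linarith
    then show "(norm (c - \<beta>))\<^sup>2 \<le> ?R / lam" by (subst pos_le_divide_eq[OF lam(1)], subst mult.commute)
  qed
  have t5: "\<bar>(\<Sum>k\<in>UNIV. \<delta> k * Sigma_mat \<mu> \<kappa> $ k $ j) - (\<Sum>k\<in>UNIV. \<delta> k * avg n (\<lambda>i. x i $ k * \<rho> i))\<bar>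
     \<le> real CARD('q) * (sqrt (?R / lam) * sqrt (L / real n))"
  proof -
    have "\<bar>(\<Sum>k\<in>UNIV. \<delta> k * Sigma_mat \<mu> \<kappa> $ k $ j) - (\<Sum>k\<in>UNIV. \<delta> k * avg n (\<lambda>i. x i $ k * \<rho> i))\<bar>
      = \<bar>\<Sum>k\<in>UNIV. \<delta> k * (Sigma_mat \<mu> \<kappa> $ k $ j - avg n (\<lambda>i. x i $ k * \<rho> i))\<bar>"
      by (simp add: sum_subtractf right_diff_distrib)
    also have "\<dots> \<le> (\<Sum>k\<in>UNIV. \<bar>\<delta> k * (Sigma_mat \<mu> \<kappa> $ k $ j - avg n (\<lambda>i. x i $ k * \<rho> i))\<bar>)" by (rule sum_abs)
    also have "\<dots> \<le> (\<Sum>k\<in>(UNIV :: 'q set). sqrt (?R / lam) * sqrt (L / real n))"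
    proof (rule sum_mono)
      fix k :: 'q
      have "\<bar>\<delta> k\<bar> \<le> norm (c - \<beta>)" using component_le_norm_cart[of "c - \<beta>" k] by (simp add: \<delta>_def)
      then have a: "\<bar>\<delta> k\<bar> \<le> sqrt (?R / lam)" using nd by linarith
      have bb: "\<bar>Sigma_mat \<mu> \<kappa> $ k $ j - avg n (\<lambda>i. x i $ k * \<rho> i)\<bar> \<le> sqrt (L / real n)"
        using cov_dev[of k j] unfolding \<rho>_def by (intro real_le_rsqrt) (simp only: power2_abs power2_commute)
      show "\<bar>\<delta> k * (Sigma_mat \<mu> \<kappa> $ k $ j - avg n (\<lambda>i. x i $ k * \<rho> i))\<bar> \<le> sqrt (?R / lam) * sqrt (L / real n)"
        unfolding abs_mult by (rule mult_mono[OF a bb order_trans[OF abs_ge_zero a] abs_ge_zero])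
    qed
    finally show ?thesis by simp
  qed
  show ?thesis
    using t1 t2 t3 t4 t5 t6 eq unfolding err_def \<delta>_def[symmetric] \<rho>_def[symmetric] by linarith
qed

text \<open>On the good event the value is the fitted vector c itself: the selected set is
  \<open>I0\<close>, least squares is unique there, and the norm restriction holds. Multiplying the
  score equations for j in \<open>I0\<close> by the block inverse isolates each component; outside
  \<open>I0\<close> the difference is exactly 0.\<close>

theorem selected_value_expansion:
  assumes sv: "selected_value n r \<K> (UNIV \<times> {K}) (log_penalty n r) obs bh"
  defines "B \<equiv> block_inv I0 (Sigma_mat \<mu> \<kappa>)"
  shows "\<bar>(bh $ i - \<beta> $ i) - (if i \<in> I0 then \<Sum>j\<in>I0. B $ i $ j * avg n (\<lambda>l. w l * resid (x l, t l) $ j) else 0)\<bar>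
     \<le> (\<Sum>i\<in>UNIV. \<Sum>j\<in>UNIV. \<bar>B $ i $ j\<bar>) * err"
proof -
  obtain I K' c v where c: "\<forall>j. j \<notin> I \<longrightarrow> c $ j = 0" and v': "v \<in> pw_poly r K'"
    and pm: "penalized_minimizer n r (UNIV \<times> {K}) (log_penalty n r) obs I K' (reg_fun c v)"
    and bh: "bh = (if unique_least_squares n obs (approx_space r I K') \<and>
                 L2_norm (restrict_space lborel (\<K> \<times> {0..1})) (reg_fun c v)
                   \<le> ennreal (2 * exp ((ln (real n))\<^sup>2))
              then c else 0)"
    using sv unfolding selected_value_def by blast
  have KK: "K' = K" using pm by (simp add: penalized_minimizer_def)
  have v: "v \<in> pw_poly r K" using v' KK by simp
  define gt where "gt = (\<lambda>s. 1 * v s + (-1) * fK s)"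
  have gtp: "gt \<in> pw_poly r K" unfolding gt_def by (rule pw_poly_lincomb[OF v fK])
  have min: "emp_risk n obs (reg_fun c v) + log_penalty n r I K \<le> emp_risk n obs u' + log_penalty n r I' K"
    if "u' \<in> approx_space r I' K" for u' I'
    using pm that unfolding penalized_minimizer_def KK by fastforce
  have sK: "reg_fun \<beta> fK \<in> approx_space r I0 K" by (rule approx_spaceI) (auto simp: I0 fK)
  have bi: "pop (c - \<beta>) gt \<le> C3 * L * real K / real n + 8 * (log_penalty n r I0 K - log_penalty n r I K)"
    unfolding gt_def by (rule basic_inequality[OF v min[OF sK]])
  have II: "I = I0" by (rule selection_consistent[OF v c bi gtp])
  have N: "pop (c - \<beta>) gt \<le> C3 * L * real K / real n" using bi unfolding II by simp
  have min': "emp_risk n obs (reg_fun c v) \<le> emp_risk n obs u'" if "u' \<in> approx_space r I K" for u'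
    using min[OF that] by simp
  have "unique_least_squares n obs (approx_space r I K)"
    by (rule unique_fit[OF approx_spaceI[OF c v] min'])
  moreover have "pop (c - \<beta>) gt \<le> 1" using N big4 unfolding C3_def by linarith
  ultimately have bc: "bh = c" unfolding bh KK using norm_bound[OF v] by (simp add: gt_def)
  have err0: "0 \<le> err"
    unfolding err_def C3_def using L C2(1) \<epsilon> lam(1)
    by (intro add_nonneg_nonneg mult_nonneg_nonneg real_sqrt_ge_zero divide_nonneg_nonneg) auto
  have score: "\<bar>(\<Sum>k\<in>UNIV. (c $ k - \<beta> $ k) * Sigma_mat \<mu> \<kappa> $ k $ j) - avg n (\<lambda>i. w i * resid (x i, t i) $ j)\<bar> \<le> err"
    if "j \<in> I0" for j
    by (rule score_equation[OF v N gt_def normal_equation[OF refl c v min']]) (use that II in auto)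
  have Bsum: "(\<Sum>j\<in>I0. \<bar>B $ i $ j\<bar>) \<le> (\<Sum>i\<in>UNIV. \<Sum>j\<in>UNIV. \<bar>B $ i $ j\<bar>)"
  proof -
    have "(\<Sum>j\<in>I0. \<bar>B $ i $ j\<bar>) \<le> (\<Sum>j\<in>UNIV. \<bar>B $ i $ j\<bar>)" by (rule sum_mono2) auto
    also have "\<dots> \<le> (\<Sum>i\<in>UNIV. \<Sum>j\<in>UNIV. \<bar>B $ i $ j\<bar>)"
      by (rule member_le_sum[of i UNIV "\<lambda>i. \<Sum>j\<in>UNIV. \<bar>B $ i $ j\<bar>"]) (auto intro: sum_nonneg)
    finally show ?thesis .
  qed
  show ?thesis
  proof (cases "i \<in> I0")
    case True
    have BA: "(\<Sum>j\<in>I0. B $ i $ j * Sigma_mat \<mu> \<kappa> $ k $ j) = (if i = k then 1 else 0)" if "k \<in> I0" for k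
    proof -
      have "Sigma_mat \<mu> \<kappa> $ k $ j = Sigma_mat \<mu> \<kappa> $ j $ k" for j
        using Sigma_sym by (metis transpose_def vec_lambda_beta)
      then show ?thesis
        using block_inv_factor(1)[OF Sigma_posdef Sigma_sym True that] by (simp add: B_def)
    qed
    have d0: "c $ k - \<beta> $ k = 0" if "k \<notin> I0" for k using c that II by (simp add: I0)
    have "(\<Sum>j\<in>I0. B $ i $ j * (\<Sum>k\<in>UNIV. (c $ k - \<beta> $ k) * Sigma_mat \<mu> \<kappa> $ k $ j))
       = (\<Sum>j\<in>I0. \<Sum>k\<in>I0. (c $ k - \<beta> $ k) * (B $ i $ j * Sigma_mat \<mu> \<kappa> $ k $ j))"
    proof (intro sum.cong refl)
      fix j
      have "(\<Sum>k\<in>UNIV. (c $ k - \<beta> $ k) * Sigma_mat \<mu> \<kappa> $ k $ j) = (\<Sum>k\<in>I0. (c $ k - \<beta> $ k) * Sigma_mat \<mu> \<kappa> $ k $ j)"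
        using d0 by (intro sum.mono_neutral_right) auto
      then show "B $ i $ j * (\<Sum>k\<in>UNIV. (c $ k - \<beta> $ k) * Sigma_mat \<mu> \<kappa> $ k $ j) = (\<Sum>k\<in>I0. (c $ k - \<beta> $ k) * (B $ i $ j * Sigma_mat \<mu> \<kappa> $ k $ j))"
        by (simp add: sum_distrib_left mult_ac)
    qed
    also have "\<dots> = (\<Sum>k\<in>I0. (c $ k - \<beta> $ k) * (\<Sum>j\<in>I0. B $ i $ j * Sigma_mat \<mu> \<kappa> $ k $ j))"
      unfolding sum_distrib_left by (rule sum.swap)
    also have "\<dots> = (\<Sum>k\<in>I0. if i = k then c $ k - \<beta> $ k else 0)"
      using BA by (intro sum.cong refl) auto
    also have "\<dots> = c $ i - \<beta> $ i" using True by (simp add: sum.delta)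
    finally have e: "c $ i - \<beta> $ i = (\<Sum>j\<in>I0. B $ i $ j * (\<Sum>k\<in>UNIV. (c $ k - \<beta> $ k) * Sigma_mat \<mu> \<kappa> $ k $ j))" by simp
    have "\<bar>(c $ i - \<beta> $ i) - (\<Sum>j\<in>I0. B $ i $ j * avg n (\<lambda>l. w l * resid (x l, t l) $ j))\<bar>
      = \<bar>\<Sum>j\<in>I0. B $ i $ j * ((\<Sum>k\<in>UNIV. (c $ k - \<beta> $ k) * Sigma_mat \<mu> \<kappa> $ k $ j) - avg n (\<lambda>l. w l * resid (x l, t l) $ j))\<bar>"
      unfolding e by (simp only: right_diff_distrib sum_subtractf)
    also have "\<dots> \<le> (\<Sum>j\<in>I0. \<bar>B $ i $ j\<bar> * err)"
      using score by (intro order_trans[OF sum_abs] sum_mono) (simp add: abs_mult mult_left_mono del: resid_component)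
    also have "\<dots> = (\<Sum>j\<in>I0. \<bar>B $ i $ j\<bar>) * err" by (simp only: sum_distrib_right)
    also have "\<dots> \<le> (\<Sum>i\<in>UNIV. \<Sum>j\<in>UNIV. \<bar>B $ i $ j\<bar>) * err" by (rule mult_right_mono[OF Bsum err0])
    finally show ?thesis using True bc by simp
  next
    case False
    then have "c $ i - \<beta> $ i = 0" using c II by (simp add: I0)
    moreover have "0 \<le> (\<Sum>i\<in>UNIV. \<Sum>j\<in>UNIV. \<bar>B $ i $ j\<bar>) * err"
      using err0 by (intro mult_nonneg_nonneg sum_nonneg) auto
    ultimately show ?thesis using False bc by simp
  qed
qed

end

section \<open>The random sample\<close>

lemma integral_pair_product:
  fixes u :: "'a \<Rightarrow> real" and v :: "'b \<Rightarrow> real"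
  assumes "prob_space P" "prob_space Q" and u: "integrable P u" and v: "integrable Q v"
  shows "integrable (P \<Otimes>\<^sub>M Q) (\<lambda>z. u (fst z) * v (snd z))"
    "(\<integral>z. u (fst z) * v (snd z) \<partial>(P \<Otimes>\<^sub>M Q)) = (\<integral>x. u x \<partial>P) * (\<integral>y. v y \<partial>Q)"
proof -
  interpret P: prob_space P by fact
  interpret Q: prob_space Q by fact
  interpret PQ: pair_prob_space P Q ..
  have [measurable]: "u \<in> borel_measurable P" "v \<in> borel_measurable Q" using u v by auto
  show i: "integrable (P \<Otimes>\<^sub>M Q) (\<lambda>z. u (fst z) * v (snd z))"
  proof (rule PQ.Fubini_integrable)
    show "(\<lambda>z. u (fst z) * v (snd z)) \<in> borel_measurable (P \<Otimes>\<^sub>M Q)" by measurable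
    show "integrable P (\<lambda>x. \<integral>y. norm (u (fst (x, y)) * v (snd (x, y))) \<partial>Q)" using u by (simp add: abs_mult)
    show "AE x in P. integrable Q (\<lambda>y. u (fst (x, y)) * v (snd (x, y)))" using v by simp
  qed
  show "(\<integral>z. u (fst z) * v (snd z) \<partial>(P \<Otimes>\<^sub>M Q)) = (\<integral>x. u x \<partial>P) * (\<integral>y. v y \<partial>Q)"
    using PQ.integral_fst'[OF i] by simp
qed

locale sampling = design \<mu> \<kappa> \<K> h0 h1
  for \<mu> :: "((real ^ 'q) \<times> real) measure" and \<kappa> :: "real \<Rightarrow> (real ^ 'q) measure"
    and \<K> :: "(real ^ 'q) set" and h0 h1 :: real +
  fixes n :: nat and M :: "'w measure" and X :: "nat \<Rightarrow> 'w \<Rightarrow> real ^ 'q"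
    and T W :: "nat \<Rightarrow> 'w \<Rightarrow> real" and \<zeta> :: "real measure" and \<sigma> :: real
  assumes n: "n \<ge> 2" and sample: "iid_sample n M X T W \<mu> \<zeta>" and noise: "noise_law \<zeta> \<sigma>"
begin

abbreviation \<nu> :: "(((real ^ 'q) \<times> real) \<times> real) measure" where "\<nu> \<equiv> \<mu> \<Otimes>\<^sub>M \<zeta>"

lemma prob_M: "prob_space M" using sample by (simp add: iid_sample_def)

lemma noise_facts: "prob_space \<zeta>" "sets \<zeta> = sets borel" "integrable \<zeta> (\<lambda>w. w\<^sup>2)" "(\<integral>w. w \<partial>\<zeta>) = 0" "(\<integral>w. w\<^sup>2 \<partial>\<zeta>) = \<sigma>\<^sup>2"
  using noise by (auto simp: noise_law_def)

lemma integrable_noise: "integrable \<zeta> (\<lambda>w. w)"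
proof -
  have "(\<lambda>w. w) \<in> L2_fun \<zeta>" using noise_facts(2,3) by (auto simp: L2_fun_def cong: measurable_cong_sets)
  then show ?thesis
    using L2_fun_integrable prob_space.finite_measure[OF noise_facts(1)] by blast
qed

lemma prob_\<nu>: "prob_space \<nu>"
proof -
  interpret Z: prob_space \<zeta> by (rule noise_facts)
  interpret pair_prob_space \<mu> \<zeta> ..
  show ?thesis by (rule prob_space_axioms)
qed

lemma sets_\<nu>: "sets \<nu> = sets borel"
  by (subst borel_prod[symmetric]) (rule sets_pair_measure_cong[OF sets_mu noise_facts(2)])

lemma sample_indep: "prob_space.indep_vars M (\<lambda>_. borel) (\<lambda>i \<omega>. ((X i \<omega>, T i \<omega>), W i \<omega>)) {1..n}"
  and sample_law: "\<And>i. i \<in> {1..n} \<Longrightarrow> distr M borel (\<lambda>\<omega>. ((X i \<omega>, T i \<omega>), W i \<omega>)) = \<nu>"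
  using sample by (auto simp: iid_sample_def)

lemma sample_measurable: "i \<in> {1..n} \<Longrightarrow> (\<lambda>\<omega>. ((X i \<omega>, T i \<omega>), W i \<omega>)) \<in> M \<rightarrow>\<^sub>M borel"
  using sample_indep unfolding prob_space.indep_vars_def[OF prob_M] by auto

text \<open>The witness \<open>G\<close> need not be the event itself, so \<open>P\<close> may be
  nonmeasurable. The measure of the complement is bounded because such bounds add up under
  conjunction.\<close>

abbreviation whp :: "real \<Rightarrow> ('w \<Rightarrow> bool) \<Rightarrow> bool" where
  "whp e P \<equiv> \<exists>G\<in>sets M. measure M (space M - G) \<le> e \<and> (\<forall>\<omega>\<in>G. P \<omega>)"

text \<open>Markov's inequality, with the scale s separated from the level \<open>L\<close>, so that
  the failure probability B / L does not involve s.\<close>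

lemma markov_event:
  assumes i: "integrable M Q" and pos: "\<And>\<omega>. 0 \<le> Q \<omega>" and E: "(\<integral>\<omega>. Q \<omega> \<partial>M) \<le> B * s" and s: "s > 0" and L: "L > 0"
  shows "whp (B / L) (\<lambda>\<omega>. Q \<omega> \<le> L * s)"
proof (intro bexI conjI ballI)
  interpret M: prob_space M by (rule prob_M)
  have [measurable]: "Q \<in> borel_measurable M" using i by auto
  let ?G = "{\<omega> \<in> space M. Q \<omega> \<le> L * s}"
  show "?G \<in> sets M" by measurable
  have "measure M (space M - ?G) \<le> measure M {\<omega> \<in> space M. L * s \<le> Q \<omega>}"
    by (rule M.finite_measure_mono) auto
  also have "\<dots> \<le> (\<integral>\<omega>. Q \<omega> \<partial>M) / (L * s)"
    by (rule integral_Markov_inequality_measure[where A="{}"]) (use i pos L s in auto)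
  also have "\<dots> \<le> B * s / (L * s)" using E L s by (intro divide_right_mono) auto
  finally show "measure M (space M - ?G) \<le> B / L" using s by simp
qed auto

text \<open>Chebyshev's inequality for the whole family at once: the expected sum of squared
  deviations is at most the integral of the sum of squares divided by n. Summing variances, in place
  of a union bound, keeps the number of functions out of the bound.\<close>

lemma deviation_event:
  fixes h :: "'i \<Rightarrow> ((real ^ 'q) \<times> real) \<times> real \<Rightarrow> real"
  assumes h: "\<And>a. a \<in> A \<Longrightarrow> h a \<in> borel_measurable borel"
    and sq: "\<And>a. a \<in> A \<Longrightarrow> integrable \<nu> (\<lambda>z. (h a z)\<^sup>2)"
    and B: "(\<integral>z. (\<Sum>a\<in>A. (h a z)\<^sup>2) \<partial>\<nu>) \<le> B * s" and s: "s > 0" and L: "L > 0"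
  shows "whp (B / L) (\<lambda>\<omega>. (\<Sum>a\<in>A. (avg n (\<lambda>i. h a ((X i \<omega>, T i \<omega>), W i \<omega>)) - (\<integral>z. h a z \<partial>\<nu>))\<^sup>2) \<le> L * (s / real n))"
proof (rule markov_event)
  interpret M: prob_space M by (rule prob_M)
  have n1: "n \<ge> 1" using n by simp
  note dev = M.iid_mean_deviation[OF sample_indep sample_law prob_\<nu> sets_\<nu> h sq n1]
  show "integrable M (\<lambda>\<omega>. \<Sum>a\<in>A. (avg n (\<lambda>i. h a ((X i \<omega>, T i \<omega>), W i \<omega>)) - (\<integral>z. h a z \<partial>\<nu>))\<^sup>2)"
    unfolding avg_def by (intro Bochner_Integration.integrable_sum dev(1))
  have "(\<integral>\<omega>. (\<Sum>a\<in>A. (avg n (\<lambda>i. h a ((X i \<omega>, T i \<omega>), W i \<omega>)) - (\<integral>z. h a z \<partial>\<nu>))\<^sup>2) \<partial>M)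
     = (\<Sum>a\<in>A. \<integral>\<omega>. (avg n (\<lambda>i. h a ((X i \<omega>, T i \<omega>), W i \<omega>)) - (\<integral>z. h a z \<partial>\<nu>))\<^sup>2 \<partial>M)"
    unfolding avg_def by (intro Bochner_Integration.integral_sum dev(1))
  also have "\<dots> \<le> (\<Sum>a\<in>A. (\<integral>z. (h a z)\<^sup>2 \<partial>\<nu>) / real n)"
    unfolding avg_def by (intro sum_mono dev(2))
  also have "\<dots> = (\<integral>z. (\<Sum>a\<in>A. (h a z)\<^sup>2) \<partial>\<nu>) / real n"
    using sq by (simp add: sum_divide_distrib)
  also have "\<dots> \<le> B * s / real n" using B by (intro divide_right_mono) auto
  finally show "(\<integral>\<omega>. (\<Sum>a\<in>A. (avg n (\<lambda>i. h a ((X i \<omega>, T i \<omega>), W i \<omega>)) - (\<integral>z. h a z \<partial>\<nu>))\<^sup>2) \<partial>M) \<le> B * (s / real n)"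
    by simp
qed (use s L n in \<open>auto intro: sum_nonneg\<close>)

lemma fst_\<nu>:
  fixes u :: "(real ^ 'q) \<times> real \<Rightarrow> real"
  assumes "integrable \<mu> u"
  shows "integrable \<nu> (\<lambda>z. u (fst z))" "(\<integral>z. u (fst z) \<partial>\<nu>) = (\<integral>z. u z \<partial>\<mu>)"
proof -
  interpret Z: prob_space \<zeta> by (rule noise_facts)
  show "integrable \<nu> (\<lambda>z. u (fst z))" "(\<integral>z. u (fst z) \<partial>\<nu>) = (\<integral>z. u z \<partial>\<mu>)"
    using integral_pair_product[OF law noise_facts(1) assms, of "\<lambda>_. 1"] Z.prob_space by auto
qed

lemma borel_fst_comp: "u \<in> borel_measurable borel \<Longrightarrow> (\<lambda>z :: ((real ^ 'q) \<times> real) \<times> real. u (fst z)) \<in> borel_measurable borel"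
  for u :: "(real ^ 'q) \<times> real \<Rightarrow> real"
  by (rule measurable_compose[OF fst_borel])

lemma design_deviation_event:
  fixes u :: "'i \<Rightarrow> (real ^ 'q) \<times> real \<Rightarrow> real"
  assumes u: "\<And>a. a \<in> A \<Longrightarrow> u a \<in> borel_measurable borel" "\<And>a. a \<in> A \<Longrightarrow> u a \<in> L2_fun \<mu>"
    and B: "(\<integral>z. (\<Sum>a\<in>A. (u a z)\<^sup>2) \<partial>\<mu>) \<le> B * s" and s: "s > 0" and L: "L > 0"
  shows "whp (B / L) (\<lambda>\<omega>. (\<Sum>a\<in>A. (avg n (\<lambda>i. u a (X i \<omega>, T i \<omega>)) - (\<integral>z. u a z \<partial>\<mu>))\<^sup>2) \<le> L * (s / real n))"
proof -
  have i: "integrable \<mu> (\<lambda>z. (u a z)\<^sup>2)" if "a \<in> A" for a using u(2)[OF that] by (rule L2_fun_integrable_sq)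
  have "whp (B / L) (\<lambda>\<omega>. (\<Sum>a\<in>A. (avg n (\<lambda>i. u a (fst ((X i \<omega>, T i \<omega>), W i \<omega>))) - (\<integral>z. u a (fst z) \<partial>\<nu>))\<^sup>2) \<le> L * (s / real n))"
  proof (rule deviation_event[where h="\<lambda>a z. u a (fst z)"])
    show "(\<lambda>z :: ((real ^ 'q) \<times> real) \<times> real. u a (fst z)) \<in> borel_measurable borel" if "a \<in> A" for a by (rule borel_fst_comp[OF u(1)[OF that]])
    show "integrable \<nu> (\<lambda>z. (u a (fst z))\<^sup>2)" if "a \<in> A" for a using fst_\<nu>(1)[OF i[OF that]] .
    have "(\<integral>z. (\<Sum>a\<in>A. (u a (fst z))\<^sup>2) \<partial>\<nu>) = (\<integral>z. (\<Sum>a\<in>A. (u a z)\<^sup>2) \<partial>\<mu>)"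
      by (rule fst_\<nu>(2)[of "\<lambda>z. \<Sum>a\<in>A. (u a z)\<^sup>2"]) (intro Bochner_Integration.integrable_sum i)
    then show "(\<integral>z. (\<Sum>a\<in>A. (u a (fst z))\<^sup>2) \<partial>\<nu>) \<le> B * s" using B by simp
  qed fact+
  moreover have "(\<integral>z. u a (fst z) \<partial>\<nu>) = (\<integral>z. u a z \<partial>\<mu>)" if "a \<in> A" for a
    by (rule fst_\<nu>(2)[OF L2_fun_integrable[OF finite_measure_axioms u(2)[OF that]]])
  ultimately show ?thesis by (simp cong: sum.cong)
qed

lemma noise_product:
  assumes u: "u \<in> L2_fun \<mu>"
  shows "integrable \<nu> (\<lambda>z. (snd z * u (fst z))\<^sup>2)" "(\<integral>z. (snd z * u (fst z))\<^sup>2 \<partial>\<nu>) = \<sigma>\<^sup>2 * (\<integral>z. (u z)\<^sup>2 \<partial>\<mu>)"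
    "(\<integral>z. snd z * u (fst z) \<partial>\<nu>) = 0"
  using integral_pair_product[OF law noise_facts(1) L2_fun_integrable_sq[OF u] noise_facts(3)]
    integral_pair_product(2)[OF law noise_facts(1) L2_fun_integrable[OF finite_measure_axioms u] integrable_noise]
  by (simp_all add: noise_facts(4,5) power_mult_distrib mult.commute)

text \<open>The errors are centered and independent of the covariates, so the means vanish and the
  second moments factor, which brings in \<sigma> squared.\<close>

lemma noise_deviation_event:
  fixes u :: "'i \<Rightarrow> (real ^ 'q) \<times> real \<Rightarrow> real"
  assumes u: "\<And>a. a \<in> A \<Longrightarrow> u a \<in> borel_measurable borel" "\<And>a. a \<in> A \<Longrightarrow> u a \<in> L2_fun \<mu>"
    and B: "(\<integral>z. (\<Sum>a\<in>A. (u a z)\<^sup>2) \<partial>\<mu>) \<le> B * s" and s: "s > 0" and L: "L > 0"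
  shows "whp (\<sigma>\<^sup>2 * B / L) (\<lambda>\<omega>. (\<Sum>a\<in>A. (avg n (\<lambda>i. W i \<omega> * u a (X i \<omega>, T i \<omega>)))\<^sup>2) \<le> L * (s / real n))"
proof -
  have "whp (\<sigma>\<^sup>2 * B / L) (\<lambda>\<omega>. (\<Sum>a\<in>A. (avg n (\<lambda>i. snd ((X i \<omega>, T i \<omega>), W i \<omega>) * u a (fst ((X i \<omega>, T i \<omega>), W i \<omega>))) - (\<integral>z. snd z * u a (fst z) \<partial>\<nu>))\<^sup>2) \<le> L * (s / real n))"
  proof (rule deviation_event[where h="\<lambda>a z. snd z * u a (fst z)"])
    show "(\<lambda>z. snd z * u a (fst z)) \<in> borel_measurable borel" if "a \<in> A" for a
      by (intro borel_measurable_times snd_borel borel_fst_comp[OF u(1)[OF that]])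
    show i: "integrable \<nu> (\<lambda>z. (snd z * u a (fst z))\<^sup>2)" if "a \<in> A" for a by (rule noise_product(1)[OF u(2)[OF that]])
    have "(\<integral>z. (\<Sum>a\<in>A. (snd z * u a (fst z))\<^sup>2) \<partial>\<nu>) = (\<Sum>a\<in>A. \<sigma>\<^sup>2 * (\<integral>z. (u a z)\<^sup>2 \<partial>\<mu>))"
      by (subst Bochner_Integration.integral_sum[OF i]) (auto intro!: sum.cong noise_product(2) u(2))
    also have "\<dots> = \<sigma>\<^sup>2 * (\<integral>z. (\<Sum>a\<in>A. (u a z)\<^sup>2) \<partial>\<mu>)"
      by (subst Bochner_Integration.integral_sum) (auto intro!: L2_fun_integrable_sq u(2) simp: sum_distrib_left)
    also have "\<dots> \<le> \<sigma>\<^sup>2 * (B * s)" by (rule mult_left_mono[OF B]) simp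
    finally show "(\<integral>z. (\<Sum>a\<in>A. (snd z * u a (fst z))\<^sup>2) \<partial>\<nu>) \<le> \<sigma>\<^sup>2 * B * s" by simp
  qed fact+
  moreover have "(\<integral>z. snd z * u a (fst z) \<partial>\<nu>) = 0" if "a \<in> A" for a by (rule noise_product(3)[OF u(2)[OF that]])
  ultimately show ?thesis by (simp cong: sum.cong)
qed

lemma mean_event:
  fixes u :: "(real ^ 'q) \<times> real \<Rightarrow> real"
  assumes u: "integrable \<mu> u" and pos: "\<And>z. 0 \<le> u z" and B: "(\<integral>z. u z \<partial>\<mu>) \<le> B * s" and s: "s > 0" and L: "L > 0"
  shows "whp (B / L) (\<lambda>\<omega>. avg n (\<lambda>i. u (X i \<omega>, T i \<omega>)) \<le> L * s)"
proof (rule markov_event)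
  interpret M: prob_space M by (rule prob_M)
  have n1: "n \<ge> 1" using n by simp
  note mean = M.iid_mean[OF sample_measurable sample_law fst_\<nu>(1)[OF u] n1]
  show "integrable M (\<lambda>\<omega>. avg n (\<lambda>i. u (X i \<omega>, T i \<omega>)))" using mean(1) by (simp add: avg_def)
  show "(\<integral>\<omega>. avg n (\<lambda>i. u (X i \<omega>, T i \<omega>)) \<partial>M) \<le> B * s" using mean(2) B fst_\<nu>(2)[OF u] by (simp add: avg_def)
qed (use s L pos in \<open>auto intro: avg_nonneg\<close>)

text \<open>A bound on the sum of squares serves twice: it bounds every member, and by total mass
  one it bounds the integral.\<close>

lemma bounded_sum_squares:
  fixes u :: "'i \<Rightarrow> (real ^ 'q) \<times> real \<Rightarrow> real"
  assumes A: "finite A" and u: "\<And>a. a \<in> A \<Longrightarrow> u a \<in> borel_measurable borel"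
    and B: "AE z in \<mu>. (\<Sum>a\<in>A. (u a z)\<^sup>2) \<le> B"
  shows "\<And>a. a \<in> A \<Longrightarrow> u a \<in> L2_fun \<mu>" "(\<integral>z. (\<Sum>a\<in>A. (u a z)\<^sup>2) \<partial>\<mu>) \<le> B * 1"
proof -
  show L: "u a \<in> L2_fun \<mu>" if a: "a \<in> A" for a
  proof (rule L2_fun_bounded[OF finite_measure_axioms])
    show "u a \<in> borel_measurable \<mu>" using u[OF a] sets_mu by (simp cong: measurable_cong_sets)
    show "AE z in \<mu>. \<bar>u a z\<bar> \<le> sqrt B"
      using B
    proof eventually_elim
      fix z assume *: "(\<Sum>a\<in>A. (u a z)\<^sup>2) \<le> B"
      have "(u a z)\<^sup>2 \<le> (\<Sum>a\<in>A. (u a z)\<^sup>2)" using a A by (intro member_le_sum[of a A "\<lambda>a. (u a z)\<^sup>2"]) auto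
      then show "\<bar>u a z\<bar> \<le> sqrt B" using * by (intro real_le_rsqrt) simp
    qed
  qed
  have "(\<integral>z. (\<Sum>a\<in>A. (u a z)\<^sup>2) \<partial>\<mu>) \<le> B"
    by (rule integral_le_const) (use B L in \<open>auto intro!: Bochner_Integration.integrable_sum L2_fun_integrable_sq\<close>)
  then show "(\<integral>z. (\<Sum>a\<in>A. (u a z)\<^sup>2) \<partial>\<mu>) \<le> B * 1" by simp
qed

text \<open>Its failure probability is 0, so conjoining it costs nothing; on this event a function
  and its cut-off \<open>cut01\<close> agree at all sample points.\<close>

lemma support_event:
  "whp 0 (\<lambda>\<omega>. \<forall>i\<in>{1..n}. X i \<omega> \<in> \<K> \<and> T i \<omega> \<in> {0..<1})"
proof (intro bexI conjI)
  interpret M: prob_space M by (rule prob_M)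
  let ?P = "\<lambda>i \<omega>. X i \<omega> \<in> \<K> \<and> T i \<omega> \<in> {0..<1}"
  let ?S = "{z :: ((real ^ 'q) \<times> real) \<times> real. fst (fst z) \<in> \<K> \<and> snd (fst z) \<in> {0..<1}}"
  have S[measurable]: "?S \<in> sets borel"
  proof -
    have [measurable]: "(\<lambda>z :: ((real ^ 'q) \<times> real) \<times> real. fst (fst z)) \<in> borel \<rightarrow>\<^sub>M borel"
      "(\<lambda>z :: ((real ^ 'q) \<times> real) \<times> real. snd (fst z)) \<in> borel \<rightarrow>\<^sub>M borel" by measurable
    show ?thesis by measurable
  qed
  have m: "{\<omega> \<in> space M. ?P i \<omega>} \<in> sets M" if "i \<in> {1..n}" for i
  proof -
    have "{\<omega> \<in> space M. ?P i \<omega>} = (\<lambda>\<omega>. ((X i \<omega>, T i \<omega>), W i \<omega>)) -` ?S \<inter> space M" by auto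
    then show ?thesis using measurable_sets[OF sample_measurable[OF that] S] by simp
  qed
  have "{\<omega> \<in> space M. \<forall>i\<in>{1..n}. ?P i \<omega>} \<in> sets M"
    by (rule sets.sets_Collect_finite_All) (use m in auto)
  then show G: "{\<omega> \<in> space M. \<forall>i\<in>{1..n}. ?P i \<omega>} \<in> sets M" .
  have "AE \<omega> in M. ?P i \<omega>" if i: "i \<in> {1..n}" for i
  proof -
    interpret Z: prob_space \<zeta> by (rule noise_facts)
    have "AE z in \<mu>. fst z \<in> \<K> \<and> snd z \<in> {0..<1}" using AE_K AE_T by auto
    then have "AE z in \<nu>. fst (fst z) \<in> \<K> \<and> snd (fst z) \<in> {0..<1}"
      by (rule AE_distrD[of fst \<nu> \<mu>, rotated, unfolded Z.distr_pair_fst]) simp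
    then have "AE z in distr M borel (\<lambda>\<omega>. ((X i \<omega>, T i \<omega>), W i \<omega>)). fst (fst z) \<in> \<K> \<and> snd (fst z) \<in> {0..<1}"
      by (simp only: sample_law[OF i])
    from AE_distrD[OF sample_measurable[OF i] this] show ?thesis by simp
  qed
  then have "AE \<omega> in M. \<forall>i\<in>{1..n}. ?P i \<omega>" by (simp add: AE_finite_all)
  then have "measure M {\<omega> \<in> space M. \<forall>i\<in>{1..n}. ?P i \<omega>} = 1" using M.prob_Collect_eq_1[OF G] by simp
  then show "measure M (space M - {\<omega> \<in> space M. \<forall>i\<in>{1..n}. ?P i \<omega>}) \<le> 0"
    using M.prob_compl[OF G] by simp
qed auto

end

text \<open>The numerators of the eight families of events in \<open>good_events\<close>, added and
  nested exactly as \<open>events_conj\<close> and \<open>events_all\<close> produce them. The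
  constant involves neither n nor \<open>K\<close>.\<close>

definition (in design) risk_const :: "real \<Rightarrow> real \<Rightarrow> real \<Rightarrow> real" where
  "risk_const \<sigma> c Cf = (let q = real CARD('q); P = q * bnd\<^sup>2 + c in
     P\<^sup>2 + (\<sigma>\<^sup>2 * P + (q * (4 * bnd\<^sup>2 * c) + (Cf + (q * 1 + (q * \<sigma>\<^sup>2 + (q * (4 * bnd\<^sup>2 * Cf) + q * (q * (4 * bnd^4)))))))))"

text \<open>The quantity \<open>err\<close> of the fixed-sample analysis with \<open>C3\<close>
  written out, as a function of n, \<epsilon> and \<open>K\<close>, so that limits can be
  taken.\<close>

definition (in design) remainder :: "nat \<Rightarrow> real \<Rightarrow> real \<Rightarrow> real \<Rightarrow> nat \<Rightarrow> real" where
  "remainder n L C2 \<epsilon> K = sqrt (L * real K / (real n)\<^sup>2) + sqrt ((L * real K / real n) * (L * \<epsilon> / real K)) + sqrt (L * \<epsilon> / real n)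
     + sqrt ((2 * ((16 + 64 * C2) * L * real K / real n)) * (L * \<epsilon> / real K))
     + real CARD('q) * (sqrt ((16 + 64 * C2) * L * real K / real n / lam) * sqrt (L / real n))
     + sqrt (C2 * real K * ((16 + 64 * C2) * L * real K / real n) * (L / real n))"

section \<open>The good event and its probability\<close>

context sampling
begin

lemma events_mono:
  assumes "whp a (\<lambda>\<omega>. P \<omega>)" and "\<And>\<omega>. P \<omega> \<Longrightarrow> Q \<omega>"
  shows "whp a (\<lambda>\<omega>. Q \<omega>)"
  using assms by blast

text \<open>All failure probabilities share the denominator \<open>L\<close>, so a union bound adds
  the numerators.\<close>

lemma events_conj:
  fixes L :: real
  assumes P: "whp (a / L) (\<lambda>\<omega>. P \<omega>)"
    and Q: "whp (b / L) (\<lambda>\<omega>. Q \<omega>)"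
  shows "whp ((a + b) / L) (\<lambda>\<omega>. P \<omega> \<and> Q \<omega>)"
proof -
  interpret M: prob_space M by (rule prob_M)
  obtain G where G: "G \<in> sets M" "measure M (space M - G) \<le> a / L" "\<forall>\<omega>\<in>G. P \<omega>" using P by blast
  obtain H where H: "H \<in> sets M" "measure M (space M - H) \<le> b / L" "\<forall>\<omega>\<in>H. Q \<omega>" using Q by blast
  have "measure M (space M - G \<inter> H) \<le> measure M (space M - G) + measure M (space M - H)"
    unfolding Diff_Int using G(1) H(1) by (intro measure_Un_le) auto
  also have "\<dots> \<le> (a + b) / L" using G(2) H(2) by (simp add: add_divide_distrib)
  finally show ?thesis using G H by (intro bexI[of _ "G \<inter> H"]) auto
qed

lemma events_all:
  fixes L :: real and P :: "'i::finite \<Rightarrow> 'w \<Rightarrow> bool"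
  assumes P: "\<And>j. whp (a / L) (\<lambda>\<omega>. P j \<omega>)"
  shows "whp (real CARD('i) * a / L) (\<lambda>\<omega>. \<forall>j. P j \<omega>)"
proof -
  have "finite (UNIV :: 'i set)" by simp
  then have "whp (real CARD('i) * a / L) (\<lambda>\<omega>. \<forall>j\<in>UNIV. P j \<omega>)"
  proof induction
    case empty
    show ?case by (intro bexI[of _ "space M"]) auto
  next
    case (insert j S)
    from events_conj[OF P[of j] insert.IH] show ?case using insert.hyps by (simp add: algebra_simps)
  qed
  then show ?thesis by simp
qed

text \<open>The facts \<open>E1\<close> to \<open>E8\<close> correspond to the conjuncts in order.
  \<open>E1\<close>, \<open>E2\<close>, \<open>E3\<close> and \<open>E8\<close> use sums of squares
  bounded independently of \<open>K\<close>, hence the rate 1 / n; \<open>E4\<close> and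
  \<open>E5\<close> are Markov bounds for means; \<open>E6\<close> and \<open>E7\<close> exploit
  that the approximation errors have a small second moment.\<close>

lemma good_events:
  fixes r K :: nat and f fK :: "real \<Rightarrow> real" and g :: "'q \<Rightarrow> real \<Rightarrow> real"
  assumes r: "r > 0" and K: "K > 0" and c: "\<And>t. (\<Sum>j<K. \<Sum>m=1..r. (local_basis r K j m t)\<^sup>2) \<le> c"
    and f: "cut01 f \<in> borel_measurable borel" and fK: "fK \<in> pw_poly r K"
    and fL: "(\<lambda>z. cut01 f (snd z) - fK (snd z)) \<in> L2_fun \<mu>" and fe: "(l2 \<mu> (\<lambda>z. cut01 f (snd z) - fK (snd z)))\<^sup>2 \<le> Cf * (real K / real n)"
    and g: "\<And>j. g j \<in> pw_poly r K"
    and gL: "\<And>j. (\<lambda>z. cut01 (cond_mean \<kappa> j) (snd z) - g j (snd z)) \<in> L2_fun \<mu>"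
    and ge: "\<And>j. (l2 \<mu> (\<lambda>z. cut01 (cond_mean \<kappa> j) (snd z) - g j (snd z)))\<^sup>2 \<le> \<epsilon> / real K"
    and \<epsilon>: "\<epsilon> > 0" and L: "L > 0"
  shows "whp (risk_const \<sigma> c Cf / L) (\<lambda>\<omega>.
    (\<Sum>a\<in>basis_index r K. \<Sum>b\<in>basis_index r K. (avg n (\<lambda>i. basis_fun r K a (X i \<omega>, T i \<omega>) * basis_fun r K b (X i \<omega>, T i \<omega>))
       - (\<integral>z. basis_fun r K a z * basis_fun r K b z \<partial>\<mu>))\<^sup>2) \<le> L / real n \<and>
    (\<Sum>a\<in>basis_index r K. (avg n (\<lambda>i. W i \<omega> * basis_fun r K a (X i \<omega>, T i \<omega>)))\<^sup>2) \<le> L / real n \<and>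
    (\<forall>k. (\<Sum>j<K. \<Sum>m=1..r. (avg n (\<lambda>i. resid (X i \<omega>, T i \<omega>) $ k * local_basis r K j m (T i \<omega>)))\<^sup>2) \<le> L / real n) \<and>
    avg n (\<lambda>i. (f (T i \<omega>) - fK (T i \<omega>))\<^sup>2) \<le> L * real K / real n \<and>
    (\<forall>j. avg n (\<lambda>i. (cond_mean \<kappa> j (T i \<omega>) - g j (T i \<omega>))\<^sup>2) \<le> L * \<epsilon> / real K) \<and>
    (\<forall>j. (avg n (\<lambda>i. W i \<omega> * (cond_mean \<kappa> j (T i \<omega>) - g j (T i \<omega>))))\<^sup>2 \<le> L * \<epsilon> / real n) \<and>
    (\<forall>j. (avg n (\<lambda>i. (f (T i \<omega>) - fK (T i \<omega>)) * resid (X i \<omega>, T i \<omega>) $ j))\<^sup>2 \<le> L * real K / (real n)\<^sup>2) \<and>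
    (\<forall>k j. (avg n (\<lambda>i. X i \<omega> $ k * resid (X i \<omega>, T i \<omega>) $ j) - Sigma_mat \<mu> \<kappa> $ k $ j)\<^sup>2 \<le> L / real n))"
proof -
  let ?IX = "basis_index r K :: ('q + nat \<times> nat) set"
  define P where "P = real CARD('q) * bnd\<^sup>2 + c"
  have n0: "real n > 0" using n by simp
  have [measurable]: "cut01 f \<in> borel_measurable borel" by (rule f)
  have [measurable]: "fK \<in> borel_measurable borel" "g j \<in> borel_measurable borel" for j
    by (rule pw_poly_measurable[OF fK], rule pw_poly_measurable[OF g])
  have [measurable]: "cut01 (cond_mean \<kappa> j) \<in> borel_measurable borel" for j
    unfolding cut01_def by measurable
  have AEX: "AE z in \<mu>. \<forall>k. \<bar>fst z $ k\<bar> \<le> bnd"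
    using AE_K by eventually_elim (use bnd_component in auto)
  have sq_le: "a\<^sup>2 \<le> b\<^sup>2" if "\<bar>a\<bar> \<le> b" for a b :: real using that abs_le_square_iff[of a b] by linarith
  have AEP: "AE z in \<mu>. (\<Sum>a\<in>?IX. (basis_fun r K a z)\<^sup>2) \<le> P"
    using AEX
  proof eventually_elim
    fix z :: "(real ^ 'q) \<times> real" assume *: "\<forall>k. \<bar>fst z $ k\<bar> \<le> bnd"
    have "(\<Sum>k\<in>UNIV. (fst z $ k)\<^sup>2) \<le> (\<Sum>k\<in>(UNIV :: 'q set). bnd\<^sup>2)"
      using * by (intro sum_mono sq_le) simp
    then show "(\<Sum>a\<in>?IX. (basis_fun r K a z)\<^sup>2) \<le> P"
      using c[of "snd z"] unfolding sum_basis_index P_def by simp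
  qed
  have E0: "whp (0 / L) (\<lambda>\<omega>. \<forall>i\<in>{1..n}. X i \<omega> \<in> \<K> \<and> T i \<omega> \<in> {0..<1})"
    using support_event by simp
  have E1: "whp (P\<^sup>2 / L) (\<lambda>\<omega>.
    (\<Sum>a\<in>?IX. \<Sum>b\<in>?IX. (avg n (\<lambda>i. basis_fun r K a (X i \<omega>, T i \<omega>) * basis_fun r K b (X i \<omega>, T i \<omega>))
       - (\<integral>z. basis_fun r K a z * basis_fun r K b z \<partial>\<mu>))\<^sup>2) \<le> L / real n)"
  proof -
    let ?u = "\<lambda>p z. basis_fun r K (fst p) z * basis_fun r K (snd p) z"
    have um: "?u p \<in> borel_measurable borel" for p :: "('q + nat \<times> nat) \<times> ('q + nat \<times> nat)" by measurable
    have ub: "AE z in \<mu>. (\<Sum>p\<in>?IX \<times> ?IX. (?u p z)\<^sup>2) \<le> P\<^sup>2"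
      using AEP
    proof eventually_elim
      fix z :: "(real ^ 'q) \<times> real" assume *: "(\<Sum>a\<in>?IX. (basis_fun r K a z)\<^sup>2) \<le> P"
      have "(\<Sum>p\<in>?IX \<times> ?IX. (?u p z)\<^sup>2) = (\<Sum>a\<in>?IX. (basis_fun r K a z)\<^sup>2)\<^sup>2"
        unfolding power2_eq_square[of "sum _ _"] sum_product
        by (simp add: sum.cartesian_product split_beta power_mult_distrib)
      also have "\<dots> \<le> P\<^sup>2" by (rule power_mono[OF *]) (simp add: sum_nonneg)
      finally show "(\<Sum>p\<in>?IX \<times> ?IX. (?u p z)\<^sup>2) \<le> P\<^sup>2" .
    qed
    have fin: "finite (?IX \<times> ?IX)" by simp
    note b = bounded_sum_squares[where A="?IX \<times> ?IX" and u="?u", OF fin um ub]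
    have "whp (P\<^sup>2 / L) (\<lambda>\<omega>.
      (\<Sum>p\<in>?IX \<times> ?IX. (avg n (\<lambda>i. ?u p (X i \<omega>, T i \<omega>)) - (\<integral>z. ?u p z \<partial>\<mu>))\<^sup>2) \<le> L * (1 / real n))"
      by (rule design_deviation_event[where u="?u", OF um b zero_less_one L])
    then show ?thesis by (simp add: sum.cartesian_product split_beta)
  qed
  have E2: "whp (\<sigma>\<^sup>2 * P / L) (\<lambda>\<omega>.
    (\<Sum>a\<in>?IX. (avg n (\<lambda>i. W i \<omega> * basis_fun r K a (X i \<omega>, T i \<omega>)))\<^sup>2) \<le> L / real n)"
    using noise_deviation_event[where A="?IX" and u="basis_fun r K", OF basis_fun_measurable
        bounded_sum_squares[OF finite_basis_index basis_fun_measurable AEP] zero_less_one L] by simp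
  have E3: "whp (4 * bnd\<^sup>2 * c / L) (\<lambda>\<omega>.
    (\<Sum>j<K. \<Sum>m=1..r. (avg n (\<lambda>i. resid (X i \<omega>, T i \<omega>) $ k * local_basis r K j m (T i \<omega>)))\<^sup>2) \<le> L / real n)" for k
  proof -
    let ?A = "{..<K} \<times> {1..r}"
    let ?u = "\<lambda>p z. resid z $ k * local_basis r K (fst p) (snd p) (snd z)"
    have um: "?u p \<in> borel_measurable borel" for p by (intro borel_measurable_times resid_measurable measurable_compose[OF snd_borel local_basis_measurable])
    have ub: "AE z in \<mu>. (\<Sum>p\<in>?A. (?u p z)\<^sup>2) \<le> 4 * bnd\<^sup>2 * c"
      using AE_resid
    proof eventually_elim
      fix z assume *: "\<forall>j. \<bar>resid z $ j\<bar> \<le> 2 * bnd"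
      have "(\<Sum>p\<in>?A. (?u p z)\<^sup>2) = (resid z $ k)\<^sup>2 * (\<Sum>j<K. \<Sum>m=1..r. (local_basis r K j m (snd z))\<^sup>2)"
        by (simp add: sum.cartesian_product split_beta power_mult_distrib sum_distrib_left del: resid_component)
      also have "\<dots> \<le> (2 * bnd)\<^sup>2 * c"
        using * by (intro mult_mono sq_le c) (auto intro!: sum_nonneg simp del: resid_component)
      finally show "(\<Sum>p\<in>?A. (?u p z)\<^sup>2) \<le> 4 * bnd\<^sup>2 * c" by (simp add: power_mult_distrib)
    qed
    have fin: "finite ?A" by simp
    note b = bounded_sum_squares[where A="?A" and u="?u", OF fin um ub]
    \<comment> \<open>The residual is orthogonal to functions of \<open>T\<close>, so these averages
      are centered at 0.\<close>
    have z: "(\<integral>z. ?u p z \<partial>\<mu>) = 0" if "p \<in> ?A" for p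
    proof (rule resid_orthogonal[OF local_basis_measurable])
      have "Inr p \<in> ?IX" using that by (auto simp: basis_index_def)
      then have "basis_fun r K (Inr p) \<in> L2_fun \<mu>"
        by (rule bounded_sum_squares(1)[OF finite_basis_index basis_fun_measurable AEP])
      then show "(\<lambda>z. local_basis r K (fst p) (snd p) (snd z)) \<in> L2_fun \<mu>"
        by (cases p) (simp add: basis_fun.simps[abs_def])
    qed
    have "whp (4 * bnd\<^sup>2 * c / L) (\<lambda>\<omega>.
      (\<Sum>p\<in>?A. (avg n (\<lambda>i. ?u p (X i \<omega>, T i \<omega>)) - (\<integral>z. ?u p z \<partial>\<mu>))\<^sup>2) \<le> L * (1 / real n))"
      by (rule design_deviation_event[where u="?u", OF um b zero_less_one L])
    then show ?thesis using z by (simp add: sum.cartesian_product split_beta del: resid_component)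
  qed
  have E4: "whp (Cf / L) (\<lambda>\<omega>. avg n (\<lambda>i. (cut01 f (T i \<omega>) - fK (T i \<omega>))\<^sup>2) \<le> L * real K / real n)"
    using mean_event[OF L2_fun_integrable_sq[OF fL] zero_le_power2 fe[unfolded l2_sq] _ L] K n0 by simp
  have E5: "whp (1 / L) (\<lambda>\<omega>. avg n (\<lambda>i. (cut01 (cond_mean \<kappa> j) (T i \<omega>) - g j (T i \<omega>))\<^sup>2) \<le> L * \<epsilon> / real K)" for j
    using mean_event[OF L2_fun_integrable_sq[OF gL[of j]] zero_le_power2, of 1 "\<epsilon> / real K", OF _ _ L] ge[of j] K \<epsilon> by (simp add: l2_sq)
  have E6: "whp (\<sigma>\<^sup>2 / L) (\<lambda>\<omega>. (avg n (\<lambda>i. W i \<omega> * (cut01 (cond_mean \<kappa> j) (T i \<omega>) - g j (T i \<omega>))))\<^sup>2 \<le> L * \<epsilon> / real n)" for j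
  proof -
    have m: "(\<lambda>z :: (real ^ 'q) \<times> real. cut01 (cond_mean \<kappa> j) (snd z) - g j (snd z)) \<in> borel_measurable borel" by measurable
    \<comment> \<open>The factor 1 / K is given away: for the noise term a second moment that tends
      to 0 is enough.\<close>
    have "\<epsilon> / real K \<le> \<epsilon> / 1" using \<epsilon> K by (intro divide_left_mono) auto
    then have "(\<integral>z. (\<Sum>a\<in>{()}. (cut01 (cond_mean \<kappa> j) (snd z) - g j (snd z))\<^sup>2) \<partial>\<mu>) \<le> 1 * \<epsilon>" using ge[of j] by (simp add: l2_sq)
    from noise_deviation_event[where A="{()}" and u="\<lambda>_ z. cut01 (cond_mean \<kappa> j) (snd z) - g j (snd z)", OF m gL this \<epsilon> L]
    show ?thesis by simp
  qed
  have E7: "whp (4 * bnd\<^sup>2 * Cf / L) (\<lambda>\<omega>. (avg n (\<lambda>i. (cut01 f (T i \<omega>) - fK (T i \<omega>)) * resid (X i \<omega>, T i \<omega>) $ j))\<^sup>2 \<le> L * real K / (real n)\<^sup>2)" for j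
  proof -
    let ?d = "\<lambda>z :: (real ^ 'q) \<times> real. cut01 f (snd z) - fK (snd z)" and ?u = "\<lambda>z. (cut01 f (snd z) - fK (snd z)) * resid z $ j"
    have dm: "?d \<in> borel_measurable borel" by measurable
    have m: "?u \<in> borel_measurable borel" by (intro borel_measurable_times dm resid_measurable)
    have m': "?u \<in> borel_measurable \<mu>" using m sets_mu by (simp cong: measurable_cong_sets)
    have ae: "AE z in \<mu>. \<bar>?u z\<bar> \<le> \<bar>2 * bnd * ?d z\<bar>"
      using AE_resid
    proof eventually_elim
      fix z assume *: "\<forall>j. \<bar>resid z $ j\<bar> \<le> 2 * bnd"
      have "\<bar>?u z\<bar> \<le> \<bar>?d z\<bar> * (2 * bnd)" unfolding abs_mult using * by (intro mult_left_mono) auto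
      moreover have "\<bar>2 * bnd * y\<bar> = \<bar>y\<bar> * (2 * bnd)" for y using bnd(1) by (simp add: abs_mult)
      ultimately show "\<bar>?u z\<bar> \<le> \<bar>2 * bnd * ?d z\<bar>" by presburger
    qed
    note mono = l2_mono[OF m' L2_fun_cmult[OF fL] ae]
    have "(\<integral>z. (?u z)\<^sup>2 \<partial>\<mu>) = (l2 \<mu> ?u)\<^sup>2" by (simp only: l2_sq)
    also have "\<dots> \<le> (l2 \<mu> (\<lambda>z. 2 * bnd * ?d z))\<^sup>2" by (rule power_mono[OF mono(1) l2_nonneg])
    also have "\<dots> = 4 * bnd\<^sup>2 * (l2 \<mu> ?d)\<^sup>2" by (simp add: l2_sq power_mult_distrib)
    also have "\<dots> \<le> 4 * bnd\<^sup>2 * (Cf * (real K / real n))" by (rule mult_left_mono[OF fe]) simp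
    finally have B: "(\<integral>z. (\<Sum>a\<in>{()}. (?u z)\<^sup>2) \<partial>\<mu>) \<le> 4 * bnd\<^sup>2 * Cf * (real K / real n)" by simp
    have "(\<integral>z. resid z $ j * (cut01 f (snd z) - fK (snd z)) \<partial>\<mu>) = 0"
      by (rule resid_orthogonal[OF _ fL]) measurable
    then have z: "(\<integral>z. ?u z \<partial>\<mu>) = 0" by (simp only: mult.commute)
    have s: "real K / real n > 0" using K n0 by simp
    from design_deviation_event[where A="{()}" and u="\<lambda>_. ?u", OF m mono(2) B s L]
    show ?thesis using z by (simp add: power2_eq_square[of "real n"] del: resid_component)
  qed
  have E8: "whp (4 * bnd^4 / L) (\<lambda>\<omega>. (avg n (\<lambda>i. X i \<omega> $ k * resid (X i \<omega>, T i \<omega>) $ j) - Sigma_mat \<mu> \<kappa> $ k $ j)\<^sup>2 \<le> L / real n)" for k j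
  proof -
    let ?u = "\<lambda>z. fst z $ k * resid z $ j"
    have m: "?u \<in> borel_measurable borel" by (intro borel_measurable_times fst_component_borel resid_measurable)
    have ub: "AE z in \<mu>. (\<Sum>a\<in>{()}. (?u z)\<^sup>2) \<le> 4 * bnd ^ 4"
      using AE_resid AEX
    proof eventually_elim
      fix z assume *: "\<forall>j. \<bar>resid z $ j\<bar> \<le> 2 * bnd" "\<forall>k. \<bar>fst z $ k\<bar> \<le> bnd"
      have "(?u z)\<^sup>2 \<le> bnd\<^sup>2 * (2 * bnd)\<^sup>2"
        unfolding power_mult_distrib[of "fst z $ k"] using * by (intro mult_mono sq_le) (auto simp del: resid_component)
      also have "bnd\<^sup>2 * (2 * bnd)\<^sup>2 = 4 * bnd ^ 4" by (simp add: power2_eq_square power4_eq_xxxx)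
      finally show "(\<Sum>a\<in>{()}. (?u z)\<^sup>2) \<le> 4 * bnd ^ 4" by simp
    qed
    have fin: "finite {()}" by simp
    note b = bounded_sum_squares[where A="{()}" and u="\<lambda>_. ?u", OF fin m ub]
    from design_deviation_event[where A="{()}" and u="\<lambda>_. ?u", OF m b zero_less_one L]
    show ?thesis by (simp add: Sigma_component_resid del: resid_component)
  qed
  have cut: "cut01 h (T i \<omega>) = h (T i \<omega>)" if "\<forall>i\<in>{1..n}. X i \<omega> \<in> \<K> \<and> T i \<omega> \<in> {0..<1}" "i \<in> {1..n}" for h i \<omega>
  proof -
    have "T i \<omega> \<in> {0..<1}" using that by blast
    then show ?thesis by (simp add: cut01_def)
  qed
  have E4': "whp (Cf / L) (\<lambda>\<omega>. avg n (\<lambda>i. (f (T i \<omega>) - fK (T i \<omega>))\<^sup>2) \<le> L * real K / real n)"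
    by (rule events_mono[OF events_conj[OF E0 E4, unfolded add_0_left]], elim conjE, erule ord_eq_le_trans[rotated],
        rule avg_cong, simp only: cut)
  have E5': "whp (1 / L) (\<lambda>\<omega>. avg n (\<lambda>i. (cond_mean \<kappa> j (T i \<omega>) - g j (T i \<omega>))\<^sup>2) \<le> L * \<epsilon> / real K)" for j
    by (rule events_mono[OF events_conj[OF E0 E5[of j], unfolded add_0_left]], elim conjE, erule ord_eq_le_trans[rotated],
        rule avg_cong, simp only: cut)
  have E6': "whp (\<sigma>\<^sup>2 / L) (\<lambda>\<omega>. (avg n (\<lambda>i. W i \<omega> * (cond_mean \<kappa> j (T i \<omega>) - g j (T i \<omega>))))\<^sup>2 \<le> L * \<epsilon> / real n)" for j
    by (rule events_mono[OF events_conj[OF E0 E6[of j], unfolded add_0_left]], elim conjE, erule ord_eq_le_trans[rotated], rule arg_cong[where f="\<lambda>x. x\<^sup>2"],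
        rule avg_cong, simp only: cut)
  have E7': "whp (4 * bnd\<^sup>2 * Cf / L) (\<lambda>\<omega>. (avg n (\<lambda>i. (f (T i \<omega>) - fK (T i \<omega>)) * resid (X i \<omega>, T i \<omega>) $ j))\<^sup>2 \<le> L * real K / (real n)\<^sup>2)" for j
    by (rule events_mono[OF events_conj[OF E0 E7[of j], unfolded add_0_left]], elim conjE, erule ord_eq_le_trans[rotated], rule arg_cong[where f="\<lambda>x. x\<^sup>2"],
        rule avg_cong, simp only: cut)
  note all = events_conj[OF E1 events_conj[OF E2 events_conj[OF events_all[OF E3] events_conj[OF E4' events_conj[OF events_all[OF E5']
      events_conj[OF events_all[OF E6'] events_conj[OF events_all[OF E7'] events_all[OF events_all[OF E8]]]]]]]]]
  show ?thesis unfolding risk_const_def Let_def P_def[symmetric] by (rule all)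
qed

text \<open>Every point of the good event yields an instance of the locale \<open>fit\<close>, in
  which the deterministic expansion holds.\<close>

lemma expansion_event:
  fixes r K :: nat and f fK :: "real \<Rightarrow> real" and g :: "'q \<Rightarrow> real \<Rightarrow> real"
  assumes r: "r > 0" and K: "K > 0" and c: "\<And>t. (\<Sum>j<K. \<Sum>m=1..r. (local_basis r K j m t)\<^sup>2) \<le> c"
    and f: "cut01 f \<in> borel_measurable borel" and fK: "fK \<in> pw_poly r K"
    and fL: "(\<lambda>z. cut01 f (snd z) - fK (snd z)) \<in> L2_fun \<mu>" and fe: "(l2 \<mu> (\<lambda>z. cut01 f (snd z) - fK (snd z)))\<^sup>2 \<le> Cf * (real K / real n)"
    and g: "\<And>j. g j \<in> pw_poly r K"
    and gL: "\<And>j. (\<lambda>z. cut01 (cond_mean \<kappa> j) (snd z) - g j (snd z)) \<in> L2_fun \<mu>"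
    and ge: "\<And>j. (l2 \<mu> (\<lambda>z. cut01 (cond_mean \<kappa> j) (snd z) - g j (snd z)))\<^sup>2 \<le> \<epsilon> / real K"
    and \<epsilon>: "\<epsilon> > 0" and L: "L > 0"
    and I0: "I0 = {j. \<beta> $ j \<noteq> 0}" and bmin: "bmin > 0" "\<And>j. j \<in> I0 \<Longrightarrow> bmin \<le> \<bar>\<beta> $ j\<bar>"
    and C2: "C2 > 0" "\<And>v l. v \<in> pw_poly r K \<Longrightarrow> basis_bounded r K C2 v l"
    and S: "(\<integral>z. (reg_fun \<beta> fK z)\<^sup>2 \<partial>\<mu>) \<le> S"
    and big1: "C2 * real K * sqrt (L / real n) \<le> 1 / 2"
    and big2: "(16 + 64 * C2) * L < 16 * real r * ln (real n)"
    and big3: "(16 + 64 * C2) * L * real K / real n + 16 * (real CARD('q) + 1) * real r * real K * (ln (real n) / real n) < lam * bmin\<^sup>2"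
    and big4: "(16 + 64 * C2) * L * real K / real n \<le> 1"
    and big5: "(2 * S + 2) / h0 \<le> (2 * exp ((ln (real n))\<^sup>2))\<^sup>2"
    and sel: "selected_estimator n M r \<K> (UNIV \<times> {K}) (log_penalty n r) (observation \<beta> f X T W) bhat"
  defines "B \<equiv> block_inv I0 (Sigma_mat \<mu> \<kappa>)"
  shows "whp (risk_const \<sigma> c Cf / L) (\<lambda>\<omega>. \<forall>i.
    \<bar>(bhat \<omega> $ i - \<beta> $ i) - (if i \<in> I0 then \<Sum>j\<in>I0. B $ i $ j * avg n (\<lambda>l. W l \<omega> * resid (X l \<omega>, T l \<omega>) $ j) else 0)\<bar>
     \<le> (\<Sum>i\<in>UNIV. \<Sum>j\<in>UNIV. \<bar>B $ i $ j\<bar>) * remainder n L C2 \<epsilon> K)"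
proof -
  from good_events[OF r K c f fK fL fe g gL ge \<epsilon> L]
  have ev: "whp (risk_const \<sigma> c Cf / L) (\<lambda>\<omega>.
    fit \<mu> \<kappa> \<K> h0 h1 n r K (\<lambda>i. X i \<omega>) (\<lambda>i. T i \<omega>) (\<lambda>i. W i \<omega>) \<beta> f fK g L \<epsilon> C2 bmin S I0)"
  proof (rule events_mono, goal_cases)
    case (1 \<omega>)
    note E = conjunct1[OF 1] conjunct1[OF conjunct2[OF 1]] conjunct1[OF conjunct2[OF conjunct2[OF 1]], rule_format]
      conjunct1[OF conjunct2[OF conjunct2[OF conjunct2[OF 1]]]]
      conjunct1[OF conjunct2[OF conjunct2[OF conjunct2[OF conjunct2[OF 1]]]], rule_format]
      conjunct1[OF conjunct2[OF conjunct2[OF conjunct2[OF conjunct2[OF conjunct2[OF 1]]]]], rule_format]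
      conjunct1[OF conjunct2[OF conjunct2[OF conjunct2[OF conjunct2[OF conjunct2[OF conjunct2[OF 1]]]]]], rule_format]
      conjunct2[OF conjunct2[OF conjunct2[OF conjunct2[OF conjunct2[OF conjunct2[OF conjunct2[OF 1]]]]]], rule_format]
    show ?case
    proof (intro fit.intro design_axioms fit_axioms.intro)
      show "bmin \<le> \<bar>\<beta> $ j\<bar>" if "j \<in> I0" for j by (rule bmin(2)[OF that])
      show "basis_bounded r K C2 v l"
        if "v \<in> pw_poly r K" for v l by (rule C2(2)[OF that])
    qed (fact n r K I0 fK g bmin(1) C2(1) E S big1 big2 big3 big4 big5 less_imp_le[OF L] less_imp_le[OF \<epsilon>])+
  qed
  then obtain G where G: "G \<in> sets M" "measure M (space M - G) \<le> risk_const \<sigma> c Cf / L"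
    and F: "\<And>\<omega>. \<omega> \<in> G \<Longrightarrow> fit \<mu> \<kappa> \<K> h0 h1 n r K (\<lambda>i. X i \<omega>) (\<lambda>i. T i \<omega>) (\<lambda>i. W i \<omega>) \<beta> f fK g L \<epsilon> C2 bmin S I0"
    by blast
  show ?thesis
  proof (intro bexI[OF _ G(1)] conjI[OF G(2)] ballI allI)
    fix \<omega> i assume w: "\<omega> \<in> G"
    interpret fit \<mu> \<kappa> \<K> h0 h1 n r K "\<lambda>i. X i \<omega>" "\<lambda>i. T i \<omega>" "\<lambda>i. W i \<omega>" \<beta> f fK g L \<epsilon> C2 bmin S I0 by (rule F[OF w])
    have "\<omega> \<in> space M" using sets.sets_into_space[OF G(1)] w by blast
    then have "selected_value n r \<K> (UNIV \<times> {K}) (log_penalty n r) (observation \<beta> f X T W \<omega>) (bhat \<omega>)"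
      using sel by (simp add: selected_estimator_def)
    moreover have "observation \<beta> f X T W \<omega> = obs" by (rule ext) (simp add: observation_def)
    ultimately have "selected_value n r \<K> (UNIV \<times> {K}) (log_penalty n r) obs (bhat \<omega>)" by simp
    from selected_value_expansion[OF this, of i]
    show "\<bar>(bhat \<omega> $ i - \<beta> $ i) - (if i \<in> I0 then \<Sum>j\<in>I0. B $ i $ j * avg n (\<lambda>l. W l \<omega> * resid (X l \<omega>, T l \<omega>) $ j) else 0)\<bar>
     \<le> (\<Sum>i\<in>UNIV. \<Sum>j\<in>UNIV. \<bar>B $ i $ j\<bar>) * remainder n L C2 \<epsilon> K"
      unfolding B_def remainder_def err_def C3_def .
  qed
qed

end

section \<open>Asymptotic smallness of the remainder\<close>

context design
begin

text \<open>After multiplication by sqrt n the factor \<open>K\<close> cancels wherever K / n meets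
  \<epsilon> / K. The first and fifth terms leave K / n; the last, where the estimation error meets
  the coefficient bound, leaves K^2 / n.\<close>

lemma remainder_tendsto:
  fixes K :: "nat \<Rightarrow> nat" and \<epsilon> :: "nat \<Rightarrow> real"
  assumes K: "\<And>n. n \<ge> 2 \<Longrightarrow> K n > 0" and K2: "(\<lambda>n. (real (K n))\<^sup>2 / real n) \<longlonglongrightarrow> 0"
    and kn: "(\<lambda>n. real (K n) / real n) \<longlonglongrightarrow> 0" and \<epsilon>: "\<epsilon> \<longlonglongrightarrow> 0"
  shows "(\<lambda>n. sqrt (real n) * remainder n L C2 (\<epsilon> n) (K n)) \<longlonglongrightarrow> 0"
proof (rule Lim_transform_eventually)
  define C where "C = 16 + 64 * C2"
  let ?R = "\<lambda>n. sqrt (L * (real (K n) / real n)) + sqrt (L * L * \<epsilon> n) + sqrt (L * \<epsilon> n) + sqrt (2 * C * L * L * \<epsilon> n)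
     + real CARD('q) * (sqrt (C * L / lam * (real (K n) / real n)) * sqrt L) + sqrt (C2 * C * L * L * ((real (K n))\<^sup>2 / real n))"
  have "?R \<longlonglongrightarrow> sqrt (L * 0) + sqrt (L * L * 0) + sqrt (L * 0) + sqrt (2 * C * L * L * 0)
     + real CARD('q) * (sqrt (C * L / lam * 0) * sqrt L) + sqrt (C2 * C * L * L * 0)"
    by (intro tendsto_intros K2 kn \<epsilon>)
  then show "?R \<longlonglongrightarrow> 0" by simp
  show "\<forall>\<^sub>F n in sequentially. ?R n = sqrt (real n) * remainder n L C2 (\<epsilon> n) (K n)"
    using eventually_ge_at_top[of 2]
  proof eventually_elim
    fix n :: nat assume n: "2 \<le> n"
    have k: "real (K n) > 0" "real n > 0" using K[OF n] n by auto
    have s: "sqrt (real n) * sqrt a = sqrt b" if "real n * a = b" for a b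
      using that by (simp add: real_sqrt_mult[symmetric])
    have e1: "sqrt (real n) * sqrt (L * real (K n) / (real n)\<^sup>2) = sqrt (L * (real (K n) / real n))"
      using k by (intro s) (simp add: power2_eq_square)
    have e2: "sqrt (real n) * sqrt ((L * real (K n) / real n) * (L * \<epsilon> n / real (K n))) = sqrt (L * L * \<epsilon> n)"
      using k by (intro s) simp
    have e3: "sqrt (real n) * sqrt (L * \<epsilon> n / real n) = sqrt (L * \<epsilon> n)"
      using k by (intro s) simp
    have e4: "sqrt (real n) * sqrt ((2 * (C * L * real (K n) / real n)) * (L * \<epsilon> n / real (K n))) = sqrt (2 * C * L * L * \<epsilon> n)"
      using k by (intro s) simp
    have e5: "sqrt (real n) * (sqrt (C * L * real (K n) / real n / lam) * sqrt (L / real n)) = sqrt (C * L / lam * (real (K n) / real n)) * sqrt L"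
    proof -
      have "sqrt (real n) * sqrt (L / real n) = sqrt L" using k by (intro s) simp
      moreover have "C * L * real (K n) / real n / lam = C * L / lam * (real (K n) / real n)" by simp
      ultimately show ?thesis by (subst mult.left_commute) (simp only:)
    qed
    have e6: "sqrt (real n) * sqrt (C2 * real (K n) * (C * L * real (K n) / real n) * (L / real n)) = sqrt (C2 * C * L * L * ((real (K n))\<^sup>2 / real n))"
      using k by (intro s) (simp add: power2_eq_square field_simps)
    have "sqrt (real n) * remainder n L C2 (\<epsilon> n) (K n) = sqrt (real n) * sqrt (L * real (K n) / (real n)\<^sup>2)
      + sqrt (real n) * sqrt ((L * real (K n) / real n) * (L * \<epsilon> n / real (K n))) + sqrt (real n) * sqrt (L * \<epsilon> n / real n)
      + sqrt (real n) * sqrt ((2 * (C * L * real (K n) / real n)) * (L * \<epsilon> n / real (K n)))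
      + real CARD('q) * (sqrt (real n) * (sqrt (C * L * real (K n) / real n / lam) * sqrt (L / real n)))
      + sqrt (real n) * sqrt (C2 * real (K n) * (C * L * real (K n) / real n) * (L / real n))"
      unfolding remainder_def C_def[symmetric]
      by (simp only: distrib_left mult.left_commute[of "sqrt (real n)" "real CARD('q)"])
    then show "?R n = sqrt (real n) * remainder n L C2 (\<epsilon> n) (K n)" unfolding e1 e2 e3 e4 e5 e6 by simp
  qed
qed

end

text \<open>The conditions on \<open>K\<close> follow from K^2 / n -> 0: K is an integer, so K <=
  K^2, and K ln n / n is the product of K / sqrt n and ln n / sqrt n.\<close>

lemma eventually_large:
  fixes K :: "nat \<Rightarrow> nat"
  assumes K2: "(\<lambda>n. (real (K n))\<^sup>2 / real n) \<longlonglongrightarrow> 0" and r: "r > 0" and m: "m > 0"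
  shows "(\<lambda>n. real (K n) / real n) \<longlonglongrightarrow> 0"
    "\<forall>\<^sub>F n in sequentially. C2 * real (K n) * sqrt (L / real n) \<le> 1 / 2"
    "\<forall>\<^sub>F n in sequentially. a < 16 * real r * ln (real n)"
    "\<forall>\<^sub>F n in sequentially. a * real (K n) / real n + 16 * (q + 1) * real r * real (K n) * (ln (real n) / real n) < m"
    "\<forall>\<^sub>F n in sequentially. a * real (K n) / real n \<le> 1"
    "\<forall>\<^sub>F n in sequentially. a \<le> (2 * exp ((ln (real n))\<^sup>2))\<^sup>2"
proof -
  have sq: "(\<lambda>n. real (K n) / sqrt (real n)) \<longlonglongrightarrow> 0"
    using tendsto_real_sqrt[OF K2] by (simp add: real_sqrt_divide)
  show kn: "(\<lambda>n. real (K n) / real n) \<longlonglongrightarrow> 0"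
  proof (rule tendsto_sandwich[OF _ _ tendsto_const K2])
    have "real (K n) / real n \<le> (real (K n))\<^sup>2 / real n" for n
    proof (rule divide_right_mono)
      have "K n \<le> K n ^ 2" by (simp add: power2_eq_square)
      then show "real (K n) \<le> (real (K n))\<^sup>2" by (simp flip: of_nat_power)
    qed simp
    then show "\<forall>\<^sub>F n in sequentially. real (K n) / real n \<le> (real (K n))\<^sup>2 / real n" by simp
  qed simp
  have "(\<lambda>n. C2 * sqrt L * (real (K n) / sqrt (real n))) \<longlonglongrightarrow> C2 * sqrt L * 0" by (intro tendsto_intros sq)
  then have "\<forall>\<^sub>F n in sequentially. C2 * sqrt L * (real (K n) / sqrt (real n)) < 1 / 2"
    by (rule order_tendstoD) simp
  then show "\<forall>\<^sub>F n in sequentially. C2 * real (K n) * sqrt (L / real n) \<le> 1 / 2"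
    by eventually_elim (simp add: real_sqrt_divide mult_ac)
  have lnr: "filterlim (\<lambda>n. ln (real n)) at_top sequentially"
    by (rule filterlim_compose[OF ln_at_top filterlim_real_sequentially])
  have "\<forall>\<^sub>F n in sequentially. a / (16 * real r) + 1 \<le> ln (real n)"
    using lnr unfolding filterlim_at_top by blast
  then show "\<forall>\<^sub>F n in sequentially. a < 16 * real r * ln (real n)"
  proof eventually_elim
    fix n assume "a / (16 * real r) + 1 \<le> ln (real n)"
    then have "a / (16 * real r) < ln (real n)" by linarith
    then show "a < 16 * real r * ln (real n)" using r by (simp add: divide_less_eq mult_ac)
  qed
  have "(\<lambda>n. (real (K n) / sqrt (real n)) * (ln (real n) / real n powr (1/2))) \<longlonglongrightarrow> 0 * 0"
    by (intro tendsto_mult sq lim_ln_over_power) simp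
  then have kl: "(\<lambda>n. real (K n) * (ln (real n) / real n)) \<longlonglongrightarrow> 0"
    by (simp add: powr_half_sqrt)
  have "(\<lambda>n. a * (real (K n) / real n) + 16 * (q + 1) * real r * (real (K n) * (ln (real n) / real n))) \<longlonglongrightarrow> a * 0 + 16 * (q + 1) * real r * 0"
    by (intro tendsto_intros kn kl)
  then have "\<forall>\<^sub>F n in sequentially. a * (real (K n) / real n) + 16 * (q + 1) * real r * (real (K n) * (ln (real n) / real n)) < m"
    by (rule order_tendstoD) (use m in simp)
  then show "\<forall>\<^sub>F n in sequentially. a * real (K n) / real n + 16 * (q + 1) * real r * real (K n) * (ln (real n) / real n) < m"
    by (simp add: mult.assoc)
  have "(\<lambda>n. a * (real (K n) / real n)) \<longlonglongrightarrow> a * 0" by (intro tendsto_intros kn)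
  then have "\<forall>\<^sub>F n in sequentially. a * (real (K n) / real n) < 1"
    by (rule order_tendstoD) simp
  then show "\<forall>\<^sub>F n in sequentially. a * real (K n) / real n \<le> 1" by eventually_elim simp
  have "\<forall>\<^sub>F n in sequentially. max a 1 \<le> ln (real n)"
    using lnr unfolding filterlim_at_top by blast
  then show "\<forall>\<^sub>F n in sequentially. a \<le> (2 * exp ((ln (real n))\<^sup>2))\<^sup>2"
  proof eventually_elim
    fix n assume *: "max a 1 \<le> ln (real n)"
    then have "ln (real n) * 1 \<le> ln (real n) * ln (real n)" by (intro mult_left_mono) auto
    then have "ln (real n) \<le> (ln (real n))\<^sup>2" by (simp add: power2_eq_square)
    then have "a \<le> (ln (real n))\<^sup>2" using * by simp
    also have "\<dots> \<le> exp ((ln (real n))\<^sup>2)" using exp_ge_add_one_self[of "(ln (real n))\<^sup>2"] by linarith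
    finally have a: "a \<le> exp ((ln (real n))\<^sup>2)" .
    have "1 \<le> exp ((ln (real n))\<^sup>2)" by simp
    then have *: "exp ((ln (real n))\<^sup>2) * 1 \<le> exp ((ln (real n))\<^sup>2) * exp ((ln (real n))\<^sup>2)" by (intro mult_left_mono) auto
    have "a \<le> 4 * p" if "a \<le> y" "y * 1 \<le> p" "0 < y" for y p :: real using that by linarith
    from this[OF a * exp_gt_zero] have "a \<le> 4 * (exp ((ln (real n))\<^sup>2) * exp ((ln (real n))\<^sup>2))" .
    then show "a \<le> (2 * exp ((ln (real n))\<^sup>2))\<^sup>2"
      unfolding power_mult_distrib power2_eq_square[of "exp _"] by simp
  qed
qed

section \<open>The leading term and its covariance\<close>

context design
begin

text \<open>The influence function of the estimator: the summand to which the central limit theorem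
  is applied. Its covariance is the claimed limit covariance, as \<open>influence_moments\<close>
  shows.\<close>

definition influence :: "'q set \<Rightarrow> ((real ^ 'q) \<times> real) \<times> real \<Rightarrow> real ^ 'q" where
  "influence I z = (\<chi> i. if i \<in> I then snd z * (\<Sum>j\<in>I. block_inv I (Sigma_mat \<mu> \<kappa>) $ i $ j * resid (fst z) $ j) else 0)"

lemma influence_component: "influence I z $ i = snd z * (if i \<in> I then \<Sum>j\<in>I. block_inv I (Sigma_mat \<mu> \<kappa>) $ i $ j * resid (fst z) $ j else 0)"
  by (simp add: influence_def)

lemma influence_measurable: "influence I \<in> borel_measurable borel"
proof -
  have "(\<lambda>z. influence I z \<bullet> b) \<in> borel_measurable borel" if b: "b \<in> Basis" for b
  proof -
    obtain i where i: "b = axis i 1" using b by (auto simp: Basis_vec_def)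
    have [measurable]: "(\<lambda>z :: ((real ^ 'q) \<times> real) \<times> real. resid (fst z) $ j) \<in> borel_measurable borel" for j
      by (rule measurable_compose[OF fst_borel resid_measurable])
    have "(\<lambda>z. influence I z \<bullet> b) = (\<lambda>z. snd z * (if i \<in> I then \<Sum>j\<in>I. block_inv I (Sigma_mat \<mu> \<kappa>) $ i $ j * resid (fst z) $ j else 0))"
      by (simp only: i inner_axis influence_component) simp
    also have "\<dots> \<in> borel_measurable borel"
      by (cases "i \<in> I") (simp_all del: resid_component, measurable)
    finally show ?thesis .
  qed
  then show ?thesis by (subst borel_measurable_euclidean_space) blast
qed

lemma L2_resid_sum: "(\<lambda>z. \<Sum>j\<in>A. a j * resid z $ j) \<in> L2_fun \<mu>"
  by (intro L2_fun_sum L2_fun_cmult L2_resid)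

end

context sampling
begin

text \<open>Noise and residual are independent, so the variance in direction t is \<sigma> squared
  times the quadratic form of \<open>Sigma_mat\<close> at y, where y is the transposed block inverse
  applied to t. On the block the inverse cancels \<open>Sigma_mat\<close>, and one factor of the
  block inverse remains.\<close>

lemma influence_moments:
  shows "integrable \<nu> (\<lambda>z. (norm (influence I z))\<^sup>2)" "(\<integral>z. influence I z \<partial>\<nu>) = 0"
    "(\<integral>z. (t \<bullet> influence I z)\<^sup>2 \<partial>\<nu>) = t \<bullet> (limit_cov I \<mu> \<kappa> \<sigma> *v t)"
proof -
  let ?B = "block_inv I (Sigma_mat \<mu> \<kappa>)"
  let ?u = "\<lambda>i z. if i \<in> I then \<Sum>j\<in>I. ?B $ i $ j * resid z $ j else 0"
  have uL: "?u i \<in> L2_fun \<mu>" for i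
  proof (cases "i \<in> I")
    case True
    then show ?thesis using L2_resid_sum[of "\<lambda>j. ?B $ i $ j" I] by (simp del: resid_component)
  next
    case False
    then show ?thesis by (simp add: L2_fun_def)
  qed
  have "(\<lambda>z. (norm (influence I z))\<^sup>2) = (\<lambda>z. \<Sum>i\<in>UNIV. (snd z * ?u i (fst z))\<^sup>2)"
    unfolding power2_norm_eq_inner inner_vec_def influence_component by (simp add: power2_eq_square)
  then show "integrable \<nu> (\<lambda>z. (norm (influence I z))\<^sup>2)"
    by (simp only:) (intro Bochner_Integration.integrable_sum noise_product(1)[OF uL])
  show "(\<integral>z. influence I z \<partial>\<nu>) = 0"
  \<comment> \<open>A nonintegrable function has Bochner integral 0 by convention, so only the
    integrable case requires a computation.\<close>
  proof (cases "integrable \<nu> (influence I)")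
    case True
    have "(\<integral>z. influence I z \<partial>\<nu>) $ i = 0" for i
    proof -
      have "(\<integral>z. influence I z \<partial>\<nu>) $ i = (\<integral>z. influence I z $ i \<partial>\<nu>)"
        by (rule integral_bounded_linear[OF bounded_linear_vec_nth True, symmetric])
      also have "\<dots> = 0" unfolding influence_component by (rule noise_product(3)[OF uL])
      finally show ?thesis .
    qed
    then show ?thesis by (simp add: vec_eq_iff)
  qed (rule not_integrable_integral_eq)
  define y :: "real ^ 'q" where "y = (\<chi> j. if j \<in> I then \<Sum>i\<in>I. t $ i * ?B $ i $ j else 0)"
  have ti: "t \<bullet> influence I z = snd z * (y \<bullet> resid (fst z))" for z
  proof -
    have "t \<bullet> influence I z = (\<Sum>i\<in>UNIV. if i \<in> I then snd z * (t $ i * (\<Sum>j\<in>I. ?B $ i $ j * resid (fst z) $ j)) else 0)"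
      unfolding inner_vec_def influence_component by (intro sum.cong refl) (simp del: resid_component)
    also have "\<dots> = (\<Sum>i\<in>I. snd z * (t $ i * (\<Sum>j\<in>I. ?B $ i $ j * resid (fst z) $ j)))"
      by (simp only: sum.If_cases finite) simp
    also have "\<dots> = snd z * (\<Sum>i\<in>I. \<Sum>j\<in>I. t $ i * ?B $ i $ j * resid (fst z) $ j)"
      by (simp only: sum_distrib_left mult.assoc)
    also have "(\<Sum>i\<in>I. \<Sum>j\<in>I. t $ i * ?B $ i $ j * resid (fst z) $ j) = (\<Sum>j\<in>I. (\<Sum>i\<in>I. t $ i * ?B $ i $ j) * resid (fst z) $ j)"
      unfolding sum_distrib_right by (rule sum.swap)
    also have "\<dots> = (\<Sum>j\<in>UNIV. if j \<in> I then (\<Sum>i\<in>I. t $ i * ?B $ i $ j) * resid (fst z) $ j else 0)"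
      by (simp only: sum.If_cases finite) simp
    also have "\<dots> = y \<bullet> resid (fst z)"
      unfolding inner_vec_def y_def by (intro sum.cong refl) (simp del: resid_component)
    finally show ?thesis .
  qed
  have "(\<integral>z. (t \<bullet> influence I z)\<^sup>2 \<partial>\<nu>) = \<sigma>\<^sup>2 * (\<integral>z. (y \<bullet> resid z)\<^sup>2 \<partial>\<mu>)"
    unfolding ti by (rule noise_product(2)[OF L2_inner_resid])
  also have "(\<integral>z. (y \<bullet> resid z)\<^sup>2 \<partial>\<mu>) = y \<bullet> (Sigma_mat \<mu> \<kappa> *v y)" by (rule Sigma_quadratic[symmetric])
  also have "\<dots> = (\<Sum>j\<in>I. (\<Sum>i\<in>I. t $ i * ?B $ i $ j) * t $ j)"
  proof -
    have sy: "Sigma_mat \<mu> \<kappa> $ j $ k = Sigma_mat \<mu> \<kappa> $ k $ j" for j k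
    proof -
      have "transpose (Sigma_mat \<mu> \<kappa>) $ j $ k = Sigma_mat \<mu> \<kappa> $ j $ k" by (simp only: Sigma_sym)
      then show ?thesis by (simp add: transpose_def)
    qed
    have col: "(Sigma_mat \<mu> \<kappa> *v y) $ j = t $ j" if j: "j \<in> I" for j
    proof -
      have "(Sigma_mat \<mu> \<kappa> *v y) $ j = (\<Sum>k\<in>UNIV. if k \<in> I then Sigma_mat \<mu> \<kappa> $ j $ k * (\<Sum>i\<in>I. t $ i * ?B $ i $ k) else 0)"
        unfolding matrix_vector_mult_def y_def by (simp, intro sum.cong refl) simp
      also have "\<dots> = (\<Sum>k\<in>I. \<Sum>i\<in>I. t $ i * (?B $ i $ k * Sigma_mat \<mu> \<kappa> $ k $ j))"
        by (simp only: sum.If_cases finite) (simp add: sum_distrib_left sy[of j] mult_ac)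
      also have "\<dots> = (\<Sum>i\<in>I. t $ i * (\<Sum>k\<in>I. ?B $ i $ k * Sigma_mat \<mu> \<kappa> $ k $ j))"
        unfolding sum_distrib_left by (rule sum.swap)
      also have "\<dots> = (\<Sum>i\<in>I. t $ i * (if i = j then 1 else 0))"
        using j by (intro sum.cong refl) (simp add: block_inv_factor(1)[OF Sigma_posdef Sigma_sym])
      also have "\<dots> = (\<Sum>i\<in>I. if i = j then t $ i else 0)" by (intro sum.cong refl) simp
      also have "\<dots> = t $ j" using j by simp
      finally show ?thesis .
    qed
    have "y \<bullet> (Sigma_mat \<mu> \<kappa> *v y) = (\<Sum>j\<in>UNIV. if j \<in> I then (\<Sum>i\<in>I. t $ i * ?B $ i $ j) * (Sigma_mat \<mu> \<kappa> *v y) $ j else 0)"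
      unfolding inner_vec_def by (intro sum.cong refl) (simp add: y_def)
    also have "\<dots> = (\<Sum>j\<in>I. (\<Sum>i\<in>I. t $ i * ?B $ i $ j) * (Sigma_mat \<mu> \<kappa> *v y) $ j)"
      by (simp only: sum.If_cases finite) simp
    finally show ?thesis using col by simp
  qed
  also have "\<sigma>\<^sup>2 * \<dots> = t \<bullet> (limit_cov I \<mu> \<kappa> \<sigma> *v t)"
  proof -
    have "t \<bullet> (limit_cov I \<mu> \<kappa> \<sigma> *v t) = (\<Sum>i\<in>UNIV. if i \<in> I then t $ i * (\<Sum>j\<in>I. \<sigma>\<^sup>2 * ?B $ i $ j * t $ j) else 0)"
    proof -
      have "(limit_cov I \<mu> \<kappa> \<sigma> *v t) $ i = (if i \<in> I then \<Sum>j\<in>I. \<sigma>\<^sup>2 * ?B $ i $ j * t $ j else 0)" for i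
      proof -
        have "(limit_cov I \<mu> \<kappa> \<sigma> *v t) $ i = (\<Sum>j\<in>UNIV. if j \<in> I then (if i \<in> I then \<sigma>\<^sup>2 * ?B $ i $ j * t $ j else 0) else 0)"
          unfolding matrix_vector_mult_def limit_cov_def by (simp, intro sum.cong refl) simp
        also have "\<dots> = (\<Sum>j\<in>I. if i \<in> I then \<sigma>\<^sup>2 * ?B $ i $ j * t $ j else 0)"
          by (simp only: sum.If_cases finite) simp
        finally show ?thesis by simp
      qed
      then show ?thesis unfolding inner_vec_def by (intro sum.cong refl) simp
    qed
    also have "\<dots> = (\<Sum>i\<in>I. t $ i * (\<Sum>j\<in>I. \<sigma>\<^sup>2 * ?B $ i $ j * t $ j))"
      by (simp only: sum.If_cases finite) simp
    also have "\<dots> = \<sigma>\<^sup>2 * (\<Sum>i\<in>I. \<Sum>j\<in>I. t $ i * ?B $ i $ j * t $ j)"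
      by (simp add: sum_distrib_left mult_ac)
    also have "(\<Sum>i\<in>I. \<Sum>j\<in>I. t $ i * ?B $ i $ j * t $ j) = (\<Sum>j\<in>I. (\<Sum>i\<in>I. t $ i * ?B $ i $ j) * t $ j)"
      unfolding sum_distrib_right by (rule sum.swap)
    finally show ?thesis by simp
  qed
  finally show "(\<integral>z. (t \<bullet> influence I z)\<^sup>2 \<partial>\<nu>) = t \<bullet> (limit_cov I \<mu> \<kappa> \<sigma> *v t)" .
qed

end

section \<open>The limit law\<close>

text \<open>Separates the statistics from the rates: approximation theory enters only through a
  squared error of order K / n for \<open>f\<close> and of smaller order than 1 / K for the
  conditional means.\<close>

theorem (in design) selected_estimator_limit:
  fixes M :: "nat \<Rightarrow> 'w measure" and X :: "nat \<Rightarrow> nat \<Rightarrow> 'w \<Rightarrow> real ^ 'q" and T W :: "nat \<Rightarrow> nat \<Rightarrow> 'w \<Rightarrow> real"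
    and K :: "nat \<Rightarrow> nat" and \<epsilon> :: "nat \<Rightarrow> real"
  assumes noise: "noise_law \<zeta> \<sigma>" and sample: "\<And>n. n \<ge> 2 \<Longrightarrow> iid_sample n (M n) (X n) (T n) (W n) \<mu> \<zeta>"
    and I0: "I0 = {j. \<beta> $ j \<noteq> 0}" and r: "r > 0"
    and K: "\<And>n. n \<ge> 2 \<Longrightarrow> K n > 0" and K2: "(\<lambda>n. (real (K n))\<^sup>2 / real n) \<longlonglongrightarrow> 0"
    and f: "cut01 f \<in> borel_measurable borel"
    and fK: "\<And>n. n \<ge> 2 \<Longrightarrow> approximable r (K n) f (Cf * (real (K n) / real n))"
    and g: "\<And>n j. n \<ge> 2 \<Longrightarrow> approximable r (K n) (cond_mean \<kappa> j) (\<epsilon> n / real (K n))"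
    and \<epsilon>: "\<And>n. n \<ge> 2 \<Longrightarrow> \<epsilon> n > 0" "\<epsilon> \<longlonglongrightarrow> 0"
    and sel: "\<And>n. n \<ge> 2 \<Longrightarrow> selected_estimator n (M n) r \<K> (UNIV \<times> {K n}) (log_penalty n r) (observation \<beta> f (X n) (T n) (W n)) (bhat n)"
  shows "converges_weakly (\<lambda>n. distr (M n) borel (\<lambda>\<omega>. sqrt (real n) *\<^sub>R (bhat n \<omega> - \<beta>))) (mv_normal 0 (limit_cov I0 \<mu> \<kappa> \<sigma>))"
proof -
  let ?V = "limit_cov I0 \<mu> \<kappa> \<sigma>" and ?B = "block_inv I0 (Sigma_mat \<mu> \<kappa>)"
  have smp: "sampling \<mu> \<kappa> \<K> h0 h1 n (M n) (X n) (T n) (W n) \<zeta> \<sigma>" if "n \<ge> 2" for n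
    by (intro sampling.intro design_axioms sampling_axioms.intro that sample noise)
  have smp2: "sampling \<mu> \<kappa> \<K> h0 h1 (n + 2) (M (n + 2)) (X (n + 2)) (T (n + 2)) (W (n + 2)) \<zeta> \<sigma>" for n
    by (rule smp) simp
  have R: "\<exists>R :: real^'q^'q. R ** transpose R = ?V"
    unfolding limit_cov_def by (rule block_inv_factor(2)[OF Sigma_posdef Sigma_sym])
  obtain C2 where C2: "C2 > 0" "\<And>K v l. K > 0 \<Longrightarrow> v \<in> pw_poly r K \<Longrightarrow> basis_bounded r K C2 v l"
    by (rule basis_coercive[OF r], rule that, assumption, assumption)
  obtain c where c: "c \<ge> 0" "\<And>K t. K > 0 \<Longrightarrow> (\<Sum>j<K. \<Sum>m=1..r. (local_basis r K j m t)\<^sup>2) \<le> c"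
    by (rule local_basis_bound[of r], rule that, assumption, assumption)
  \<comment> \<open>The inserted 1 keeps the minimum defined when \<open>I0\<close> is
    empty.\<close>
  define bmin where "bmin = Min (insert 1 ((\<lambda>j. \<bar>\<beta> $ j\<bar>) ` I0))"
  have bmin: "bmin > 0" "\<And>j. j \<in> I0 \<Longrightarrow> bmin \<le> \<bar>\<beta> $ j\<bar>"
    unfolding bmin_def by (simp_all add: I0)
  define Z where "Z n \<omega> = sqrt (real n) *\<^sub>R (bhat n \<omega> - \<beta>)" for n \<omega>
  define U where "U n \<omega> = (1 / sqrt (real n)) *\<^sub>R (\<Sum>i=1..n. influence I0 ((X n i \<omega>, T n i \<omega>), W n i \<omega>))" for n \<omega>
  \<comment> \<open>The hypotheses speak of n >= 2 only, so the limit is taken along n + 2 and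
    shifted back at the end.\<close>
  have "converges_weakly (\<lambda>n. distr (M (n + 2)) borel (Z (n + 2))) (mv_normal 0 ?V)"
  proof (rule converges_weakly_slutsky[where U="\<lambda>n. U (n + 2)"])
    show "prob_space (M (n + 2))" for n by (rule sampling.prob_M[OF smp2])
    show "Z (n + 2) \<in> borel_measurable (M (n + 2))" for n
    proof -
      have [measurable]: "bhat (n + 2) \<in> borel_measurable (M (n + 2))"
        using sel[of "n + 2"] by (simp add: selected_estimator_def)
      show ?thesis unfolding Z_def[abs_def] by measurable
    qed
    show "U (n + 2) \<in> borel_measurable (M (n + 2))" for n
    proof -
      have "(\<lambda>\<omega>. influence I0 ((X (n + 2) i \<omega>, T (n + 2) i \<omega>), W (n + 2) i \<omega>)) \<in> borel_measurable (M (n + 2))" if "i \<in> {1..n + 2}" for i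
        by (rule measurable_compose[OF sampling.sample_measurable[OF smp2 that] influence_measurable])
      then show ?thesis unfolding U_def[abs_def] by (intro borel_measurable_scaleR borel_measurable_sum) auto
    qed
    show "prob_space (mv_normal 0 ?V)" "sets (mv_normal 0 ?V) = sets borel" by (rule mv_normal_0[OF R])+
    show "(\<lambda>n. mv_char (distr (M (n + 2)) borel (U (n + 2))) t) \<longlonglongrightarrow> mv_char (mv_normal 0 ?V) t" for t
    proof -
      have k: "filterlim (\<lambda>n :: nat. n + 2) at_top sequentially" by (rule filterlim_add_const_nat_at_top)
      have "(\<lambda>n. mv_char (distr (M (n + 2)) borel (\<lambda>\<omega>. (1 / sqrt (real (n + 2))) *\<^sub>R (\<Sum>i=1..n + 2. influence I0 ((X (n + 2) i \<omega>, T (n + 2) i \<omega>), W (n + 2) i \<omega>)))) t)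
        \<longlonglongrightarrow> exp (- (\<integral>z. (t \<bullet> influence I0 z)\<^sup>2 \<partial>(\<mu> \<Otimes>\<^sub>M \<zeta>)) / 2)"
        by (rule mv_char_clt[where k="\<lambda>n. n + 2" and N=borel and Z="\<lambda>n i \<omega>. ((X (n + 2) i \<omega>, T (n + 2) i \<omega>), W (n + 2) i \<omega>)",
          OF sampling.prob_M[OF smp2] sampling.sample_indep[OF smp2] sampling.sample_law[OF smp2] sampling.prob_\<nu>[OF smp2] sampling.sets_\<nu>[OF smp2]
            influence_measurable sampling.influence_moments(1,2)[OF smp2] k])
      then show ?thesis
        unfolding U_def[abs_def] sampling.influence_moments(3)[OF smp2] mv_normal_0(3)[OF R] .
    qed
    fix e :: real assume e: "e > 0"
    \<comment> \<open>The level is fixed by e before n grows, so that the failure probability is at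
      most e.\<close>
    define L where "L = \<bar>risk_const \<sigma> c Cf\<bar> / e + 1"
    have L: "L > 0" using e by (simp add: L_def add_nonneg_pos)
    have Le: "risk_const \<sigma> c Cf / L \<le> e"
    proof -
      have "risk_const \<sigma> c Cf \<le> e * L" using e by (simp add: L_def distrib_left)
      then show ?thesis using L by (simp add: divide_le_eq)
    qed
    \<comment> \<open>A bound, uniform in n, for the squared norm of the regression function with
      \<open>f\<close> replaced by its approximation; it relies on K / n <= 1.\<close>
    define S where "S = 2 * (\<integral>z. (reg_fun \<beta> (cut01 f) z)\<^sup>2 \<partial>\<mu>) + 2 * \<bar>Cf\<bar>"
    define Q where "Q = (\<Sum>i\<in>UNIV. \<Sum>j\<in>UNIV. \<bar>?B $ i $ j\<bar>)"
    have lb: "lam * bmin\<^sup>2 > 0" using lam(1) bmin(1) by simp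
    note large = eventually_large[OF K2 r lb]
    have "(\<lambda>n. real CARD('q) * Q * (sqrt (real n) * remainder n L C2 (\<epsilon> n) (K n))) \<longlonglongrightarrow> real CARD('q) * Q * 0"
      by (intro tendsto_intros remainder_tendsto K K2 large(1) \<epsilon>(2))
    then have rem: "\<forall>\<^sub>F n in sequentially. real CARD('q) * Q * (sqrt (real n) * remainder n L C2 (\<epsilon> n) (K n)) < e"
      by (rule order_tendstoD) (use e in simp)
    have "\<forall>\<^sub>F n in sequentially. \<exists>G\<in>sets (M n). measure (M n) G \<ge> 1 - e \<and> (\<forall>\<omega>\<in>G. dist (Z n \<omega>) (U n \<omega>) \<le> e)"
      using eventually_ge_at_top[of 2] rem large(2)[of C2 L] large(3)[of "(16 + 64 * C2) * L"] large(4)[of "(16 + 64 * C2) * L" "real CARD('q)"]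
        large(5)[of "(16 + 64 * C2) * L"] large(6)[of "(2 * S + 2) / h0"] large(5)[of 1]
    proof eventually_elim
      case (elim n)
      interpret sampling \<mu> \<kappa> \<K> h0 h1 n "M n" "X n" "T n" "W n" \<zeta> \<sigma> by (rule smp[OF elim(1)])
      interpret P: prob_space "M n" by (rule prob_M)
      obtain v where v: "v \<in> pw_poly r (K n)" "(\<lambda>z. cut01 f (snd z) - v (snd z)) \<in> L2_fun \<mu>"
        "(l2 \<mu> (\<lambda>z. cut01 f (snd z) - v (snd z)))\<^sup>2 \<le> Cf * (real (K n) / real n)"
        using fK[OF elim(1)] by blast
      obtain w where w: "\<And>j. w j \<in> pw_poly r (K n)" "\<And>j. (\<lambda>z. cut01 (cond_mean \<kappa> j) (snd z) - w j (snd z)) \<in> L2_fun \<mu>"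
        "\<And>j. (l2 \<mu> (\<lambda>z. cut01 (cond_mean \<kappa> j) (snd z) - w j (snd z)))\<^sup>2 \<le> \<epsilon> n / real (K n)"
      proof -
        have "\<forall>j. \<exists>v. v \<in> pw_poly r (K n) \<and> (\<lambda>z. cut01 (cond_mean \<kappa> j) (snd z) - v (snd z)) \<in> L2_fun \<mu> \<and>
          (l2 \<mu> (\<lambda>z. cut01 (cond_mean \<kappa> j) (snd z) - v (snd z)))\<^sup>2 \<le> \<epsilon> n / real (K n)"
          using g[OF elim(1)] by blast
        from choice[OF this] show ?thesis using that by blast
      qed
      have S: "(\<integral>z. (reg_fun \<beta> v z)\<^sup>2 \<partial>\<mu>) \<le> S"
      proof -
        let ?d = "\<lambda>z :: (real ^ 'q) \<times> real. cut01 f (snd z) - v (snd z)"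
        have vL: "(\<lambda>z. v (snd z)) \<in> L2_fun \<mu>" by (rule L2_pw_poly[OF v(1) r K[OF elim(1)]])
        have "(\<lambda>z. cut01 f (snd z)) \<in> L2_fun \<mu>" using L2_fun_add[OF v(2) vL] by simp
        then have fL: "reg_fun \<beta> (cut01 f) \<in> L2_fun \<mu>" by (rule L2_reg_fun)
        have "(\<integral>z. (reg_fun \<beta> v z)\<^sup>2 \<partial>\<mu>) \<le> (\<integral>z. 2 * (reg_fun \<beta> (cut01 f) z)\<^sup>2 + 2 * (?d z)\<^sup>2 \<partial>\<mu>)"
        proof (rule integral_mono)
          show "integrable \<mu> (\<lambda>z. (reg_fun \<beta> v z)\<^sup>2)" by (rule L2_fun_integrable_sq[OF L2_reg_fun[OF vL]])
          show "integrable \<mu> (\<lambda>z. 2 * (reg_fun \<beta> (cut01 f) z)\<^sup>2 + 2 * (?d z)\<^sup>2)"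
            by (intro Bochner_Integration.integrable_add integrable_mult_right L2_fun_integrable_sq fL v(2))
          fix z
          have "reg_fun \<beta> v z = reg_fun \<beta> (cut01 f) z - ?d z" by (simp add: reg_fun_def split_beta)
          moreover have "(a - b)\<^sup>2 \<le> 2 * a\<^sup>2 + 2 * b\<^sup>2" for a b :: real
            using zero_le_power2[of "a + b"] by (simp add: power2_sum power2_diff)
          ultimately show "(reg_fun \<beta> v z)\<^sup>2 \<le> 2 * (reg_fun \<beta> (cut01 f) z)\<^sup>2 + 2 * (?d z)\<^sup>2" by simp
        qed
        also have "\<dots> = 2 * (\<integral>z. (reg_fun \<beta> (cut01 f) z)\<^sup>2 \<partial>\<mu>) + 2 * (l2 \<mu> ?d)\<^sup>2"
          using L2_fun_integrable_sq[OF fL] L2_fun_integrable_sq[OF v(2)] by (simp add: l2_sq)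
        also have "(l2 \<mu> ?d)\<^sup>2 \<le> \<bar>Cf\<bar>"
        proof -
          have "Cf * (real (K n) / real n) \<le> \<bar>Cf\<bar> * 1" using elim(8) by (intro mult_mono) auto
          then show ?thesis using v(3) by linarith
        qed
        finally show ?thesis by (simp add: S_def)
      qed
      from expansion_event[OF r K[OF elim(1)] c(2)[OF K[OF elim(1)]] f v w \<epsilon>(1)[OF elim(1)] L I0 bmin C2(1) C2(2)[OF K[OF elim(1)]] S elim(3-7) sel[OF elim(1)]]
      obtain G where G: "G \<in> sets (M n)" "measure (M n) (space (M n) - G) \<le> risk_const \<sigma> c Cf / L"
        and ex: "\<And>\<omega> i. \<omega> \<in> G \<Longrightarrow> \<bar>(bhat n \<omega> $ i - \<beta> $ i) - (if i \<in> I0 then \<Sum>j\<in>I0. ?B $ i $ j * avg n (\<lambda>l. W n l \<omega> * resid (X n l \<omega>, T n l \<omega>) $ j) else 0)\<bar>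
           \<le> Q * remainder n L C2 (\<epsilon> n) (K n)"
        unfolding Q_def by blast
      have n0: "sqrt (real n) > 0" using elim(1) by simp
      have "dist (Z n \<omega>) (U n \<omega>) \<le> e" if w: "\<omega> \<in> G" for \<omega>
      proof -
        have Ui: "U n \<omega> $ i = sqrt (real n) * (if i \<in> I0 then \<Sum>j\<in>I0. ?B $ i $ j * avg n (\<lambda>l. W n l \<omega> * resid (X n l \<omega>, T n l \<omega>) $ j) else 0)" for i
        proof (cases "i \<in> I0")
          case True
          have "(\<Sum>j\<in>I0. ?B $ i $ j * avg n (\<lambda>l. W n l \<omega> * resid (X n l \<omega>, T n l \<omega>) $ j))
            = avg n (\<lambda>l. W n l \<omega> * (\<Sum>j\<in>I0. ?B $ i $ j * resid (X n l \<omega>, T n l \<omega>) $ j))"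
            by (simp only: avg_cmult[symmetric] avg_sum[symmetric] sum_distrib_left mult.left_commute)
          moreover have "U n \<omega> $ i = (1 / sqrt (real n)) * (\<Sum>l=1..n. W n l \<omega> * (\<Sum>j\<in>I0. ?B $ i $ j * resid (X n l \<omega>, T n l \<omega>) $ j))"
            using True by (simp add: U_def influence_component del: resid_component)
          moreover have "1 / x * s = x * (s / (x * x))" if "x > 0" for x s :: real
            using that by simp
          from this[OF n0] have "1 / sqrt (real n) * s = sqrt (real n) * (s / real n)" for s by simp
          ultimately show ?thesis using True unfolding avg_def by simp
        next
          case False
          then show ?thesis by (simp add: U_def influence_component del: resid_component)
        qed
        have "dist (Z n \<omega>) (U n \<omega>) \<le> (\<Sum>i\<in>UNIV. \<bar>(Z n \<omega> - U n \<omega>) $ i\<bar>)"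
          unfolding dist_norm by (rule norm_le_l1_cart)
        also have "\<dots> \<le> (\<Sum>i\<in>(UNIV :: 'q set). sqrt (real n) * (Q * remainder n L C2 (\<epsilon> n) (K n)))"
        proof (rule sum_mono)
          fix i
          have "(Z n \<omega> - U n \<omega>) $ i = sqrt (real n) * ((bhat n \<omega> $ i - \<beta> $ i) - (if i \<in> I0 then \<Sum>j\<in>I0. ?B $ i $ j * avg n (\<lambda>l. W n l \<omega> * resid (X n l \<omega>, T n l \<omega>) $ j) else 0))"
            unfolding vector_minus_component Ui right_diff_distrib[of "sqrt (real n)"] by (simp add: Z_def right_diff_distrib)
          then show "\<bar>(Z n \<omega> - U n \<omega>) $ i\<bar> \<le> sqrt (real n) * (Q * remainder n L C2 (\<epsilon> n) (K n))"
            using ex[OF w, of i] n0 by (simp only: abs_mult) (simp add: mult_left_mono)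
        qed
        also have "\<dots> = real CARD('q) * Q * (sqrt (real n) * remainder n L C2 (\<epsilon> n) (K n))" by simp
        finally show ?thesis using elim(2) by linarith
      qed
      moreover have "measure (M n) G \<ge> 1 - e" using P.prob_compl[OF G(1)] G(2) Le by linarith
      ultimately show ?case using G(1) by blast
    qed
    then show "\<forall>\<^sub>F n in sequentially. \<exists>G\<in>sets (M (n + 2)). measure (M (n + 2)) G \<ge> 1 - e \<and> (\<forall>\<omega>\<in>G. dist (Z (n + 2) \<omega>) (U (n + 2) \<omega>) \<le> e)"
      by (rule eventually_sequentially_seg[THEN iffD2])
  qed
  then have shift: "(\<lambda>n. \<integral>x. h x \<partial>distr (M (n + 2)) borel (Z (n + 2))) \<longlonglongrightarrow> (\<integral>x. h x \<partial>mv_normal 0 ?V)"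
    if "continuous_on UNIV h \<and> bounded (range h)" for h :: "real ^ 'q \<Rightarrow> real"
    using that unfolding converges_weakly_def by blast
  have "converges_weakly (\<lambda>n. distr (M n) borel (Z n)) (mv_normal 0 ?V)"
    unfolding converges_weakly_def
  proof (intro allI impI)
    fix h :: "real ^ 'q \<Rightarrow> real" assume h: "continuous_on UNIV h \<and> bounded (range h)"
    show "(\<lambda>n. \<integral>x. h x \<partial>distr (M n) borel (Z n)) \<longlonglongrightarrow> (\<integral>x. h x \<partial>mv_normal 0 ?V)"
      by (rule LIMSEQ_offset[where k=2 and f="\<lambda>n. \<integral>x. h x \<partial>distr (M n) borel (Z n)"]) (rule shift[OF h])
  qed
  then show ?thesis unfolding Z_def .
qed

text \<open>The common form of both cases. The condition \<rho> < 1/2 gives K^2 / n -> 0, and 1 <=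
  \<rho> (2 \<alpha> + 1) makes the squared bias K powr (-2 \<alpha>) at most a multiple of K / n.
  The procedure depends on \<rho> and not on \<alpha>, which is how one choice serves a whole range
  of \<alpha>.\<close>

lemma (in design) selected_estimator_limit_dyadic:
  fixes M :: "nat \<Rightarrow> 'w measure" and X :: "nat \<Rightarrow> nat \<Rightarrow> 'w \<Rightarrow> real ^ 'q" and T W :: "nat \<Rightarrow> nat \<Rightarrow> 'w \<Rightarrow> real"
    and K :: "nat \<Rightarrow> nat"
  assumes noise: "noise_law \<zeta> \<sigma>" and sample: "\<And>n. n \<ge> 2 \<Longrightarrow> iid_sample n (M n) (X n) (T n) (W n) \<mu> \<zeta>"
    and I0: "I0 = {j. \<beta> $ j \<noteq> 0}" and r: "r > 0"
    and means: "\<And>j. cond_mean \<kappa> j \<in> Lip_ball P_T \<gamma> A" and A: "A \<ge> 0" and \<gamma>: "3 / 4 \<le> \<gamma>"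
    and f: "f \<in> Lip_ball P_T \<alpha> A'" and A': "A' \<ge> 0" and \<alpha>: "0 < \<alpha>" "\<alpha> < real r"
    and K: "\<And>n. n \<ge> 2 \<Longrightarrow> dyadic_near (K n) (real n powr \<rho>)" and \<rho>: "0 < \<rho>" "\<rho> < 1 / 2" "1 \<le> \<rho> * (2 * \<alpha> + 1)"
    and sel: "\<And>n. n \<ge> 2 \<Longrightarrow> selected_estimator n (M n) r \<K> (UNIV \<times> {K n}) (log_penalty n r) (observation \<beta> f (X n) (T n) (W n)) (bhat n)"
  shows "converges_weakly (\<lambda>n. distr (M n) borel (\<lambda>\<omega>. sqrt (real n) *\<^sub>R (bhat n \<omega> - \<beta>))) (mv_normal 0 (limit_cov I0 \<mu> \<kappa> \<sigma>))"
proof -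
  have Kd: "\<exists>m. K n = 2 ^ m" "real n powr \<rho> / 2 \<le> real (K n)" "real (K n) \<le> 2 * real n powr \<rho>" if "n \<ge> 2" for n
    using K[OF that] by (auto simp: dyadic_near_def)
  have Kpos: "K n > 0" if "n \<ge> 2" for n using Kd(1)[OF that] by auto
  have pw: "((2 powr - a) ^ m)\<^sup>2 = real (2 ^ m) powr (- (2 * a))" for a m
    by (simp add: powr_power powr_realpow[symmetric] powr_powr mult_ac)
  obtain C where C: "C \<ge> 0" "\<And>m. approximable r (2 ^ m) f (C * ((2 powr - \<alpha>) ^ m)\<^sup>2)"
    by (rule Lip_ball_approx[OF f A' \<alpha>], rule that, assumption, assumption)
  have r1: "r \<ge> 1" using r by simp
  have "\<exists>D\<ge>0. \<forall>m. approximable r (2 ^ m) (cond_mean \<kappa> j) (D * ((2 powr - (3/4)) ^ m)\<^sup>2)" for j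
    by (rule Lip_ball_approx_const[OF means A \<gamma> r1]) blast
  then have "\<forall>j. \<exists>D\<ge>0. \<forall>m. approximable r (2 ^ m) (cond_mean \<kappa> j) (D * ((2 powr - (3/4)) ^ m)\<^sup>2)"
    by blast
  from choice[OF this] obtain D where D: "\<And>j. D j \<ge> 0" "\<And>j m. approximable r (2 ^ m) (cond_mean \<kappa> j) (D j * ((2 powr - (3/4)) ^ m)\<^sup>2)"
    by blast
  \<comment> \<open>One constant for all coordinates; the added 1 makes it positive.\<close>
  define E where "E = 1 + (\<Sum>j\<in>UNIV. D j)"
  have E: "E > 0" "D j \<le> E" for j
  proof -
    have "D j \<le> (\<Sum>j\<in>UNIV. D j)" using D(1) by (intro member_le_sum) auto
    then show "E > 0" "D j \<le> E" using D(1)[of j] unfolding E_def by linarith+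
  qed
  have powr0: "(\<lambda>n. real n powr s) \<longlonglongrightarrow> 0" if "s < 0" for s
    using tendsto_neg_powr[OF that filterlim_real_sequentially] by simp
  \<comment> \<open>The piecewise constants have squared error of order K powr (-3/2) = K powr
    (-1/2) / K, hence the choice of \<epsilon>. The factor 2 powr (2 \<alpha> + 1) in
    \<open>Cf\<close> comes from K >= n powr \<rho> / 2.\<close>
  show ?thesis
  proof (rule selected_estimator_limit[OF noise sample I0 r Kpos _ _ _ _ _ _ sel, where \<epsilon>="\<lambda>n. E * real (K n) powr (- (1 / 2))" and Cf="C * 2 powr (2 * \<alpha> + 1)"])
    show "(\<lambda>n. (real (K n))\<^sup>2 / real n) \<longlonglongrightarrow> 0"
    proof (rule tendsto_sandwich[OF _ _ tendsto_const])
      have "(\<lambda>n. 4 * real n powr (2 * \<rho> - 1)) \<longlonglongrightarrow> 4 * 0" by (intro tendsto_intros powr0) (use \<rho> in simp)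
      then show "(\<lambda>n. 4 * real n powr (2 * \<rho> - 1)) \<longlonglongrightarrow> 0" by simp
      show "\<forall>\<^sub>F n in sequentially. (real (K n))\<^sup>2 / real n \<le> 4 * real n powr (2 * \<rho> - 1)"
        using eventually_ge_at_top[of 2]
      proof eventually_elim
        fix n :: nat assume n: "2 \<le> n"
        have "(real (K n))\<^sup>2 / real n \<le> (2 * real n powr \<rho>)\<^sup>2 / real n"
          using Kd(3)[OF n] by (intro divide_right_mono power_mono) auto
        also have "\<dots> = 4 * real n powr (2 * \<rho> - 1)"
          using n by (simp add: power_mult_distrib powr_diff powr_power mult.commute)
        finally show "(real (K n))\<^sup>2 / real n \<le> 4 * real n powr (2 * \<rho> - 1)" .
      qed
    qed simp
    show "cut01 f \<in> borel_measurable borel" by (rule Lip_ball_lborel(1)[OF f A'])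
    show "approximable r (K n) f (C * 2 powr (2 * \<alpha> + 1) * (real (K n) / real n))" if n: "n \<ge> 2" for n
    proof -
      obtain m where m: "K n = 2 ^ m" using Kd(1)[OF n] by blast
      have k: "real (K n) > 0" "real n > 0" using Kpos[OF n] n by auto
      have "real n powr 1 \<le> real n powr (\<rho> * (2 * \<alpha> + 1))" using n \<rho>(3) by (intro powr_mono) auto
      also have "\<dots> = (real n powr \<rho>) powr (2 * \<alpha> + 1)" by (simp add: powr_powr)
      also have "\<dots> \<le> (2 * real (K n)) powr (2 * \<alpha> + 1)"
        using Kd(2)[OF n] \<alpha>(1) by (intro powr_mono2) auto
      also have "\<dots> = 2 powr (2 * \<alpha> + 1) * (real (K n) powr (2 * \<alpha>) * real (K n))"
        using k by (simp add: powr_mult powr_add)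
      finally have "real n \<le> 2 powr (2 * \<alpha> + 1) * (real (K n) powr (2 * \<alpha>) * real (K n))" using k by simp
      then have "real (K n) powr (- (2 * \<alpha>)) \<le> 2 powr (2 * \<alpha> + 1) * (real (K n) / real n)"
        using k by (simp add: powr_minus field_simps)
      then have "C * ((2 powr - \<alpha>) ^ m)\<^sup>2 \<le> C * (2 powr (2 * \<alpha> + 1) * (real (K n) / real n))"
        unfolding pw m[symmetric] using C(1) by (intro mult_left_mono)
      then show ?thesis using C(2)[of m] unfolding m[symmetric] mult.assoc by (meson order_trans)
    qed
    show "approximable r (K n) (cond_mean \<kappa> j) (E * real (K n) powr (- (1 / 2)) / real (K n))" if n: "n \<ge> 2" for n j
    proof -
      obtain m where m: "K n = 2 ^ m" using Kd(1)[OF n] by blast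
      have k: "real (K n) > 0" using Kpos[OF n] by auto
      have "real (K n) powr (- (2 * (3 / 4))) = real (K n) powr (- (1 / 2) - 1)" by simp
      also have "\<dots> = real (K n) powr (- (1 / 2)) / real (K n)" using k by (simp only: powr_diff powr_one)
      finally have "D j * ((2 powr - (3/4)) ^ m)\<^sup>2 = D j * (real (K n) powr (- (1 / 2)) / real (K n))"
        unfolding pw m[symmetric] by simp
      also have "\<dots> \<le> E * (real (K n) powr (- (1 / 2)) / real (K n))" by (intro mult_right_mono E) simp
      finally show ?thesis using D(2)[of m j] unfolding m[symmetric] times_divide_eq_right by (meson order_trans)
    qed
    show "0 < E * real (K n) powr (- (1 / 2))" if "n \<ge> 2" for n using E(1) Kpos[OF that] by simp
    show "(\<lambda>n. E * real (K n) powr (- (1 / 2))) \<longlonglongrightarrow> 0"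
    proof (rule tendsto_sandwich[OF _ _ tendsto_const])
      have "(\<lambda>n. E * 2 powr (1 / 2) * real n powr (- (\<rho> / 2))) \<longlonglongrightarrow> E * 2 powr (1 / 2) * 0"
        by (intro tendsto_intros powr0) (use \<rho> in simp)
      then show "(\<lambda>n. E * 2 powr (1 / 2) * real n powr (- (\<rho> / 2))) \<longlonglongrightarrow> 0" by simp
      show "\<forall>\<^sub>F n in sequentially. E * real (K n) powr (- (1 / 2)) \<le> E * 2 powr (1 / 2) * real n powr (- (\<rho> / 2))"
        using eventually_ge_at_top[of 2]
      proof eventually_elim
        fix n :: nat assume n: "2 \<le> n"
        have "real (K n) powr (- (1 / 2)) \<le> (real n powr \<rho> / 2) powr (- (1 / 2))"
          using Kd(2)[OF n] n by (intro powr_mono2') auto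
        also have "\<dots> = 2 powr (1 / 2) * real n powr (- (\<rho> / 2))"
          using n by (simp add: powr_divide powr_powr powr_minus field_simps)
        finally show "E * real (K n) powr (- (1 / 2)) \<le> E * 2 powr (1 / 2) * real n powr (- (\<rho> / 2))"
          using E(1) by (simp add: mult.assoc)
      qed
      show "\<forall>\<^sub>F n in sequentially. 0 \<le> E * real (K n) powr (- (1 / 2))" using E(1) by (simp add: less_imp_le)
    qed
  qed
qed

theorem theorem4p2:
  fixes M :: "nat \<Rightarrow> 'w measure"
    and X :: "nat \<Rightarrow> nat \<Rightarrow> 'w \<Rightarrow> real ^ 'q"
    and T W :: "nat \<Rightarrow> nat \<Rightarrow> 'w \<Rightarrow> real"
    and \<mu> :: "((real ^ 'q) \<times> real) measure"
    and \<zeta> :: "real measure"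
    and \<kappa> :: "real \<Rightarrow> (real ^ 'q) measure"
    and \<K> :: "(real ^ 'q) set"
    and \<beta> :: "real ^ 'q"
    and f :: "real \<Rightarrow> real"
    and \<sigma> b h0 h1 :: real
    and r :: nat
    and I0 :: "'q set"
    and V :: "real ^ 'q ^ 'q"
    and obs :: "nat \<Rightarrow> 'w \<Rightarrow> nat \<Rightarrow> ((real ^ 'q) \<times> real) \<times> real"
  assumes noise: "noise_law \<zeta> \<sigma>"
    and law: "prob_space \<mu>" "sets \<mu> = sets borel"
    and sample: "\<And>n. n \<ge> 2 \<Longrightarrow> iid_sample n (M n) (X n) (T n) (W n) \<mu> \<zeta>"
    and obs: "\<And>n. obs n = observation \<beta> f (X n) (T n) (W n)"
    and cond: "conditional_law \<mu> \<kappa>"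
    and b: "b \<ge> 3"
    and r: "r = nat \<lfloor>(b - 1) / 2\<rfloor>"
    and A1: "design_density \<mu> \<K> h0 h1"
    and A2: "error_moments \<zeta>"
    and A3: "nondegenerate_given_T \<kappa>"
    and A4: "regression_L2 \<beta> f \<K>"
    and A5: "smooth_cond_means \<mu> \<kappa> b"
    and I0: "I0 = {j. \<beta> $ j \<noteq> 0}"
    and V: "V = limit_cov I0 \<mu> \<kappa> \<sigma>"
  shows
    "(\<forall>\<alpha> L K bhat.
        1 / 2 < \<alpha> \<and> \<alpha> < real r \<and> L > 0 \<and> f \<in> Lip_ball (law_T \<mu>) \<alpha> L \<and>
        (\<forall>n\<ge>2. dyadic_near (K n) (real n powr (1 / (2 * \<alpha> + 1)))) \<and>
        (\<forall>n\<ge>2. selected_estimator n (M n) r \<K> (UNIV \<times> {K n}) (log_penalty n r) (obs n) (bhat n))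
        \<longrightarrow> converges_weakly
              (\<lambda>n. distr (M n) borel (\<lambda>\<omega>. sqrt (real n) *\<^sub>R (bhat n \<omega> - \<beta>))) (mv_normal 0 V))
     \<and>
     (\<forall>a K bhat.
        0 < a \<and> a < real r - 1 / 2 \<and>
        (\<forall>n\<ge>2. dyadic_near (K n) (real n powr (1 / (2 * a + 2)))) \<and>
        (\<forall>n\<ge>2. selected_estimator n (M n) r \<K> (UNIV \<times> {K n}) (log_penalty n r) (obs n) (bhat n))
        \<longrightarrow> (\<forall>\<alpha>\<in>{1 / 2 + a..<real r}. \<forall>L>0. f \<in> Lip_ball (law_T \<mu>) \<alpha> L \<longrightarrow>
              converges_weakly
                (\<lambda>n. distr (M n) borel (\<lambda>\<omega>. sqrt (real n) *\<^sub>R (bhat n \<omega> - \<beta>))) (mv_normal 0 V)))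
     \<and>
     (AE v in mv_normal 0 V. \<forall>j. j \<notin> I0 \<longrightarrow> v $ j = 0)"
proof (intro conjI allI impI ballI)
  interpret design \<mu> \<kappa> \<K> h0 h1 by (rule design.intro[OF law cond A1 A3])
  have "1 \<le> \<lfloor>(b - 1) / 2\<rfloor>" using b by (simp add: le_floor_iff)
  then have r0: "r > 0" using r by simp
  obtain \<gamma> A where \<gamma>: "\<gamma> > b / 4" and A: "A > 0" and means: "\<And>j. cond_mean \<kappa> j \<in> Lip_ball (law_T \<mu>) \<gamma> A"
    using A5 unfolding smooth_cond_means_def by blast
  \<comment> \<open>Here b >= 3 supplies the exponent 3/4 for the conditional means.\<close>
  have \<gamma>': "3 / 4 \<le> \<gamma>" using \<gamma> b by simp
  have lim: "converges_weakly (\<lambda>n. distr (M n) borel (\<lambda>\<omega>. sqrt (real n) *\<^sub>R (bhat n \<omega> - \<beta>))) (mv_normal 0 V)"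
    if "0 < \<alpha>" "\<alpha> < real r" "L > 0" "f \<in> Lip_ball (law_T \<mu>) \<alpha> L" "0 < \<rho>" "\<rho> < 1 / 2" "1 \<le> \<rho> * (2 * \<alpha> + 1)"
      "\<forall>n\<ge>2. dyadic_near (K n) (real n powr \<rho>)"
      "\<forall>n\<ge>2. selected_estimator n (M n) r \<K> (UNIV \<times> {K n}) (log_penalty n r) (obs n) (bhat n)"
    for \<alpha> \<rho> L :: real and K bhat
    unfolding V
    by (rule selected_estimator_limit_dyadic[where K=K, OF noise sample I0 r0 means less_imp_le[OF A] \<gamma>' that(4) less_imp_le[OF that(3)] that(1,2) _ that(5-7)])
      (use that(8,9) in \<open>simp_all add: obs\<close>)
  {
    fix \<alpha> L :: real and K bhat
    assume *: "1 / 2 < \<alpha> \<and> \<alpha> < real r \<and> L > 0 \<and> f \<in> Lip_ball (law_T \<mu>) \<alpha> L \<and>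
        (\<forall>n\<ge>2. dyadic_near (K n) (real n powr (1 / (2 * \<alpha> + 1)))) \<and>
        (\<forall>n\<ge>2. selected_estimator n (M n) r \<K> (UNIV \<times> {K n}) (log_penalty n r) (obs n) (bhat n))"
    \<comment> \<open>The exponent is below 1/2 exactly when \<alpha> > 1/2, and the bias condition
      holds with equality.\<close>
    have "1 / (2 * \<alpha> + 1) < 1 / 2" "1 \<le> 1 / (2 * \<alpha> + 1) * (2 * \<alpha> + 1)" using * by (auto simp: field_simps)
    then show "converges_weakly (\<lambda>n. distr (M n) borel (\<lambda>\<omega>. sqrt (real n) *\<^sub>R (bhat n \<omega> - \<beta>))) (mv_normal 0 V)"
      using * by (intro lim[of \<alpha> L "1 / (2 * \<alpha> + 1)" K bhat]) auto
  }
  {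
    fix a \<alpha> L :: real and K bhat
    assume *: "0 < a \<and> a < real r - 1 / 2 \<and>
        (\<forall>n\<ge>2. dyadic_near (K n) (real n powr (1 / (2 * a + 2)))) \<and>
        (\<forall>n\<ge>2. selected_estimator n (M n) r \<K> (UNIV \<times> {K n}) (log_penalty n r) (obs n) (bhat n))"
      and \<alpha>: "\<alpha> \<in> {1 / 2 + a..<real r}" and L: "L > 0" "f \<in> Lip_ball (law_T \<mu>) \<alpha> L"
    \<comment> \<open>Here a > 0 keeps the exponent below 1/2, and \<alpha> >= 1/2 + a gives 2
      \<alpha> + 1 >= 2 a + 2, so the bias condition holds for every \<alpha> in the range.\<close>
    have "1 / (2 * a + 2) < 1 / 2" "1 \<le> 1 / (2 * a + 2) * (2 * \<alpha> + 1)" using * \<alpha> by (auto simp: field_simps)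
    then show "converges_weakly (\<lambda>n. distr (M n) borel (\<lambda>\<omega>. sqrt (real n) *\<^sub>R (bhat n \<omega> - \<beta>))) (mv_normal 0 V)"
      using * \<alpha> L by (intro lim[of \<alpha> L "1 / (2 * a + 2)" K bhat]) auto
  }
  have R: "\<exists>R :: real^'q^'q. R ** transpose R = V"
    unfolding V limit_cov_def by (rule block_inv_factor(2)[OF Sigma_posdef Sigma_sym])
  show "AE v in mv_normal 0 V. \<forall>j. j \<notin> I0 \<longrightarrow> v $ j = 0"
    by (rule mv_normal_0(4)[OF R]) (simp add: V limit_cov_def)
qed

end
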